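(* Let $f:\mathbb S^1\times\mathbb R\to\mathbb R$ be smooth and proper, let $F:B^1\to B^0$, $F(u)(t)=u'(t)+f(t,u(t))$, and let $\Sigma_1:B^1\to\mathbb R$, $\Sigma_1(u)=\int_{\mathbb S^1}D_2f(t,u(t))\,dt$. If $0$ is a regular value of $\Sigma_1$ and all singularities (critical points) of $F$ are folds, then $F$ is a global fold.
   Context: $\mathbb S^1=\mathbb R/\mathbb Z$. The pair $(B^1,B^0)$ is either $(H^1(\mathbb S^1;\mathbb R),L^2(\mathbb S^1;\mathbb R))$ or $(C^1(\mathbb S^1;\mathbb R),C^0(\mathbb S^1;\mathbb R))$; the result is asserted in both cases. $D_2f$ is the partial derivative of $f$ in the second variable. For $u\in B^i$, $\overline u=\int u$ and $\tilde u=u-\overline u$; $\tilde B^0$ is the space of average-zero functions in $B^0$. A critical point of $F$ is a $u$ at which $DF(u)$ is not invertible. Since $f$ is proper, the map $\Psi:B^1\to B^0$, $\Psi(u)=F(u)-\int F(u)+\int u$, is a diffeomorphism and $F\circ\Psi^{-1}(\tilde v,\overline u)=(\tilde v,\phi(\tilde v,\overline u))$ on $B^0=\tilde B^0\oplus\mathbb R$, where $\phi:\tilde B^0\times\mathbb R\to\mathbb R$ is smooth. A *fold* (Morin singularity of order 1) of $F$ is a point $u$ such that at $\Psi(u)$ one has $D_2\phi=0$ and $D_2^2\phi\ne0$, where $D_2\phi$ is the derivative in the real variable $\overline u$. $G:B^1\to B^0$ is a *global fold* if there are diffeomorphisms $\Xi_1:B^1\to\mathbb R\times\tilde B^0$ and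 $\Xi_0:B^0\to\mathbb R\times\tilde B^0$ with $(\Xi_0\circ G\circ\Xi_1^{-1})(x,\tilde v)=(x^2,\tilde v)$ for all $(x,\tilde v)\in\mathbb R\times\tilde B^0$.
   Formalization: "0 is a regular value of Σ₁" is taken to include that Σ₁ attains 0; otherwise f(t,x)=x meets all hypotheses, but F(u)=u'+u is then a linear isomorphism without critical points and not a global fold. *)

theory Defs
  imports "HOL-Analysis.Analysis"
begin

section \<open>Smooth maps between normed spaces\<close>

text \<open>
  The \<open>k\<close>-th Frechet derivative at a point is represented by a function on argument lists of
  length \<open>k\<close>.  All notions are relative to a linear subspace \<open>V\<close> (with the norm of the ambient
  space), so that they apply to spaces such as \<open>\<real> \<times> {v. average v = 0}\<close>.
\<close>

definition bounded_multilinear_on ::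
    "'a::real_normed_vector set \<Rightarrow> nat \<Rightarrow> ('a list \<Rightarrow> 'b::real_normed_vector) \<Rightarrow> bool" where
  "bounded_multilinear_on V k A \<longleftrightarrow>
     (\<forall>hs i h h' c. length hs = k \<and> set hs \<subseteq> V \<and> i < k \<and> h \<in> V \<and> h' \<in> V \<longrightarrow>
        A (hs[i := c *\<^sub>R h + h']) = c *\<^sub>R A (hs[i := h]) + A (hs[i := h'])) \<and>
     (\<exists>C. \<forall>hs. length hs = k \<and> set hs \<subseteq> V \<longrightarrow> norm (A hs) \<le> C * prod_list (map norm hs))"

text \<open>
  \<open>D x [h1, \<dots>, hk]\<close> is the \<open>k\<close>-th derivative at \<open>x\<close> applied to \<open>h1, \<dots>, hk\<close>.  The last clause says
  that \<open>x \<mapsto> D x\<close> (on lists of length \<open>k\<close>) is Frechet differentiable with respect to the operator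
  norm of bounded \<open>k\<close>-linear maps, with the \<open>(k+1)\<close>-st derivative as its derivative.
\<close>

definition smooth_on :: "'a::real_normed_vector set \<Rightarrow> ('a \<Rightarrow> 'b::real_normed_vector) \<Rightarrow> bool" where
  "smooth_on V g \<longleftrightarrow>
     (\<exists>D :: 'a \<Rightarrow> 'a list \<Rightarrow> 'b.
        (\<forall>x\<in>V. D x [] = g x) \<and>
        (\<forall>k. \<forall>x\<in>V. bounded_multilinear_on V k (D x)) \<and>
        (\<forall>k. \<forall>x\<in>V. \<forall>\<epsilon>>0. \<exists>\<delta>>0. \<forall>h\<in>V. norm h < \<delta> \<longrightarrow>
           (\<forall>hs. length hs = k \<and> set hs \<subseteq> V \<longrightarrow>
              norm (D (x + h) hs - D x hs - D x (h # hs)) \<le> \<epsilon> * norm h * prod_list (map norm hs))))"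

definition diffeomorphism_on ::
    "'a::real_normed_vector set \<Rightarrow> 'b::real_normed_vector set \<Rightarrow> ('a \<Rightarrow> 'b) \<Rightarrow> bool" where
  "diffeomorphism_on V W g \<longleftrightarrow>
     bij_betw g V W \<and> smooth_on V g \<and> smooth_on W (inv_into V g)"

definition critical_point ::
    "('a::real_normed_vector \<Rightarrow> 'b::real_normed_vector) \<Rightarrow> 'a \<Rightarrow> bool" where
  "critical_point G u \<longleftrightarrow>
     (\<exists>G'. (G has_derivative G') (at u) \<and> \<not> (bij G' \<and> bounded_linear (inv G')))"

text \<open>
  A regular value is understood to be a value, i.e. to be attained.  If vacuously regular values
  were admitted, \<open>f t x = x\<close> would satisfy all hypotheses of the theorem although
  \<open>u \<mapsto> u' + u\<close> is then a linear isomorphism and not a global fold.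
\<close>

definition regular_value :: "('a::real_normed_vector \<Rightarrow> real) \<Rightarrow> real \<Rightarrow> bool" where
  "regular_value g c \<longleftrightarrow>
     c \<in> range g \<and> (\<forall>u. g u = c \<longrightarrow> (\<exists>g'. (g has_derivative g') (at u) \<and> surj g'))"


section \<open>Folds and global folds\<close>

text \<open>
  Function spaces on the circle, with the average \<open>\<integral>u\<close> and the embedding of the constants.
\<close>

class circle_space = real_normed_vector +
  fixes average :: "'a \<Rightarrow> real"
    and const_fun :: "real \<Rightarrow> 'a"
  assumes average_add: "average (u + v) = average u + average v"
    and average_scaleR: "average (c *\<^sub>R u) = c * average u"
    and average_const_fun: "average (const_fun c) = c"
    and const_fun_add: "const_fun (c + d) = const_fun c + const_fun d"
    and const_fun_scaleR: "const_fun (c * d) = c *\<^sub>R const_fun d"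

definition avg_zero :: "'a::circle_space set" where
  "avg_zero = {v. average v = 0}"

definition Psi :: "('a::circle_space \<Rightarrow> 'b::circle_space) \<Rightarrow> 'a \<Rightarrow> 'b" where
  "Psi F u = F u - const_fun (average (F u)) + const_fun (average u)"

text \<open>
  The second component of \<open>F \<circ> Psi\<^sup>-\<^sup>1\<close> in the splitting \<open>w = v + const_fun s\<close>, \<open>v \<in> avg_zero\<close>.
\<close>

definition phi :: "('a::circle_space \<Rightarrow> 'b::circle_space) \<Rightarrow> 'b \<Rightarrow> real \<Rightarrow> real" where
  "phi F v s = average (F (inv (Psi F) (v + const_fun s)))"

definition fold_point :: "('a::circle_space \<Rightarrow> 'b::circle_space) \<Rightarrow> 'a \<Rightarrow> bool" where
  "fold_point F u \<longleftrightarrow>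
     (let s = average (Psi F u); v = Psi F u - const_fun s
      in deriv (phi F v) s = 0 \<and> deriv (deriv (phi F v)) s \<noteq> 0)"

definition global_fold :: "('a::circle_space \<Rightarrow> 'b::circle_space) \<Rightarrow> bool" where
  "global_fold G \<longleftrightarrow>
     (\<exists>(\<Xi>\<^sub>1 :: 'a \<Rightarrow> real \<times> 'b) (\<Xi>\<^sub>0 :: 'b \<Rightarrow> real \<times> 'b).
        diffeomorphism_on UNIV (UNIV \<times> avg_zero) \<Xi>\<^sub>1 \<and>
        diffeomorphism_on UNIV (UNIV \<times> avg_zero) \<Xi>\<^sub>0 \<and>
        (\<forall>x. \<forall>v\<in>avg_zero. \<Xi>\<^sub>0 (G (inv \<Xi>\<^sub>1 (x, v))) = (x\<^sup>2, v)))"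


section \<open>Function spaces on the circle\<close>

text \<open>
  Functions on \<open>\<real>/\<int>\<close> are 1-periodic functions on \<open>\<real>\<close>; integration over the circle is integration
  over the fundamental domain \<open>[0,1]\<close>.
\<close>

definition circle :: "real measure" where
  "circle = restrict_space lborel {0..1}"

lemma space_circle [simp]: "space circle = {0..1}"
  by (simp add: circle_def space_restrict_space)

lemma emeasure_circle_space [simp]: "emeasure circle {0..1} = 1"
  by (simp add: circle_def emeasure_restrict_space)

interpretation circle: finite_measure circle
  by standard simp

lemma measure_circle [simp]: "measure circle {0..1} = 1"
  by (simp add: measure_def)

lemma borel_measurable_circle:
  "u \<in> borel_measurable borel \<Longrightarrow> u \<in> borel_measurable circle"
  unfolding circle_def by (intro measurable_restrict_space1) simp


subsection \<open>Continuous functions\<close>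

typedef C0 = "{u :: real \<Rightarrow>\<^sub>C real. \<forall>t. apply_bcontfun u (t + 1) = apply_bcontfun u t}"
  by (rule exI[of _ 0]) simp

setup_lifting type_definition_C0

definition C0_fun :: "C0 \<Rightarrow> real \<Rightarrow> real" where
  "C0_fun u = apply_bcontfun (Rep_C0 u)"

definition C0_of :: "(real \<Rightarrow> real) \<Rightarrow> C0" where
  "C0_of u = Abs_C0 (Bcontfun u)"

lemma C0_fun_periodic: "C0_fun u (t + 1) = C0_fun u t"
  using Rep_C0[of u] by (simp add: C0_fun_def)

lemma continuous_C0_fun: "continuous_on A (C0_fun u)"
  by (simp add: C0_fun_def)

lemma C0_eqI: "(\<And>t. C0_fun u t = C0_fun v t) \<Longrightarrow> u = v"
  unfolding C0_fun_def by (metis Rep_C0_inject bcontfun_eqI)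

instantiation C0 :: real_normed_vector
begin

lift_definition zero_C0 :: C0 is 0 by simp
lift_definition plus_C0 :: "C0 \<Rightarrow> C0 \<Rightarrow> C0" is "(+)" by simp
lift_definition minus_C0 :: "C0 \<Rightarrow> C0 \<Rightarrow> C0" is "(-)" by simp
lift_definition uminus_C0 :: "C0 \<Rightarrow> C0" is uminus by simp
lift_definition scaleR_C0 :: "real \<Rightarrow> C0 \<Rightarrow> C0" is "(*\<^sub>R)" by simp
lift_definition norm_C0 :: "C0 \<Rightarrow> real" is norm .

definition dist_C0 :: "C0 \<Rightarrow> C0 \<Rightarrow> real" where "dist_C0 u v = norm (u - v)"
definition sgn_C0 :: "C0 \<Rightarrow> C0" where "sgn_C0 u = inverse (norm u) *\<^sub>R u"
definition uniformity_C0 :: "(C0 \<times> C0) filter" where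
  "uniformity_C0 = (INF e\<in>{0<..}. principal {(x, y). dist x y < e})"
definition open_C0 :: "C0 set \<Rightarrow> bool" where
  "open_C0 U \<longleftrightarrow> (\<forall>x\<in>U. eventually (\<lambda>(x', y). x' = x \<longrightarrow> y \<in> U) uniformity)"

instance
proof
  fix u v w :: C0 and a b :: real
  show "u + v + w = u + (v + w)" by transfer (simp add: algebra_simps)
  show "u + v = v + u" by transfer (simp add: algebra_simps)
  show "0 + u = u" by transfer simp
  show "- u + u = 0" by transfer simp
  show "u - v = u + - v" by transfer simp
  show "a *\<^sub>R (u + v) = a *\<^sub>R u + a *\<^sub>R v" by transfer (rule scaleR_add_right)
  show "(a + b) *\<^sub>R u = a *\<^sub>R u + b *\<^sub>R u" by transfer (rule scaleR_add_left)
  show "a *\<^sub>R b *\<^sub>R u = (a * b) *\<^sub>R u" by transfer (rule scaleR_scaleR)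
  show "1 *\<^sub>R u = u" by transfer (rule scaleR_one)
  show "dist u v = norm (u - v)" by (rule dist_C0_def)
  show "sgn u = inverse (norm u) *\<^sub>R u" by (rule sgn_C0_def)
  show "(uniformity :: (C0 \<times> C0) filter) = (INF e\<in>{0<..}. principal {(x, y). dist x y < e})"
    by (rule uniformity_C0_def)
  show "open U \<longleftrightarrow> (\<forall>x\<in>U. eventually (\<lambda>(x', y). x' = x \<longrightarrow> y \<in> U) uniformity)" for U :: "C0 set"
    by (rule open_C0_def)
  show "norm u = 0 \<longleftrightarrow> u = 0" by transfer simp
  show "norm (u + v) \<le> norm u + norm v" by transfer (rule norm_triangle_ineq)
  show "norm (a *\<^sub>R u) = \<bar>a\<bar> * norm u" by transfer (rule norm_scaleR)
qed

end

lemma C0_fun_simps [simp]: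
  "C0_fun 0 t = 0" "C0_fun (u + v) t = C0_fun u t + C0_fun v t"
  "C0_fun (u - v) t = C0_fun u t - C0_fun v t" "C0_fun (- u) t = - C0_fun u t"
  "C0_fun (c *\<^sub>R u) t = c * C0_fun u t"
  unfolding C0_fun_def by (transfer; simp)+

lemma norm_C0_eq: "norm u = (SUP t. \<bar>C0_fun u t\<bar>)"
  unfolding C0_fun_def by transfer (simp add: norm_bcontfun_def dist_bcontfun.rep_eq dist_real_def)

lemma abs_C0_fun_le: "\<bar>C0_fun u t\<bar> \<le> norm u"
  unfolding C0_fun_def using norm_bounded[of "Rep_C0 u" t] by (simp add: norm_C0.rep_eq)

lemma periodic_int:
  fixes u :: "real \<Rightarrow> real"
  assumes per: "\<And>t. u (t + 1) = u t"
  shows "u (t + of_int n) = u t"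
proof (induction n rule: int_induct[of _ 0])
  case base show ?case by simp
next
  case (step1 i) then show ?case using per[of "t + of_int i"] by (simp add: algebra_simps)
next
  case (step2 i) then show ?case using per[of "t + of_int (i - 1)"] by (simp add: algebra_simps)
qed

lemma C0_fun_C0_of:
  assumes cont: "continuous_on UNIV u" and per: "\<And>t. u (t + 1) = u t"
  shows "C0_fun (C0_of u) = u"
proof -
  have per_int: "u (t + of_int n) = u t" for t n
    using per by (rule periodic_int)
  have "compact (u ` {0..1})"
    using cont by (intro compact_continuous_image) (auto intro: continuous_on_subset)
  then obtain b where b: "\<And>t. t \<in> {0..1} \<Longrightarrow> norm (u t) \<le> b"
    using compact_imp_bounded bounded_iff by (metis imageI)
  have "norm (u t) \<le> b" for t
    using b[of "frac t"] per_int[of t "- \<lfloor>t\<rfloor>"] frac_ge_0[of t] frac_lt_1[of t]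
    by (simp add: frac_def)
  then have bc: "u \<in> bcontfun" using cont by (rule bcontfun_normI[rotated])
  then have "apply_bcontfun (Bcontfun u) = u" by (simp add: Bcontfun_inverse)
  then show ?thesis by (simp add: C0_fun_def C0_of_def Abs_C0_inverse per)
qed

lemma integrable_C0_fun [simp]: "integrable circle (C0_fun u)"
  by (rule circle.integrable_const_bound[of _ "norm u"])
     (auto intro!: borel_measurable_circle borel_measurable_continuous_onI continuous_C0_fun
       simp: abs_C0_fun_le)

instantiation C0 :: circle_space
begin

definition average_C0 :: "C0 \<Rightarrow> real" where
  "average_C0 u = (\<integral>t. C0_fun u t \<partial>circle)"
definition const_fun_C0 :: "real \<Rightarrow> C0" where
  "const_fun_C0 c = C0_of (\<lambda>_. c)"

lemma C0_fun_const_fun: "C0_fun (const_fun c) t = c"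
  unfolding const_fun_C0_def by (subst C0_fun_C0_of) auto

instance
proof
  note c = C0_fun_const_fun
  fix u v :: C0 and c d :: real
  show "average (u + v) = average u + average v" by (simp add: average_C0_def)
  show "average (c *\<^sub>R u) = c * average u" by (simp add: average_C0_def)
  show "average (const_fun c :: C0) = c" by (simp add: average_C0_def c)
  show "(const_fun (c + d) :: C0) = const_fun c + const_fun d" by (rule C0_eqI) (simp add: c)
  show "(const_fun (c * d) :: C0) = c *\<^sub>R const_fun d" by (rule C0_eqI) (simp add: c)
qed

end


subsection \<open>Continuously differentiable functions\<close>

definition C0_has_deriv :: "C0 \<Rightarrow> C0 \<Rightarrow> bool" where
  "C0_has_deriv u v \<longleftrightarrow> (\<forall>t. (C0_fun u has_real_derivative C0_fun v t) (at t))"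

lemma C0_has_deriv_unique: "C0_has_deriv u v \<Longrightarrow> C0_has_deriv u w \<Longrightarrow> v = w"
  unfolding C0_has_deriv_def by (intro C0_eqI) (metis DERIV_unique)

lemma C0_has_deriv_simps:
  "C0_has_deriv 0 0"
  "C0_has_deriv u u' \<Longrightarrow> C0_has_deriv v v' \<Longrightarrow> C0_has_deriv (u + v) (u' + v')"
  "C0_has_deriv u u' \<Longrightarrow> C0_has_deriv v v' \<Longrightarrow> C0_has_deriv (u - v) (u' - v')"
  "C0_has_deriv u u' \<Longrightarrow> C0_has_deriv (- u) (- u')"
  "C0_has_deriv u u' \<Longrightarrow> C0_has_deriv (c *\<^sub>R u) (c *\<^sub>R u')"
proof -
  have eq: "C0_fun 0 = (\<lambda>t. 0)" "C0_fun (u + v) = (\<lambda>t. C0_fun u t + C0_fun v t)"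
    "C0_fun (u - v) = (\<lambda>t. C0_fun u t - C0_fun v t)" "C0_fun (- u) = (\<lambda>t. - C0_fun u t)"
    "C0_fun (c *\<^sub>R u) = (\<lambda>t. c * C0_fun u t)" for u v c by auto
  show "C0_has_deriv 0 0"
    "C0_has_deriv u u' \<Longrightarrow> C0_has_deriv v v' \<Longrightarrow> C0_has_deriv (u + v) (u' + v')"
    "C0_has_deriv u u' \<Longrightarrow> C0_has_deriv v v' \<Longrightarrow> C0_has_deriv (u - v) (u' - v')"
    "C0_has_deriv u u' \<Longrightarrow> C0_has_deriv (- u) (- u')"
    "C0_has_deriv u u' \<Longrightarrow> C0_has_deriv (c *\<^sub>R u) (c *\<^sub>R u')"
    unfolding C0_has_deriv_def eq
    by (auto intro!: derivative_eq_intros)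
qed

typedef C1 = "{u :: C0. \<exists>v. C0_has_deriv u v}"
  using C0_has_deriv_simps(1) by blast

setup_lifting type_definition_C1

definition C1_fun :: "C1 \<Rightarrow> real \<Rightarrow> real" where
  "C1_fun u = C0_fun (Rep_C1 u)"

lift_definition C1_deriv :: "C1 \<Rightarrow> C0" is "\<lambda>u. THE v. C0_has_deriv u v" .

lemma C1_deriv: "C0_has_deriv (Rep_C1 u) (C1_deriv u)"
  using Rep_C1[of u] unfolding C1_deriv.rep_eq by (auto intro: theI2 C0_has_deriv_unique)

lemma C1_derivI: "C0_has_deriv (Rep_C1 u) v \<Longrightarrow> C1_deriv u = v"
  using C1_deriv C0_has_deriv_unique by blast

instantiation C1 :: real_normed_vector
begin

lift_definition zero_C1 :: C1 is 0 by (auto intro: C0_has_deriv_simps)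
lift_definition plus_C1 :: "C1 \<Rightarrow> C1 \<Rightarrow> C1" is "(+)" by (auto intro: C0_has_deriv_simps)
lift_definition minus_C1 :: "C1 \<Rightarrow> C1 \<Rightarrow> C1" is "(-)" by (auto intro: C0_has_deriv_simps)
lift_definition uminus_C1 :: "C1 \<Rightarrow> C1" is uminus by (auto intro: C0_has_deriv_simps)
lift_definition scaleR_C1 :: "real \<Rightarrow> C1 \<Rightarrow> C1" is "(*\<^sub>R)" by (auto intro: C0_has_deriv_simps)

definition norm_C1 :: "C1 \<Rightarrow> real" where "norm_C1 u = norm (Rep_C1 u) + norm (C1_deriv u)"
definition dist_C1 :: "C1 \<Rightarrow> C1 \<Rightarrow> real" where "dist_C1 u v = norm (u - v)"
definition sgn_C1 :: "C1 \<Rightarrow> C1" where "sgn_C1 u = inverse (norm u) *\<^sub>R u"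
definition uniformity_C1 :: "(C1 \<times> C1) filter" where
  "uniformity_C1 = (INF e\<in>{0<..}. principal {(x, y). dist x y < e})"
definition open_C1 :: "C1 set \<Rightarrow> bool" where
  "open_C1 U \<longleftrightarrow> (\<forall>x\<in>U. eventually (\<lambda>(x', y). x' = x \<longrightarrow> y \<in> U) uniformity)"

instance
proof
  fix u v w :: C1 and a b :: real
  have d: "C1_deriv 0 = 0" "C1_deriv (u + v) = C1_deriv u + C1_deriv v"
    "C1_deriv (a *\<^sub>R u) = a *\<^sub>R C1_deriv u"
    by (rule C1_derivI, unfold zero_C1.rep_eq plus_C1.rep_eq scaleR_C1.rep_eq,
        intro C0_has_deriv_simps C1_deriv)+
  show "u + v + w = u + (v + w)" by transfer (simp add: algebra_simps)
  show "u + v = v + u" by transfer (simp add: algebra_simps)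
  show "0 + u = u" by transfer simp
  show "- u + u = 0" by transfer simp
  show "u - v = u + - v" by transfer simp
  show "a *\<^sub>R (u + v) = a *\<^sub>R u + a *\<^sub>R v" by transfer (rule scaleR_add_right)
  show "(a + b) *\<^sub>R u = a *\<^sub>R u + b *\<^sub>R u" by transfer (rule scaleR_add_left)
  show "a *\<^sub>R b *\<^sub>R u = (a * b) *\<^sub>R u" by transfer (rule scaleR_scaleR)
  show "1 *\<^sub>R u = u" by transfer (rule scaleR_one)
  show "dist u v = norm (u - v)" by (rule dist_C1_def)
  show "sgn u = inverse (norm u) *\<^sub>R u" by (rule sgn_C1_def)
  show "(uniformity :: (C1 \<times> C1) filter) = (INF e\<in>{0<..}. principal {(x, y). dist x y < e})"
    by (rule uniformity_C1_def)
  show "open U \<longleftrightarrow> (\<forall>x\<in>U. eventually (\<lambda>(x', y). x' = x \<longrightarrow> y \<in> U) uniformity)" for U :: "C1 set"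
    by (rule open_C1_def)
  have "norm u = 0 \<Longrightarrow> u = 0"
    unfolding norm_C1_def
    by (simp add: add_nonneg_eq_0_iff Rep_C1_inject[symmetric] zero_C1.rep_eq)
  then show "norm u = 0 \<longleftrightarrow> u = 0" by (auto simp: norm_C1_def d zero_C1.rep_eq)
  show "norm (u + v) \<le> norm u + norm v"
    unfolding norm_C1_def d plus_C1.rep_eq
    using norm_triangle_ineq[of "Rep_C1 u" "Rep_C1 v"]
      norm_triangle_ineq[of "C1_deriv u" "C1_deriv v"] by linarith
  show "norm (a *\<^sub>R u) = \<bar>a\<bar> * norm u"
    unfolding norm_C1_def d scaleR_C1.rep_eq by (simp add: algebra_simps)
qed

end

instantiation C1 :: circle_space
begin

definition average_C1 :: "C1 \<Rightarrow> real" where "average_C1 u = average (Rep_C1 u)"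
lift_definition const_fun_C1 :: "real \<Rightarrow> C1" is const_fun
proof -
  fix c
  have "C0_fun (const_fun c) = (\<lambda>_. c)"
    unfolding const_fun_C0_def by (subst C0_fun_C0_of) auto
  then have "C0_has_deriv (const_fun c) 0" by (simp add: C0_has_deriv_def)
  then show "\<exists>v. C0_has_deriv (const_fun c) v" ..
qed

instance
proof
  fix u v :: C1 and c d :: real
  show "average (u + v) = average u + average v"
    by (simp add: average_C1_def plus_C1.rep_eq average_add)
  show "average (c *\<^sub>R u) = c * average u"
    by (simp add: average_C1_def scaleR_C1.rep_eq average_scaleR)
  show "average (const_fun c :: C1) = c"
    by (simp add: average_C1_def const_fun_C1.rep_eq average_const_fun)
  show "(const_fun (c + d) :: C1) = const_fun c + const_fun d" by transfer (rule const_fun_add)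
  show "(const_fun (c * d) :: C1) = c *\<^sub>R const_fun d" by transfer (rule const_fun_scaleR)
qed

end


subsection \<open>Square integrable functions modulo equality almost everywhere\<close>

definition sq_integrable :: "(real \<Rightarrow> real) \<Rightarrow> bool" where
  "sq_integrable u \<longleftrightarrow> u \<in> borel_measurable circle \<and> integrable circle (\<lambda>t. (u t)\<^sup>2)"

lemma sq_integrable_mult:
  assumes "sq_integrable u" "sq_integrable v"
  shows "integrable circle (\<lambda>t. u t * v t)"
proof (rule Bochner_Integration.integrable_bound)
  show "integrable circle (\<lambda>t. (u t)\<^sup>2 + (v t)\<^sup>2)"
    using assms by (simp add: sq_integrable_def)
  show "(\<lambda>t. u t * v t) \<in> borel_measurable circle"
    using assms by (auto simp: sq_integrable_def intro!: borel_measurable_times)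
  have "\<bar>x * y\<bar> \<le> x\<^sup>2 + y\<^sup>2" for x y :: real
    using sum_squares_bound[of "\<bar>x\<bar>" "\<bar>y\<bar>"] zero_le_power2[of x] zero_le_power2[of y]
    unfolding abs_mult power2_abs by linarith
  then show "AE t in circle. norm (u t * v t) \<le> norm ((u t)\<^sup>2 + (v t)\<^sup>2)"
    by (intro always_eventually allI) (simp add: abs_mult)
qed

lemma sq_integrable_const: "sq_integrable (\<lambda>_. c)"
  by (simp add: sq_integrable_def)

lemma sq_integrable_integrable: "sq_integrable u \<Longrightarrow> integrable circle u"
  using sq_integrable_mult[OF _ sq_integrable_const[of 1]] by simp

lemma sq_integrable_scale:
  assumes "sq_integrable u" shows "sq_integrable (\<lambda>t. c * u t)"
  using assms by (auto simp: sq_integrable_def power_mult_distrib intro!: borel_measurable_times)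

lemma sq_integrable_add:
  assumes u: "sq_integrable u" and v: "sq_integrable v"
  shows "sq_integrable (\<lambda>t. u t + v t)"
proof -
  have "integrable circle (\<lambda>t. (u t)\<^sup>2 + 2 * (u t * v t) + (v t)\<^sup>2)"
    using u v sq_integrable_mult[OF u v] by (simp add: sq_integrable_def)
  then show ?thesis
    using u v by (auto simp: sq_integrable_def power2_sum algebra_simps intro!: borel_measurable_add)
qed

definition L2_rel :: "(real \<Rightarrow> real) \<Rightarrow> (real \<Rightarrow> real) \<Rightarrow> bool" where
  "L2_rel u v \<longleftrightarrow> sq_integrable u \<and> sq_integrable v \<and> (AE t in circle. u t = v t)"

quotient_type L2 = "real \<Rightarrow> real" / partial: L2_rel
proof (rule part_equivpI)
  show "\<exists>u. L2_rel u u"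
    using sq_integrable_const[of 0] by (auto simp: L2_rel_def)
  show "symp L2_rel"
    by (rule sympI) (auto simp: L2_rel_def elim: AE_mp)
  show "transp L2_rel"
  proof (rule transpI)
    fix u v w assume "L2_rel u v" "L2_rel v w"
    then show "L2_rel u w" unfolding L2_rel_def by (auto elim: AE_mp)
  qed
qed

lemma L2_rel_rep: "L2_rel (rep_L2 u) (rep_L2 u)"
  by (rule Quotient_rep_reflp[OF Quotient_L2])

lemma sq_integrable_rep_L2: "sq_integrable (rep_L2 u)"
  using L2_rel_rep[of u] by (simp add: L2_rel_def)

lemma L2_rel_rep_abs: "sq_integrable u \<Longrightarrow> L2_rel (rep_L2 (abs_L2 u)) u"
  by (intro Quotient_rep_abs[OF Quotient_L2]) (simp add: L2_rel_def)

lemma AE_rep_abs_L2: "sq_integrable u \<Longrightarrow> AE t in circle. rep_L2 (abs_L2 u) t = u t"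
  using L2_rel_rep_abs by (simp add: L2_rel_def)

lemma L2_eqI: "(AE t in circle. rep_L2 u t = rep_L2 v t) \<Longrightarrow> u = v"
  using Quotient_rel_rep[OF Quotient_L2, of u v] sq_integrable_rep_L2[of u] sq_integrable_rep_L2[of v]
  by (simp add: L2_rel_def)

instantiation L2 :: real_inner
begin

definition zero_L2 :: L2 where "zero_L2 = abs_L2 (\<lambda>_. 0)"
definition plus_L2 :: "L2 \<Rightarrow> L2 \<Rightarrow> L2" where
  "plus_L2 u v = abs_L2 (\<lambda>t. rep_L2 u t + rep_L2 v t)"
definition scaleR_L2 :: "real \<Rightarrow> L2 \<Rightarrow> L2" where
  "scaleR_L2 c u = abs_L2 (\<lambda>t. c * rep_L2 u t)"
definition uminus_L2 :: "L2 \<Rightarrow> L2" where "uminus_L2 u = (-1) *\<^sub>R u"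
definition minus_L2 :: "L2 \<Rightarrow> L2 \<Rightarrow> L2" where "minus_L2 u v = u + - v"
definition inner_L2 :: "L2 \<Rightarrow> L2 \<Rightarrow> real" where
  "inner_L2 u v = (\<integral>t. rep_L2 u t * rep_L2 v t \<partial>circle)"
definition norm_L2 :: "L2 \<Rightarrow> real" where "norm_L2 u = sqrt (inner u u)"
definition dist_L2 :: "L2 \<Rightarrow> L2 \<Rightarrow> real" where "dist_L2 u v = norm (u - v)"
definition sgn_L2 :: "L2 \<Rightarrow> L2" where "sgn_L2 u = inverse (norm u) *\<^sub>R u"
definition uniformity_L2 :: "(L2 \<times> L2) filter" where
  "uniformity_L2 = (INF e\<in>{0<..}. principal {(x, y). dist x y < e})"
definition open_L2 :: "L2 set \<Rightarrow> bool" where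
  "open_L2 U \<longleftrightarrow> (\<forall>x\<in>U. eventually (\<lambda>(x', y). x' = x \<longrightarrow> y \<in> U) uniformity)"

lemma AE_rep_L2_zero: "AE t in circle. rep_L2 0 t = 0"
  unfolding zero_L2_def by (rule AE_rep_abs_L2[OF sq_integrable_const])

lemma AE_rep_L2_add: "AE t in circle. rep_L2 (u + v) t = rep_L2 u t + rep_L2 v t"
  unfolding plus_L2_def by (intro AE_rep_abs_L2 sq_integrable_add sq_integrable_rep_L2)

lemma AE_rep_L2_scaleR: "AE t in circle. rep_L2 (c *\<^sub>R u) t = c * rep_L2 u t"
  unfolding scaleR_L2_def by (intro AE_rep_abs_L2 sq_integrable_scale sq_integrable_rep_L2)

lemma AE_rep_L2_uminus: "AE t in circle. rep_L2 (- u) t = - rep_L2 u t"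
  unfolding uminus_L2_def using AE_rep_L2_scaleR[of "-1" u] by simp

lemma rep_L2_measurable: "rep_L2 u \<in> borel_measurable circle"
  using sq_integrable_rep_L2[of u] by (simp add: sq_integrable_def)

lemma integrable_rep_L2_mult: "integrable circle (\<lambda>t. rep_L2 u t * rep_L2 v t)"
  by (intro sq_integrable_mult sq_integrable_rep_L2)

instance
proof
  note [measurable] = rep_L2_measurable
  fix u v w :: L2 and a b :: real
  show "u + v + w = u + (v + w)"
    by (rule L2_eqI)
       (use AE_rep_L2_add[of "u + v" w] AE_rep_L2_add[of u v] AE_rep_L2_add[of u "v + w"]
         AE_rep_L2_add[of v w] in eventually_elim, simp)
  show "u + v = v + u"
    by (rule L2_eqI) (use AE_rep_L2_add[of u v] AE_rep_L2_add[of v u] in eventually_elim, simp)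
  show "0 + u = u"
    by (rule L2_eqI) (use AE_rep_L2_add[of 0 u] AE_rep_L2_zero in eventually_elim, simp)
  show "- u + u = 0"
    by (rule L2_eqI)
       (use AE_rep_L2_add[of "- u" u] AE_rep_L2_zero AE_rep_L2_uminus[of u] in eventually_elim, simp)
  show "u - v = u + - v" by (rule minus_L2_def)
  show "a *\<^sub>R (u + v) = a *\<^sub>R u + a *\<^sub>R v"
    by (rule L2_eqI)
       (use AE_rep_L2_add[of u v] AE_rep_L2_add[of "a *\<^sub>R u" "a *\<^sub>R v"] AE_rep_L2_scaleR[of a u]
         AE_rep_L2_scaleR[of a v] AE_rep_L2_scaleR[of a "u + v"]
         in eventually_elim, simp add: algebra_simps)
  show "(a + b) *\<^sub>R u = a *\<^sub>R u + b *\<^sub>R u"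
    by (rule L2_eqI)
       (use AE_rep_L2_add[of "a *\<^sub>R u" "b *\<^sub>R u"] AE_rep_L2_scaleR[of a u] AE_rep_L2_scaleR[of b u]
         AE_rep_L2_scaleR[of "a + b" u] in eventually_elim, simp add: algebra_simps)
  show "a *\<^sub>R b *\<^sub>R u = (a * b) *\<^sub>R u"
    by (rule L2_eqI)
       (use AE_rep_L2_scaleR[of a "b *\<^sub>R u"] AE_rep_L2_scaleR[of b u] AE_rep_L2_scaleR[of "a * b" u]
         in eventually_elim, simp)
  show "1 *\<^sub>R u = u"
    by (rule L2_eqI) (use AE_rep_L2_scaleR[of 1 u] in eventually_elim, simp)
  show "dist u v = norm (u - v)" by (rule dist_L2_def)
  show "sgn u = inverse (norm u) *\<^sub>R u" by (rule sgn_L2_def)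
  show "(uniformity :: (L2 \<times> L2) filter) = (INF e\<in>{0<..}. principal {(x, y). dist x y < e})"
    by (rule uniformity_L2_def)
  show "open U \<longleftrightarrow> (\<forall>x\<in>U. eventually (\<lambda>(x', y). x' = x \<longrightarrow> y \<in> U) uniformity)" for U :: "L2 set"
    by (rule open_L2_def)
  show "inner u v = inner v u" by (simp add: inner_L2_def mult.commute)
  have "inner (u + v) w = (\<integral>t. rep_L2 u t * rep_L2 w t + rep_L2 v t * rep_L2 w t \<partial>circle)"
    unfolding inner_L2_def
    by (rule integral_cong_AE; (measurable)?)
       (use AE_rep_L2_add[of u v] in eventually_elim, simp add: algebra_simps)
  then show "inner (u + v) w = inner u w + inner v w"
    by (simp add: inner_L2_def integrable_rep_L2_mult)
  have "inner (a *\<^sub>R u) v = (\<integral>t. a * (rep_L2 u t * rep_L2 v t) \<partial>circle)"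
    unfolding inner_L2_def
    by (rule integral_cong_AE; (measurable)?)
       (use AE_rep_L2_scaleR[of a u] in eventually_elim, simp)
  then show "inner (a *\<^sub>R u) v = a * inner u v"
    by (simp add: inner_L2_def)
  show "0 \<le> inner u u" by (simp add: inner_L2_def)
  have "inner u u = 0 \<longleftrightarrow> (AE t in circle. rep_L2 u t * rep_L2 u t = 0)"
    unfolding inner_L2_def by (rule integral_nonneg_eq_0_iff_AE[OF integrable_rep_L2_mult]) simp
  also have "\<dots> \<longleftrightarrow> u = 0"
  proof
    assume "AE t in circle. rep_L2 u t * rep_L2 u t = 0"
    then have "AE t in circle. rep_L2 u t = rep_L2 0 t"
      using AE_rep_L2_zero by eventually_elim simp
    then show "u = 0" by (rule L2_eqI)
  next
    assume "u = 0"
    show "AE t in circle. rep_L2 u t * rep_L2 u t = 0"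
      unfolding \<open>u = 0\<close> using AE_rep_L2_zero by eventually_elim simp
  qed
  finally show "inner u u = 0 \<longleftrightarrow> u = 0" .
  show "norm u = sqrt (inner u u)" by (rule norm_L2_def)
qed

end

lemma integrable_rep_L2 [simp]: "integrable circle (rep_L2 u)"
  by (rule sq_integrable_integrable[OF sq_integrable_rep_L2])

lemma set_integral_rep_L2_add:
  assumes "A \<in> sets circle"
  shows "set_lebesgue_integral circle A (rep_L2 (u + v)) =
    set_lebesgue_integral circle A (rep_L2 u) + set_lebesgue_integral circle A (rep_L2 v)"
proof -
  note [measurable] = rep_L2_measurable assms
  have "set_lebesgue_integral circle A (rep_L2 (u + v)) =
      set_lebesgue_integral circle A (\<lambda>t. rep_L2 u t + rep_L2 v t)"
    unfolding set_lebesgue_integral_def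
    by (rule integral_cong_AE; (measurable)?)
       (use AE_rep_L2_add[of u v] in eventually_elim, simp)
  also have "\<dots> = set_lebesgue_integral circle A (rep_L2 u) + set_lebesgue_integral circle A (rep_L2 v)"
    by (intro set_integral_add(2); unfold set_integrable_def;
        intro integrable_mult_indicator integrable_rep_L2 assms)
  finally show ?thesis .
qed

lemma set_integral_rep_L2_scaleR:
  assumes "A \<in> sets circle"
  shows "set_lebesgue_integral circle A (rep_L2 (c *\<^sub>R u)) = c * set_lebesgue_integral circle A (rep_L2 u)"
proof -
  note [measurable] = rep_L2_measurable assms
  have "set_lebesgue_integral circle A (rep_L2 (c *\<^sub>R u)) =
      set_lebesgue_integral circle A (\<lambda>t. c * rep_L2 u t)"
    unfolding set_lebesgue_integral_def
    by (rule integral_cong_AE; (measurable)?)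
       (use AE_rep_L2_scaleR[of c u] in eventually_elim, simp)
  then show ?thesis by simp
qed

instantiation L2 :: circle_space
begin

definition average_L2 :: "L2 \<Rightarrow> real" where
  "average_L2 u = (\<integral>t. rep_L2 u t \<partial>circle)"
definition const_fun_L2 :: "real \<Rightarrow> L2" where
  "const_fun_L2 c = abs_L2 (\<lambda>_. c)"

instance
proof
  have av: "average u = set_lebesgue_integral circle (space circle) (rep_L2 u)" for u :: L2
    unfolding average_L2_def set_lebesgue_integral_def
    by (rule Bochner_Integration.integral_cong) auto
  have c: "AE t in circle. rep_L2 (const_fun c) t = c" for c
    unfolding const_fun_L2_def by (rule AE_rep_abs_L2[OF sq_integrable_const])
  fix u v :: L2 and c d :: real
  show "average (u + v) = average u + average v"
    unfolding av by (rule set_integral_rep_L2_add) (rule sets.top)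
  show "average (c *\<^sub>R u) = c * average u"
    unfolding av by (rule set_integral_rep_L2_scaleR) (rule sets.top)
  have "average (const_fun c :: L2) = (\<integral>t. c \<partial>circle)"
    unfolding average_L2_def
    by (rule integral_cong_AE) (use c rep_L2_measurable in auto)
  then show "average (const_fun c :: L2) = c" by simp
  show "(const_fun (c + d) :: L2) = const_fun c + const_fun d"
    by (rule L2_eqI)
       (use c[of c] c[of d] c[of "c + d"] AE_rep_L2_add[of "const_fun c" "const_fun d"]
        in eventually_elim, simp)
  show "(const_fun (c * d) :: L2) = c *\<^sub>R const_fun d"
    by (rule L2_eqI)
       (use c[of d] c[of "c * d"] AE_rep_L2_scaleR[of c "const_fun d"] in eventually_elim, simp)
qed

end

definition C0_to_L2 :: "C0 \<Rightarrow> L2" where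
  "C0_to_L2 u = abs_L2 (C0_fun u)"

lemma sq_integrable_C0_fun: "sq_integrable (C0_fun u)"
proof -
  have m: "C0_fun u \<in> borel_measurable circle"
    by (intro borel_measurable_circle borel_measurable_continuous_onI continuous_C0_fun)
  have "(C0_fun u t)\<^sup>2 \<le> (norm u)\<^sup>2" for t
    using abs_C0_fun_le[of u t] by (metis abs_le_square_iff abs_norm_cancel)
  then have "integrable circle (\<lambda>t. (C0_fun u t)\<^sup>2)"
    by (intro circle.integrable_const_bound[of _ "(norm u)\<^sup>2"] borel_measurable_power m) auto
  with m show ?thesis by (simp add: sq_integrable_def)
qed

lemma AE_rep_C0_to_L2: "AE t in circle. rep_L2 (C0_to_L2 u) t = C0_fun u t"
  unfolding C0_to_L2_def by (rule AE_rep_abs_L2[OF sq_integrable_C0_fun])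

lemma C0_to_L2_zero: "C0_to_L2 0 = 0"
  by (rule L2_eqI) (use AE_rep_C0_to_L2[of 0] AE_rep_L2_zero in eventually_elim, simp)

lemma C0_to_L2_add: "C0_to_L2 (u + v) = C0_to_L2 u + C0_to_L2 v"
  by (rule L2_eqI)
     (use AE_rep_C0_to_L2[of u] AE_rep_C0_to_L2[of v] AE_rep_C0_to_L2[of "u + v"]
       AE_rep_L2_add[of "C0_to_L2 u" "C0_to_L2 v"] in eventually_elim, simp)

lemma C0_to_L2_scaleR: "C0_to_L2 (c *\<^sub>R u) = c *\<^sub>R C0_to_L2 u"
  by (rule L2_eqI)
     (use AE_rep_C0_to_L2[of u] AE_rep_C0_to_L2[of "c *\<^sub>R u"]
       AE_rep_L2_scaleR[of c "C0_to_L2 u"] in eventually_elim, simp)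


lemma inner_C0_to_L2: "inner v (C0_to_L2 w) = (\<integral>t. rep_L2 v t * C0_fun w t \<partial>circle)"
proof -
  have [measurable]: "C0_fun w \<in> borel_measurable circle"
    using sq_integrable_C0_fun[of w] by (simp add: sq_integrable_def)
  note [measurable] = rep_L2_measurable
  show ?thesis unfolding inner_L2_def
    by (rule integral_cong_AE; (measurable)?)
       (use AE_rep_C0_to_L2[of w] in eventually_elim, simp)
qed

lemma C0_to_L2_eq_0D:
  assumes "C0_to_L2 u = 0" shows "u = 0"
proof -
  have "AE t in circle. C0_fun u t = 0"
    using AE_rep_C0_to_L2[of u] AE_rep_L2_zero unfolding assms by eventually_elim simp
  then have "AE t in lborel. t \<in> {0..1} \<longrightarrow> C0_fun u t = 0"
    unfolding circle_def by (subst (asm) AE_restrict_space_iff) auto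
  then have "AE t in lebesgue. t \<in> {0<..<1} \<longrightarrow> t \<in> {t. C0_fun u t = 0}"
    by (intro AE_completion) (auto elim: AE_mp)
  moreover have "closed {t. C0_fun u t = 0}"
    by (intro closed_Collect_eq continuous_C0_fun continuous_on_const)
  ultimately have open01: "C0_fun u t = 0" if "t \<in> {0<..<1}" for t
    using mem_closed_if_AE_lebesgue_open[of "{0<..<1}" "{t. C0_fun u t = 0}" t] that by auto
  have "closure {0<..<1::real} \<subseteq> {t. C0_fun u t = 0}"
    using open01 \<open>closed {t. C0_fun u t = 0}\<close> by (intro closure_minimal) auto
  then have unit: "C0_fun u t = 0" if "0 \<le> t" "t \<le> 1" for t
    using that by auto
  show ?thesis
  proof (rule C0_eqI)
    fix t
    have "C0_fun u t = C0_fun u (frac t)"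
      using periodic_int[of "C0_fun u" t "- \<lfloor>t\<rfloor>"] C0_fun_periodic by (simp add: frac_def)
    also have "\<dots> = 0"
      by (rule unit) (simp_all add: frac_ge_0 less_imp_le[OF frac_lt_1])
    finally show "C0_fun u t = C0_fun 0 t" by simp
  qed
qed


subsection \<open>The Sobolev space \<open>H\<^sup>1\<close>\<close>

text \<open>
  Elements of \<open>H\<^sup>1\<close> are identified with their continuous representatives (in one dimension
  every element of \<open>H\<^sup>1\<close> has exactly one), so that the values \<open>u t\<close> are defined for every \<open>t\<close>.
\<close>

definition weak_deriv :: "C0 \<Rightarrow> L2 \<Rightarrow> bool" where
  "weak_deriv u v \<longleftrightarrow>
     (\<forall>\<phi> :: C1. inner (C0_to_L2 u) (C0_to_L2 (C1_deriv \<phi>)) = - inner v (C0_to_L2 (Rep_C1 \<phi>)))"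

lemma weak_deriv_zero: "weak_deriv 0 0"
  by (simp add: weak_deriv_def C0_to_L2_zero)

lemma weak_deriv_add: "weak_deriv u u' \<Longrightarrow> weak_deriv v v' \<Longrightarrow> weak_deriv (u + v) (u' + v')"
  by (simp add: weak_deriv_def C0_to_L2_add inner_add_left)

lemma weak_deriv_scaleR: "weak_deriv u u' \<Longrightarrow> weak_deriv (c *\<^sub>R u) (c *\<^sub>R u')"
  by (simp add: weak_deriv_def C0_to_L2_scaleR)

lemma weak_deriv_uminus: "weak_deriv u u' \<Longrightarrow> weak_deriv (- u) (- u')"
  using weak_deriv_scaleR[of u u' "-1"] by simp

lemma weak_deriv_diff: "weak_deriv u u' \<Longrightarrow> weak_deriv v v' \<Longrightarrow> weak_deriv (u - v) (u' - v')"
  using weak_deriv_add[of u u' "- v" "- v'"] weak_deriv_uminus by simp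

lemma DERIV_max0_sq: "((\<lambda>y::real. (max 0 y)\<^sup>2) has_real_derivative 2 * max 0 y) (at y)"
proof -
  consider "y < 0" | "y > 0" | "y = 0" by linarith
  then show ?thesis
  proof cases
    case 1
    have "((\<lambda>y. 0) has_real_derivative 2 * max 0 y) (at y)" using 1 by simp
    then show ?thesis
      by (rule has_field_derivative_transform_within_open[of _ _ _ "{..<0}"]) (use 1 in auto)
  next
    case 2
    have "((\<lambda>y. y\<^sup>2) has_real_derivative 2 * max 0 y) (at y)"
      using 2 by (auto intro!: derivative_eq_intros)
    then show ?thesis
      by (rule has_field_derivative_transform_within_open[of _ _ _ "{0<..}"]) (use 2 in auto)
  next
    case 3
    have "isCont (\<lambda>z::real. max 0 z) 0" by (intro continuous_intros)
    then show ?thesis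
      unfolding CARAT_DERIV 3
      by (intro exI[of _ "\<lambda>z. max 0 z"]) (auto simp: max_def power2_eq_square)
  qed
qed

lemma exists_C1:
  assumes d: "\<And>t. (g has_real_derivative g' t) (at t)" and c: "continuous_on UNIV g'"
    and per: "\<And>t. g (t + 1) = g t" "\<And>t. g' (t + 1) = g' t"
  shows "\<exists>\<phi>. C0_fun (Rep_C1 \<phi>) = g"
proof -
  have "continuous_on UNIV g"
    by (rule DERIV_continuous_on) (use d in \<open>auto intro: DERIV_subset\<close>)
  then have g: "C0_fun (C0_of g) = g" using per by (intro C0_fun_C0_of)
  moreover have "C0_fun (C0_of g') = g'" using per c by (intro C0_fun_C0_of)
  ultimately have "C0_has_deriv (C0_of g) (C0_of g')"
    using d by (simp add: C0_has_deriv_def)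
  then have "Rep_C1 (Abs_C1 (C0_of g)) = C0_of g" by (intro Abs_C1_inverse) auto
  with g show ?thesis by metis
qed

text \<open>Test functions separate \<open>L\<^sup>2\<close>: the indicator of an interval is a limit of test functions.\<close>

lemma L2_eq_0_if_orthogonal_C1:
  assumes orth: "\<And>\<phi>. inner z (C0_to_L2 (Rep_C1 \<phi>)) = 0" shows "z = 0"
proof -
  have int: "set_integrable circle A (rep_L2 z)" if "A \<in> sets circle" for A
    using that unfolding set_integrable_def by (intro integrable_mult_indicator integrable_rep_L2)
  have sets: "B \<inter> {0..1} \<in> sets circle" if "B \<in> sets borel" for B
    using that by (subst circle_def, subst sets_restrict_space_iff) auto
  have cong: "(LINT t:A|circle. rep_L2 z t) = (LINT t:B|circle. rep_L2 z t)"
    if "\<And>t. 0 \<le> t \<Longrightarrow> t \<le> 1 \<Longrightarrow> t \<in> A \<longleftrightarrow> t \<in> B" for A B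
    unfolding set_lebesgue_integral_def
    by (rule Bochner_Integration.integral_cong) (use that in \<open>auto simp: indicator_def\<close>)
  have open_ivl: "(LINT t:{a<..<b} \<inter> {0..1}|circle. rep_L2 z t) = 0"
    if ab: "0 \<le> a" "a < b" "b \<le> 1" for a b
  proof -
    define p where "p t = sin (pi * (t - a)) * sin (pi * (b - t))" for t
    define p' where "p' t = pi * cos (pi * (t - a)) * sin (pi * (b - t))
      - pi * sin (pi * (t - a)) * cos (pi * (b - t))" for t
    define q where "q t = max 0 (p t)" for t
    define \<Phi> where "\<Phi> n t = (q t)\<^sup>2 / ((q t)\<^sup>2 + inverse (real (Suc n)))" for n t
    define \<Phi>' where "\<Phi>' n t = 2 * q t * p' t * inverse (real (Suc n)) /
      ((q t)\<^sup>2 + inverse (real (Suc n)))\<^sup>2" for n t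
    have p_per: "p (t + 1) = p t" "p' (t + 1) = p' t" for t
    proof -
      have e: "pi * (t + 1 - a) = pi * (t - a) + pi" "pi * (b - (t + 1)) = pi * (b - t) - pi"
        by (simp_all add: algebra_simps)
      show "p (t + 1) = p t" "p' (t + 1) = p' t"
        unfolding p_def p'_def e by (simp_all add: sin_diff cos_diff)
    qed
    have dp: "(p has_real_derivative p' t) (at t)" for t
      unfolding p_def p'_def by (auto intro!: derivative_eq_intros simp: algebra_simps)
    have dq: "((\<lambda>t. (q t)\<^sup>2) has_real_derivative 2 * q t * p' t) (at t)" for t
      unfolding q_def by (rule DERIV_chain2[OF DERIV_max0_sq dp])
    have pos: "(q t)\<^sup>2 + inverse (real (Suc n)) > 0" for n t
      by (intro add_nonneg_pos) auto
    have d\<Phi>: "(\<Phi> n has_real_derivative \<Phi>' n t) (at t)" for n t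
    proof -
      let ?e = "inverse (real (Suc n))"
      have "((\<lambda>t. (q t)\<^sup>2 / ((q t)\<^sup>2 + ?e)) has_real_derivative
         ((2 * q t * p' t) * ((q t)\<^sup>2 + ?e) - (q t)\<^sup>2 * (2 * q t * p' t + 0)) /
         (((q t)\<^sup>2 + ?e) * ((q t)\<^sup>2 + ?e))) (at t)"
        by (intro DERIV_divide DERIV_add dq DERIV_const) (use pos[of t n] in linarith)
      moreover have "(2 * q t * p' t) * ((q t)\<^sup>2 + ?e) - (q t)\<^sup>2 * (2 * q t * p' t + 0)
         = 2 * q t * p' t * ?e"
        by (simp only: distrib_left add_0_right) (simp only: mult.commute[of "(q t)\<^sup>2"] add_diff_cancel_left')
      ultimately show ?thesis
        unfolding \<Phi>_def \<Phi>'_def power2_eq_square[of "(q t)\<^sup>2 + ?e"] by (simp only:)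
    qed
    have "continuous_on UNIV p"
      unfolding p_def by (intro continuous_intros)
    then have cq: "continuous_on UNIV q" unfolding q_def by (intro continuous_intros)
    have cp': "continuous_on UNIV p'" unfolding p'_def by (intro continuous_intros)
    have c\<Phi>': "continuous_on UNIV (\<Phi>' n)" for n
      unfolding \<Phi>'_def
      by (intro continuous_intros cq cp') (use pos[of _ n] in \<open>auto simp: less_imp_neq[symmetric]\<close>)
    have c\<Phi>: "continuous_on UNIV (\<Phi> n)" for n
      by (rule DERIV_continuous_on) (use d\<Phi> in \<open>auto intro: DERIV_subset\<close>)
    have zero: "(\<integral>t. rep_L2 z t * \<Phi> n t \<partial>circle) = 0" for n
    proof -
      obtain \<phi> where "C0_fun (Rep_C1 \<phi>) = \<Phi> n"
        using exists_C1[OF d\<Phi> c\<Phi>', of n]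
        by (auto simp: \<Phi>_def \<Phi>'_def q_def p_per)
      then show ?thesis using orth[of \<phi>] by (simp add: inner_C0_to_L2)
    qed
    have bound: "\<bar>\<Phi> n t\<bar> \<le> 1" for n t
      unfolding \<Phi>_def using pos[of t n] by (simp add: abs_of_nonneg divide_le_eq_1)
    have lim: "(\<lambda>n. \<Phi> n t) \<longlonglongrightarrow> (if q t > 0 then 1 else 0)" for t
    proof (cases "q t > 0")
      case True
      have "(\<lambda>n. (q t)\<^sup>2 / ((q t)\<^sup>2 + inverse (real (Suc n)))) \<longlonglongrightarrow> (q t)\<^sup>2 / ((q t)\<^sup>2 + 0)"
        by (intro tendsto_intros LIMSEQ_inverse_real_of_nat) (use True in auto)
      then show ?thesis unfolding \<Phi>_def using True by simp
    next
      case False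
      then have "q t = 0" by (auto simp: q_def)
      then show ?thesis unfolding \<Phi>_def by simp
    qed
    have q_pos: "q t > 0 \<longleftrightarrow> t \<in> {a<..<b} \<inter> {0..1}" if t: "0 \<le> t" "t \<le> 1" for t
    proof -
      have nn: "0 \<le> sin (pi * x)" if "0 \<le> x" "x \<le> 1" for x
        by (rule sin_ge_zero) (use that mult_left_mono[of x 1 pi] in auto)
      have np: "sin (pi * x) \<le> 0" if "-1 \<le> x" "x \<le> 0" for x
        using nn[of "- x"] that by simp
      consider "t \<le> a" | "t \<ge> b" | "a < t" "t < b" by linarith
      then show ?thesis
      proof cases
        case 1
        have "p t \<le> 0" unfolding p_def
          by (rule mult_nonpos_nonneg) (use 1 t ab in \<open>auto intro!: nn np\<close>)
        with 1 show ?thesis by (simp add: q_def)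
      next
        case 2
        have "p t \<le> 0" unfolding p_def
          by (rule mult_nonneg_nonpos) (use 2 t ab in \<open>auto intro!: nn np\<close>)
        with 2 show ?thesis by (simp add: q_def)
      next
        case 3
        have gt: "0 < sin (pi * x)" if "0 < x" "x < 1" for x
          by (rule sin_gt_zero) (use that mult_strict_left_mono[of x 1 pi] in auto)
        have "p t > 0" unfolding p_def
          by (rule mult_pos_pos) (use 3 t ab in \<open>auto intro!: gt\<close>)
        with 3 t show ?thesis by (simp add: q_def)
      qed
    qed
    have "(\<lambda>n. \<integral>t. rep_L2 z t * \<Phi> n t \<partial>circle) \<longlonglongrightarrow>
        (\<integral>t. indicator ({a<..<b} \<inter> {0..1}) t *\<^sub>R rep_L2 z t \<partial>circle)"
    proof (rule integral_dominated_convergence[where w = "\<lambda>t. \<bar>rep_L2 z t\<bar>"])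
      have "{a<..<b} \<inter> {0..1} \<in> sets circle" by (rule sets) simp
      then show "(\<lambda>t. indicator ({a<..<b} \<inter> {0..1}) t *\<^sub>R rep_L2 z t) \<in> borel_measurable circle"
        by (intro borel_measurable_scaleR borel_measurable_indicator rep_L2_measurable)
      show "(\<lambda>t. rep_L2 z t * \<Phi> n t) \<in> borel_measurable circle" for n
        by (intro borel_measurable_times rep_L2_measurable borel_measurable_circle
            borel_measurable_continuous_onI c\<Phi>)
      show "integrable circle (\<lambda>t. \<bar>rep_L2 z t\<bar>)" by simp
      show "AE t in circle. (\<lambda>n. rep_L2 z t * \<Phi> n t) \<longlonglongrightarrow>
          indicator ({a<..<b} \<inter> {0..1}) t *\<^sub>R rep_L2 z t"
      proof (rule AE_I2)
        fix t assume "t \<in> space circle"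
        then have "(if q t > 0 then 1 else 0) = (indicator ({a<..<b} \<inter> {0..1}) t :: real)"
          using q_pos[of t] by (simp add: indicator_def)
        then show "(\<lambda>n. rep_L2 z t * \<Phi> n t) \<longlonglongrightarrow> indicator ({a<..<b} \<inter> {0..1}) t *\<^sub>R rep_L2 z t"
          using tendsto_mult[OF tendsto_const[of "rep_L2 z t"] lim[of t]]
          by (simp add: mult.commute)
      qed
      show "AE t in circle. norm (rep_L2 z t * \<Phi> n t) \<le> \<bar>rep_L2 z t\<bar>" for n
        by (rule AE_I2) (use bound[of n] in \<open>simp add: abs_mult mult_left_le\<close>)
    qed
    then show ?thesis
      unfolding zero set_lebesgue_integral_def by (simp add: LIMSEQ_const_iff)
  qed
  have main: "(LINT t:B \<inter> {0..1}|circle. rep_L2 z t) = 0" if "B \<in> sets borel" for B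
  proof -
    let ?G = "range (\<lambda>(a, b). box a b :: real set)"
    have G: "sets borel = sigma_sets UNIV ?G"
      by (subst borel_eq_box) (rule sets_measure_of, simp)
    have "Int_stable ?G"
      by (auto simp: Int_stable_def box_real)
    moreover have "?G \<subseteq> Pow UNIV" by simp
    moreover have "B \<in> sigma_sets UNIV ?G" using that G by simp
    ultimately show ?thesis
    proof (induction rule: sigma_sets_induct_disjoint)
      case (basic A)
      then obtain a b where A: "A = {a<..<b}" by (auto simp: box_real)
      show ?case
      proof (cases "max a 0 < min b 1")
        case True
        have "(LINT t:A \<inter> {0..1}|circle. rep_L2 z t) =
            (LINT t:{max a 0<..<min b 1} \<inter> {0..1}|circle. rep_L2 z t)"
          unfolding set_lebesgue_integral_def
        proof (rule integral_cong_AE)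
          have "AE t in circle. t \<noteq> 0 \<and> t \<noteq> 1"
            unfolding circle_def
            by (subst AE_restrict_space_iff) (auto intro: AE_mp[OF AE_conjI[OF AE_lborel_singleton[of 0] AE_lborel_singleton[of 1]]])
          then show "AE t in circle. indicator (A \<inter> {0..1}) t *\<^sub>R rep_L2 z t =
              indicator ({max a 0<..<min b 1} \<inter> {0..1}) t *\<^sub>R rep_L2 z t"
            by eventually_elim (auto simp: A indicator_def)
        qed (intro borel_measurable_scaleR borel_measurable_indicator rep_L2_measurable sets; simp add: A)+
        then show ?thesis using open_ivl[of "max a 0" "min b 1"] True by simp
      next
        case False
        have "AE t in circle. t \<noteq> 0 \<and> t \<noteq> 1"
          unfolding circle_def
          by (subst AE_restrict_space_iff) (auto intro: AE_mp[OF AE_conjI[OF AE_lborel_singleton[of 0] AE_lborel_singleton[of 1]]])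
        then have "AE t in circle. indicator (A \<inter> {0..1}) t *\<^sub>R rep_L2 z t = 0"
          by eventually_elim (use False in \<open>auto simp: A indicator_def\<close>)
        then show ?thesis unfolding set_lebesgue_integral_def by (rule integral_eq_zero_AE)
      qed
    next
      case empty then show ?case by (simp add: set_lebesgue_integral_def)
    next
      case (compl A)
      have A: "A \<in> sets borel" using compl G by simp
      have "(LINT t:(A \<inter> {0..1}) \<union> ((UNIV - A) \<inter> {0..1})|circle. rep_L2 z t) =
         (LINT t:A \<inter> {0..1}|circle. rep_L2 z t) + (LINT t:(UNIV - A) \<inter> {0..1}|circle. rep_L2 z t)"
        by (rule set_integral_Un) (use A in \<open>auto intro!: int sets\<close>)
      moreover have "(A \<inter> {0..1}) \<union> ((UNIV - A) \<inter> {0..1}) = {0..1}" by auto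
      moreover have "(LINT t:{0..1}|circle. rep_L2 z t) = 0"
      proof -
        obtain \<phi> where \<phi>: "C0_fun (Rep_C1 \<phi>) = (\<lambda>_. 1)"
          using exists_C1[of "\<lambda>_. 1" "\<lambda>_. 0"] by auto
        have "(LINT t:{0..1}|circle. rep_L2 z t) = (\<integral>t. rep_L2 z t * 1 \<partial>circle)"
          unfolding set_lebesgue_integral_def by (rule Bochner_Integration.integral_cong) auto
        then show ?thesis using orth[of \<phi>] by (simp add: inner_C0_to_L2 \<phi>)
      qed
      ultimately show ?case using compl by simp
    next
      case (union A)
      have A: "A i \<in> sets borel" for i using union G by auto
      have "(LINT t:(\<Union>i. A i \<inter> {0..1})|circle. rep_L2 z t) =
          (\<Sum>i. (LINT t:A i \<inter> {0..1}|circle. rep_L2 z t))"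
      proof (rule lebesgue_integral_countable_add)
        show "A i \<inter> {0..1} \<in> sets circle" for i by (rule sets[OF A])
        then show "set_integrable circle (\<Union>i. A i \<inter> {0..1}) (rep_L2 z)"
          by (intro int sets.countable_UN) auto
        show "A i \<inter> {0..1} \<inter> (A j \<inter> {0..1}) = {}" if "i \<noteq> j" for i j
          using union(1) that by (auto simp: disjoint_family_on_def)
      qed
      then show ?case using union by simp
    qed
  qed
  have "AE t in circle. rep_L2 z t = 0"
  proof (rule circle.density_zero)
    fix A assume "A \<in> sets circle"
    then obtain B where "B \<in> sets borel" "A = B \<inter> {0..1}"
      by (auto simp: circle_def sets_restrict_space)
    then show "set_lebesgue_integral circle A (rep_L2 z) = 0" using main by simp
  qed simp
  then have "AE t in circle. rep_L2 z t = rep_L2 0 t"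
    using AE_rep_L2_zero by eventually_elim simp
  then show ?thesis by (rule L2_eqI)
qed

lemma weak_deriv_unique:
  assumes "weak_deriv u v" "weak_deriv u w" shows "v = w"
proof -
  have "inner (v - w) (C0_to_L2 (Rep_C1 \<phi>)) = 0" for \<phi>
    using assms by (simp add: weak_deriv_def inner_diff_left)
  then show ?thesis using L2_eq_0_if_orthogonal_C1[of "v - w"] by simp
qed

typedef H1 = "{u :: C0. \<exists>v. weak_deriv u v}"
  using weak_deriv_zero by blast

setup_lifting type_definition_H1

definition H1_fun :: "H1 \<Rightarrow> real \<Rightarrow> real" where
  "H1_fun u = C0_fun (Rep_H1 u)"

lift_definition H1_deriv :: "H1 \<Rightarrow> L2" is "\<lambda>u. THE v. weak_deriv u v" .

lemma H1_deriv: "weak_deriv (Rep_H1 u) (H1_deriv u)"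
  using Rep_H1[of u] unfolding H1_deriv.rep_eq by (auto intro: theI2 weak_deriv_unique)

lemma H1_derivI: "weak_deriv (Rep_H1 u) v \<Longrightarrow> H1_deriv u = v"
  using H1_deriv weak_deriv_unique by blast


instantiation H1 :: real_inner
begin

lift_definition zero_H1 :: H1 is 0 by (auto intro: weak_deriv_zero)
lift_definition plus_H1 :: "H1 \<Rightarrow> H1 \<Rightarrow> H1" is "(+)" by (auto intro: weak_deriv_add)
lift_definition minus_H1 :: "H1 \<Rightarrow> H1 \<Rightarrow> H1" is "(-)" by (auto intro: weak_deriv_diff)
lift_definition uminus_H1 :: "H1 \<Rightarrow> H1" is uminus by (auto intro: weak_deriv_uminus)
lift_definition scaleR_H1 :: "real \<Rightarrow> H1 \<Rightarrow> H1" is "(*\<^sub>R)" by (auto intro: weak_deriv_scaleR)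

definition inner_H1 :: "H1 \<Rightarrow> H1 \<Rightarrow> real" where
  "inner_H1 u v = inner (C0_to_L2 (Rep_H1 u)) (C0_to_L2 (Rep_H1 v)) + inner (H1_deriv u) (H1_deriv v)"
definition norm_H1 :: "H1 \<Rightarrow> real" where "norm_H1 u = sqrt (inner u u)"
definition dist_H1 :: "H1 \<Rightarrow> H1 \<Rightarrow> real" where "dist_H1 u v = norm (u - v)"
definition sgn_H1 :: "H1 \<Rightarrow> H1" where "sgn_H1 u = inverse (norm u) *\<^sub>R u"
definition uniformity_H1 :: "(H1 \<times> H1) filter" where
  "uniformity_H1 = (INF e\<in>{0<..}. principal {(x, y). dist x y < e})"
definition open_H1 :: "H1 set \<Rightarrow> bool" where
  "open_H1 U \<longleftrightarrow> (\<forall>x\<in>U. eventually (\<lambda>(x', y). x' = x \<longrightarrow> y \<in> U) uniformity)"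

instance
proof
  fix u v w :: H1 and a b :: real
  have d: "H1_deriv 0 = 0" "H1_deriv (u + v) = H1_deriv u + H1_deriv v"
    "H1_deriv (a *\<^sub>R u) = a *\<^sub>R H1_deriv u"
    by (rule H1_derivI, unfold zero_H1.rep_eq plus_H1.rep_eq scaleR_H1.rep_eq,
        intro weak_deriv_zero weak_deriv_add weak_deriv_scaleR H1_deriv)+
  show "u + v + w = u + (v + w)" by transfer (simp add: algebra_simps)
  show "u + v = v + u" by transfer (simp add: algebra_simps)
  show "0 + u = u" by transfer simp
  show "- u + u = 0" by transfer simp
  show "u - v = u + - v" by transfer simp
  show "a *\<^sub>R (u + v) = a *\<^sub>R u + a *\<^sub>R v" by transfer (rule scaleR_add_right)
  show "(a + b) *\<^sub>R u = a *\<^sub>R u + b *\<^sub>R u" by transfer (rule scaleR_add_left)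
  show "a *\<^sub>R b *\<^sub>R u = (a * b) *\<^sub>R u" by transfer (rule scaleR_scaleR)
  show "1 *\<^sub>R u = u" by transfer (rule scaleR_one)
  show "dist u v = norm (u - v)" by (rule dist_H1_def)
  show "sgn u = inverse (norm u) *\<^sub>R u" by (rule sgn_H1_def)
  show "(uniformity :: (H1 \<times> H1) filter) = (INF e\<in>{0<..}. principal {(x, y). dist x y < e})"
    by (rule uniformity_H1_def)
  show "open U \<longleftrightarrow> (\<forall>x\<in>U. eventually (\<lambda>(x', y). x' = x \<longrightarrow> y \<in> U) uniformity)" for U :: "H1 set"
    by (rule open_H1_def)
  show "inner u v = inner v u" unfolding inner_H1_def by (simp add: inner_commute)
  have "H1_deriv (u + v) = H1_deriv u + H1_deriv v" by (rule d)
  then show "inner (u + v) w = inner u w + inner v w"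
    unfolding inner_H1_def by (simp add: plus_H1.rep_eq C0_to_L2_add inner_add_left)
  show "inner (a *\<^sub>R u) v = a * inner u v"
    unfolding inner_H1_def by (simp add: d scaleR_H1.rep_eq C0_to_L2_scaleR algebra_simps)
  show "0 \<le> inner u u" unfolding inner_H1_def by simp
  show "inner u u = 0 \<longleftrightarrow> u = 0"
  proof
    assume "inner u u = 0"
    then have z: "C0_to_L2 (Rep_H1 u) = 0" "H1_deriv u = 0"
      unfolding inner_H1_def by (simp_all add: add_nonneg_eq_0_iff)
    have "Rep_H1 u = 0" using z(1) by (rule C0_to_L2_eq_0D)
    then show "u = 0" by (simp add: Rep_H1_inject[symmetric] zero_H1.rep_eq)
  qed (simp add: inner_H1_def d zero_H1.rep_eq C0_to_L2_zero)
  show "norm u = sqrt (inner u u)" by (rule norm_H1_def)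
qed

end

instantiation H1 :: circle_space
begin

definition average_H1 :: "H1 \<Rightarrow> real" where "average_H1 u = average (Rep_H1 u)"
lift_definition const_fun_H1 :: "real \<Rightarrow> H1" is const_fun
proof -
  fix c
  have "inner (C0_to_L2 (const_fun c)) (C0_to_L2 (C1_deriv \<phi>)) = 0" for \<phi>
  proof -
    let ?g = "C0_fun (Rep_C1 \<phi>)" and ?g' = "C0_fun (C1_deriv \<phi>)"
    have "inner (C0_to_L2 (const_fun c)) (C0_to_L2 (C1_deriv \<phi>)) = (\<integral>t. c * ?g' t \<partial>circle)"
      unfolding inner_C0_to_L2
    proof (rule integral_cong_AE)
      show "AE t in circle. rep_L2 (C0_to_L2 (const_fun c)) t * ?g' t = c * ?g' t"
        using AE_rep_C0_to_L2[of "const_fun c"] by eventually_elim (simp add: C0_fun_const_fun)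
    qed (intro borel_measurable_times borel_measurable_const rep_L2_measurable
        borel_measurable_circle borel_measurable_continuous_onI continuous_C0_fun)+
    also have "\<dots> = c * (\<integral>t. ?g' t \<partial>circle)" by simp
    also have "(\<integral>t. ?g' t \<partial>circle) = (LBINT t:{0..1}. ?g' t)"
      unfolding circle_def by (subst integral_restrict_space) (auto simp: set_lebesgue_integral_def)
    also have "(LBINT t:{0..1}. ?g' t) = ?g 1 - ?g 0"
      unfolding set_lebesgue_integral_def
      by (intro integral_FTC_atLeastAtMost continuous_C0_fun)
         (use C1_deriv[of \<phi>] in \<open>auto simp: C0_has_deriv_def has_real_derivative_iff_has_vector_derivative[symmetric] intro: DERIV_subset\<close>)
    also have "\<dots> = 0" using C0_fun_periodic[of "Rep_C1 \<phi>" 0] by simp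
    finally show ?thesis by simp
  qed
  then have "weak_deriv (const_fun c) 0" by (simp add: weak_deriv_def)
  then show "\<exists>v. weak_deriv (const_fun c) v" ..
qed

instance
proof
  fix u v :: H1 and c d :: real
  show "average (u + v) = average u + average v"
    by (simp add: average_H1_def plus_H1.rep_eq average_add)
  show "average (c *\<^sub>R u) = c * average u"
    by (simp add: average_H1_def scaleR_H1.rep_eq average_scaleR)
  show "average (const_fun c :: H1) = c"
    by (simp add: average_H1_def const_fun_H1.rep_eq average_const_fun)
  show "(const_fun (c + d) :: H1) = const_fun c + const_fun d" by transfer (rule const_fun_add)
  show "(const_fun (c * d) :: H1) = c *\<^sub>R const_fun d" by transfer (rule const_fun_scaleR)
qed

end


section \<open>The differential operator\<close>

text \<open>
  A function on \<open>\<real>/\<int> \<times> \<real>\<close> is a function \<open>f\<close> on \<open>\<real> \<times> \<real>\<close> that is 1-periodic in the first variable.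
  It is proper iff its restriction to the fundamental domain \<open>[0,1] \<times> \<real>\<close> is, because the latter
  is mapped properly onto \<open>\<real>/\<int> \<times> \<real>\<close>.
\<close>

definition circle_proper :: "(real \<Rightarrow> real \<Rightarrow> real) \<Rightarrow> bool" where
  "circle_proper f \<longleftrightarrow> (\<forall>K. compact K \<longrightarrow> compact {(t, x). t \<in> {0..1} \<and> f t x \<in> K})"

definition nemytskii :: "(real \<Rightarrow> real \<Rightarrow> real) \<Rightarrow> C0 \<Rightarrow> C0" where
  "nemytskii f u = C0_of (\<lambda>t. f t (C0_fun u t))"

lemma nemytskii_apply:
  assumes "continuous_on UNIV (\<lambda>(t, x). f t x)" and "\<And>t x. f (t + 1) x = f t x"
  shows "C0_fun (nemytskii f u) t = f t (C0_fun u t)"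
proof -
  have "continuous_on UNIV (\<lambda>t. (t, C0_fun u t))"
    by (intro continuous_intros continuous_C0_fun)
  then have "continuous_on UNIV (\<lambda>t. f t (C0_fun u t))"
    using continuous_on_compose2[OF assms(1)] by fastforce
  then show ?thesis
    unfolding nemytskii_def by (subst C0_fun_C0_of) (auto simp: C0_fun_periodic assms(2))
qed

definition F_C1 :: "(real \<Rightarrow> real \<Rightarrow> real) \<Rightarrow> C1 \<Rightarrow> C0" where
  "F_C1 f u = C1_deriv u + nemytskii f (Rep_C1 u)"

definition F_H1 :: "(real \<Rightarrow> real \<Rightarrow> real) \<Rightarrow> H1 \<Rightarrow> L2" where
  "F_H1 f u = H1_deriv u + C0_to_L2 (nemytskii f (Rep_H1 u))"

definition Sigma1 :: "(real \<Rightarrow> real \<Rightarrow> real) \<Rightarrow> (real \<Rightarrow> real) \<Rightarrow> real" where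
  "Sigma1 f u = (\<integral>t. deriv (f t) (u t) \<partial>circle)"

end

theory Submission
  imports Defs
begin

text \<open>
  Let \<open>p\<close> be the primitive of average zero and put \<open>K x = x + p (f(\<cdot>, x))\<close>.  This is a proper diffeomorphism
  of \<open>C\<^sup>0\<close>: two solutions cannot cross in one direction only, so it is injective, and its linearisation is
  invertible by Gronwall.  Since \<open>\<Psi> u = w\<close> is equivalent to \<open>K u = \<integral>w + p w\<close>, in both settings \<open>F \<circ> \<Psi>\<^sup>-\<^sup>1\<close> is
  described by one smooth function \<open>\<Phi> q = \<integral>f(\<cdot>, K\<^sup>-\<^sup>1 q)\<close> on \<open>C\<^sup>0\<close>, restricted to the lines \<open>q + \<real>\<close>.

  On the critical set \<open>\<Sigma>\<^sub>1 = 0\<close> the second derivative of \<open>\<Phi>\<close> along these lines does not vanish.  It has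
  constant sign there because the critical set is path connected: \<open>u\<^sub>0\<close> is joined to \<open>u\<^sub>1\<close> by functions that
  switch between the two on a rapidly oscillating set, so that \<open>\<Sigma>\<^sub>1\<close> stays near a convex combination of
  its values, that is, near 0, and a small bump where \<open>D\<^sub>2\<^sup>2f \<noteq> 0\<close> (this is where regularity of the value
  0 enters) restores \<open>\<Sigma>\<^sub>1 = 0\<close> exactly.

  Hence, up to one global sign, \<open>\<Phi>\<close> has only nondegenerate minima on the lines.  One line
  contains a critical point; properness then forces \<open>\<Phi>\<close> to tend to infinity at both ends of every line, so each line
  contains exactly one minimum.  The parametrised Morse lemma
  \<open>\<phi>(m + s) - \<phi>(m) = s\<^sup>2 \<integral>\<^sub>0\<^sup>1 (1 - r) \<phi>''(m + r s) dr\<close> now yields the global normal form.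
\<close>

section \<open>Smooth maps\<close>

text \<open>The equation for K comes from integrating once. In u' + f(., u) - \<integral>f(., u) +
  \<integral>u = w the averages give \<integral>u = \<integral>w, and p turns the rest into u -
  \<integral>u + p f(., u) = p w; the sum of the two contains no derivative. So the nonlinear
  analysis takes place in C0, which is complete and common to both settings, while the other spaces
  enter through bounded linear maps.

  \<Sigma>_1 is nonlinear, so the segment between two critical functions may leave its zero set far
  behind. Oscillation helps because only the fraction of time spent at each of the two functions
  then counts. The transitions between them spoil this a little and are therefore kept short. The
  correcting bump must act with the same strength along the whole path, so it has to sit where the
  path does not move.

  Smoothness means Frechet derivatives of all orders, relative to a subspace. Composition, inversion
  and parameter integrals are needed in that sense; with locally bounded families of directional
  derivatives each of them becomes one induction on the order.\<close>

definition dir_deriv ::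
    "'a::real_normed_vector set \<Rightarrow> ('a \<Rightarrow> 'b::real_normed_vector) \<Rightarrow> 'a \<Rightarrow> ('a \<Rightarrow> 'b) \<Rightarrow> bool" where
  "dir_deriv V G h G' \<longleftrightarrow> (\<forall>x\<in>V. ((\<lambda>t. G (x + t *\<^sub>R h)) has_vector_derivative G' x) (at 0))"

definition loc_bdd :: "'a::real_normed_vector set \<Rightarrow> ('a \<Rightarrow> 'b::real_normed_vector) set \<Rightarrow> bool" where
  "loc_bdd V A \<longleftrightarrow> (\<forall>x\<in>V. \<exists>\<delta>>0. \<exists>C. \<forall>y\<in>V. norm (y - x) < \<delta> \<longrightarrow> (\<forall>G\<in>A. norm (G y) \<le> C))"

text \<open>
  Frechet smoothness is equivalent to the existence of locally bounded iterated directional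
  derivatives (\<open>smooth_on_iff_usm\<close>).  The bounds are stated for families, uniformly in the member,
  because the derivatives of one map in all unit directions form a family: this makes induction
  on the order possible.
\<close>

primrec usm :: "'a::real_normed_vector set \<Rightarrow> nat \<Rightarrow> ('a \<Rightarrow> 'b::real_normed_vector) set \<Rightarrow> bool" where
  "usm V 0 A \<longleftrightarrow> loc_bdd V A"
| "usm V (Suc k) A \<longleftrightarrow> loc_bdd V A \<and>
     (\<exists>B. usm V k B \<and> (\<forall>G\<in>A. \<forall>h\<in>V. norm h \<le> 1 \<longrightarrow> (\<exists>G'\<in>B. dir_deriv V G h G')))"

section \<open>Directional derivatives and closure properties of \<open>usm\<close>\<close>

lemma hvd0_iff:
  fixes f :: "real \<Rightarrow> 'b::real_normed_vector"
  shows "(f has_vector_derivative D) (at 0) \<longleftrightarrow>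
    (\<forall>e>0. \<exists>d>0. \<forall>t. \<bar>t\<bar> < d \<longrightarrow> norm (f t - f 0 - t *\<^sub>R D) \<le> e * \<bar>t\<bar>)"
  unfolding has_vector_derivative_def has_derivative_at_alt
  by (auto intro: bounded_linear_scaleR_left)

lemma hvd0_tendsto:
  fixes f :: "real \<Rightarrow> 'b::real_normed_vector"
  shows "(f has_vector_derivative D) (at 0) \<longleftrightarrow> ((\<lambda>t. (f t - f 0) /\<^sub>R t) \<longlongrightarrow> D) (at 0)"
proof -
  have eq: "norm (f y - (f 0 + (y - 0) *\<^sub>R D)) / norm (y - 0) = norm ((f y - f 0) /\<^sub>R y - D)" if "y \<noteq> 0" for y
  proof -
    have "f y - (f 0 + (y - 0) *\<^sub>R D) = y *\<^sub>R ((f y - f 0) /\<^sub>R y - D)" using that by (simp add: algebra_simps)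
    then show ?thesis using that by simp
  qed
  have "(f has_vector_derivative D) (at 0) \<longleftrightarrow> ((\<lambda>y. norm (f y - (f 0 + (y - 0) *\<^sub>R D)) / norm (y - 0)) \<longlongrightarrow> 0) (at 0)"
    unfolding has_vector_derivative_def has_derivative_iff_norm
    by (simp add: bounded_linear_scaleR_left diff_diff_eq)
  also have "\<dots> \<longleftrightarrow> ((\<lambda>y. norm ((f y - f 0) /\<^sub>R y - D)) \<longlongrightarrow> 0) (at 0)"
    by (intro filterlim_cong refl) (use eq in \<open>auto simp: eventually_at_filter\<close>)
  also have "\<dots> \<longleftrightarrow> ((\<lambda>t. (f t - f 0) /\<^sub>R t) \<longlongrightarrow> D) (at 0)"
    by (simp add: tendsto_norm_zero_iff LIM_zero_iff)
  finally show ?thesis .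
qed

lemma hvd_shift:
  fixes f :: "real \<Rightarrow> 'b::real_normed_vector"
  assumes "((\<lambda>t. f (s + t)) has_vector_derivative D) (at 0)"
  shows "(f has_vector_derivative D) (at s)"
  using assms unfolding has_vector_derivative_def has_derivative_at_alt
  apply (simp add: bounded_linear_scaleR_left)
  apply (intro allI impI)
  subgoal for e
    apply (drule spec[of _ e]) apply clarsimp
    subgoal for d apply (rule exI[of _ d]) apply clarsimp
      subgoal for y apply (drule spec[of _ "y - s"]) by simp done done done

lemma dir_derivD: "dir_deriv V G h G' \<Longrightarrow> x \<in> V \<Longrightarrow> ((\<lambda>t. G (x + t *\<^sub>R h)) has_vector_derivative G' x) (at 0)"
  by (simp add: dir_deriv_def)

lemma dir_deriv_line:
  assumes "dir_deriv V G h G'" "subspace V" "x \<in> V" "h \<in> V"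
  shows "((\<lambda>t. G (x + t *\<^sub>R h)) has_vector_derivative G' (x + s *\<^sub>R h)) (at s)"
proof (rule hvd_shift)
  have "x + s *\<^sub>R h \<in> V" using assms by (simp add: subspace_add subspace_scale)
  from dir_derivD[OF assms(1) this]
  show "((\<lambda>t. G (x + (s + t) *\<^sub>R h)) has_vector_derivative G' (x + s *\<^sub>R h)) (at 0)"
    by (simp add: algebra_simps)
qed

lemma dir_deriv_unique: "dir_deriv V G h G1 \<Longrightarrow> dir_deriv V G h G2 \<Longrightarrow> x \<in> V \<Longrightarrow> G1 x = G2 x"
  unfolding dir_deriv_def by (metis vector_derivative_unique_at)

lemma dir_deriv_cong:
  assumes "dir_deriv V G h G'" "subspace V" "h \<in> V" "\<And>x. x \<in> V \<Longrightarrow> G x = H x" "\<And>x. x \<in> V \<Longrightarrow> G' x = H' x"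
  shows "dir_deriv V H h H'"
  unfolding dir_deriv_def
proof
  fix x assume x: "x \<in> V"
  have "H (x + t *\<^sub>R h) = G (x + t *\<^sub>R h)" for t
    using assms x by (simp add: subspace_add subspace_scale)
  then show "((\<lambda>t. H (x + t *\<^sub>R h)) has_vector_derivative H' x) (at 0)"
    using dir_derivD[OF assms(1) x] assms(5)[OF x] by simp
qed

lemma loc_bdd_subset: "loc_bdd V A' \<Longrightarrow> A \<subseteq> A' \<Longrightarrow> loc_bdd V A"
  unfolding loc_bdd_def by (meson subsetD)

lemma loc_bdd_Un: assumes "loc_bdd V A" "loc_bdd V B" shows "loc_bdd V (A \<union> B)"
  unfolding loc_bdd_def
proof
  fix x assume "x \<in> V"
  with assms obtain d1 C1 d2 C2 where "d1 > 0" "d2 > 0"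
    "\<forall>y\<in>V. norm (y - x) < d1 \<longrightarrow> (\<forall>G\<in>A. norm (G y) \<le> C1)"
    "\<forall>y\<in>V. norm (y - x) < d2 \<longrightarrow> (\<forall>G\<in>B. norm (G y) \<le> C2)" unfolding loc_bdd_def by metis
  then show "\<exists>d>0. \<exists>C. \<forall>y\<in>V. norm (y - x) < d \<longrightarrow> (\<forall>G\<in>A \<union> B. norm (G y) \<le> C)"
    by (intro exI[of _ "min d1 d2"] conjI exI[of _ "max C1 C2"]) (auto simp: le_max_iff_disj)
qed

lemma loc_bdd_two:
  assumes "loc_bdd V A" "loc_bdd V B" "x \<in> V"
  obtains d C where "d > 0" "C \<ge> 0" "\<And>y G. y \<in> V \<Longrightarrow> norm (y - x) < d \<Longrightarrow> G \<in> A \<Longrightarrow> norm (G y) \<le> C"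
    "\<And>y G. y \<in> V \<Longrightarrow> norm (y - x) < d \<Longrightarrow> G \<in> B \<Longrightarrow> norm (G y) \<le> C"
proof -
  from assms obtain d1 C1 d2 C2 where "d1 > 0" "d2 > 0"
    "\<forall>y\<in>V. norm (y - x) < d1 \<longrightarrow> (\<forall>G\<in>A. norm (G y) \<le> C1)"
    "\<forall>y\<in>V. norm (y - x) < d2 \<longrightarrow> (\<forall>G\<in>B. norm (G y) \<le> C2)" unfolding loc_bdd_def by metis
  then show thesis
    by (intro that[of "min d1 d2" "max 0 (max C1 C2)"]) (auto simp: le_max_iff_disj)
qed

text \<open>A majorant \<open>N\<close> of the norms that grows towards the diagonal is what sums,
  pairs and products have in common; a majorant that ignores its second argument covers linear
  images.\<close>

lemma loc_bdd_binop:
  assumes "loc_bdd V A" "loc_bdd V B" and p: "\<And>a b. norm (p a b) \<le> N (norm a) (norm b)"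
    and mono: "\<And>a b C. 0 \<le> a \<Longrightarrow> 0 \<le> b \<Longrightarrow> a \<le> C \<Longrightarrow> b \<le> C \<Longrightarrow> N a b \<le> N C C"
  shows "loc_bdd V {\<lambda>x. p (G x) (H x) | G H. G \<in> A \<and> H \<in> B}"
  unfolding loc_bdd_def
proof
  fix x assume "x \<in> V"
  from loc_bdd_two[OF assms(1,2) this] obtain d C where d: "d > 0"
    "\<And>y G. y \<in> V \<Longrightarrow> norm (y - x) < d \<Longrightarrow> G \<in> A \<Longrightarrow> norm (G y) \<le> C"
    "\<And>y G. y \<in> V \<Longrightarrow> norm (y - x) < d \<Longrightarrow> G \<in> B \<Longrightarrow> norm (G y) \<le> C" by metis
  show "\<exists>d>0. \<exists>C. \<forall>y\<in>V. norm (y - x) < d \<longrightarrow>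
      (\<forall>G'\<in>{\<lambda>x. p (G x) (H x) | G H. G \<in> A \<and> H \<in> B}. norm (G' y) \<le> C)"
  proof (rule exI[of _ d], intro conjI, rule d, rule exI[of _ "N C C"], intro ballI impI)
    fix y F assume y: "y \<in> V" "norm (y - x) < d" and "F \<in> {\<lambda>x. p (G x) (H x) | G H. G \<in> A \<and> H \<in> B}"
    then obtain G H where "F = (\<lambda>x. p (G x) (H x))" "G \<in> A" "H \<in> B" by auto
    then show "norm (F y) \<le> N C C" using d(2)[OF y] d(3)[OF y] by (auto intro!: order.trans[OF p] mono)
  qed
qed

lemma usm_loc_bdd: "usm V k A \<Longrightarrow> loc_bdd V A" by (cases k) auto

lemma usm_subset: assumes "usm V k A'" "A \<subseteq> A'" shows "usm V k A"
proof (cases k)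
  case 0 then show ?thesis using assms loc_bdd_subset by auto
next
  case (Suc j)
  with assms obtain B where "loc_bdd V A'" "usm V j B" "\<And>G h. G \<in> A' \<Longrightarrow> h \<in> V \<Longrightarrow> norm h \<le> 1 \<Longrightarrow> \<exists>G'\<in>B. dir_deriv V G h G'"
    by auto
  then show ?thesis using assms(2) loc_bdd_subset[OF _ assms(2)] unfolding Suc usm.simps by blast
qed

lemma usm_Suc_imp: "usm V (Suc k) A \<Longrightarrow> usm V k A"
proof (induction k arbitrary: A)
  case (Suc k)
  then obtain B where "loc_bdd V A" "usm V (Suc k) B"
    "\<forall>G\<in>A. \<forall>h\<in>V. norm h \<le> 1 \<longrightarrow> (\<exists>G'\<in>B. dir_deriv V G h G')" by (auto simp del: usm.simps simp: usm.simps(2)[of V "Suc k"])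
  with Suc.IH[of B] show ?case by auto
qed simp

lemma usm_SucE:
  assumes "usm V (Suc k) A"
  obtains B where "usm V k B" "\<And>G h. G \<in> A \<Longrightarrow> h \<in> V \<Longrightarrow> norm h \<le> 1 \<Longrightarrow> \<exists>G'\<in>B. dir_deriv V G h G'"
  using assms by (auto)

lemma usm_SucI:
  assumes "loc_bdd V A" "usm V k B" "\<And>G h. G \<in> A \<Longrightarrow> h \<in> V \<Longrightarrow> norm h \<le> 1 \<Longrightarrow> \<exists>G'\<in>B. dir_deriv V G h G'"
  shows "usm V (Suc k) A"
  using assms by (auto)

lemma usm_Un: "usm V k A \<Longrightarrow> usm V k B \<Longrightarrow> usm V k (A \<union> B)"
proof (induction k arbitrary: A B)
  case 0 then show ?case by (simp add: loc_bdd_Un)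
next
  case (Suc k)
  obtain A' where A': "usm V k A'" "\<And>G h. G \<in> A \<Longrightarrow> h \<in> V \<Longrightarrow> norm h \<le> 1 \<Longrightarrow> \<exists>G'\<in>A'. dir_deriv V G h G'"
    using usm_SucE[OF Suc.prems(1)] by metis
  obtain B' where B': "usm V k B'" "\<And>G h. G \<in> B \<Longrightarrow> h \<in> V \<Longrightarrow> norm h \<le> 1 \<Longrightarrow> \<exists>G'\<in>B'. dir_deriv V G h G'"
    using usm_SucE[OF Suc.prems(2)] by metis
  show ?case
    by (rule usm_SucI[OF loc_bdd_Un[OF Suc.prems[THEN usm_loc_bdd]] Suc.IH[OF A'(1) B'(1)]])
      (use A'(2) B'(2) in blast)
qed

lemma usm_add:
  "usm V k A \<Longrightarrow> usm V k B \<Longrightarrow> usm V k {\<lambda>x. G x + H x | G H. G \<in> A \<and> H \<in> B}"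
proof (induction k arbitrary: A B)
  case 0 then show ?case
    by (auto intro!: loc_bdd_binop[where N = "(+)"] norm_triangle_ineq)
next
  case (Suc k)
  obtain A' where A': "usm V k A'" "\<And>G h. G \<in> A \<Longrightarrow> h \<in> V \<Longrightarrow> norm h \<le> 1 \<Longrightarrow> \<exists>G'\<in>A'. dir_deriv V G h G'"
    using usm_SucE[OF Suc.prems(1)] by metis
  obtain B' where B': "usm V k B'" "\<And>G h. G \<in> B \<Longrightarrow> h \<in> V \<Longrightarrow> norm h \<le> 1 \<Longrightarrow> \<exists>G'\<in>B'. dir_deriv V G h G'"
    using usm_SucE[OF Suc.prems(2)] by metis
  show ?case
  proof (rule usm_SucI[OF _ Suc.IH[OF A'(1) B'(1)]])
    show "loc_bdd V {\<lambda>x. G x + H x | G H. G \<in> A \<and> H \<in> B}"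
      using Suc.prems usm_loc_bdd by (auto intro!: loc_bdd_binop[where N = "(+)"] norm_triangle_ineq)
    fix F h assume F: "F \<in> {\<lambda>x. G x + H x | G H. G \<in> A \<and> H \<in> B}" and h: "h \<in> V" "norm h \<le> 1"
    then obtain G H where "F = (\<lambda>x. G x + H x)" "G \<in> A" "H \<in> B" by auto
    with A'(2)[OF _ h] B'(2)[OF _ h] obtain G' H' where
      "F = (\<lambda>x. G x + H x)" "G' \<in> A'" "H' \<in> B'" "dir_deriv V G h G'" "dir_deriv V H h H'" by metis
    then have "dir_deriv V F h (\<lambda>x. G' x + H' x)"
      by (auto simp: dir_deriv_def intro!: has_vector_derivative_add)
    then show "\<exists>G'\<in>{\<lambda>x. G x + H x | G H. G \<in> A' \<and> H \<in> B'}. dir_deriv V F h G'"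
      using \<open>G' \<in> A'\<close> \<open>H' \<in> B'\<close> by blast
  qed
qed

lemma loc_bdd_const: "loc_bdd V {\<lambda>x. c | c. norm c \<le> C}"
  unfolding loc_bdd_def using zero_less_one by blast

lemma usm_const: "usm V k {\<lambda>x. c | c. norm c \<le> C}"
proof (induction k)
  case 0 show ?case unfolding usm.simps by (rule loc_bdd_const)
next
  case (Suc k) show ?case
  proof (rule usm_SucI[OF _ Suc])
    fix G :: "'a \<Rightarrow> 'b" and h :: 'a assume "G \<in> {\<lambda>x. c | c. norm c \<le> C}"
    then obtain c where c: "G = (\<lambda>x. c)" "norm c \<le> C" by auto
    then have "0 \<le> C" using norm_ge_zero order_trans by blast
    then show "\<exists>G'\<in>{\<lambda>x. c | c. norm c \<le> C}. dir_deriv V G h G'"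
      by (intro bexI[of _ "\<lambda>x. 0"]) (auto simp: dir_deriv_def c)
  qed (rule loc_bdd_const)
qed

text \<open>Differentiating an expression with several slots gives one summand per slot;
  \<open>comp_usm\<close> collects them with this lemma.\<close>

lemma usm_sum:
  assumes "usm V k A"
  shows "usm V k {\<lambda>x. \<Sum>i<(n::nat). G i x | G. \<forall>i<n. G i \<in> A}"
proof (induction n)
  case 0 show ?case by (rule usm_subset[OF usm_const[of V k 0]]) auto
next
  case (Suc n)
  show ?case
  proof (rule usm_subset[OF usm_add[OF Suc assms]], clarify)
    fix G :: "nat \<Rightarrow> _" assume "\<forall>i<Suc n. G i \<in> A"
    then show "\<exists>Ga H. (\<lambda>x. \<Sum>i<Suc n. G i x) = (\<lambda>x. Ga x + H x) \<and>
        Ga \<in> {\<lambda>x. \<Sum>i<n. G i x |G. \<forall>i<n. G i \<in> A} \<and> H \<in> A"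
      by (intro exI[of _ "\<lambda>x. \<Sum>i<n. G i x"] exI[of _ "G n"]) auto
  qed
qed

lemma usm_image_bounded_linear:
  assumes T: "bounded_linear T"
  shows "usm V k A \<Longrightarrow> usm V k {\<lambda>x. T (G x) | G. G \<in> A}"
proof (induction k arbitrary: A)
  case 0
  obtain M where M: "\<And>x. norm (T x) \<le> norm x * M" "M \<ge> 0"
    using bounded_linear.nonneg_bounded[OF T] by metis
  show ?case using loc_bdd_binop[OF 0[simplified] 0[simplified], of "\<lambda>a b. T a" "\<lambda>a b. a * M"] M
    by (auto intro: mult_right_mono loc_bdd_subset)
next
  case (Suc k)
  obtain A' where A': "usm V k A'" "\<And>G h. G \<in> A \<Longrightarrow> h \<in> V \<Longrightarrow> norm h \<le> 1 \<Longrightarrow> \<exists>G'\<in>A'. dir_deriv V G h G'"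
    using usm_SucE[OF Suc.prems(1)] by metis
  obtain M where M: "\<And>x. norm (T x) \<le> norm x * M" "M \<ge> 0"
    using bounded_linear.nonneg_bounded[OF T] by metis
  show ?case
  proof (rule usm_SucI[OF _ Suc.IH[OF A'(1)]])
    show "loc_bdd V {\<lambda>x. T (G x) | G. G \<in> A}"
      using loc_bdd_binop[OF usm_loc_bdd[OF Suc.prems] usm_loc_bdd[OF Suc.prems], of "\<lambda>a b. T a" "\<lambda>a b. a * M"] M
      by (auto intro: mult_right_mono loc_bdd_subset)
    fix F h assume F: "F \<in> {\<lambda>x. T (G x) | G. G \<in> A}" and h: "h \<in> V" "norm h \<le> 1"
    then obtain G where "F = (\<lambda>x. T (G x))" "G \<in> A" by auto
    with A'(2)[OF _ h] obtain G' where
      "F = (\<lambda>x. T (G x))" "G' \<in> A'" "dir_deriv V G h G'" by metis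
    then have "dir_deriv V F h (\<lambda>x. T (G' x))"
      by (auto simp: dir_deriv_def intro!: bounded_linear.has_vector_derivative[OF T])
    then show "\<exists>G'\<in>{\<lambda>x. T (G x) | G. G \<in> A'}. dir_deriv V F h G'"
      using \<open>G' \<in> A'\<close> by blast
  qed
qed

lemma usm_bilinear:
  assumes p: "bounded_bilinear p"
  shows "usm V k A \<Longrightarrow> usm V k B \<Longrightarrow> usm V k {\<lambda>x. p (G x) (H x) | G H. G \<in> A \<and> H \<in> B}"
proof (induction k arbitrary: A B)
  case 0
  obtain M where M: "\<And>a b. norm (p a b) \<le> norm a * norm b * M" "M \<ge> 0"
    using bounded_bilinear.nonneg_bounded[OF p] by metis
  show ?case using 0 by (auto intro!: loc_bdd_binop[where N="\<lambda>a b. a * b * M"] M mult_right_mono mult_mono)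
next
  case (Suc k)
  obtain M where M: "\<And>a b. norm (p a b) \<le> norm a * norm b * M" "M \<ge> 0"
    using bounded_bilinear.nonneg_bounded[OF p] by metis
  obtain A' where A': "usm V k A'" "\<And>G h. G \<in> A \<Longrightarrow> h \<in> V \<Longrightarrow> norm h \<le> 1 \<Longrightarrow> \<exists>G'\<in>A'. dir_deriv V G h G'"
    using usm_SucE[OF Suc.prems(1)] by metis
  obtain B' where B': "usm V k B'" "\<And>G h. G \<in> B \<Longrightarrow> h \<in> V \<Longrightarrow> norm h \<le> 1 \<Longrightarrow> \<exists>G'\<in>B'. dir_deriv V G h G'"
    using usm_SucE[OF Suc.prems(2)] by metis
  \<comment> \<open>The product rule leaves one factor undifferentiated, so the original families
    are needed at order \<open>k\<close> as well.\<close>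
  have AB: "usm V k A" "usm V k B" using Suc.prems usm_Suc_imp by blast+
  let ?S = "\<lambda>A B. {\<lambda>x. p (G x) (H x) | G H. G \<in> A \<and> H \<in> B}"
  show ?case
  proof (rule usm_SucI[OF _ usm_add[OF Suc.IH[OF AB(1) B'(1)] Suc.IH[OF A'(1) AB(2)]]])
    show "loc_bdd V (?S A B)"
      using Suc.prems[THEN usm_loc_bdd] by (auto intro!: loc_bdd_binop[where N="\<lambda>a b. a * b * M"] M mult_right_mono mult_mono)
    fix F h assume F: "F \<in> ?S A B" and h: "h \<in> V" "norm h \<le> 1"
    then obtain G H where FGH: "F = (\<lambda>x. p (G x) (H x))" "G \<in> A" "H \<in> B" by auto
    with A'(2)[OF _ h] B'(2)[OF _ h] obtain G' H' where
      GH: "G' \<in> A'" "H' \<in> B'" "dir_deriv V G h G'" "dir_deriv V H h H'" by metis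
    have "dir_deriv V F h (\<lambda>x. p (G x) (H' x) + p (G' x) (H x))"
      unfolding dir_deriv_def
    proof
      fix x assume x: "x \<in> V"
      show "((\<lambda>t. F (x + t *\<^sub>R h)) has_vector_derivative p (G x) (H' x) + p (G' x) (H x)) (at 0)"
        using bounded_bilinear.has_vector_derivative[OF p dir_derivD[OF GH(3) x] dir_derivD[OF GH(4) x]]
        by (simp add: FGH)
    qed
    moreover have "(\<lambda>x. p (G x) (H' x)) \<in> ?S A B'" using FGH GH by blast
    moreover have "(\<lambda>x. p (G' x) (H x)) \<in> ?S A' B" using FGH GH by blast
    ultimately show "\<exists>G'\<in>{\<lambda>x. G x + H x | G H. G \<in> ?S A B' \<and> H \<in> ?S A' B}. dir_deriv V F h G'"
      by (intro bexI) (assumption, rule CollectI, intro exI conjI, rule refl)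
  qed
qed

lemma usm_linear:
  assumes T: "bounded_linear T" shows "usm V k {T}"
proof -
  obtain M where M: "\<And>x. norm (T x) \<le> norm x * M" "M \<ge> 0"
    using bounded_linear.nonneg_bounded[OF T] by metis
  have lb: "loc_bdd V {T}"
    unfolding loc_bdd_def
  proof
    fix x assume "x \<in> V"
    have "norm (T y) \<le> (norm x + 1) * M" if "norm (y - x) < 1" for y
      by (rule order.trans[OF M(1)], rule mult_right_mono[OF _ M(2)]) (use that norm_triangle_sub[of y x] in linarith)
    then show "\<exists>\<delta>>0. \<exists>C. \<forall>y\<in>V. norm (y - x) < \<delta> \<longrightarrow> (\<forall>G\<in>{T}. norm (G y) \<le> C)"
      by (intro exI[of _ 1]) auto
  qed
  show ?thesis
  proof (cases k)
    case 0 then show ?thesis using lb by simp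
  next
    case (Suc k')
    show ?thesis unfolding Suc
    proof (rule usm_SucI[OF lb usm_const[of V _ M]])
      fix G h assume "G \<in> {T}" "h \<in> V" "norm h \<le> 1"
      have "dir_deriv V T h (\<lambda>x. T h)"
        unfolding dir_deriv_def
      proof
        fix x
        have "((\<lambda>t. x + t *\<^sub>R h) has_vector_derivative h) (at 0)"
          by (auto intro!: derivative_eq_intros)
        from bounded_linear.has_vector_derivative[OF T this]
        show "((\<lambda>t. T (x + t *\<^sub>R h)) has_vector_derivative T h) (at 0)" .
      qed
      moreover have "norm (T h) \<le> M"
        using M(1)[of h] mult_right_mono[OF \<open>norm h \<le> 1\<close> M(2)] by simp
      ultimately show "\<exists>G'\<in>{\<lambda>x. c | c. norm c \<le> M}. dir_deriv V G h G'" using \<open>G \<in> {T}\<close> by blast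
    qed
  qed
qed

section \<open>Towers of Frechet derivatives\<close>

definition tower :: "'a::real_normed_vector set \<Rightarrow> ('a \<Rightarrow> 'a list \<Rightarrow> 'b::real_normed_vector) \<Rightarrow> bool" where
  "tower V D \<longleftrightarrow> (\<forall>k. \<forall>x\<in>V. bounded_multilinear_on V k (D x)) \<and>
     (\<forall>k. \<forall>x\<in>V. \<forall>\<epsilon>>0. \<exists>\<delta>>0. \<forall>h\<in>V. norm h < \<delta> \<longrightarrow>
           (\<forall>hs. length hs = k \<and> set hs \<subseteq> V \<longrightarrow>
              norm (D (x + h) hs - D x hs - D x (h # hs)) \<le> \<epsilon> * norm h * prod_list (map norm hs)))"

lemma smooth_on_tower: "smooth_on V g \<longleftrightarrow> (\<exists>D. (\<forall>x\<in>V. D x [] = g x) \<and> tower V D)"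
  unfolding smooth_on_def tower_def ..

lemma towerD:
  assumes "tower V D" "x \<in> V" "\<epsilon> > 0"
  obtains \<delta> where "\<delta> > 0" "\<And>h hs. h \<in> V \<Longrightarrow> norm h < \<delta> \<Longrightarrow> length hs = k \<Longrightarrow> set hs \<subseteq> V \<Longrightarrow>
              norm (D (x + h) hs - D x hs - D x (h # hs)) \<le> \<epsilon> * norm h * prod_list (map norm hs)"
proof -
  from assms have "\<exists>\<delta>>0. \<forall>h\<in>V. norm h < \<delta> \<longrightarrow>
           (\<forall>hs. length hs = k \<and> set hs \<subseteq> V \<longrightarrow>
              norm (D (x + h) hs - D x hs - D x (h # hs)) \<le> \<epsilon> * norm h * prod_list (map norm hs))"
    unfolding tower_def by blast
  then show thesis using that by blast
qed

lemma bounded_multilinear_on_bound: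
  assumes "bounded_multilinear_on V k A"
  obtains C where "C \<ge> 0" "\<And>hs. length hs = k \<Longrightarrow> set hs \<subseteq> V \<Longrightarrow> norm (A hs) \<le> C * prod_list (map norm hs)"
proof -
  obtain C where C: "\<And>hs. length hs = k \<Longrightarrow> set hs \<subseteq> V \<Longrightarrow> norm (A hs) \<le> C * prod_list (map norm hs)"
    using assms unfolding bounded_multilinear_on_def by blast
  have "norm (A hs) \<le> max 0 C * prod_list (map norm hs)" if "length hs = k" "set hs \<subseteq> V" for hs
    using C[OF that] mult_right_mono[of C "max 0 C" "prod_list (map norm hs)"]
    by (smt (verit) ex_map_conv max.cobounded2 norm_ge_zero prod_list_nonneg)
  then show thesis using that[of "max 0 C"] by auto
qed

text \<open>Index updates are replaced by the shape \<open>ps @ h # hs\<close>, which suits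
  inductions that treat the slots from left to right.\<close>

lemma bounded_multilinear_on_slot:
  assumes "bounded_multilinear_on V k A" "length ps + Suc (length hs) = k" "set ps \<subseteq> V" "set hs \<subseteq> V" "h \<in> V" "h' \<in> V"
  shows "A (ps @ (c *\<^sub>R h + h') # hs) = c *\<^sub>R A (ps @ h # hs) + A (ps @ h' # hs)"
proof -
  have "A ((ps @ h # hs)[length ps := c *\<^sub>R h + h']) = c *\<^sub>R A ((ps @ h # hs)[length ps := h]) + A ((ps @ h # hs)[length ps := h'])"
    using assms unfolding bounded_multilinear_on_def
    by (elim conjE allE[of _ "ps @ h # hs"] allE[of _ "length ps"]) auto
  then show ?thesis by simp
qed

lemma bounded_multilinear_on_slots:
  assumes "bounded_multilinear_on V k A" "subspace V" "length ps + Suc (length hs) = k" "set ps \<subseteq> V" "set hs \<subseteq> V" "h \<in> V" "h' \<in> V"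
  shows "A (ps @ (h + h') # hs) = A (ps @ h # hs) + A (ps @ h' # hs)"
    "A (ps @ (h - h') # hs) = A (ps @ h # hs) - A (ps @ h' # hs)"
    "A (ps @ (c *\<^sub>R h) # hs) = c *\<^sub>R A (ps @ h # hs)"
    "A (ps @ 0 # hs) = 0"
proof -
  note s = bounded_multilinear_on_slot[OF assms(1,3,4,5)]
  show "A (ps @ (h + h') # hs) = A (ps @ h # hs) + A (ps @ h' # hs)" using s[of h h' 1] assms by simp
  have 0: "0 \<in> V" using assms(2) by (simp add: subspace_0)
  show z: "A (ps @ 0 # hs) = 0" using s[of 0 0 1] 0 by simp
  show "A (ps @ (c *\<^sub>R h) # hs) = c *\<^sub>R A (ps @ h # hs)" using s[of h 0 c] z 0 assms by simp
  show "A (ps @ (h - h') # hs) = A (ps @ h # hs) - A (ps @ h' # hs)" using s[of h' h "-1"] assms by simp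
qed

lemma prod_list_norm_le_1: "\<forall>h\<in>set hs. norm h \<le> 1 \<Longrightarrow> prod_list (map norm hs) \<le> 1"
  by (induction hs) (auto intro!: mult_le_one prod_list_nonneg)

lemma prod_list_norm_nonneg: "0 \<le> prod_list (map norm hs)"
  by (induction hs) auto

lemma tower_dir_deriv:
  fixes D :: "'a::real_normed_vector \<Rightarrow> 'a list \<Rightarrow> 'b::real_normed_vector"
  assumes D: "tower V D" and V: "subspace V" and hs: "set hs \<subseteq> V" and h: "h \<in> V"
  shows "dir_deriv V (\<lambda>x. D x hs) h (\<lambda>x. D x (h # hs))"
  unfolding dir_deriv_def hvd0_iff
proof (intro ballI allI impI)
  fix x :: 'a and e :: real assume x: "x \<in> V" and e: "0 < e"
  define P where "P = norm h * prod_list (map norm hs)"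
  have P: "P \<ge> 0" by (simp add: P_def prod_list_norm_nonneg)
  \<comment> \<open>The 1 guards against \<open>P = 0\<close>; the radius chosen below guards
    against \<open>h = 0\<close> in the same way.\<close>
  define e' where "e' = e / (P + 1)"
  have e': "e' > 0" using e P by (simp add: e'_def)
  obtain d where d: "d > 0" "\<And>h ks. h \<in> V \<Longrightarrow> norm h < d \<Longrightarrow> length ks = length hs \<Longrightarrow> set ks \<subseteq> V \<Longrightarrow>
              norm (D (x + h) ks - D x ks - D x (h # ks)) \<le> e' * norm h * prod_list (map norm ks)"
    using towerD[OF D x e'] by metis
  have "norm (D (x + t *\<^sub>R h) hs - D x hs - t *\<^sub>R D x (h # hs)) \<le> e * \<bar>t\<bar>" if t: "\<bar>t\<bar> < d / (norm h + 1)" for t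
  proof -
    have "norm (t *\<^sub>R h) \<le> \<bar>t\<bar> * (norm h + 1)" by (simp add: algebra_simps)
    also have "\<dots> < d" using t by (simp add: pos_less_divide_eq add_nonneg_pos)
    finally have "norm (D (x + t *\<^sub>R h) hs - D x hs - D x (t *\<^sub>R h # hs)) \<le> e' * norm (t *\<^sub>R h) * prod_list (map norm hs)"
      using V h hs by (intro d) (auto intro: subspace_scale)
    moreover have "D x (t *\<^sub>R h # hs) = t *\<^sub>R D x (h # hs)"
      using bounded_multilinear_on_slots(3)[of V "Suc (length hs)" "D x" "[]" hs h h t] D V x h hs by (auto simp: tower_def)
    moreover have "e' * norm (t *\<^sub>R h) * prod_list (map norm hs) = e' * P * \<bar>t\<bar>" by (simp add: P_def)
    moreover have "e' * P \<le> e" using e P by (simp add: e'_def field_simps)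
    ultimately show ?thesis by (smt (verit) abs_ge_zero mult_right_mono)
  qed
  then show "\<exists>d>0. \<forall>t. \<bar>t\<bar> < d \<longrightarrow> norm (D (x + t *\<^sub>R h) hs - D (x + 0 *\<^sub>R h) hs - t *\<^sub>R D x (h # hs)) \<le> e * \<bar>t\<bar>"
    using d(1) by (intro exI[of _ "d / (norm h + 1)"]) (auto simp: add_nonneg_pos)
qed

text \<open>Differentiability at \<open>x\<close> with tolerance 1 suffices: near \<open>x\<close>
  the value \<open>D y hs\<close> is close to \<open>D x hs + D x ((y - x) # hs)\<close>, and
  \<open>D x\<close> is bounded in the orders \<open>n\<close> and \<open>n + 1\<close>.\<close>

lemma tower_loc_bound:
  fixes D :: "'a::real_normed_vector \<Rightarrow> 'a list \<Rightarrow> 'b::real_normed_vector"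
  assumes D: "tower V D" and V: "subspace V" and x: "x \<in> V"
  obtains \<delta> C where "\<delta> > 0" "C \<ge> 0" "\<And>y hs. y \<in> V \<Longrightarrow> norm (y - x) < \<delta> \<Longrightarrow> length hs = n \<Longrightarrow> set hs \<subseteq> V \<Longrightarrow>
    norm (D y hs) \<le> C * prod_list (map norm hs)"
proof -
  obtain d where d: "d > 0" "\<And>h hs. h \<in> V \<Longrightarrow> norm h < d \<Longrightarrow> length hs = n \<Longrightarrow> set hs \<subseteq> V \<Longrightarrow>
              norm (D (x + h) hs - D x hs - D x (h # hs)) \<le> 1 * norm h * prod_list (map norm hs)"
    using towerD[OF D x zero_less_one] by metis
  obtain C1 where C1: "C1 \<ge> 0" "\<And>hs. length hs = n \<Longrightarrow> set hs \<subseteq> V \<Longrightarrow> norm (D x hs) \<le> C1 * prod_list (map norm hs)"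
    using D x bounded_multilinear_on_bound[of V n "D x"] unfolding tower_def by metis
  obtain C2 where C2: "C2 \<ge> 0" "\<And>hs. length hs = Suc n \<Longrightarrow> set hs \<subseteq> V \<Longrightarrow> norm (D x hs) \<le> C2 * prod_list (map norm hs)"
    using D x bounded_multilinear_on_bound[of V "Suc n" "D x"] unfolding tower_def by metis
  show thesis
  proof (rule that[of "d" "C1 + d + C2 * d"])
    fix y hs assume y: "y \<in> V" "norm (y - x) < d" and hs: "length hs = n" "set hs \<subseteq> V"
    have yx: "y - x \<in> V" using V y x by (simp add: subspace_diff)
    let ?P = "prod_list (map norm hs)"
    have P: "?P \<ge> 0" by (rule prod_list_norm_nonneg)
    have "norm (D y hs - D x hs - D x ((y - x) # hs)) \<le> norm (y - x) * ?P"
      using d(2)[OF yx y(2) hs] by simp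
    moreover have "norm (D x ((y - x) # hs)) \<le> C2 * (norm (y - x) * ?P)" using C2(2)[of "(y-x) # hs"] yx hs by simp
    moreover have "norm (D x hs) \<le> C1 * ?P" by (rule C1(2)[OF hs])
    moreover have le: "norm (y - x) * ?P \<le> d * ?P" using y P by (intro mult_right_mono) auto
    moreover have "C2 * (norm (y - x) * ?P) \<le> C2 * (d * ?P)" using le C2(1) by (intro mult_left_mono)
    moreover have "norm (D y hs) \<le> norm (D y hs - D x hs - D x ((y - x) # hs)) + norm (D x hs) + norm (D x ((y-x) # hs))"
      by (smt (verit, ccfv_SIG) norm_triangle_sub)
    ultimately show "norm (D y hs) \<le> (C1 + d + C2 * d) * ?P" by (simp add: algebra_simps)
  qed (use d C1 C2 in auto)
qed

text \<open>The derivatives of one order in all unit directions form one family, and differentiating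
  along a further unit vector leads into the family of the next order; so \<open>n\<close> has to
  vary in the induction on \<open>k\<close>.\<close>

lemma tower_usm:
  fixes D :: "'a::real_normed_vector \<Rightarrow> 'a list \<Rightarrow> 'b::real_normed_vector"
  assumes D: "tower V D" and V: "subspace V"
  shows "usm V k {\<lambda>x. D x hs | hs. length hs = n \<and> set hs \<subseteq> V \<and> (\<forall>h\<in>set hs. norm h \<le> 1)}"
proof (induction k arbitrary: n)
  have lb: "loc_bdd V {\<lambda>x. D x hs | hs. length hs = n \<and> set hs \<subseteq> V \<and> (\<forall>h\<in>set hs. norm h \<le> 1)}" for n
    unfolding loc_bdd_def
  proof
    fix x assume "x \<in> V"
    from tower_loc_bound[OF D V this, of n] obtain \<delta> C where \<delta>: "\<delta> > 0" "C \<ge> 0" "\<And>y hs. y \<in> V \<Longrightarrow> norm (y - x) < \<delta> \<Longrightarrow> length hs = n \<Longrightarrow> set hs \<subseteq> V \<Longrightarrow>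
      norm (D y hs) \<le> C * prod_list (map norm hs)" by metis
    have "norm (D y hs) \<le> C" if "y \<in> V" "norm (y - x) < \<delta>" "length hs = n" "set hs \<subseteq> V" "\<forall>h\<in>set hs. norm h \<le> 1" for y hs
      using \<delta>(3)[OF that(1-4)] mult_left_mono[OF prod_list_norm_le_1[OF that(5)] \<delta>(2)] by simp
    then show "\<exists>\<delta>>0. \<exists>C. \<forall>y\<in>V. norm (y - x) < \<delta> \<longrightarrow>
       (\<forall>G\<in>{\<lambda>x. D x hs | hs. length hs = n \<and> set hs \<subseteq> V \<and> (\<forall>h\<in>set hs. norm h \<le> 1)}. norm (G y) \<le> C)"
      using \<delta>(1) by blast
  qed
  { case 0 then show ?case using lb by simp }
  { case (Suc k)
    show ?case
    proof (rule usm_SucI[OF lb Suc.IH[of "Suc n"]])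
      fix G h assume "G \<in> {\<lambda>x. D x hs | hs. length hs = n \<and> set hs \<subseteq> V \<and> (\<forall>h\<in>set hs. norm h \<le> 1)}" and h: "h \<in> V" "norm h \<le> 1"
      then obtain hs where hs: "G = (\<lambda>x. D x hs)" "length hs = n" "set hs \<subseteq> V" "\<forall>h\<in>set hs. norm h \<le> 1" by auto
      show "\<exists>G'\<in>{\<lambda>x. D x hs | hs. length hs = Suc n \<and> set hs \<subseteq> V \<and> (\<forall>h\<in>set hs. norm h \<le> 1)}. dir_deriv V G h G'"
        by (rule bexI[of _ "\<lambda>x. D x (h # hs)"])
           (use hs h tower_dir_deriv[OF D V hs(3) h(1)] in \<open>auto intro!: exI[of _ "h # hs"]\<close>)
    qed }
qed

lemma usm_cong_single:
  assumes V: "subspace V" and u: "usm V k {G}" and eq: "\<And>x. x \<in> V \<Longrightarrow> G x = H x"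
  shows "usm V k {H}"
proof (cases k)
  case 0 then show ?thesis using u eq by (auto simp: loc_bdd_def)
next
  case (Suc j)
  with u obtain B where B: "usm V j B" "\<And>h. h \<in> V \<Longrightarrow> norm h \<le> 1 \<Longrightarrow> \<exists>G'\<in>B. dir_deriv V G h G'" by auto
  show ?thesis unfolding Suc
  proof (rule usm_SucI[OF _ B(1)])
    show "loc_bdd V {H}" using usm_loc_bdd[OF u] eq by (auto simp: loc_bdd_def)
    fix F h assume "F \<in> {H}" "h \<in> V" "norm h \<le> 1"
    with B(2) obtain G' where "G' \<in> B" "dir_deriv V G h G'" by blast
    then show "\<exists>G'\<in>B. dir_deriv V F h G'" using dir_deriv_cong[OF _ V \<open>h \<in> V\<close>, of G G' H G'] eq \<open>F \<in> {H}\<close> by blast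
  qed
qed

text \<open>Two mean value inequalities: the bound on \<open>\<psi>''\<close> controls the variation
  of \<open>\<psi>'\<close>, and this controls that of
  \<open>\<psi> t - t *\<^sub>R \<psi>' 0\<close>. The factor 1/2 of the sharp remainder is given
  up, and vector-valued integrals are avoided.\<close>

lemma taylor1_bound:
  fixes \<psi> :: "real \<Rightarrow> 'b::real_normed_vector"
  assumes d1: "\<And>t. t \<in> {0..1} \<Longrightarrow> (\<psi> has_vector_derivative \<psi>' t) (at t)"
    and d2: "\<And>t. t \<in> {0..1} \<Longrightarrow> (\<psi>' has_vector_derivative \<psi>'' t) (at t)"
    and B: "\<And>t. t \<in> {0..1} \<Longrightarrow> norm (\<psi>'' t) \<le> B"
  shows "norm (\<psi> 1 - \<psi> 0 - \<psi>' 0) \<le> B"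
proof -
  have 1: "norm (\<psi>' t - \<psi>' 0) \<le> B" if t: "t \<in> {0..1}" for t
  proof -
    have "norm (\<psi>' t - \<psi>' 0) \<le> B * norm (t - 0)"
    proof (rule differentiable_bound[of "{0..1}" \<psi>' "\<lambda>x h. h *\<^sub>R \<psi>'' x"])
      fix x :: real assume x: "x \<in> {0..1}"
      show "(\<psi>' has_derivative (\<lambda>h. h *\<^sub>R \<psi>'' x)) (at x within {0..1})"
        using d2[OF x] unfolding has_vector_derivative_def by (rule has_derivative_at_withinI)
      show "onorm (\<lambda>h. h *\<^sub>R \<psi>'' x) \<le> B"
        by (rule onorm_le) (use B[OF x] in \<open>auto simp: mult.commute[of B] intro: mult_left_mono\<close>)
    qed (use t in auto)
    also have "\<dots> \<le> B" using t B[of 0] order_trans[OF norm_ge_zero B[of 0]] by (auto intro!: mult_left_le)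
    finally show ?thesis .
  qed
  have "norm ((\<psi> 1 - 1 *\<^sub>R \<psi>' 0) - (\<psi> 0 - 0 *\<^sub>R \<psi>' 0)) \<le> B * norm (1 - 0::real)"
  proof (rule differentiable_bound[of "{0..1}" "\<lambda>t. \<psi> t - t *\<^sub>R \<psi>' 0" "\<lambda>x h. h *\<^sub>R (\<psi>' x - \<psi>' 0)"])
    fix x :: real assume x: "x \<in> {0..1}"
    show "((\<lambda>t. \<psi> t - t *\<^sub>R \<psi>' 0) has_derivative (\<lambda>h. h *\<^sub>R (\<psi>' x - \<psi>' 0))) (at x within {0..1})"
    proof (rule has_derivative_at_withinI)
      have "((\<lambda>t. \<psi> t - t *\<^sub>R \<psi>' 0) has_vector_derivative \<psi>' x - \<psi>' 0) (at x)"
        using d1[OF x] by (auto intro!: derivative_eq_intros)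
      then show "((\<lambda>t. \<psi> t - t *\<^sub>R \<psi>' 0) has_derivative (\<lambda>h. h *\<^sub>R (\<psi>' x - \<psi>' 0))) (at x)"
        by (simp add: has_vector_derivative_def)
    qed
    show "onorm (\<lambda>h. h *\<^sub>R (\<psi>' x - \<psi>' 0)) \<le> B"
      by (rule onorm_le) (use 1[OF x] in \<open>auto simp: mult.commute[of B] intro: mult_left_mono\<close>)
  qed auto
  then show ?thesis by (simp add: algebra_simps)
qed

section \<open>From iterated directional derivatives to a tower\<close>

primrec iter_dd :: "('a::real_normed_vector \<Rightarrow> 'b::real_normed_vector) \<Rightarrow> 'a list \<Rightarrow> 'a \<Rightarrow> 'b" where
  "iter_dd g [] = g"
| "iter_dd g (h # hs) = (\<lambda>x. vector_derivative (\<lambda>t. iter_dd g hs (x + t *\<^sub>R h)) (at 0))"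

text \<open>\<open>vector_derivative\<close> has an arbitrary value where no derivative exists. Each
  iterate is therefore compared on \<open>V\<close> with a member of a family supplied by
  \<open>usm\<close>. Every step costs one order, which is affordable because \<open>g\<close> has
  all orders.\<close>

lemma usm_iter_dd:
  assumes V: "subspace V" and g: "\<And>k. usm V k {g}"
  shows "\<exists>B. usm V k B \<and> (\<forall>hs. length hs = n \<and> set hs \<subseteq> V \<and> (\<forall>h\<in>set hs. norm h \<le> 1) \<longrightarrow>
           (\<exists>G\<in>B. \<forall>x\<in>V. iter_dd g hs x = G x))"
proof (induction n arbitrary: k)
  case 0 show ?case using g[of k] by (intro exI[of _ "{g}"]) auto
next
  case (Suc n)
  obtain B where B: "usm V (Suc k) B" "\<And>hs. length hs = n \<Longrightarrow> set hs \<subseteq> V \<Longrightarrow> (\<forall>h\<in>set hs. norm h \<le> 1) \<Longrightarrow>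
           \<exists>G\<in>B. \<forall>x\<in>V. iter_dd g hs x = G x" using Suc.IH[of "Suc k"] by blast
  obtain B' where B': "usm V k B'" "\<And>G h. G \<in> B \<Longrightarrow> h \<in> V \<Longrightarrow> norm h \<le> 1 \<Longrightarrow> \<exists>G'\<in>B'. dir_deriv V G h G'"
    using usm_SucE[OF B(1)] by metis
  have "\<exists>G\<in>B'. \<forall>x\<in>V. iter_dd g hs x = G x"
    if hs: "length hs = Suc n" "set hs \<subseteq> V" "\<forall>h\<in>set hs. norm h \<le> 1" for hs
  proof -
    obtain h ks where hk: "hs = h # ks" "length ks = n" using hs(1) by (auto simp: length_Suc_conv)
    obtain G where G: "G \<in> B" "\<And>x. x \<in> V \<Longrightarrow> iter_dd g ks x = G x" using B(2)[of ks] hk hs by auto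
    obtain G' where G': "G' \<in> B'" "dir_deriv V G h G'" using B'(2)[OF G(1), of h] hk hs by auto
    have "dir_deriv V (iter_dd g ks) h G'"
      by (rule dir_deriv_cong[OF G'(2) V]) (use hk hs G in auto)
    then have "iter_dd g hs x = G' x" if "x \<in> V" for x
      unfolding hk using that by (simp add: dir_deriv_def vector_derivative_at)
    with G'(1) show ?thesis by blast
  qed
  then show ?case using B'(1) by blast
qed

lemma usm_iter_dd_unit:
  assumes V: "subspace V" and g: "\<And>k. usm V k {g}" and hs: "set hs \<subseteq> V" "\<forall>h\<in>set hs. norm h \<le> 1" and h: "h \<in> V" "norm h \<le> 1"
  shows "dir_deriv V (iter_dd g hs) h (iter_dd g (h # hs))"
proof -
  obtain B where B: "usm V (Suc 0) B" "\<exists>G\<in>B. \<forall>x\<in>V. iter_dd g hs x = G x"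
    using usm_iter_dd[OF V g, of "Suc 0" "length hs"] hs by blast
  then obtain G where G: "G \<in> B" "\<And>x. x \<in> V \<Longrightarrow> iter_dd g hs x = G x" by auto
  obtain B' where B': "\<And>G h. G \<in> B \<Longrightarrow> h \<in> V \<Longrightarrow> norm h \<le> 1 \<Longrightarrow> \<exists>G'\<in>B'. dir_deriv V G h G'"
    using usm_SucE[OF B(1)] by metis
  obtain G' where G': "dir_deriv V G h G'" using B'[OF G(1) h] by auto
  have d: "dir_deriv V (iter_dd g hs) h G'"
    by (rule dir_deriv_cong[OF G' V h(1)]) (use G in auto)
  then have "iter_dd g (h # hs) x = G' x" if "x \<in> V" for x
    using that by (simp add: dir_deriv_def vector_derivative_at)
  with d show ?thesis unfolding dir_deriv_def by simp
qed

lemma dir_deriv_scale: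
  assumes "dir_deriv V G h G'"
  shows "dir_deriv V (\<lambda>x. a *\<^sub>R G x) (c *\<^sub>R h) (\<lambda>x. (a * c) *\<^sub>R G' x)"
  unfolding dir_deriv_def
proof
  fix x assume "x \<in> V"
  have "((\<lambda>t. t * c) has_vector_derivative c) (at 0)" by (auto intro!: derivative_eq_intros)
  moreover have "((\<lambda>t. G (x + t *\<^sub>R h)) has_vector_derivative G' x) (at (0 * c))"
    using dir_derivD[OF assms \<open>x \<in> V\<close>] by simp
  ultimately have "((\<lambda>t. G (x + t *\<^sub>R h)) \<circ> (\<lambda>t. t * c) has_vector_derivative c *\<^sub>R G' x) (at 0)"
    by (rule vector_diff_chain_at)
  then have "((\<lambda>t. G (x + (t * c) *\<^sub>R h)) has_vector_derivative c *\<^sub>R G' x) (at 0)" by (simp add: o_def)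
  from has_vector_derivative_scaleR[OF DERIV_const[of a] this]
  show "((\<lambda>t. a *\<^sub>R G (x + t *\<^sub>R c *\<^sub>R h)) has_vector_derivative (a * c) *\<^sub>R G' x) (at 0)" by simp
qed

lemma norm_sgn_le_1: "norm (sgn h) \<le> 1" for h :: "'a::real_normed_vector"
  by (simp add: norm_sgn)

lemma sgn_in_subspace: "subspace V \<Longrightarrow> h \<in> V \<Longrightarrow> sgn h \<in> V" for h :: "'a::real_normed_vector"
  by (simp add: sgn_div_norm subspace_scale)

lemma norm_scaleR_sgn: "norm h *\<^sub>R sgn h = h" for h :: "'a::real_normed_vector"
  by (cases "h = 0") (simp_all add: sgn_div_norm)

text \<open>\<open>usm\<close> speaks of directions of norm at most 1, so every direction is
  normalised by \<open>sgn\<close>, with \<open>sgn 0 = 0\<close> covering the zero vector. The two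
  claims feed each other: the identity for \<open>hs\<close> is differentiated along
  \<open>h\<close>, and the derivative so obtained is the identity for
  \<open>h # hs\<close>.\<close>

lemma usm_iter_dd_all:
  assumes V: "subspace V" and g: "\<And>k. usm V k {g}"
  shows "set hs \<subseteq> V \<Longrightarrow> (\<forall>x\<in>V. iter_dd g hs x = prod_list (map norm hs) *\<^sub>R iter_dd g (map sgn hs) x) \<and>
    (\<forall>h\<in>V. dir_deriv V (iter_dd g hs) h (\<lambda>x. (prod_list (map norm hs) * norm h) *\<^sub>R iter_dd g (sgn h # map sgn hs) x))"
proof (induction hs)
  note sg = norm_sgn_le_1 norm_scaleR_sgn
  have sgV: "sgn h \<in> V" if "h \<in> V" for h using that V by (simp add: sgn_div_norm subspace_scale)
  have *: "\<forall>h\<in>V. dir_deriv V (iter_dd g hs) h (\<lambda>x. (prod_list (map norm hs) * norm h) *\<^sub>R iter_dd g (sgn h # map sgn hs) x)"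
    if hs: "set hs \<subseteq> V" and eq: "\<forall>x\<in>V. iter_dd g hs x = prod_list (map norm hs) *\<^sub>R iter_dd g (map sgn hs) x" for hs
  proof
    fix h assume h: "h \<in> V"
    have "dir_deriv V (iter_dd g (map sgn hs)) (sgn h) (iter_dd g (sgn h # map sgn hs))"
      by (rule usm_iter_dd_unit[OF V g]) (use hs h sg sgV in auto)
    from dir_deriv_scale[OF this, of "prod_list (map norm hs)" "norm h"]
    show "dir_deriv V (iter_dd g hs) h (\<lambda>x. (prod_list (map norm hs) * norm h) *\<^sub>R iter_dd g (sgn h # map sgn hs) x)"
      unfolding sg(2) by (rule dir_deriv_cong[OF _ V h]) (use eq in auto)
  qed
  { case Nil then show ?case using *[of "[]"] by simp }
  { case (Cons h hs)
    then have "dir_deriv V (iter_dd g hs) h (\<lambda>x. (prod_list (map norm hs) * norm h) *\<^sub>R iter_dd g (sgn h # map sgn hs) x)"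
      by simp
    then have eq: "\<forall>x\<in>V. iter_dd g (h # hs) x = prod_list (map norm (h # hs)) *\<^sub>R iter_dd g (map sgn (h # hs)) x"
      by (simp add: dir_deriv_def vector_derivative_at mult.commute)
    with *[of "h # hs"] Cons.prems show ?case by blast }
qed

lemma usm_iter_dd_dir:
  assumes V: "subspace V" and g: "\<And>k. usm V k {g}" and hs: "set hs \<subseteq> V" and h: "h \<in> V"
  shows "dir_deriv V (iter_dd g hs) h (iter_dd g (h # hs))"
proof -
  have "dir_deriv V (iter_dd g hs) h (\<lambda>x. (prod_list (map norm hs) * norm h) *\<^sub>R iter_dd g (sgn h # map sgn hs) x)"
    using usm_iter_dd_all[OF V g hs] h by blast
  then have "\<forall>x\<in>V. \<exists>l. ((\<lambda>t. iter_dd g hs (x + t *\<^sub>R h)) has_vector_derivative l) (at 0)"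
    unfolding dir_deriv_def by blast
  then show ?thesis unfolding dir_deriv_def iter_dd.simps by (metis vector_derivative_at)
qed

lemma usm_iter_dd_bound:
  fixes g :: "'a::real_normed_vector \<Rightarrow> 'b::real_normed_vector"
  assumes V: "subspace V" and g: "\<And>k. usm V k {g}" and x: "x \<in> V"
  obtains \<delta> C where "\<delta> > 0" "C \<ge> 0" "\<And>y hs. y \<in> V \<Longrightarrow> norm (y - x) < \<delta> \<Longrightarrow> length hs = n \<Longrightarrow> set hs \<subseteq> V \<Longrightarrow>
    norm (iter_dd g hs y) \<le> C * prod_list (map norm hs)"
proof -
  obtain B where B: "usm V 0 B" "\<And>hs. length hs = n \<Longrightarrow> set hs \<subseteq> V \<Longrightarrow> (\<forall>h\<in>set hs. norm h \<le> 1) \<Longrightarrow>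
           (\<exists>G\<in>B. \<forall>x\<in>V. iter_dd g hs x = G x)" using usm_iter_dd[OF V g, of 0 n] by blast
  then obtain \<delta> C where d: "\<delta> > 0" "\<And>y G. y \<in> V \<Longrightarrow> norm (y - x) < \<delta> \<Longrightarrow> G \<in> B \<Longrightarrow> norm (G y) \<le> C"
    using x unfolding usm.simps loc_bdd_def by metis
  show thesis
  proof (rule that[OF d(1), of "max 0 C"])
    fix y hs assume y: "y \<in> V" "norm (y - x) < \<delta>" and hs: "length hs = n" "set hs \<subseteq> V"
    have "set (map sgn hs) \<subseteq> V" "\<forall>h\<in>set (map sgn hs). norm h \<le> 1"
      using hs sgn_in_subspace[OF V] norm_sgn_le_1 by auto
    then obtain G where G: "G \<in> B" "\<forall>x\<in>V. iter_dd g (map sgn hs) x = G x" using B(2)[of "map sgn hs"] hs by auto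
    have "norm (iter_dd g hs y) = prod_list (map norm hs) * norm (G y)"
      using usm_iter_dd_all[OF V g hs(2)] G y prod_list_norm_nonneg[of hs] by simp
    also have "\<dots> \<le> prod_list (map norm hs) * max 0 C"
      by (intro mult_left_mono prod_list_norm_nonneg) (use d(2)[OF y G(1)] in auto)
    finally show "norm (iter_dd g hs y) \<le> max 0 C * prod_list (map norm hs)" by (simp add: mult.commute)
  qed auto
qed

text \<open>The second derivative along a segment near \<open>x\<close> is bounded, so
  \<open>taylor1_bound\<close> gives a quadratic remainder. The base point \<open>y\<close> may vary
  because \<open>iter_dd_add\<close> uses the estimate at moving points; halving the radius keeps
  the whole segment in the ball where the bound holds.\<close>

lemma iter_dd_frechet:
  fixes g :: "'a::real_normed_vector \<Rightarrow> 'b::real_normed_vector"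
  assumes V: "subspace V" and g: "\<And>k. usm V k {g}" and x: "x \<in> V"
  obtains \<delta> C where "\<delta> > 0" "C \<ge> 0" "\<And>y h hs. y \<in> V \<Longrightarrow> norm (y - x) < \<delta> \<Longrightarrow> h \<in> V \<Longrightarrow> norm h < \<delta> \<Longrightarrow>
    length hs = n \<Longrightarrow> set hs \<subseteq> V \<Longrightarrow>
    norm (iter_dd g hs (y + h) - iter_dd g hs y - iter_dd g (h # hs) y) \<le> C * (norm h * norm h) * prod_list (map norm hs)"
proof -
  obtain d C where d: "d > 0" "C \<ge> 0" "\<And>y hs. y \<in> V \<Longrightarrow> norm (y - x) < d \<Longrightarrow> length hs = Suc (Suc n) \<Longrightarrow> set hs \<subseteq> V \<Longrightarrow>
    norm (iter_dd g hs y) \<le> C * prod_list (map norm hs)" by (rule usm_iter_dd_bound[OF V g x, where n = "Suc (Suc n)"]) blast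
  show thesis
  proof (rule that[of "d/2" C])
    fix y h hs assume y: "y \<in> V" "norm (y - x) < d / 2" and h: "h \<in> V" "norm h < d / 2" and hs: "length hs = n" "set hs \<subseteq> V"
    have in_V: "y + t *\<^sub>R h \<in> V" for t using V y h by (simp add: subspace_add subspace_scale)
    have "norm (iter_dd g hs (y + 1 *\<^sub>R h) - iter_dd g hs (y + 0 *\<^sub>R h) - iter_dd g (h # hs) (y + 0 *\<^sub>R h))
      \<le> C * (norm h * (norm h * prod_list (map norm hs)))"
    proof (rule taylor1_bound[of _ _ "\<lambda>t. iter_dd g (h # h # hs) (y + t *\<^sub>R h)"])
      fix t :: real assume t: "t \<in> {0..1}"
      show "((\<lambda>t. iter_dd g hs (y + t *\<^sub>R h)) has_vector_derivative iter_dd g (h # hs) (y + t *\<^sub>R h)) (at t)"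
        by (rule dir_deriv_line[OF usm_iter_dd_dir[OF V g hs(2) h(1)] V y(1) h(1)])
      show "((\<lambda>t. iter_dd g (h # hs) (y + t *\<^sub>R h)) has_vector_derivative iter_dd g (h # h # hs) (y + t *\<^sub>R h)) (at t)"
        by (rule dir_deriv_line[OF usm_iter_dd_dir[OF V g _ h(1)] V y(1) h(1)]) (use hs h in auto)
      have "norm (y + t *\<^sub>R h - x) \<le> norm (y - x) + norm (t *\<^sub>R h)" by (metis add_diff_eq add.commute diff_add_eq norm_triangle_ineq)
      also have "norm (t *\<^sub>R h) \<le> norm h" using t by (simp add: mult_left_le_one_le)
      finally have "norm (y + t *\<^sub>R h - x) < d" using y h by simp
      from d(3)[OF in_V this, of "h # h # hs"] show "norm (iter_dd g (h # h # hs) (y + t *\<^sub>R h)) \<le> C * (norm h * (norm h * prod_list (map norm hs)))"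
        using hs h by simp
    qed
    then show "norm (iter_dd g hs (y + h) - iter_dd g hs y - iter_dd g (h # hs) y) \<le> C * (norm h * norm h) * prod_list (map norm hs)"
      by (simp add: algebra_simps del: iter_dd.simps(2))
  qed (use d(1,2) in auto)
qed

lemma iter_dd_scale:
  assumes V: "subspace V" and g: "\<And>k. usm V k {g}" and hs: "set hs \<subseteq> V" and h: "h \<in> V" and x: "x \<in> V"
  shows "iter_dd g (c *\<^sub>R h # hs) x = c *\<^sub>R iter_dd g (h # hs) x"
proof -
  have "dir_deriv V (iter_dd g hs) (c *\<^sub>R h) (\<lambda>x. c *\<^sub>R iter_dd g (h # hs) x)"
    using dir_deriv_scale[OF usm_iter_dd_dir[OF V g hs h], of 1 c] by (simp del: iter_dd.simps(2))
  moreover have "dir_deriv V (iter_dd g hs) (c *\<^sub>R h) (iter_dd g (c *\<^sub>R h # hs))"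
    by (rule usm_iter_dd_dir[OF V g hs]) (use V h in \<open>auto intro: subspace_scale\<close>)
  ultimately show ?thesis using dir_deriv_unique x by metis
qed

text \<open>The increment along \<open>h + h'\<close> is made in two steps, first by
  \<open>t *\<^sub>R h\<close> and then by \<open>t *\<^sub>R h'\<close>. Up to a quadratic error
  the second step is \<open>t\<close> times the derivative along \<open>h'\<close> at the moving
  point, and this derivative is continuous along \<open>h\<close> because it is differentiable
  there. In this way local bounds of second order make directional derivatives additive.\<close>

lemma iter_dd_add:
  fixes g :: "'a::real_normed_vector \<Rightarrow> 'b::real_normed_vector"
  assumes V: "subspace V" and g: "\<And>k. usm V k {g}" and hs: "set hs \<subseteq> V" and h: "h \<in> V" and h': "h' \<in> V" and x: "x \<in> V"
  shows "iter_dd g ((h + h') # hs) x = iter_dd g (h # hs) x + iter_dd g (h' # hs) x"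
proof -
  note del = iter_dd.simps(2)[simp del]
  let ?D = "iter_dd g"
  obtain d C where d: "d > 0" "C \<ge> 0" "\<And>y h. y \<in> V \<Longrightarrow> norm (y - x) < d \<Longrightarrow> h \<in> V \<Longrightarrow> norm h < d \<Longrightarrow>
    norm (?D hs (y + h) - ?D hs y - ?D (h # hs) y) \<le> C * (norm h * norm h) * prod_list (map norm hs)"
  proof -
    obtain d C where "d > 0" "C \<ge> 0" and d: "\<And>y h ks. y \<in> V \<Longrightarrow> norm (y - x) < d \<Longrightarrow> h \<in> V \<Longrightarrow> norm h < d \<Longrightarrow> length ks = length hs \<Longrightarrow> set ks \<subseteq> V \<Longrightarrow>
      norm (iter_dd g ks (y + h) - iter_dd g ks y - iter_dd g (h # ks) y) \<le> C * (norm h * norm h) * prod_list (map norm ks)"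
      by (rule iter_dd_frechet[OF V g x, where n = "length hs"]) blast
    then show thesis using that[of d C] d[OF _ _ _ _ refl hs] by blast
  qed
  define M where "M = C * (norm h' * norm h') * prod_list (map norm hs)"
  have dd: "((\<lambda>t. ?D hs (x + t *\<^sub>R k)) has_vector_derivative ?D (k # hs) x) (at 0)" if "k \<in> V" for k
    by (rule dir_derivD[OF usm_iter_dd_dir[OF V g hs that] x])
  have lim1: "((\<lambda>t. (?D hs (x + t *\<^sub>R k) - ?D hs x) /\<^sub>R t) \<longlongrightarrow> ?D (k # hs) x) (at 0)" if "k \<in> V" for k
    using dd[OF that] unfolding hvd0_tendsto by simp
  have "((\<lambda>t. ?D (h' # hs) (x + t *\<^sub>R h)) has_vector_derivative ?D (h # h' # hs) x) (at 0)"
    by (rule dir_derivD[OF usm_iter_dd_dir[OF V g _ h] x]) (use hs h' in auto)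
  then have lim2: "((\<lambda>t. ?D (h' # hs) (x + t *\<^sub>R h)) \<longlongrightarrow> ?D (h' # hs) x) (at 0)"
    using has_vector_derivative_continuous[of _ _ 0 UNIV] by (fastforce simp: continuous_within)
  have hh: "h + h' \<in> V" using V h h' by (simp add: subspace_add)
  have "((\<lambda>t. (?D hs (x + t *\<^sub>R (h + h')) - ?D hs x) /\<^sub>R t - (?D hs (x + t *\<^sub>R h) - ?D hs x) /\<^sub>R t
       - ?D (h' # hs) (x + t *\<^sub>R h)) \<longlongrightarrow> ?D ((h + h') # hs) x - ?D (h # hs) x - ?D (h' # hs) x) (at 0)"
    by (intro tendsto_diff lim1 lim2 hh h)
  moreover have "((\<lambda>t. (?D hs (x + t *\<^sub>R (h + h')) - ?D hs x) /\<^sub>R t - (?D hs (x + t *\<^sub>R h) - ?D hs x) /\<^sub>R t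
       - ?D (h' # hs) (x + t *\<^sub>R h)) \<longlongrightarrow> 0) (at 0)"
  proof (rule Lim_null_comparison[of _ "\<lambda>t. M * \<bar>t\<bar>"])
    have "\<forall>\<^sub>F t in at 0. norm (t *\<^sub>R h) < d" "\<forall>\<^sub>F t in at 0. norm (t *\<^sub>R h') < d"
    proof -
      have "((\<lambda>t. norm (t *\<^sub>R k)) \<longlongrightarrow> norm (0 *\<^sub>R k)) (at (0::real))" for k :: 'a by (intro tendsto_intros)
      then have "((\<lambda>t. norm (t *\<^sub>R k)) \<longlongrightarrow> 0) (at (0::real))" for k :: 'a by simp
      from order_tendstoD(2)[OF this d(1)] show "\<forall>\<^sub>F t in at 0. norm (t *\<^sub>R h) < d" "\<forall>\<^sub>F t in at 0. norm (t *\<^sub>R h') < d" by blast+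
    qed
    moreover have "\<forall>\<^sub>F t in at (0::real). t \<noteq> 0" by (simp add: eventually_at_filter)
    ultimately show "\<forall>\<^sub>F t in at 0. norm ((?D hs (x + t *\<^sub>R (h + h')) - ?D hs x) /\<^sub>R t - (?D hs (x + t *\<^sub>R h) - ?D hs x) /\<^sub>R t
       - ?D (h' # hs) (x + t *\<^sub>R h)) \<le> M * \<bar>t\<bar>"
    proof eventually_elim
      case (elim t)
      have V': "x + t *\<^sub>R h \<in> V" "t *\<^sub>R h' \<in> V" using V x h h' by (simp_all add: subspace_add subspace_scale)
      have "norm (?D hs (x + t *\<^sub>R h + t *\<^sub>R h') - ?D hs (x + t *\<^sub>R h) - ?D (t *\<^sub>R h' # hs) (x + t *\<^sub>R h))
          \<le> C * (norm (t *\<^sub>R h') * norm (t *\<^sub>R h')) * prod_list (map norm hs)"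
        by (rule d(3)) (use V' elim in auto)
      also have "\<dots> = M * \<bar>t\<bar> * \<bar>t\<bar>" by (simp add: M_def)
      also have "?D (t *\<^sub>R h' # hs) (x + t *\<^sub>R h) = t *\<^sub>R ?D (h' # hs) (x + t *\<^sub>R h)"
        by (rule iter_dd_scale[OF V g hs h' V'(1)])
      also have "x + t *\<^sub>R h + t *\<^sub>R h' = x + t *\<^sub>R (h + h')" by (simp add: algebra_simps)
      finally have "norm (?D hs (x + t *\<^sub>R (h + h')) - ?D hs (x + t *\<^sub>R h) - t *\<^sub>R ?D (h' # hs) (x + t *\<^sub>R h)) / \<bar>t\<bar> \<le> M * \<bar>t\<bar>"
        using elim by (simp add: divide_le_eq)
      moreover have "(?D hs (x + t *\<^sub>R (h + h')) - ?D hs x) /\<^sub>R t - (?D hs (x + t *\<^sub>R h) - ?D hs x) /\<^sub>R t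
       - ?D (h' # hs) (x + t *\<^sub>R h) = (?D hs (x + t *\<^sub>R (h + h')) - ?D hs (x + t *\<^sub>R h) - t *\<^sub>R ?D (h' # hs) (x + t *\<^sub>R h)) /\<^sub>R t"
        using elim by (simp add: algebra_simps)
      ultimately show ?case by (simp add: divide_inverse mult.commute)
    qed
    show "((\<lambda>t. M * \<bar>t\<bar>) \<longlongrightarrow> 0) (at 0)" by (auto intro!: tendsto_eq_intros)
  qed
  ultimately have "?D ((h + h') # hs) x - ?D (h # hs) x - ?D (h' # hs) x = 0"
    by (rule tendsto_unique[rotated]) simp
  then show ?thesis by (simp add: algebra_simps)
qed

text \<open>The head slot is the business of \<open>iter_dd_add\<close> and
  \<open>iter_dd_scale\<close>. For a later slot, the identity for the tail holds at all points of
  \<open>V\<close> and is differentiated along the head.\<close>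

lemma iter_dd_multilinear:
  assumes V: "subspace V" and g: "\<And>k. usm V k {g}"
  shows "set hs \<subseteq> V \<Longrightarrow> i < length hs \<Longrightarrow> h \<in> V \<Longrightarrow> h' \<in> V \<Longrightarrow> x \<in> V \<Longrightarrow>
     iter_dd g (hs[i := c *\<^sub>R h + h']) x = c *\<^sub>R iter_dd g (hs[i := h]) x + iter_dd g (hs[i := h']) x"
proof (induction hs arbitrary: i x)
  case (Cons k hs)
  note del = iter_dd.simps(2)[simp del]
  show ?case
  proof (cases i)
    case 0
    have "c *\<^sub>R h \<in> V" using V Cons.prems by (simp add: subspace_scale)
    then show ?thesis using 0 Cons.prems by (simp add: iter_dd_add[OF V g] iter_dd_scale[OF V g])
  next
    case (Suc j)
    have ch: "c *\<^sub>R h + h' \<in> V" using V Cons.prems by (simp add: subspace_scale subspace_add)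
    have upd: "set (hs[j := a]) \<subseteq> V" if "a \<in> V" for a
      using Cons.prems that set_update_subset_insert[of hs j a] by auto
    have "dir_deriv V (iter_dd g (hs[j := c *\<^sub>R h + h'])) k (\<lambda>x. c *\<^sub>R iter_dd g (k # hs[j := h]) x + iter_dd g (k # hs[j := h']) x)"
    proof (rule dir_deriv_cong[OF _ V])
      show "dir_deriv V (\<lambda>x. c *\<^sub>R iter_dd g (hs[j := h]) x + iter_dd g (hs[j := h']) x) k
        (\<lambda>x. c *\<^sub>R iter_dd g (k # hs[j := h]) x + iter_dd g (k # hs[j := h']) x)"
        unfolding dir_deriv_def
        by (intro ballI has_vector_derivative_add bounded_linear.has_vector_derivative[OF bounded_linear_scaleR_right]
            dir_derivD[OF usm_iter_dd_dir[OF V g]] upd) (use Cons.prems in auto)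
    qed (use Cons Suc in auto)
    from dir_deriv_unique[OF _ this Cons.prems(5)]
    have "dir_deriv V (iter_dd g (hs[j := c *\<^sub>R h + h'])) k (iter_dd g (k # hs[j := c *\<^sub>R h + h'])) \<Longrightarrow>
      iter_dd g (k # hs[j := c *\<^sub>R h + h']) x = c *\<^sub>R iter_dd g (k # hs[j := h]) x + iter_dd g (k # hs[j := h']) x" .
    moreover have "dir_deriv V (iter_dd g (hs[j := c *\<^sub>R h + h'])) k (iter_dd g (k # hs[j := c *\<^sub>R h + h']))"
      by (rule usm_iter_dd_dir[OF V g upd[OF ch]]) (use Cons in auto)
    ultimately have "iter_dd g (k # hs[j := c *\<^sub>R h + h']) x = c *\<^sub>R iter_dd g (k # hs[j := h]) x + iter_dd g (k # hs[j := h']) x"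
      by blast
    then show ?thesis by (simp add: Suc)
  qed
qed simp

lemma iter_dd_tower:
  fixes g :: "'a::real_normed_vector \<Rightarrow> 'b::real_normed_vector"
  assumes V: "subspace V" and g: "\<And>k. usm V k {g}"
  shows "tower V (\<lambda>x hs. iter_dd g hs x)"
  unfolding tower_def
proof (intro conjI allI ballI impI)
  note del = iter_dd.simps(2)[simp del]
  fix k and x assume x: "x \<in> V"
  obtain d0 C0 where "d0 > 0" and C0: "\<And>y hs. y \<in> V \<Longrightarrow> norm (y - x) < d0 \<Longrightarrow> length hs = k \<Longrightarrow> set hs \<subseteq> V \<Longrightarrow>
    norm (iter_dd g hs y) \<le> C0 * prod_list (map norm hs)"
    by (rule usm_iter_dd_bound[OF V g x, where n = k]) blast
  have "\<And>hs. length hs = k \<Longrightarrow> set hs \<subseteq> V \<Longrightarrow> norm (iter_dd g hs x) \<le> C0 * prod_list (map norm hs)"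
    using C0[OF x] \<open>d0 > 0\<close> by simp
  then show "bounded_multilinear_on V k (\<lambda>hs. iter_dd g hs x)"
    unfolding bounded_multilinear_on_def using iter_dd_multilinear[OF V g _ _ _ _ x] by blast
  fix e :: real assume e: "e > 0"
  obtain d C where d0: "d > 0" "C \<ge> 0" "\<And>y h hs. y \<in> V \<Longrightarrow> norm (y - x) < d \<Longrightarrow> h \<in> V \<Longrightarrow> norm h < d \<Longrightarrow> length hs = k \<Longrightarrow> set hs \<subseteq> V \<Longrightarrow>
    norm (iter_dd g hs (y + h) - iter_dd g hs y - iter_dd g (h # hs) y) \<le> C * (norm h * norm h) * prod_list (map norm hs)"
    by (rule iter_dd_frechet[OF V g x, where n = k]) blast
  have d: "d > 0" "C \<ge> 0" "\<And>h hs. h \<in> V \<Longrightarrow> norm h < d \<Longrightarrow> length hs = k \<Longrightarrow> set hs \<subseteq> V \<Longrightarrow>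
    norm (iter_dd g hs (x + h) - iter_dd g hs x - iter_dd g (h # hs) x) \<le> C * (norm h * norm h) * prod_list (map norm hs)"
    using d0(1,2) d0(3)[OF x] d0(1) by simp_all
  show "\<exists>\<delta>>0. \<forall>h\<in>V. norm h < \<delta> \<longrightarrow> (\<forall>hs. length hs = k \<and> set hs \<subseteq> V \<longrightarrow>
      norm (iter_dd g hs (x + h) - iter_dd g hs x - iter_dd g (h # hs) x) \<le> e * norm h * prod_list (map norm hs))"
  proof (intro exI[of _ "min d (e / (C + 1))"] conjI ballI impI allI)
    show "0 < min d (e / (C + 1))" using d e by simp
    fix h hs assume h: "h \<in> V" "norm h < min d (e / (C + 1))" and hs: "length hs = k \<and> set hs \<subseteq> V"
    have "norm h * (C + 1) \<le> e" using h(2) d(2) by (simp add: pos_less_divide_eq add_nonneg_pos)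
    then have "C * norm h \<le> e" by (smt (verit) norm_ge_zero mult.commute ring_class.ring_distribs(1) mult_cancel_right2)
    then have "C * norm h * (norm h * prod_list (map norm hs)) \<le> e * (norm h * prod_list (map norm hs))"
      by (intro mult_right_mono) (auto simp: prod_list_norm_nonneg)
    then show "norm (iter_dd g hs (x + h) - iter_dd g hs x - iter_dd g (h # hs) x) \<le> e * norm h * prod_list (map norm hs)"
      using d(3)[of h hs] h hs by (simp add: mult.assoc)
  qed
qed

theorem smooth_on_iff_usm:
  assumes V: "subspace V"
  shows "smooth_on V g \<longleftrightarrow> (\<forall>k. usm V k {g})"
proof
  assume "smooth_on V g"
  then obtain D where D: "\<forall>x\<in>V. D x [] = g x" "tower V D" unfolding smooth_on_tower by auto
  show "\<forall>k. usm V k {g}"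
  proof
    fix k
    have u: "usm V k {\<lambda>x. D x []}" by (rule usm_subset[OF tower_usm[OF D(2) V, of k 0]]) auto
    show "usm V k {g}" by (rule usm_cong_single[OF V u]) (use D in auto)
  qed
next
  assume "\<forall>k. usm V k {g}"
  then show "smooth_on V g" unfolding smooth_on_tower
    by (intro exI[of _ "\<lambda>x hs. iter_dd g hs x"]) (auto intro: iter_dd_tower[OF V])
qed

section \<open>The chain rule and composition of smooth maps\<close>

lemma tendsto_prod_list_norm:
  fixes as :: "(('c \<Rightarrow> 'w::real_normed_vector) \<times> 'w) list"
  assumes "\<And>p. p \<in> set as \<Longrightarrow> (fst p \<longlongrightarrow> snd p) F"
  shows "((\<lambda>t. prod_list (map norm (map (\<lambda>p. fst p t) as))) \<longlongrightarrow> prod_list (map norm (map snd as))) F"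
  using assms by (induction as) (auto intro!: tendsto_mult tendsto_norm)

text \<open>A pair in \<open>as\<close> consists of a curve and its limit. The slots are frozen at
  their limits from left to right, and \<open>ps\<close> holds those already frozen. The slot in
  turn is split into limit plus difference; the term with the difference has a factor that tends to
  0 while the others stay bounded.\<close>

lemma multilinear_tendsto:
  fixes as :: "(('c \<Rightarrow> 'w::real_normed_vector) \<times> 'w) list"
  assumes A: "bounded_multilinear_on W k A" and W: "subspace W"
  shows "length ps + length as = k \<Longrightarrow> set ps \<subseteq> W \<Longrightarrow>
    (\<And>p. p \<in> set as \<Longrightarrow> (\<forall>t. fst p t \<in> W) \<and> snd p \<in> W \<and> (fst p \<longlongrightarrow> snd p) F) \<Longrightarrow>
    ((\<lambda>t. A (ps @ map (\<lambda>p. fst p t) as)) \<longlongrightarrow> A (ps @ map snd as)) F"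
proof (induction as arbitrary: ps)
  case Nil then show ?case by simp
next
  case (Cons p as)
  obtain a l where p: "p = (a, l)" by (cases p)
  have al: "\<And>t. a t \<in> W" "l \<in> W" "(a \<longlongrightarrow> l) F" using Cons.prems(3)[of p] p by auto
  have as: "\<And>q t. q \<in> set as \<Longrightarrow> fst q t \<in> W" "\<And>q. q \<in> set as \<Longrightarrow> snd q \<in> W" "\<And>q. q \<in> set as \<Longrightarrow> (fst q \<longlongrightarrow> snd q) F"
    using Cons.prems(3) by auto
  let ?r = "\<lambda>t. map (\<lambda>p. fst p t) as"
  obtain C where C: "C \<ge> 0" "\<And>hs. length hs = k \<Longrightarrow> set hs \<subseteq> W \<Longrightarrow> norm (A hs) \<le> C * prod_list (map norm hs)"
    using bounded_multilinear_on_bound[OF A] by metis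
  have rW: "set (?r t) \<subseteq> W" for t using as by auto
  have split: "A (ps @ a t # ?r t) = A (ps @ (a t - l) # ?r t) + A ((ps @ [l]) @ ?r t)" for t
    using bounded_multilinear_on_slots(2)[OF A W, of ps "?r t" "a t" l] Cons.prems(1,2) rW al by simp
  have "((\<lambda>t. A (ps @ (a t - l) # ?r t)) \<longlongrightarrow> 0) F"
  proof (rule Lim_null_comparison)
    show "\<forall>\<^sub>F t in F. norm (A (ps @ (a t - l) # ?r t)) \<le> C * (prod_list (map norm ps) * (norm (a t - l) * prod_list (map norm (?r t))))"
    proof (rule always_eventually, rule allI)
      fix t
      have "norm (A (ps @ (a t - l) # ?r t)) \<le> C * prod_list (map norm (ps @ (a t - l) # ?r t))"
        by (rule C(2)) (use Cons.prems al rW W in \<open>auto simp: subspace_diff\<close>)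
      then show "norm (A (ps @ (a t - l) # ?r t)) \<le> C * (prod_list (map norm ps) * (norm (a t - l) * prod_list (map norm (?r t))))"
        by simp
    qed
    have "((\<lambda>t. C * (prod_list (map norm ps) * (norm (a t - l) * prod_list (map norm (?r t))))) \<longlongrightarrow>
       C * (prod_list (map norm ps) * (norm (l - l) * prod_list (map norm (map snd as))))) F"
      by (intro tendsto_mult tendsto_const tendsto_norm tendsto_diff al tendsto_prod_list_norm as)
    then show "((\<lambda>t. C * (prod_list (map norm ps) * (norm (a t - l) * prod_list (map norm (?r t))))) \<longlongrightarrow> 0) F" by simp
  qed
  moreover have "((\<lambda>t. A ((ps @ [l]) @ ?r t)) \<longlongrightarrow> A ((ps @ [l]) @ map snd as)) F"
    by (rule Cons.IH) (use Cons.prems al in auto)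
  ultimately have "((\<lambda>t. A (ps @ a t # ?r t)) \<longlongrightarrow> 0 + A ((ps @ [l]) @ map snd as)) F"
    unfolding split by (rule tendsto_add)
  then show ?case by (simp add: p)
qed

text \<open>The same freezing gives the product rule; here a pair is a curve with its derivative,
  and a slot is frozen at the value at 0. In the difference quotient of one slot the slots to its
  right still move, so \<open>multilinear_tendsto\<close> is applied with the pairs
  \<open>(fst q, fst q 0)\<close>.\<close>

lemma multilinear_hvd:
  fixes as :: "((real \<Rightarrow> 'w::real_normed_vector) \<times> 'w) list"
  assumes A: "bounded_multilinear_on W k A" and W: "subspace W"
  shows "length ps + length as = k \<Longrightarrow> set ps \<subseteq> W \<Longrightarrow>
    (\<And>p. p \<in> set as \<Longrightarrow> (\<forall>t. fst p t \<in> W) \<and> snd p \<in> W \<and> (fst p has_vector_derivative snd p) (at 0)) \<Longrightarrow>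
    ((\<lambda>t. A (ps @ map (\<lambda>p. fst p t) as)) has_vector_derivative
       (\<Sum>i<length as. A (ps @ (map (\<lambda>p. fst p 0) as)[i := snd (as ! i)]))) (at 0)"
proof (induction as arbitrary: ps)
  case Nil then show ?case by simp
next
  case (Cons p as)
  obtain a l where p: "p = (a, l)" by (cases p)
  have al: "\<And>t. a t \<in> W" "l \<in> W" "(a has_vector_derivative l) (at 0)" using Cons.prems(3)[of p] p by auto
  have as: "\<And>q t. q \<in> set as \<Longrightarrow> fst q t \<in> W" "\<And>q. q \<in> set as \<Longrightarrow> snd q \<in> W" "\<And>q. q \<in> set as \<Longrightarrow> (fst q has_vector_derivative snd q) (at 0)"
    using Cons.prems(3) by auto
  let ?r = "\<lambda>t. map (\<lambda>p. fst p t) as"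
  have rW: "set (?r t) \<subseteq> W" for t using as by auto
  have split: "A (ps @ a t # ?r t) = A (ps @ (a t - a 0) # ?r t) + A ((ps @ [a 0]) @ ?r t)" for t
    using bounded_multilinear_on_slots(2)[OF A W, of ps "?r t" "a t" "a 0"] Cons.prems(1,2) rW al by simp
  have sc: "A (ps @ (a t - a 0) # ?r t) /\<^sub>R t = A (ps @ ((a t - a 0) /\<^sub>R t) # ?r t)" for t
    using bounded_multilinear_on_slots(3)[OF A W, of ps "?r t" "a t - a 0" "a 0"] Cons.prems(1,2) rW al W by (simp add: subspace_diff)
  have "((\<lambda>t. A (ps @ map (\<lambda>p. fst p t) ((\<lambda>t. (a t - a 0) /\<^sub>R t, l) # map (\<lambda>q. (fst q, fst q 0)) as))) \<longlongrightarrow>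
      A (ps @ map snd ((\<lambda>t. (a t - a 0) /\<^sub>R t, l) # map (\<lambda>q. (fst q, fst q 0)) as))) (at 0)"
  proof (rule multilinear_tendsto[OF A W])
    fix q assume "q \<in> set ((\<lambda>t. (a t - a 0) /\<^sub>R t, l) # map (\<lambda>q. (fst q, fst q 0)) as)"
    then consider "q = (\<lambda>t. (a t - a 0) /\<^sub>R t, l)" | r where "r \<in> set as" "q = (fst r, fst r 0)" by auto
    then show "(\<forall>t. fst q t \<in> W) \<and> snd q \<in> W \<and> (fst q \<longlongrightarrow> snd q) (at 0)"
    proof cases
      case 1 then show ?thesis using al W by (auto simp: hvd0_tendsto[symmetric] subspace_diff subspace_scale)
    next
      case 2
      have "isCont (fst r) 0" using has_vector_derivative_continuous[OF as(3)[OF 2(1)]] .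
      then show ?thesis using 2 as by (auto simp: isCont_def)
    qed
  qed (use Cons.prems in auto)
  then have 1: "((\<lambda>t. A (ps @ (a t - a 0) # ?r t) /\<^sub>R t) \<longlongrightarrow> A (ps @ l # ?r 0)) (at 0)"
    by (simp add: sc o_def)
  have "((\<lambda>t. A ((ps @ [a 0]) @ ?r t)) has_vector_derivative (\<Sum>i<length as. A ((ps @ [a 0]) @ (?r 0)[i := snd (as ! i)]))) (at 0)"
    by (rule Cons.IH) (use Cons.prems al in auto)
  then have 2: "((\<lambda>t. (A ((ps @ [a 0]) @ ?r t) - A ((ps @ [a 0]) @ ?r 0)) /\<^sub>R t) \<longlongrightarrow> (\<Sum>i<length as. A ((ps @ [a 0]) @ (?r 0)[i := snd (as ! i)]))) (at 0)"
    unfolding hvd0_tendsto .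
  have "((\<lambda>t. (A (ps @ a t # ?r t) - A (ps @ a 0 # ?r 0)) /\<^sub>R t) \<longlongrightarrow>
     A (ps @ l # ?r 0) + (\<Sum>i<length as. A ((ps @ [a 0]) @ (?r 0)[i := snd (as ! i)]))) (at 0)"
  proof -
    have eq: "(A (ps @ a t # ?r t) - A (ps @ a 0 # ?r 0)) /\<^sub>R t = A (ps @ (a t - a 0) # ?r t) /\<^sub>R t +
        (A ((ps @ [a 0]) @ ?r t) - A ((ps @ [a 0]) @ ?r 0)) /\<^sub>R t" for t
      unfolding split[of t] by (simp add: algebra_simps)
    show ?thesis unfolding eq by (rule tendsto_add[OF 1 2])
  qed
  then show ?case unfolding hvd0_tendsto by (simp add: p sum.lessThan_Suc_shift del: sum.lessThan_Suc)
qed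

text \<open>Differentiability at \<open>x\<close> with tolerance 1 reduces the moving base point to
  the fixed multilinear maps \<open>E x\<close> of two consecutive orders, to which
  \<open>multilinear_tendsto\<close> applies.\<close>

lemma tower_tendsto:
  fixes as :: "(('c \<Rightarrow> 'w::real_normed_vector) \<times> 'w) list"
  assumes E: "tower W E" and W: "subspace W" and F: "(f \<longlongrightarrow> x) F" "\<And>t. f t \<in> W" "x \<in> W"
    and as: "\<And>p. p \<in> set as \<Longrightarrow> (\<forall>t. fst p t \<in> W) \<and> snd p \<in> W \<and> (fst p \<longlongrightarrow> snd p) F"
  shows "((\<lambda>t. E (f t) (map (\<lambda>p. fst p t) as)) \<longlongrightarrow> E x (map snd as)) F"
proof -
  let ?r = "\<lambda>t. map (\<lambda>p. fst p t) as"
  let ?P = "\<lambda>t. prod_list (map norm (?r t))"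
  have ml: "bounded_multilinear_on W (length as) (E x)" "bounded_multilinear_on W (Suc (length as)) (E x)"
    using E F by (auto simp: tower_def)
  obtain d where d: "d > 0" "\<And>h hs. h \<in> W \<Longrightarrow> norm h < d \<Longrightarrow> length hs = length as \<Longrightarrow> set hs \<subseteq> W \<Longrightarrow>
              norm (E (x + h) hs - E x hs - E x (h # hs)) \<le> 1 * norm h * prod_list (map norm hs)"
    using towerD[OF E F(3) zero_less_one] by metis
  have rW: "set (?r t) \<subseteq> W" for t using as by auto
  have 1: "((\<lambda>t. E x (?r t)) \<longlongrightarrow> E x (map snd as)) F"
    using multilinear_tendsto[OF ml(1) W, of "[]" as] as by simp
  have "((\<lambda>t. E x ([] @ map (\<lambda>p. fst p t) ((\<lambda>t. f t - x, 0) # as))) \<longlongrightarrow> E x ([] @ map snd ((\<lambda>t. f t - x, 0) # as))) F"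
  proof (rule multilinear_tendsto[OF ml(2) W])
    fix q assume "q \<in> set ((\<lambda>t. f t - x, 0) # as)"
    then consider "q = (\<lambda>t. f t - x, 0)" | "q \<in> set as" by auto
    then show "(\<forall>t. fst q t \<in> W) \<and> snd q \<in> W \<and> (fst q \<longlongrightarrow> snd q) F"
    proof cases
      case 1 then show ?thesis using F W tendsto_diff[OF F(1) tendsto_const[of x]] by (auto simp: subspace_diff subspace_0)
    next
      case 2 then show ?thesis by (rule as)
    qed
  qed auto
  then have 2: "((\<lambda>t. E x ((f t - x) # ?r t)) \<longlongrightarrow> 0) F"
  proof -
    have "set (map snd as) \<subseteq> W" using as by fastforce
    then have "E x (0 # map snd as) = 0"
      using bounded_multilinear_on_slots(4)[OF ml(2) W, of "[]" "map snd as" x x] F by simp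
    then show "((\<lambda>t. E x ([] @ map (\<lambda>p. fst p t) ((\<lambda>t. f t - x, 0) # as))) \<longlongrightarrow> E x ([] @ map snd ((\<lambda>t. f t - x, 0) # as))) F \<Longrightarrow>
      ((\<lambda>t. E x ((f t - x) # ?r t)) \<longlongrightarrow> 0) F" by simp
  qed
  have 3: "((\<lambda>t. E (f t) (?r t) - E x (?r t) - E x ((f t - x) # ?r t)) \<longlongrightarrow> 0) F"
  proof (rule Lim_null_comparison)
    have "((\<lambda>t. dist (f t) x) \<longlongrightarrow> 0) F" using F(1) by (rule iffD1[OF tendsto_dist_iff])
    from order_tendstoD(2)[OF this d(1)] show "\<forall>\<^sub>F t in F. norm (E (f t) (?r t) - E x (?r t) - E x ((f t - x) # ?r t)) \<le> norm (f t - x) * ?P t"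
    proof eventually_elim
      case (elim t)
      then show ?case using d(2)[of "f t - x" "?r t"] rW F W by (simp add: dist_norm subspace_diff)
    qed
    have "((\<lambda>t. norm (f t - x) * ?P t) \<longlongrightarrow> norm (x - x) * prod_list (map norm (map snd as))) F"
      by (intro tendsto_mult tendsto_norm tendsto_diff F tendsto_const tendsto_prod_list_norm) (use as in auto)
    then show "((\<lambda>t. norm (f t - x) * ?P t) \<longlongrightarrow> 0) F" by simp
  qed
  from tendsto_add[OF tendsto_add[OF 3 2] 1] show ?thesis by simp
qed

text \<open>This chain rule with moving base point and moving directions is the rule on which
  composition and inversion rest. The error \<open>R\<close> of the Frechet expansion at
  \<open>f 0\<close> is o(t), since \<open>f t - f 0\<close> is O(t); the remaining terms are
  multilinear maps at the fixed point \<open>f 0\<close>.\<close>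

lemma tower_hvd:
  fixes as :: "((real \<Rightarrow> 'w::real_normed_vector) \<times> 'w) list"
  assumes E: "tower W E" and W: "subspace W" and F: "(f has_vector_derivative f') (at 0)" "\<And>t. f t \<in> W" "f' \<in> W"
    and as: "\<And>p. p \<in> set as \<Longrightarrow> (\<forall>t. fst p t \<in> W) \<and> snd p \<in> W \<and> (fst p has_vector_derivative snd p) (at 0)"
  shows "((\<lambda>t. E (f t) (map (\<lambda>p. fst p t) as)) has_vector_derivative
     E (f 0) (f' # map (\<lambda>p. fst p 0) as) + (\<Sum>i<length as. E (f 0) ((map (\<lambda>p. fst p 0) as)[i := snd (as ! i)]))) (at 0)"
proof -
  let ?r = "\<lambda>t. map (\<lambda>p. fst p t) as"
  let ?P = "\<lambda>t. prod_list (map norm (?r t))"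
  let ?x = "f 0"
  have ml: "bounded_multilinear_on W (length as) (E ?x)" "bounded_multilinear_on W (Suc (length as)) (E ?x)"
    using E F by (auto simp: tower_def)
  have rW: "set (?r t) \<subseteq> W" for t using as by auto
  have as0: "(fst q \<longlongrightarrow> fst q 0) (at 0)" if "q \<in> set as" for q
    using has_vector_derivative_continuous[of "fst q" "snd q" 0 UNIV] as[OF that] by (simp add: isCont_def)
  have f0: "(f \<longlongrightarrow> f 0) (at 0)" using has_vector_derivative_continuous[OF F(1)] by (simp add: isCont_def)
  have 1: "((\<lambda>t. (E ?x (?r t) - E ?x (?r 0)) /\<^sub>R t) \<longlongrightarrow> (\<Sum>i<length as. E (f 0) ((?r 0)[i := snd (as ! i)]))) (at 0)"
    using multilinear_hvd[OF ml(1) W, of "[]" as] as unfolding hvd0_tendsto by simp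
  define Q where "Q = (\<lambda>t. (f t - ?x) /\<^sub>R t)"
  have Q: "(Q \<longlongrightarrow> f') (at 0)" using F(1) unfolding hvd0_tendsto Q_def .
  have QW: "Q t \<in> W" for t using F W by (simp add: Q_def subspace_diff subspace_scale)
  have "((\<lambda>t. E ?x ([] @ map (\<lambda>p. fst p t) ((Q, f') # map (\<lambda>q. (fst q, fst q 0)) as))) \<longlongrightarrow>
      E ?x ([] @ map snd ((Q, f') # map (\<lambda>q. (fst q, fst q 0)) as))) (at 0)"
    by (rule multilinear_tendsto[OF ml(2) W]) (use as as0 Q QW F in auto)
  then have 2: "((\<lambda>t. E ?x (Q t # ?r t)) \<longlongrightarrow> E ?x (f' # ?r 0)) (at 0)" by (simp add: o_def)
  define R where "R = (\<lambda>t. E (f t) (?r t) - E ?x (?r t) - E ?x ((f t - ?x) # ?r t))"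
  have 3: "((\<lambda>t. R t /\<^sub>R t) \<longlongrightarrow> 0) (at 0)"
  proof (rule tendstoI)
    fix e :: real assume e: "e > 0"
    \<comment> \<open>\<open>norm (Q t) * ?P t\<close> tends to \<open>norm f' * ?P 0\<close>; the
      added 1 makes \<open>M\<close> an eventual bound and positive.\<close>
    define M where "M = norm f' * ?P 0 + 1"
    have "0 \<le> norm f' * ?P 0" by (intro mult_nonneg_nonneg prod_list_norm_nonneg norm_ge_zero)
    then have M: "M > 0" by (simp only: M_def)
    obtain d where d: "d > 0" "\<And>h hs. h \<in> W \<Longrightarrow> norm h < d \<Longrightarrow> length hs = length as \<Longrightarrow> set hs \<subseteq> W \<Longrightarrow>
              norm (E (?x + h) hs - E ?x hs - E ?x (h # hs)) \<le> e / M * norm h * prod_list (map norm hs)"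
      using towerD[OF E F(2) divide_pos_pos[OF e M]] by metis
    have PP: "(?P \<longlongrightarrow> ?P 0) (at 0)"
    proof -
      have "(fst p \<longlongrightarrow> snd p) (at 0)" if "p \<in> set (map (\<lambda>q. (fst q, fst q 0)) as)" for p
        using that as0 by auto
      from tendsto_prod_list_norm[of "map (\<lambda>q. (fst q, fst q 0)) as" "at 0", OF this] show ?thesis by (simp add: o_def)
    qed
    have "((\<lambda>t. norm (Q t) * ?P t) \<longlongrightarrow> norm f' * ?P 0) (at 0)"
      by (intro tendsto_mult tendsto_norm Q PP)
    then have ev1: "\<forall>\<^sub>F t in at 0. norm (Q t) * ?P t < M"
      by (rule order_tendstoD) (simp add: M_def)
    have "((\<lambda>t. dist (f t) ?x) \<longlongrightarrow> 0) (at 0)" using f0 by (rule iffD1[OF tendsto_dist_iff])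
    from order_tendstoD(2)[OF this d(1)] ev1
    have "\<forall>\<^sub>F t in at 0. norm (R t /\<^sub>R t) < e"
      using eventually_at_filter[of "\<lambda>t. t \<noteq> 0" 0 UNIV, simplified]
    proof eventually_elim
      case (elim t)
      have "norm (R t) \<le> e / M * norm (f t - ?x) * ?P t"
        unfolding R_def using d(2)[of "f t - ?x" "?r t"] elim rW F W by (simp add: dist_norm subspace_diff)
      then have "norm (R t) / \<bar>t\<bar> \<le> e / M * norm (f t - ?x) * ?P t / \<bar>t\<bar>" by (intro divide_right_mono) auto
      also have "\<dots> = e / M * (norm (Q t) * ?P t)" by (simp add: Q_def divide_inverse mult_ac)
      also have "\<dots> < e / M * M" using elim(2) e M by (intro mult_strict_left_mono) auto
      also have "\<dots> = e" using M by simp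
      finally show ?case by (simp add: divide_inverse mult.commute)
    qed
    then show "\<forall>\<^sub>F t in at 0. dist (R t /\<^sub>R t) 0 < e" by simp
  qed
  have eq: "(E (f t) (?r t) - E ?x (?r 0)) /\<^sub>R t = R t /\<^sub>R t + E ?x (Q t # ?r t) + (E ?x (?r t) - E ?x (?r 0)) /\<^sub>R t" for t
  proof -
    have "E ?x (Q t # ?r t) = E ?x ((f t - ?x) # ?r t) /\<^sub>R t"
      using bounded_multilinear_on_slots(3)[OF ml(2) W, of "[]" "?r t" "f t - ?x" ?x] rW F W by (simp add: Q_def subspace_diff)
    then show ?thesis by (simp add: R_def algebra_simps)
  qed
  show ?thesis unfolding hvd0_tendsto eq using tendsto_add[OF tendsto_add[OF 3 2] 1] by simp
qed

lemma hvd_in_closed_subspace: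
  assumes W: "subspace W" "closed W" and f: "(f has_vector_derivative f') (at 0)" "\<And>t. f t \<in> W"
  shows "f' \<in> W"
proof (rule Lim_in_closed_set[OF W(2), of "\<lambda>t. (f t - f 0) /\<^sub>R t" "at 0"])
  show "((\<lambda>t. (f t - f 0) /\<^sub>R t) \<longlongrightarrow> f') (at 0)" using f(1) by (simp add: hvd0_tendsto)
qed (use f W in \<open>auto simp: subspace_diff subspace_scale\<close>)

lemma dir_deriv_in:
  assumes "dir_deriv V G h G'" "subspace V" "h \<in> V" "\<forall>x\<in>V. G x \<in> W" "subspace W" "closed W" "x \<in> V"
  shows "G' x \<in> W"
  by (rule hvd_in_closed_subspace[OF assms(5,6) dir_derivD[OF assms(1,7)]])
     (use assms in \<open>auto simp: subspace_add subspace_scale\<close>)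

lemma prod_list_norm_le_power:
  assumes "\<And>h. h \<in> set hs \<Longrightarrow> norm h \<le> M" "M \<ge> 0"
  shows "prod_list (map norm hs) \<le> M ^ length hs"
  using assms by (induction hs) (auto intro!: mult_mono prod_list_nonneg)

text \<open>The higher chain rule without its combinatorics: expressions \<open>E (f x)\<close>
  applied to a list of functions are closed under differentiation once the pool of functions
  contains the derivatives of its members and of \<open>f\<close>. One differentiation either hits
  the base point, which adds a slot, or hits one of the slots.\<close>

lemma comp_usm:
  fixes E :: "'w::real_normed_vector \<Rightarrow> 'w list \<Rightarrow> 'b::real_normed_vector" and f :: "'v::real_normed_vector \<Rightarrow> 'w"
  assumes V: "subspace V" and W: "subspace W" "closed W" and E: "tower W E"
    and fW: "\<And>x. x \<in> V \<Longrightarrow> f x \<in> W" and cf: "continuous_on V f"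
  shows "usm V k {f} \<Longrightarrow> usm V k A \<Longrightarrow> (\<And>a x. a \<in> A \<Longrightarrow> x \<in> V \<Longrightarrow> a x \<in> W) \<Longrightarrow>
     usm V k {\<lambda>x. E (f x) (map (\<lambda>a. a x) as) | as. length as = m \<and> set as \<subseteq> A}"
proof (induction k arbitrary: A m)
  have lb: "loc_bdd V {\<lambda>x. E (f x) (map (\<lambda>a. a x) as) | as. length as = m \<and> set as \<subseteq> A}"
    if A: "loc_bdd V A" "\<And>a x. a \<in> A \<Longrightarrow> x \<in> V \<Longrightarrow> a x \<in> W" for A m
    unfolding loc_bdd_def
  proof
    fix x assume x: "x \<in> V"
    obtain d1 C where d1: "d1 > 0" "C \<ge> 0" "\<And>y hs. y \<in> W \<Longrightarrow> norm (y - f x) < d1 \<Longrightarrow> length hs = m \<Longrightarrow> set hs \<subseteq> W \<Longrightarrow>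
      norm (E y hs) \<le> C * prod_list (map norm hs)"
      by (rule tower_loc_bound[OF E W(1) fW[OF x], where n = m]) blast
    obtain d2 where d2: "d2 > 0" "\<And>y. y \<in> V \<Longrightarrow> norm (y - x) < d2 \<Longrightarrow> norm (f y - f x) < d1"
      using cf x d1(1) unfolding continuous_on_iff dist_norm by metis
    obtain d3 M where d3: "d3 > 0" "M \<ge> 0" "\<And>y G. y \<in> V \<Longrightarrow> norm (y - x) < d3 \<Longrightarrow> G \<in> A \<Longrightarrow> norm (G y) \<le> M"
      using loc_bdd_two[OF A(1) A(1) x] by metis
    have "norm (E (f y) (map (\<lambda>a. a y) as)) \<le> C * M ^ m"
      if y: "y \<in> V" "norm (y - x) < min d2 d3" and as: "length as = m" "set as \<subseteq> A" for y as
    proof -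
      have "norm (E (f y) (map (\<lambda>a. a y) as)) \<le> C * prod_list (map norm (map (\<lambda>a. a y) as))"
        by (rule d1(3)) (use y as d2 fW A in auto)
      also have "\<dots> \<le> C * M ^ length (map (\<lambda>a. a y) as)"
        by (intro mult_left_mono prod_list_norm_le_power) (use y as d3 d1 in auto)
      finally show ?thesis using as by simp
    qed
    then show "\<exists>\<delta>>0. \<exists>C. \<forall>y\<in>V. norm (y - x) < \<delta> \<longrightarrow>
        (\<forall>G\<in>{\<lambda>x. E (f x) (map (\<lambda>a. a x) as) | as. length as = m \<and> set as \<subseteq> A}. norm (G y) \<le> C)"
      using d2(1) d3(1) by (intro exI[of _ "min d2 d3"] conjI exI[of _ "C * M ^ m"]) auto
  qed
  { case 0 then show ?case using lb by simp }
  { case (Suc k)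
    obtain A' where A': "usm V k A'" "\<And>G h. G \<in> A \<Longrightarrow> h \<in> V \<Longrightarrow> norm h \<le> 1 \<Longrightarrow> \<exists>G'\<in>A'. dir_deriv V G h G'"
      using usm_SucE[OF Suc.prems(2)] by metis
    obtain Bf where Bf: "usm V k Bf" "\<And>h. h \<in> V \<Longrightarrow> norm h \<le> 1 \<Longrightarrow> \<exists>G'\<in>Bf. dir_deriv V f h G'"
      using usm_SucE[OF Suc.prems(1)] by (metis singletonI)
    \<comment> \<open>The families supplied by \<open>usm\<close> may contain functions that leave
      \<open>W\<close>, where \<open>E\<close> carries no information. The derivatives that occur do
      stay in \<open>W\<close>, because \<open>W\<close> is closed.\<close>
    define S where "S = {a \<in> A \<union> A' \<union> Bf. \<forall>x\<in>V. a x \<in> W}"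
    have S: "usm V k S" unfolding S_def
      by (rule usm_subset[OF usm_Un[OF usm_Un[OF usm_Suc_imp[OF Suc.prems(2)] A'(1)] Bf(1)]]) auto
    let ?T = "\<lambda>m. {\<lambda>x. E (f x) (map (\<lambda>a. a x) as) | as. length as = m \<and> set as \<subseteq> S}"
    have T: "usm V k (?T m)" for m
      by (rule Suc.IH[OF usm_Suc_imp[OF Suc.prems(1)] S]) (auto simp: S_def)
    show ?case
    proof (rule usm_SucI[OF _ usm_sum[OF usm_Un[OF T[of m] T[of "Suc m"]], of "Suc m"]])
      show "loc_bdd V {\<lambda>x. E (f x) (map (\<lambda>a. a x) as) | as. length as = m \<and> set as \<subseteq> A}"
        by (rule lb[OF usm_loc_bdd[OF Suc.prems(2)]]) (rule Suc.prems(3))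
      fix G h assume "G \<in> {\<lambda>x. E (f x) (map (\<lambda>a. a x) as) | as. length as = m \<and> set as \<subseteq> A}" and h: "h \<in> V" "norm h \<le> 1"
      then obtain as where as: "G = (\<lambda>x. E (f x) (map (\<lambda>a. a x) as))" "length as = m" "set as \<subseteq> A" by auto
      obtain f' where f': "f' \<in> Bf" "dir_deriv V f h f'" using Bf(2)[OF h] by auto
      have f'W: "f' x \<in> W" if "x \<in> V" for x
        using dir_deriv_in[OF f'(2) V h(1) _ W that] fW by auto
      obtain d where d: "\<And>a. a \<in> A \<Longrightarrow> d a \<in> A' \<and> dir_deriv V a h (d a)" using A'(2)[OF _ h] by metis
      have dW: "d a x \<in> W" if "a \<in> A" "x \<in> V" for a x
        using dir_deriv_in[OF _ V h(1) _ W that(2), of a "d a"] d[OF that(1)] Suc.prems(3)[OF that(1)] by auto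
      \<comment> \<open>Index 0 is the term from the base point, with one slot more; index
        \<open>j + 1\<close> differentiates slot \<open>j\<close>.\<close>
      define H where "H i = (if i = 0 then (\<lambda>x. E (f x) (map (\<lambda>a. a x) (f' # as)))
         else (\<lambda>x. E (f x) (map (\<lambda>a. a x) (as[i - 1 := d (as ! (i - 1))]))))" for i :: nat
      have "dir_deriv V G h (\<lambda>x. \<Sum>i<Suc m. H i x)"
        unfolding dir_deriv_def
      proof
        fix x assume x: "x \<in> V"
        have xt: "x + t *\<^sub>R h \<in> V" for t using V x h by (simp add: subspace_add subspace_scale)
        define ps where "ps = map (\<lambda>a. (\<lambda>t. a (x + t *\<^sub>R h), d a x)) as"
        have "((\<lambda>t. E (f (x + t *\<^sub>R h)) (map (\<lambda>p. fst p t) ps)) has_vector_derivative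
            E (f (x + 0 *\<^sub>R h)) (f' x # map (\<lambda>p. fst p 0) ps) + (\<Sum>i<length ps. E (f (x + 0 *\<^sub>R h)) ((map (\<lambda>p. fst p 0) ps)[i := snd (ps ! i)]))) (at 0)"
          by (rule tower_hvd[OF E W(1) dir_derivD[OF f'(2) x]])
             (use fW xt f'W x Suc.prems(3) as d dW in \<open>auto simp: ps_def dir_deriv_def\<close>)
        moreover have "(\<Sum>i<length ps. E (f (x + 0 *\<^sub>R h)) ((map (\<lambda>p. fst p 0) ps)[i := snd (ps ! i)])) = (\<Sum>i<m. H (Suc i) x)"
          by (rule sum.cong) (auto simp: ps_def as o_def H_def map_update)
        moreover have "E (f (x + 0 *\<^sub>R h)) (f' x # map (\<lambda>p. fst p 0) ps) = H 0 x" by (simp add: H_def ps_def o_def)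
        moreover have "map (\<lambda>p. fst p t) ps = map (\<lambda>a. a (x + t *\<^sub>R h)) as" for t by (simp add: ps_def o_def)
        ultimately show "((\<lambda>t. G (x + t *\<^sub>R h)) has_vector_derivative (\<Sum>i<Suc m. H i x)) (at 0)"
          unfolding sum.lessThan_Suc_shift as(1) by simp
      qed
      moreover have "H i \<in> ?T m \<union> ?T (Suc m)" if "i < Suc m" for i
      proof (cases i)
        case 0
        have "set (f' # as) \<subseteq> S" using f'(1) f'W as Suc.prems(3) by (auto simp: S_def)
        then have "H 0 \<in> ?T (Suc m)" unfolding H_def using as by (auto intro!: exI[of _ "f' # as"])
        then show ?thesis using 0 by blast
      next
        case (Suc j)
        then have "as ! j \<in> A" using that as by (metis Suc_less_SucD nth_mem subsetD)
        then have "set (as[j := d (as ! j)]) \<subseteq> S"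
          using d dW as Suc.prems(3) set_update_subset_insert[of as j "d (as ! j)"] by (fastforce simp: S_def)
        then have "H i \<in> ?T m" unfolding H_def Suc using as by (auto intro!: exI[of _ "as[j := d (as ! j)]"])
        then show ?thesis by blast
      qed
      ultimately show "\<exists>G'\<in>{\<lambda>x. \<Sum>i<Suc m. G i x | G. \<forall>i<Suc m. G i \<in> ?T m \<union> ?T (Suc m)}. dir_deriv V G h G'"
        by (intro bexI[of _ "\<lambda>x. \<Sum>i<Suc m. H i x"]) blast+
    qed }
qed

lemma smooth_onE_tower:
  assumes "smooth_on V g"
  obtains D where "tower V D" "\<And>x. x \<in> V \<Longrightarrow> D x [] = g x"
  using assms unfolding smooth_on_tower by blast

lemma smooth_on_usm: "subspace V \<Longrightarrow> smooth_on V g \<Longrightarrow> usm V k {g}"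
  by (simp add: smooth_on_iff_usm)

lemma smooth_onI_usm: "subspace V \<Longrightarrow> (\<And>k. usm V k {g}) \<Longrightarrow> smooth_on V g"
  by (simp add: smooth_on_iff_usm)

lemma smooth_on_cong:
  assumes "\<And>x. x \<in> V \<Longrightarrow> g x = h x" shows "smooth_on V g \<longleftrightarrow> smooth_on V h"
  using assms by (simp add: smooth_on_def)

lemma smooth_on_continuous_on:
  fixes g :: "'a::real_normed_vector \<Rightarrow> 'b::real_normed_vector"
  assumes g: "smooth_on V g" and V: "subspace V" shows "continuous_on V g"
proof -
  obtain E where E: "tower V E" "\<And>x. x \<in> V \<Longrightarrow> E x [] = g x" using smooth_onE_tower[OF g] by blast
  have "continuous_on V (\<lambda>x. E x [])"
    unfolding continuous_on_def
  proof
    fix x assume x: "x \<in> V"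
    \<comment> \<open>\<open>tower_tendsto\<close> wants all values of the curve in
      \<open>V\<close>, hence a map that is constant off \<open>V\<close>.\<close>
    define f where "f y = (if y \<in> V then y else x)" for y
    have "(f \<longlongrightarrow> x) (at x within V)"
      by (rule Lim_transform_within[OF tendsto_ident_at[of x V], of 1]) (auto simp: f_def)
    from tower_tendsto[OF E(1) V this _ x, of "[]"] have "((\<lambda>t. E (f t) []) \<longlongrightarrow> E x []) (at x within V)"
      using x by (simp add: f_def)
    then show "((\<lambda>x. E x []) \<longlongrightarrow> E x []) (at x within V)"
      by (rule Lim_transform_within[of _ _ _ _ 1]) (auto simp: f_def)
  qed
  then show ?thesis using E(2) by (rule continuous_on_eq)
qed

theorem smooth_on_compose:
  fixes f :: "'a::real_normed_vector \<Rightarrow> 'b::real_normed_vector" and g :: "'b \<Rightarrow> 'c::real_normed_vector"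
  assumes V: "subspace V" and W: "subspace W" "closed W"
    and g: "smooth_on W g" and f: "smooth_on V f" and fW: "\<And>x. x \<in> V \<Longrightarrow> f x \<in> W"
  shows "smooth_on V (\<lambda>x. g (f x))"
proof (rule smooth_onI_usm[OF V])
  fix k
  obtain E where E: "tower W E" "\<And>x. x \<in> W \<Longrightarrow> E x [] = g x" using smooth_onE_tower[OF g] by blast
  have "usm V k {\<lambda>x. E (f x) (map (\<lambda>a. a x) as) | as. length as = 0 \<and> set as \<subseteq> {}}"
    by (rule comp_usm[OF V W E(1) fW smooth_on_continuous_on[OF f V] smooth_on_usm[OF V f]])
       (auto intro: usm_subset[OF usm_const[of V k 0]])
  then have "usm V k {\<lambda>x. E (f x) []}" by (rule usm_subset) auto
  then show "usm V k {\<lambda>x. g (f x)}" by (rule usm_cong_single[OF V]) (use E fW in auto)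
qed

section \<open>Pairs, sums, products and roots of smooth maps\<close>

lemma usm_Pair:
  "usm V k A \<Longrightarrow> usm V k B \<Longrightarrow> usm V k {\<lambda>x. (G x, H x) | G H. G \<in> A \<and> H \<in> B}"
proof (induction k arbitrary: A B)
  case 0 then show ?case
    by (auto intro!: loc_bdd_binop[where N = "(+)"] norm_Pair_le)
next
  case (Suc k)
  obtain A' where A': "usm V k A'" "\<And>G h. G \<in> A \<Longrightarrow> h \<in> V \<Longrightarrow> norm h \<le> 1 \<Longrightarrow> \<exists>G'\<in>A'. dir_deriv V G h G'"
    using usm_SucE[OF Suc.prems(1)] by metis
  obtain B' where B': "usm V k B'" "\<And>G h. G \<in> B \<Longrightarrow> h \<in> V \<Longrightarrow> norm h \<le> 1 \<Longrightarrow> \<exists>G'\<in>B'. dir_deriv V G h G'"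
    using usm_SucE[OF Suc.prems(2)] by metis
  show ?case
  proof (rule usm_SucI[OF _ Suc.IH[OF A'(1) B'(1)]])
    show "loc_bdd V {\<lambda>x. (G x, H x) | G H. G \<in> A \<and> H \<in> B}"
      using Suc.prems[THEN usm_loc_bdd] by (auto intro!: loc_bdd_binop[where N = "(+)"] norm_Pair_le)
    fix F h assume F: "F \<in> {\<lambda>x. (G x, H x) | G H. G \<in> A \<and> H \<in> B}" and h: "h \<in> V" "norm h \<le> 1"
    then obtain G H where "F = (\<lambda>x. (G x, H x))" "G \<in> A" "H \<in> B" by auto
    with A'(2)[OF _ h] B'(2)[OF _ h] obtain G' H' where
      "F = (\<lambda>x. (G x, H x))" "G' \<in> A'" "H' \<in> B'" "dir_deriv V G h G'" "dir_deriv V H h H'" by metis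
    then have "dir_deriv V F h (\<lambda>x. (G' x, H' x))"
      by (auto simp: dir_deriv_def intro!: has_vector_derivative_Pair)
    then show "\<exists>G'\<in>{\<lambda>x. (G x, H x) | G H. G \<in> A' \<and> H \<in> B'}. dir_deriv V F h G'"
      using \<open>G' \<in> A'\<close> \<open>H' \<in> B'\<close> by blast
  qed
qed

lemma smooth_on_Pair:
  assumes "subspace V" "smooth_on V f" "smooth_on V g" shows "smooth_on V (\<lambda>x. (f x, g x))"
proof (rule smooth_onI_usm[OF assms(1)])
  fix k show "usm V k {\<lambda>x. (f x, g x)}"
    by (rule usm_subset[OF usm_Pair[OF assms(2,3)[THEN smooth_on_usm[OF assms(1)]]]]) auto
qed

lemma smooth_on_add:
  assumes "subspace V" "smooth_on V f" "smooth_on V g" shows "smooth_on V (\<lambda>x. f x + g x)"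
proof (rule smooth_onI_usm[OF assms(1)])
  fix k show "usm V k {\<lambda>x. f x + g x}"
    by (rule usm_subset[OF usm_add[OF assms(2,3)[THEN smooth_on_usm[OF assms(1)]]]]) auto
qed

lemma smooth_on_bilinear:
  assumes "bounded_bilinear p" "subspace V" "smooth_on V f" "smooth_on V g" shows "smooth_on V (\<lambda>x. p (f x) (g x))"
proof (rule smooth_onI_usm[OF assms(2)])
  fix k show "usm V k {\<lambda>x. p (f x) (g x)}"
    by (rule usm_subset[OF usm_bilinear[OF assms(1) assms(3,4)[THEN smooth_on_usm[OF assms(2)]]]]) auto
qed

lemma smooth_on_linear:
  assumes "bounded_linear T" "subspace V" shows "smooth_on V T"
  by (rule smooth_onI_usm[OF assms(2) usm_linear[OF assms(1)]])

lemma smooth_on_linear_compose: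
  assumes "bounded_linear T" "subspace V" "smooth_on V f" shows "smooth_on V (\<lambda>x. T (f x))"
proof (rule smooth_onI_usm[OF assms(2)])
  fix k show "usm V k {\<lambda>x. T (f x)}"
    by (rule usm_subset[OF usm_image_bounded_linear[OF assms(1) smooth_on_usm[OF assms(2,3)]]]) auto
qed

lemma smooth_on_diff:
  assumes "subspace V" "smooth_on V f" "smooth_on V g" shows "smooth_on V (\<lambda>x. f x - g x)"
  using smooth_on_add[OF assms(1,2) smooth_on_linear_compose[OF bounded_linear_minus[OF bounded_linear_ident] assms(1,3)]]
  by simp

text \<open>The derivative of \<open>a * q x powr p\<close> is a function of the same shape, with
  \<open>a * p\<close> and \<open>p - 1\<close>, times the derivative of \<open>q\<close>. With
  \<open>a\<close> and \<open>p\<close> arbitrary the induction closes, which it would not for the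
  square root alone.\<close>

lemma usm_powr:
  fixes q :: "'a::real_normed_vector \<Rightarrow> real"
  assumes V: "subspace V" and q: "\<And>k. usm V k {q}" and pos: "\<And>x. x \<in> V \<Longrightarrow> q x > 0" and c: "continuous_on V q"
  shows "usm V k {\<lambda>x. a * q x powr p}"
proof (induction k arbitrary: a p)
  have lb: "loc_bdd V {\<lambda>x. a * q x powr p}" for a p
    unfolding loc_bdd_def
  proof
    fix x assume x: "x \<in> V"
    have "continuous_on V (\<lambda>x. a * q x powr p)"
      by (intro continuous_intros c) (use pos in force)
    then obtain d where d: "d > 0" "\<And>y. y \<in> V \<Longrightarrow> norm (y - x) < d \<Longrightarrow> dist (a * q y powr p) (a * q x powr p) < 1"
      using x unfolding continuous_on_iff dist_norm[symmetric, of _ x] by (metis zero_less_one)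
    have "norm (a * q y powr p) \<le> 1 + norm (a * q x powr p)" if "y \<in> V" "norm (y - x) < d" for y
      using d(2)[OF that] by (auto simp: dist_real_def)
    then show "\<exists>\<delta>>0. \<exists>C. \<forall>y\<in>V. norm (y - x) < \<delta> \<longrightarrow> (\<forall>G\<in>{\<lambda>x. a * q x powr p}. norm (G y) \<le> C)"
      using d(1) by blast
  qed
  { case 0 then show ?case using lb by simp }
  { case (Suc k)
    obtain B where B: "usm V k B" "\<And>h. h \<in> V \<Longrightarrow> norm h \<le> 1 \<Longrightarrow> \<exists>G'\<in>B. dir_deriv V q h G'"
      using usm_SucE[OF q[of "Suc k"]] by (metis singletonI)
    show ?case
    proof (rule usm_SucI[OF lb usm_bilinear[OF bounded_bilinear_mult Suc.IH[of "a * p" "p - 1"] B(1)]])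
      fix G h assume G: "G \<in> {\<lambda>x. a * q x powr p}" and h: "h \<in> V" "norm h \<le> 1"
      obtain q' where q': "q' \<in> B" "dir_deriv V q h q'" using B(2)[OF h] by auto
      have "dir_deriv V G h (\<lambda>x. a * p * q x powr (p - 1) * q' x)"
        unfolding dir_deriv_def
      proof
        fix x assume x: "x \<in> V"
        have 1: "((\<lambda>t. q (x + t *\<^sub>R h)) has_real_derivative q' x) (at 0)"
          using dir_derivD[OF q'(2) x] by (simp add: has_real_derivative_iff_has_vector_derivative)
        have "((\<lambda>t. q (x + t *\<^sub>R h) powr p) has_real_derivative p * q (x + 0 *\<^sub>R h) powr (p - 1) * q' x) (at 0)"
          using DERIV_fun_powr[OF 1, of p] pos[OF x] by simp
        from DERIV_cmult[OF this, of a]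
        show "((\<lambda>t. G (x + t *\<^sub>R h)) has_vector_derivative a * p * q x powr (p - 1) * q' x) (at 0)"
          using G by (simp add: has_real_derivative_iff_has_vector_derivative mult_ac)
      qed
      moreover have "(\<lambda>x. a * p * q x powr (p - 1) * q' x) \<in> {\<lambda>x. G x * H x | G H. G \<in> {\<lambda>x. a * p * q x powr (p - 1)} \<and> H \<in> B}"
        by (rule CollectI, rule exI[of _ "\<lambda>x. a * p * q x powr (p - 1)"], rule exI[of _ q'], simp add: q'(1))
      ultimately show "\<exists>G'\<in>{\<lambda>x. G x * H x | G H. G \<in> {\<lambda>x. a * p * q x powr (p - 1)} \<and> H \<in> B}. dir_deriv V G h G'"
        by (rule bexI)
    qed }
qed

lemma smooth_on_sqrt:
  fixes q :: "'a::real_normed_vector \<Rightarrow> real"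
  assumes V: "subspace V" and q: "smooth_on V q" and pos: "\<And>x. x \<in> V \<Longrightarrow> q x > 0"
  shows "smooth_on V (\<lambda>x. sqrt (q x))"
proof -
  have "smooth_on V (\<lambda>x. 1 * q x powr (1/2))"
    by (rule smooth_onI_usm[OF V], rule usm_powr[OF V smooth_on_usm[OF V q] pos smooth_on_continuous_on[OF q V]])
  then show ?thesis by (subst smooth_on_cong[of V _ "\<lambda>x. 1 * q x powr (1/2)"]) (auto simp: powr_half_sqrt less_imp_le[OF pos])
qed

section \<open>Inverse and implicit maps\<close>

lemma tower_range:
  assumes E: "tower V E" and V: "subspace V" and W: "subspace W" "closed W" and g: "\<And>x. x \<in> V \<Longrightarrow> E x [] \<in> W"
  shows "set hs \<subseteq> V \<Longrightarrow> x \<in> V \<Longrightarrow> E x hs \<in> W"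
proof (induction hs arbitrary: x)
  case Nil then show ?case using g by simp
next
  case (Cons h hs)
  then show ?case
    using dir_deriv_in[OF tower_dir_deriv[OF E V, of hs h] V _ _ W, of x] by auto
qed

text \<open>Order one of the tower is differentiable at \<open>x\<close> with a derivative bounded
  by \<open>C\<close>, so near \<open>x\<close> it deviates in operator norm by at most
  \<open>C + 1\<close> times the distance. \<open>implicit_smooth\<close> uses this to keep the
  inverses bounded.\<close>

lemma tower1_continuous:
  assumes E: "tower V E" and V: "subspace V" and x: "x \<in> V" and e: "e > 0"
  obtains d where "d > 0" "\<And>y h. y \<in> V \<Longrightarrow> norm (y - x) < d \<Longrightarrow> h \<in> V \<Longrightarrow> norm (E y [h] - E x [h]) \<le> e * norm h"
proof -
  obtain C where C: "C \<ge> 0" "\<And>hs. length hs = 2 \<Longrightarrow> set hs \<subseteq> V \<Longrightarrow> norm (E x hs) \<le> C * prod_list (map norm hs)"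
    using E x bounded_multilinear_on_bound[of V 2 "E x"] unfolding tower_def by metis
  obtain d where d: "d > 0" "\<And>h hs. h \<in> V \<Longrightarrow> norm h < d \<Longrightarrow> length hs = 1 \<Longrightarrow> set hs \<subseteq> V \<Longrightarrow>
              norm (E (x + h) hs - E x hs - E x (h # hs)) \<le> 1 * norm h * prod_list (map norm hs)"
    using towerD[OF E x zero_less_one] by metis
  show thesis
  proof (rule that[of "min d (e / (C + 1))"])
    show "min d (e / (C + 1)) > 0" using d e C by simp
    fix y h assume y: "y \<in> V" "norm (y - x) < min d (e / (C + 1))" and h: "h \<in> V"
    have yx: "y - x \<in> V" using V x y by (simp add: subspace_diff)
    have "norm (E y [h] - E x [h] - E x [y - x, h]) \<le> norm (y - x) * norm h"
      using d(2)[of "y - x" "[h]"] yx y h by simp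
    moreover have "norm (E x [y - x, h]) \<le> C * (norm (y - x) * norm h)" using C(2)[of "[y-x, h]"] yx h by simp
    ultimately have "norm (E y [h] - E x [h]) \<le> (C + 1) * norm (y - x) * norm h"
      using norm_triangle_sub[of "E y [h] - E x [h]" "E x [y - x, h]"] by (simp add: algebra_simps)
    also have "(C + 1) * norm (y - x) \<le> e" using y(2) C by (simp add: pos_less_divide_eq add_nonneg_pos mult.commute)
    then have "(C + 1) * norm (y - x) * norm h \<le> e * norm h" by (intro mult_right_mono) auto
    finally show "norm (E y [h] - E x [h]) \<le> e * norm h" .
  qed
qed

text \<open>
  \<open>L y\<close> is the inverse of the derivative of the map at \<open>\<kappa> y\<close>.  No completeness is needed, since the
  solution \<open>\<kappa>\<close> is given and known to be continuous; it covers inverse maps (\<open>e\<close> the identity) as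
  well as roots (\<open>e\<close> the inclusion of a factor).
\<close>

theorem implicit_smooth:
  fixes g :: "'v::real_normed_vector \<Rightarrow> 'w::real_normed_vector" and \<kappa> :: "'u::real_normed_vector \<Rightarrow> 'v" and e :: "'u \<Rightarrow> 'w"
  assumes U: "subspace U" and V: "subspace V" "closed V" and W: "subspace W" "closed W"
    and E: "tower V E" and gW: "\<And>x. x \<in> V \<Longrightarrow> E x [] \<in> W"
    and kV: "\<And>y. y \<in> U \<Longrightarrow> \<kappa> y \<in> V" and ck: "continuous_on U \<kappa>"
    and e: "bounded_linear e" "\<And>y. y \<in> U \<Longrightarrow> e y \<in> W"
    and eq: "\<And>y. y \<in> U \<Longrightarrow> E (\<kappa> y) [] = e y"
    and L: "\<And>y r. y \<in> U \<Longrightarrow> r \<in> W \<Longrightarrow> L y r \<in> V" "\<And>y r. y \<in> U \<Longrightarrow> r \<in> W \<Longrightarrow> E (\<kappa> y) [L y r] = r"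
      "\<And>y h. y \<in> U \<Longrightarrow> h \<in> V \<Longrightarrow> L y (E (\<kappa> y) [h]) = h"
    and Lb: "\<And>y. y \<in> U \<Longrightarrow> \<exists>C. \<forall>r\<in>W. norm (L y r) \<le> C * norm r"
  shows "smooth_on U \<kappa>"
proof -
  have ml1: "bounded_multilinear_on V 1 (E x)" if "x \<in> V" for x using E that by (auto simp: tower_def)
  have Elin: "E x [a + b] = E x [a] + E x [b]" "E x [a - b] = E x [a] - E x [b]" "E x [c *\<^sub>R a] = c *\<^sub>R E x [a]"
    if "x \<in> V" "a \<in> V" "b \<in> V" for x a b c
    using bounded_multilinear_on_slots[OF ml1[OF that(1)] V(1), of "[]" "[]" a b] that by auto
  have EW: "E x hs \<in> W" if "x \<in> V" "set hs \<subseteq> V" for x hs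
    by (rule tower_range[OF E V(1) W gW]) (use that in auto)
  have Llin: "L y (c *\<^sub>R r + r') = c *\<^sub>R L y r + L y r'" if y: "y \<in> U" and r: "r \<in> W" "r' \<in> W" for y r r' c
  proof -
    have m: "c *\<^sub>R L y r \<in> V" "L y r' \<in> V" "c *\<^sub>R L y r + L y r' \<in> V" using L(1)[OF y] r V(1) by (simp_all add: subspace_add subspace_scale)
    have "E (\<kappa> y) [c *\<^sub>R L y r + L y r'] = c *\<^sub>R r + r'"
      using Elin(1)[OF kV[OF y] m(1,2)] Elin(3)[OF kV[OF y] L(1)[OF y r(1)] L(1)[OF y r(1)]] L(2)[OF y] r by simp
    then show ?thesis using L(3)[OF y m(3)] by simp
  qed
  \<comment> \<open>Inverses of nearby operators: \<open>L y r\<close> is recovered through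
    \<open>L y0\<close>, and the difference of the two derivatives, at most
    \<open>1 / (2 * C)\<close>, is absorbed on the left.\<close>
  have Lloc: "\<exists>d>0. \<exists>C\<ge>0. \<forall>y\<in>U. norm (y - y0) < d \<longrightarrow> (\<forall>r\<in>W. norm (L y r) \<le> C * norm r)" if y0: "y0 \<in> U" for y0
  proof -
    obtain C0 where C0: "\<And>r. r \<in> W \<Longrightarrow> norm (L y0 r) \<le> C0 * norm r" using Lb[OF y0] by blast
    define C where "C = max 1 C0"
    have C: "C > 0" "\<And>r. r \<in> W \<Longrightarrow> norm (L y0 r) \<le> C * norm r"
      by (simp add: C_def, rule order.trans[OF C0], auto simp: C_def intro: mult_right_mono)
    have "1 / (2 * C) > 0" using C by simp
    from tower1_continuous[OF E V(1) kV[OF y0] this] obtain d1 where d1: "d1 > 0"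
      "\<And>y h. y \<in> V \<Longrightarrow> norm (y - \<kappa> y0) < d1 \<Longrightarrow> h \<in> V \<Longrightarrow> norm (E y [h] - E (\<kappa> y0) [h]) \<le> 1 / (2 * C) * norm h" by blast
    obtain d where d: "d > 0" "\<And>y. y \<in> U \<Longrightarrow> norm (y - y0) < d \<Longrightarrow> norm (\<kappa> y - \<kappa> y0) < d1"
      using ck y0 d1(1) unfolding continuous_on_iff dist_norm by metis
    have "norm (L y r) \<le> 2 * C * norm r" if y: "y \<in> U" "norm (y - y0) < d" and r: "r \<in> W" for y r
    proof -
      let ?h = "L y r"
      have hV: "?h \<in> V" by (rule L(1)[OF y(1) r])
      have "?h = L y0 (E (\<kappa> y0) [?h])" using L(3)[OF y0 hV] by simp
      then have "norm ?h \<le> C * norm (E (\<kappa> y0) [?h])" using C(2)[OF EW[OF kV[OF y0]], of "[?h]"] hV by simp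
      also have "norm (E (\<kappa> y0) [?h]) \<le> norm (E (\<kappa> y) [?h]) + norm (E (\<kappa> y) [?h] - E (\<kappa> y0) [?h])"
        by (metis norm_minus_commute norm_triangle_sub)
      also have "\<dots> \<le> norm r + 1 / (2 * C) * norm ?h"
        using d1(2)[OF kV[OF y(1)] d(2)[OF y] hV] L(2)[OF y(1) r] by simp
      finally have "norm ?h \<le> C * (norm r + 1 / (2 * C) * norm ?h)" using C by simp
      also have "\<dots> = C * norm r + norm ?h / 2" using C by (simp add: distrib_left)
      finally show ?thesis by simp
    qed
    then show ?thesis using d(1) C(1) by (intro exI[of _ d] conjI exI[of _ "2 * C"]) auto
  qed
  have ev: "\<forall>\<^sub>F t in at (0::real). norm ((y + t *\<^sub>R r) - y) < d" if "d > 0" for y r :: 'u and d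
  proof -
    have "((\<lambda>t. norm ((y + t *\<^sub>R r) - y)) \<longlongrightarrow> norm ((y + 0 *\<^sub>R r) - y)) (at (0::real))" by (intro tendsto_intros)
    from order_tendstoD(2)[OF this, of d] show ?thesis using that by simp
  qed
  have line: "y + t *\<^sub>R r \<in> U" if "y \<in> U" "r \<in> U" for y r t using U that by (simp add: subspace_add subspace_scale)
  have null: "((\<lambda>t. L (y + t *\<^sub>R r) (w t)) \<longlongrightarrow> 0) (at 0)"
    if y: "y \<in> U" and r: "r \<in> U" and w: "(w \<longlongrightarrow> 0) (at 0)" "\<And>t. w t \<in> W" for y r w
  proof -
    obtain d C where d: "d > 0" "C \<ge> 0" "\<And>y'. y' \<in> U \<Longrightarrow> norm (y' - y) < d \<Longrightarrow> (\<forall>r\<in>W. norm (L y' r) \<le> C * norm r)"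
      using Lloc[OF y] by metis
    show ?thesis
    proof (rule Lim_null_comparison)
      show "\<forall>\<^sub>F t in at 0. norm (L (y + t *\<^sub>R r) (w t)) \<le> C * norm (w t)"
        using ev[OF d(1), of y r] by eventually_elim (use d(3) line[OF y r] w in blast)
      show "((\<lambda>t. C * norm (w t)) \<longlongrightarrow> 0) (at 0)"
        using tendsto_mult[OF tendsto_const tendsto_norm[OF w(1)], of C] by simp
    qed
  qed
  have ktend: "((\<lambda>t. \<kappa> (y + t *\<^sub>R r)) \<longlongrightarrow> \<kappa> y) (at 0)" if y: "y \<in> U" and r: "r \<in> U" for y r
  proof (rule tendstoI)
    fix \<epsilon> :: real assume "\<epsilon> > 0"
    then obtain d where d: "d > 0" "\<And>y'. y' \<in> U \<Longrightarrow> norm (y' - y) < d \<Longrightarrow> norm (\<kappa> y' - \<kappa> y) < \<epsilon>"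
      using ck y unfolding continuous_on_iff dist_norm by metis
    show "\<forall>\<^sub>F t in at 0. dist (\<kappa> (y + t *\<^sub>R r)) (\<kappa> y) < \<epsilon>"
      using ev[OF d(1), of y r] by eventually_elim (use d(2) line[OF y r] in \<open>simp add: dist_norm\<close>)
  qed
  have dk: "dir_deriv U \<kappa> r (\<lambda>y. L y (e r))" if r: "r \<in> U" for r
    unfolding dir_deriv_def hvd0_tendsto
  proof
    fix y assume y: "y \<in> U"
    obtain C0 where C0: "\<And>r. r \<in> W \<Longrightarrow> norm (L y r) \<le> C0 * norm r" using Lb[OF y] by blast
    define C where "C = max 1 C0"
    have C: "C > 0" "\<And>r. r \<in> W \<Longrightarrow> norm (L y r) \<le> C * norm r"
      by (simp add: C_def, rule order.trans[OF C0], auto simp: C_def intro: mult_right_mono)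
    define K where "K t = \<kappa> (y + t *\<^sub>R r) - \<kappa> y" for t
    have KV: "K t \<in> V" for t using kV line[OF y r] y V by (simp add: K_def subspace_diff)
    have K0: "(K \<longlongrightarrow> 0) (at 0)" using tendsto_diff[OF ktend[OF y r] tendsto_const[of "\<kappa> y"]] by (simp add: K_def[abs_def])
    let ?l = "L y (e r)"
    \<comment> \<open>Differentiability of the given map at \<open>\<kappa> y\<close>, read
      backwards through \<open>L y\<close>; the error is still measured by \<open>K t\<close>
      itself.\<close>
    have main: "\<forall>\<^sub>F t in at 0. norm (K t - t *\<^sub>R ?l) \<le> C * \<eta> * norm (K t)" if \<eta>: "\<eta> > 0" for \<eta>
    proof -
      obtain d where d: "d > 0" "\<And>h hs. h \<in> V \<Longrightarrow> norm h < d \<Longrightarrow> length hs = 0 \<Longrightarrow> set hs \<subseteq> V \<Longrightarrow>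
              norm (E (\<kappa> y + h) hs - E (\<kappa> y) hs - E (\<kappa> y) (h # hs)) \<le> \<eta> * norm h * prod_list (map norm hs)"
        using towerD[OF E kV[OF y] \<eta>] by metis
      have "\<forall>\<^sub>F t in at 0. norm (K t) < d"
        using order_tendstoD(2)[OF tendsto_norm[OF K0], of d] d(1) by simp
      then show ?thesis
      proof eventually_elim
        case (elim t)
        have "norm (E (\<kappa> y + K t) [] - E (\<kappa> y) [] - E (\<kappa> y) [K t]) \<le> \<eta> * norm (K t)"
          using d(2)[OF KV elim, of "[]"] by simp
        moreover have "E (\<kappa> y + K t) [] - E (\<kappa> y) [] = t *\<^sub>R e r"
          using eq[OF line[OF y r]] eq[OF y] e(1) by (simp add: K_def linear_add linear_scale bounded_linear.linear)
        ultimately have 1: "norm (t *\<^sub>R e r - E (\<kappa> y) [K t]) \<le> \<eta> * norm (K t)" by simp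
        have mem: "E (\<kappa> y) [K t] \<in> W" "e r \<in> W" using EW[OF kV[OF y]] KV e r by auto
        have "L y ((-t) *\<^sub>R e r + E (\<kappa> y) [K t]) = (-t) *\<^sub>R ?l + L y (E (\<kappa> y) [K t])"
          by (rule Llin[OF y mem(2,1)])
        also have "L y (E (\<kappa> y) [K t]) = K t" by (rule L(3)[OF y KV])
        finally have "norm (K t - t *\<^sub>R ?l) = norm (L y ((-t) *\<^sub>R e r + E (\<kappa> y) [K t]))" by simp
        also have "\<dots> \<le> C * norm ((-t) *\<^sub>R e r + E (\<kappa> y) [K t])"
          by (rule C(2)[OF subspace_add[OF W(1) subspace_scale[OF W(1) mem(2)] mem(1)]])
        also have "norm ((-t) *\<^sub>R e r + E (\<kappa> y) [K t]) = norm (t *\<^sub>R e r - E (\<kappa> y) [K t])"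
          by (metis add.commute norm_minus_commute scaleR_minus_left diff_conv_add_uminus)
        finally show ?case using 1 C(1) by (smt (verit) mult.assoc mult_left_mono)
      qed
    qed
    \<comment> \<open>For \<open>C * \<eta> = 1 / 2\<close> the error is absorbed, so
      \<open>K t\<close> is O(t); only with this does \<open>main\<close> become an o(t)
      statement.\<close>
    have half: "\<forall>\<^sub>F t in at 0. norm (K t) \<le> 2 * norm (t *\<^sub>R ?l)"
    proof -
      have "1 / (2 * C) > 0" using C by simp
      from main[OF this] show ?thesis
      proof eventually_elim
        case (elim t)
        then have "norm (K t - t *\<^sub>R ?l) \<le> norm (K t) / 2" using C(1) by simp
        then show ?case using norm_triangle_sub[of "K t" "t *\<^sub>R ?l"] by simp
      qed
    qed
    have "((\<lambda>t. K t /\<^sub>R t) \<longlongrightarrow> ?l) (at 0)"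
    proof (rule tendstoI)
      fix \<epsilon> :: real assume \<epsilon>: "\<epsilon> > 0"
      define \<eta> where "\<eta> = \<epsilon> / (2 * C * (norm ?l + 1))"
      have \<eta>: "\<eta> > 0" using \<epsilon> C by (simp add: \<eta>_def add_nonneg_pos)
      show "\<forall>\<^sub>F t in at 0. dist (K t /\<^sub>R t) ?l < \<epsilon>"
        using main[OF \<eta>] half eventually_at_filter[of "\<lambda>t. t \<noteq> 0" 0 UNIV, simplified]
      proof eventually_elim
        case (elim t)
        have "norm (K t - t *\<^sub>R ?l) \<le> C * \<eta> * (2 * norm (t *\<^sub>R ?l))"
          using elim(1,2) C(1) \<eta> by (smt (verit) mult_left_mono mult_pos_pos)
        also have "\<dots> = (2 * C * \<eta> * norm ?l) * \<bar>t\<bar>" by simp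
        also have "(2 * C * \<eta> * norm ?l) * \<bar>t\<bar> < \<epsilon> * \<bar>t\<bar>"
        proof -
        have "2 * C * \<eta> * norm ?l < \<epsilon>"
        proof -
          have "2 * C * \<eta> * (norm ?l + 1) = \<epsilon>" using C(1) by (simp add: \<eta>_def add_nonneg_eq_0_iff)
          moreover have "2 * C * \<eta> > 0" using C(1) \<eta> by simp
          ultimately show ?thesis unfolding distrib_left by linarith
        qed
        then show ?thesis using elim by (intro mult_strict_right_mono) auto
        qed
        finally have "norm (K t - t *\<^sub>R ?l) < \<epsilon> * \<bar>t\<bar>" .
        moreover have "K t - t *\<^sub>R ?l = t *\<^sub>R (K t /\<^sub>R t - ?l)" using elim by (simp add: algebra_simps)
        ultimately show ?case using elim by (simp add: dist_norm mult.commute)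
      qed
    qed
    then show "((\<lambda>t. (\<kappa> (y + t *\<^sub>R r) - \<kappa> (y + 0 *\<^sub>R r)) /\<^sub>R t) \<longlongrightarrow> L y (e r)) (at 0)" by (simp add: K_def)
  qed
  \<comment> \<open>The rule (A^-1)' = - A^-1 A' A^-1 for the derivative A at
    \<open>\<kappa> y\<close>, combined with the product rule for the argument
    \<open>a\<close>.\<close>
  have dL: "dir_deriv U (\<lambda>y. L y (a y)) r (\<lambda>y. L y (a' y - E (\<kappa> y) [L y (e r), L y (a y)]))"
    if r: "r \<in> U" and a: "dir_deriv U a r a'" "\<And>y. y \<in> U \<Longrightarrow> a y \<in> W" for r a a'
    unfolding dir_deriv_def hvd0_tendsto
  proof
    fix y assume y: "y \<in> U"
    let ?y = "\<lambda>t. y + t *\<^sub>R r"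
    have a'W: "a' y \<in> W" using dir_deriv_in[OF a(1) U r _ W y] a(2) by auto
    define b0 where "b0 = L y (a y)"
    define k' where "k' = L y (e r)"
    have b0: "b0 \<in> V" "k' \<in> V" using L(1)[OF y] a(2)[OF y] e(2)[OF r] by (auto simp: b0_def k'_def)
    define z where "z = a' y - E (\<kappa> y) [k', b0]"
    have zW: "z \<in> W" unfolding z_def using a'W EW[OF kV[OF y], of "[k', b0]"] b0 W by (auto intro: subspace_diff)
    define zt where "zt t = (a (?y t) - a y) /\<^sub>R t - (E (\<kappa> (?y t)) [b0] - E (\<kappa> y) [b0]) /\<^sub>R t" for t
    have ztW: "zt t \<in> W" for t unfolding zt_def
      by (intro subspace_diff[OF W(1)] subspace_scale[OF W(1)] a(2) EW kV line[OF y r] y) (use b0 in auto)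
    define ps where "ps = [(\<lambda>t::real. b0, 0::'v)]"
    have "((\<lambda>t. E (\<kappa> (?y t)) (map (\<lambda>p. fst p t) ps)) has_vector_derivative
        E (\<kappa> (?y 0)) (k' # map (\<lambda>p. fst p 0) ps) +
        (\<Sum>i<length ps. E (\<kappa> (?y 0)) ((map (\<lambda>p. fst p 0) ps)[i := snd (ps ! i)]))) (at 0)"
      by (rule tower_hvd[OF E V(1)])
         (use dir_derivD[OF dk[OF r] y] kV line[OF y r] b0 V in \<open>auto simp: k'_def ps_def subspace_0\<close>)
    then have "((\<lambda>t. E (\<kappa> (?y t)) [b0]) has_vector_derivative E (\<kappa> y) [k', b0]) (at 0)"
      using Elin(3)[OF kV[OF y] b0(1) b0(1), of 0] by (simp add: ps_def)
    then have zt: "(zt \<longlongrightarrow> z) (at 0)"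
      using dir_derivD[OF a(1) y] unfolding hvd0_tendsto zt_def[abs_def] z_def by (intro tendsto_diff) simp_all
    define w where "w t = zt t - E (\<kappa> (?y t)) [L y z]" for t
    have lz: "L y z \<in> V" by (rule L(1)[OF y zW])
    have wW: "w t \<in> W" for t unfolding w_def
      by (intro subspace_diff[OF W(1)] ztW EW kV line[OF y r]) (use lz in auto)
    define qs where "qs = [(\<lambda>t::real. L y z, L y z)]"
    have "((\<lambda>t. E (\<kappa> (?y t)) (map (\<lambda>p. fst p t) qs)) \<longlongrightarrow> E (\<kappa> y) (map snd qs)) (at 0)"
      by (rule tower_tendsto[OF E V(1) ktend[OF y r]]) (use kV line[OF y r] y lz in \<open>auto simp: qs_def\<close>)
    then have "((\<lambda>t. E (\<kappa> (?y t)) [L y z]) \<longlongrightarrow> z) (at 0)" using L(2)[OF y zW] by (simp add: qs_def)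
    from tendsto_diff[OF zt this] have "(w \<longlongrightarrow> 0) (at 0)" by (simp add: w_def[abs_def])
    from null[OF y r this wW] have lim: "((\<lambda>t. L (?y t) (w t)) \<longlongrightarrow> 0) (at 0)" .
    \<comment> \<open>An exact identity: \<open>b0\<close> and \<open>L y z\<close> are written as
      \<open>L (?y t)\<close> of their images under the derivative at
      \<open>\<kappa> (?y t)\<close>. What remains inside \<open>L (?y t)\<close> is
      \<open>w t\<close>, which tends to 0.\<close>
    have "(L (?y t) (a (?y t)) - L y (a y)) /\<^sub>R t = L (?y t) (w t) + L y z" for t
    proof -
      note l = Llin[OF line[OF y r]]
      have Eb: "E (\<kappa> (?y t)) [b0] \<in> W" "E (\<kappa> (?y t)) [L y z] \<in> W" "a (?y t) \<in> W" "a y \<in> W"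
        using EW kV line[OF y r] b0 lz a(2) y by auto
      have "a y = E (\<kappa> y) [b0]" using L(2)[OF y a(2)[OF y]] by (simp add: b0_def)
      then have "w t = (inverse t) *\<^sub>R (a (?y t)) + ((- inverse t) *\<^sub>R E (\<kappa> (?y t)) [b0] + (-1) *\<^sub>R E (\<kappa> (?y t)) [L y z])"
        by (simp add: w_def zt_def algebra_simps)
      also have "L (?y t) \<dots> = inverse t *\<^sub>R L (?y t) (a (?y t)) + L (?y t) ((- inverse t) *\<^sub>R E (\<kappa> (?y t)) [b0] + (-1) *\<^sub>R E (\<kappa> (?y t)) [L y z])"
        by (rule l) (intro subspace_add[OF W(1)] subspace_scale[OF W(1)] Eb)+
      also have "L (?y t) ((- inverse t) *\<^sub>R E (\<kappa> (?y t)) [b0] + (-1) *\<^sub>R E (\<kappa> (?y t)) [L y z]) =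
         (- inverse t) *\<^sub>R L (?y t) (E (\<kappa> (?y t)) [b0]) + L (?y t) ((-1) *\<^sub>R E (\<kappa> (?y t)) [L y z])"
        by (rule l) (intro subspace_add[OF W(1)] subspace_scale[OF W(1)] Eb)+
      also have "L (?y t) (E (\<kappa> (?y t)) [b0]) = b0" by (rule L(3)[OF line[OF y r] b0(1)])
      also have "L (?y t) ((-1) *\<^sub>R E (\<kappa> (?y t)) [L y z]) = - L y z"
      proof -
        have "(-1) *\<^sub>R E (\<kappa> (?y t)) [L y z] = E (\<kappa> (?y t)) [(-1) *\<^sub>R L y z]"
          by (rule Elin(3)[OF kV[OF line[OF y r]] lz lz, symmetric])
        then show ?thesis using L(3)[OF line[OF y r], of "(-1) *\<^sub>R L y z"] lz V by (simp add: subspace_neg)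
      qed
      finally show ?thesis by (simp add: b0_def algebra_simps)
    qed
    then show "((\<lambda>t. (L (?y t) (a (?y t)) - L (?y 0) (a (?y 0))) /\<^sub>R t) \<longlongrightarrow> L y (a' y - E (\<kappa> y) [L y (e r), L y (a y)])) (at 0)"
      using tendsto_add[OF lim tendsto_const[of "L y z"]] by (simp add: z_def b0_def k'_def)
  qed
  have lbk: "loc_bdd U {\<kappa>}"
    unfolding loc_bdd_def
  proof
    fix x assume x: "x \<in> U"
    obtain d where d: "d > 0" "\<And>y. y \<in> U \<Longrightarrow> norm (y - x) < d \<Longrightarrow> norm (\<kappa> y - \<kappa> x) < 1"
      using ck x zero_less_one unfolding continuous_on_iff dist_norm by metis
    have "norm (\<kappa> y) \<le> norm (\<kappa> x) + 1" if "y \<in> U" "norm (y - x) < d" for y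
      using d(2)[OF that] norm_triangle_sub[of "\<kappa> y" "\<kappa> x"] by simp
    then show "\<exists>\<delta>>0. \<exists>C. \<forall>y\<in>U. norm (y - x) < \<delta> \<longrightarrow> (\<forall>G\<in>{\<kappa>}. norm (G y) \<le> C)" using d(1) by blast
  qed
  have lbL: "loc_bdd U {\<lambda>y. L y (a y) | a. a \<in> A}" if A: "loc_bdd U A" "\<And>a y. a \<in> A \<Longrightarrow> y \<in> U \<Longrightarrow> a y \<in> W" for A
    unfolding loc_bdd_def
  proof
    fix x assume x: "x \<in> U"
    obtain d1 C where d1: "d1 > 0" "C \<ge> 0" "\<And>y r. y \<in> U \<Longrightarrow> norm (y - x) < d1 \<Longrightarrow> r \<in> W \<Longrightarrow> norm (L y r) \<le> C * norm r"
      using Lloc[OF x] by metis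
    obtain d2 M where d2: "d2 > 0" "\<And>y G. y \<in> U \<Longrightarrow> norm (y - x) < d2 \<Longrightarrow> G \<in> A \<Longrightarrow> norm (G y) \<le> M"
      using A(1) x unfolding loc_bdd_def by metis
    have "norm (L y (a y)) \<le> C * M" if "y \<in> U" "norm (y - x) < min d1 d2" "a \<in> A" for y a
      using d1(3)[of y "a y"] d2(2)[of y a] that A(2) mult_left_mono[OF _ d1(2), of "norm (a y)" M] by fastforce
    then show "\<exists>\<delta>>0. \<exists>C. \<forall>y\<in>U. norm (y - x) < \<delta> \<longrightarrow> (\<forall>G\<in>{\<lambda>y. L y (a y) | a. a \<in> A}. norm (G y) \<le> C)"
      using d1(1) d2(1) by (intro exI[of _ "min d1 d2"] conjI exI[of _ "C * M"]) auto
  qed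
  obtain M where M: "\<And>r. norm (e r) \<le> norm r * M" "M \<ge> 0" using bounded_linear.nonneg_bounded[OF e(1)] by metis
  \<comment> \<open>The derivatives of \<open>\<kappa>\<close> in unit directions are
    \<open>L\<close> applied to such constants.\<close>
  define CE where "CE = {\<lambda>y::'u. c | c. norm c \<le> M \<and> c \<in> W}"
  have CE: "usm U k CE" for k unfolding CE_def by (rule usm_subset[OF usm_const[of U k M]]) auto
  have CEin: "(\<lambda>y. e r) \<in> CE" if "r \<in> U" "norm r \<le> 1" for r
    using M(1)[of r] mult_right_mono[OF that(2) M(2)] e(2)[OF that(1)] by (auto simp: CE_def)
  \<comment> \<open>The derivative of \<open>\<kappa>\<close> is \<open>L\<close> applied to
    constants, and that of \<open>L y (a y)\<close> is \<open>L\<close> applied to an expression in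
    \<open>\<kappa>\<close>, \<open>L\<close> and the derivative of \<open>a\<close>. So order
    \<open>n + 1\<close> of both claims rests on order \<open>n\<close> of both.\<close>
  have P: "usm U n {\<kappa>} \<and> (\<forall>A. usm U n A \<and> (\<forall>a\<in>A. \<forall>y\<in>U. a y \<in> W) \<longrightarrow> usm U n {\<lambda>y. L y (a y) | a. a \<in> A})" for n
  proof (induction n)
    case 0 then show ?case using lbk lbL by auto
  next
    case (Suc n)
    then have IH: "usm U n {\<kappa>}" "\<And>A. usm U n A \<Longrightarrow> (\<And>a y. a \<in> A \<Longrightarrow> y \<in> U \<Longrightarrow> a y \<in> W) \<Longrightarrow> usm U n {\<lambda>y. L y (a y) | a. a \<in> A}"
      by auto
    have LC: "usm U n {\<lambda>y. L y (a y) | a. a \<in> CE}" by (rule IH(2)[OF CE]) (auto simp: CE_def)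
    show ?case
    proof (intro conjI allI impI)
      show "usm U (Suc n) {\<kappa>}"
      proof (rule usm_SucI[OF lbk LC])
        fix G r assume "G \<in> {\<kappa>}" "r \<in> U" "norm r \<le> 1"
        moreover have "(\<lambda>y. L y (e r)) \<in> {\<lambda>y. L y (a y) | a. a \<in> CE}"
          by (rule CollectI, rule exI[of _ "\<lambda>y. e r"], simp add: CEin \<open>r \<in> U\<close> \<open>norm r \<le> 1\<close>)
        ultimately show "\<exists>G'\<in>{\<lambda>y. L y (a y) | a. a \<in> CE}. dir_deriv U G r G'"
          using dk[of r] by (intro bexI) auto
      qed
      fix A assume A: "usm U (Suc n) A \<and> (\<forall>a\<in>A. \<forall>y\<in>U. a y \<in> W)"
      then obtain A0 where A0: "usm U n A0" "\<And>G h. G \<in> A \<Longrightarrow> h \<in> U \<Longrightarrow> norm h \<le> 1 \<Longrightarrow> \<exists>G'\<in>A0. dir_deriv U G h G'"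
        using usm_SucE[of U n A] by metis
      define A' where "A' = {a \<in> A0. \<forall>y\<in>U. a y \<in> W}"
      have A': "usm U n A'" unfolding A'_def by (rule usm_subset[OF A0(1)]) auto
      let ?LA = "{\<lambda>y. L y (a y) | a. a \<in> A}"
      have LA: "usm U n ?LA" by (rule IH(2)) (use A usm_Suc_imp in auto)
      define S where "S = {\<lambda>y. E (\<kappa> y) (map (\<lambda>a. a y) as) | as. length as = 2 \<and> set as \<subseteq> {\<lambda>y. L y (a y) | a. a \<in> CE} \<union> ?LA}"
      have LV: "a y \<in> V" if "a \<in> {\<lambda>y. L y (a y) | a. a \<in> CE} \<union> ?LA" "y \<in> U" for a y
        using that A L(1) by (auto simp: CE_def)
      have S: "usm U n S" unfolding S_def
        by (rule comp_usm[OF U V E kV ck IH(1) usm_Un[OF LC LA]]) (assumption, rule LV)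
      have SW: "s y \<in> W" if "s \<in> S" "y \<in> U" for s y
      proof -
        from that(1)[unfolded S_def mem_Collect_eq]
        obtain as where as: "s = (\<lambda>y. E (\<kappa> y) (map (\<lambda>a. a y) as))" "set as \<subseteq> {\<lambda>y. L y (a y) | a. a \<in> CE} \<union> ?LA"
          by (elim exE conjE) (rule that)
        have "set (map (\<lambda>a. a y) as) \<subseteq> V" unfolding set_map by (intro image_subsetI LV[OF subsetD[OF as(2)] that(2)])
        then show ?thesis unfolding as(1) by (rule EW[OF kV[OF that(2)]])
      qed
      define D where "D = {\<lambda>y. a y + s y | a s. a \<in> A' \<and> s \<in> {\<lambda>y. - s y | s. s \<in> S}}"
      have D: "usm U n D" unfolding D_def
        by (rule usm_add[OF A' usm_image_bounded_linear[OF bounded_linear_minus[OF bounded_linear_ident] S]])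
      have DW: "c y \<in> W" if "c \<in> D" "y \<in> U" for c y
        using that SW W unfolding D_def A'_def by (auto intro!: subspace_diff)
      show "usm U (Suc n) ?LA"
      proof (rule usm_SucI[of U ?LA n "{\<lambda>y. L y (a y) | a. a \<in> D}"])
        show "usm U n {\<lambda>y. L y (a y) | a. a \<in> D}" by (rule IH(2)[OF D]) (rule DW)
        show "loc_bdd U ?LA" by (rule lbL) (use A usm_loc_bdd in auto)
        fix G r assume "G \<in> ?LA" and r: "r \<in> U" "norm r \<le> 1"
        from this(1)[unfolded mem_Collect_eq]
        obtain a where a: "G = (\<lambda>y. L y (a y))" "a \<in> A" by (elim exE conjE) (rule that)
        obtain a' where a': "a' \<in> A0" "dir_deriv U a r a'" using A0(2)[OF a(2) r] by auto
        have aW: "\<And>y. y \<in> U \<Longrightarrow> a y \<in> W" using A a by auto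
        have "a' y \<in> W" if "y \<in> U" for y using dir_deriv_in[OF a'(2) U r(1) _ W that] aW by auto
        then have "a' \<in> A'" using a' by (auto simp: A'_def)
        moreover have "(\<lambda>y. E (\<kappa> y) [L y (e r), L y (a y)]) \<in> S"
          unfolding S_def using CEin[OF r] a(2)
          by (auto intro!: exI[of _ "[\<lambda>y. L y (e r), \<lambda>y. L y (a y)]"])
        ultimately have D: "(\<lambda>y. a' y + - E (\<kappa> y) [L y (e r), L y (a y)]) \<in> D"
          unfolding D_def by (intro CollectI exI[of _ a'] exI[of _ "\<lambda>y. - E (\<kappa> y) [L y (e r), L y (a y)]"]) auto
        have "(\<lambda>y. L y (a' y + - E (\<kappa> y) [L y (e r), L y (a y)])) \<in> {\<lambda>y. L y (a y) | a. a \<in> D}"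
          by (rule CollectI, rule exI[of _ "\<lambda>y. a' y + - E (\<kappa> y) [L y (e r), L y (a y)]"], simp only: D simp_thms)
        moreover have "dir_deriv U G r (\<lambda>y. L y (a' y + - E (\<kappa> y) [L y (e r), L y (a y)]))"
          using dL[OF r(1) a'(2) aW] unfolding a by simp
        ultimately show "\<exists>G'\<in>{\<lambda>y. L y (a y) | a. a \<in> D}. dir_deriv U G r G'"
          by (rule rev_bexI[where P = "dir_deriv U G r"])
      qed
    qed
  qed
  show ?thesis by (rule smooth_onI_usm[OF U]) (use P in blast)
qed

section \<open>Continuous functions on the circle\<close>

lemma has_vector_derivative_real_iff: "(f has_vector_derivative (d::real)) F \<longleftrightarrow> (f has_real_derivative d) F"
  by (simp add: has_real_derivative_iff_has_vector_derivative)

lemma C0_fun_const [simp]: "C0_fun (const_fun c) t = c"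
  unfolding const_fun_C0_def by (subst C0_fun_C0_of) auto

lemma norm_C0_le: "(\<And>t. \<bar>C0_fun u t\<bar> \<le> B) \<Longrightarrow> norm u \<le> B"
  unfolding norm_C0_eq by (rule cSUP_least) auto

lemma C0_fun_shift:
  obtains t' where "a \<le> t'" "t' < a + 1" "C0_fun u t' = C0_fun u t"
proof (rule that[of "t - of_int \<lfloor>t - a\<rfloor>"])
  show "C0_fun u (t - of_int \<lfloor>t - a\<rfloor>) = C0_fun u t"
    using periodic_int[of "C0_fun u" t "- \<lfloor>t - a\<rfloor>"] C0_fun_periodic by simp
qed (linarith+)

text \<open>The window may start anywhere, since the estimates below start at a zero whose position
  is unknown.\<close>

lemma norm_C0_le_on: "(\<And>t. a \<le> t \<Longrightarrow> t < a + 1 \<Longrightarrow> \<bar>C0_fun u t\<bar> \<le> B) \<Longrightarrow> norm u \<le> B"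
  by (rule norm_C0_le) (metis C0_fun_shift)

lemma average_C0_mono:
  assumes "\<And>t. t \<in> {0..1} \<Longrightarrow> C0_fun u t \<le> C0_fun v t" shows "average u \<le> average v"
  unfolding average_C0_def by (rule integral_mono) (use assms in auto)

lemma average_C0_interval: "average (u :: C0) = (LBINT t=0..1. C0_fun u t)"
proof -
  have "average u = (LBINT t:{0..1}. C0_fun u t)"
    unfolding average_C0_def circle_def by (subst integral_restrict_space) (auto simp: set_lebesgue_integral_def)
  then show ?thesis using interval_integral_Icc[of 0 1 "C0_fun u"] by (simp add: zero_ereal_def one_ereal_def)
qed

text \<open>The mean value theorem for integrals. For functions of average zero it provides the zero
  from which later estimates run over one period.\<close>

lemma average_C0_attained: "\<exists>t\<in>{0..1}. C0_fun u t = average u"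
proof -
  have c: "continuous_on {0..1} (C0_fun u)" by (rule continuous_C0_fun)
  obtain s where s: "s \<in> {0..1}" "\<And>t. t \<in> {0..1} \<Longrightarrow> C0_fun u t \<le> C0_fun u s"
    using continuous_attains_sup[OF _ _ c] by auto
  obtain i where i: "i \<in> {0..1}" "\<And>t. t \<in> {0..1} \<Longrightarrow> C0_fun u i \<le> C0_fun u t"
    using continuous_attains_inf[OF _ _ c] by auto
  have "average u \<le> average (const_fun (C0_fun u s) :: C0)" by (rule average_C0_mono) (use s in simp)
  moreover have "average (const_fun (C0_fun u i) :: C0) \<le> average u" by (rule average_C0_mono) (use i in simp)
  ultimately have "C0_fun u i \<le> average u" "average u \<le> C0_fun u s" by (simp_all add: average_const_fun)
  moreover have "connected (C0_fun u ` {0..1})" by (rule connected_continuous_image[OF c]) simp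
  ultimately have "average u \<in> C0_fun u ` {0..1}" using connectedD_interval s(1) i(1) by blast
  then show ?thesis by auto
qed

lemma abs_average_C0_le: "\<bar>average u\<bar> \<le> norm (u :: C0)"
proof -
  obtain t where "C0_fun u t = average u" using average_C0_attained[of u] by auto
  then show ?thesis using abs_C0_fun_le[of u t] by simp
qed

lemma average_zero: "average (0 :: 'a::circle_space) = 0"
  using average_scaleR[of 0 "0 :: 'a"] by simp
lemma average_minus: "average (- u) = - average (u :: 'a::circle_space)"
  using average_scaleR[of "-1" u] by simp
lemma average_diff: "average (u - v) = average u - average (v :: 'a::circle_space)"
  using average_add[of u "- v"] by (simp add: average_minus)
lemma const_fun_0: "const_fun 0 = (0 :: 'a::circle_space)"
  using const_fun_scaleR[of 0 0, where 'a = 'a] by simp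
lemma const_fun_minus: "const_fun (- c) = - (const_fun c :: 'a::circle_space)"
  using const_fun_scaleR[of "-1" c, where 'a = 'a] by simp
lemma const_fun_diff: "const_fun (c - d) = const_fun c - (const_fun d :: 'a::circle_space)"
  using const_fun_add[of c "- d", where 'a = 'a] by (simp add: const_fun_minus)

lemmas average_simps = average_add average_scaleR average_const_fun average_zero average_minus average_diff

lemma norm_const_C0 [simp]: "norm (const_fun c :: C0) = \<bar>c\<bar>"
proof (rule antisym)
  show "norm (const_fun c :: C0) \<le> \<bar>c\<bar>" by (rule norm_C0_le) simp
  show "\<bar>c\<bar> \<le> norm (const_fun c :: C0)" using abs_C0_fun_le[of "const_fun c" 0] by simp
qed

lemma bounded_linear_average_C0: "bounded_linear (average :: C0 \<Rightarrow> real)"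
  by (rule bounded_linear_intro[of _ 1]) (auto simp: average_simps abs_average_C0_le)

lemma bounded_linear_const_fun: "bounded_linear (const_fun :: real \<Rightarrow> 'a::circle_space)"
proof (rule bounded_linear_intro[of _ "norm (const_fun 1 :: 'a)"])
  fix x y r :: real
  show "const_fun (x + y) = (const_fun x :: 'a) + const_fun y" by (rule const_fun_add)
  show "(const_fun (r *\<^sub>R x) :: 'a) = r *\<^sub>R const_fun x" by (simp add: const_fun_scaleR)
  have "(const_fun x :: 'a) = x *\<^sub>R const_fun 1" using const_fun_scaleR[of x 1, where 'a = 'a] by simp
  then show "norm (const_fun x :: 'a) \<le> norm x * norm (const_fun 1 :: 'a)" by simp
qed

text \<open>Completeness enters in the two fixed point arguments \<open>continuity_method\<close>
  and \<open>newton_surjective\<close>, which solve the linearised equation and the equation for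
  \<open>K\<close>.\<close>

instance C0 :: banach
proof
  fix X :: "nat \<Rightarrow> C0" assume X: "Cauchy X"
  have "Cauchy (\<lambda>n. Rep_C0 (X n))"
    using X unfolding Cauchy_def dist_norm minus_C0.rep_eq[symmetric] norm_C0.rep_eq[symmetric] .
  then obtain l where l: "(\<lambda>n. Rep_C0 (X n)) \<longlonglongrightarrow> l" using Cauchy_convergent convergent_def by blast
  have ptw: "(\<lambda>n. apply_bcontfun (Rep_C0 (X n)) t) \<longlonglongrightarrow> apply_bcontfun l t" for t
  proof (rule metric_tendsto_imp_tendsto[OF l], rule always_eventually, rule allI)
    fix n show "dist (apply_bcontfun (Rep_C0 (X n)) t) (apply_bcontfun l t) \<le> dist (Rep_C0 (X n)) l"
      by (rule dist_bounded)
  qed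
  have "apply_bcontfun l (t + 1) = apply_bcontfun l t" for t
  proof (rule LIMSEQ_unique[OF ptw])
    have "apply_bcontfun (Rep_C0 (X n)) (t + 1) = apply_bcontfun (Rep_C0 (X n)) t" for n
      using Rep_C0[of "X n"] by auto
    then show "(\<lambda>n. apply_bcontfun (Rep_C0 (X n)) (t + 1)) \<longlonglongrightarrow> apply_bcontfun l t" using ptw[of t] by simp
  qed
  then have R: "Rep_C0 (Abs_C0 l) = l" by (simp add: Abs_C0_inverse)
  have "X \<longlonglongrightarrow> Abs_C0 l"
    using l unfolding LIMSEQ_iff norm_C0.rep_eq minus_C0.rep_eq R .
  then show "convergent X" by (auto simp: convergent_def)
qed

definition mult_C0 :: "C0 \<Rightarrow> C0 \<Rightarrow> C0" where
  "mult_C0 u v = C0_of (\<lambda>t. C0_fun u t * C0_fun v t)"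

lemma mult_C0_fun [simp]: "C0_fun (mult_C0 u v) t = C0_fun u t * C0_fun v t"
  unfolding mult_C0_def
  by (subst C0_fun_C0_of) (auto intro!: continuous_intros continuous_C0_fun simp: C0_fun_periodic)

lemma norm_mult_C0_le: "norm (mult_C0 u v) \<le> norm u * norm v"
  by (rule norm_C0_le) (simp add: abs_mult mult_mono abs_C0_fun_le)

lemma bounded_bilinear_mult_C0: "bounded_bilinear mult_C0"
proof
  show "\<exists>K. \<forall>a b. norm (mult_C0 a b) \<le> norm a * norm b * K"
    by (intro exI[of _ 1]) (simp add: norm_mult_C0_le)
qed (auto intro!: C0_eqI simp: algebra_simps)

subsection \<open>Primitives\<close>

lemma C0_antideriv: "\<exists>H. (\<forall>t. (H has_real_derivative C0_fun q t) (at t)) \<and> H 1 - H 0 = average q"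
proof (rule exI[of _ "\<lambda>t. LBINT s=0..ereal t. C0_fun q s"], intro conjI allI)
  fix t :: real
  have "((\<lambda>u. LBINT y=ereal 0..ereal u. C0_fun q y) has_vector_derivative C0_fun q t) (at t within {min 0 t - 1..max 0 t + 1})"
    by (rule interval_integral_FTC2) (auto intro: continuous_C0_fun)
  moreover have "at t within {min 0 t - 1..max 0 t + 1} = at t"
    by (rule at_within_interior) auto
  ultimately show "((\<lambda>u. LBINT y=0..ereal u. C0_fun q y) has_real_derivative C0_fun q t) (at t)"
    by (simp add: has_vector_derivative_real_iff zero_ereal_def)
  show "(LBINT s=0..ereal 1. C0_fun q s) - (LBINT s=0..ereal 0. C0_fun q s) = average q"
    by (simp add: average_C0_interval zero_ereal_def[symmetric] one_ereal_def)
qed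

text \<open>Subtracting the average makes the increment of a primitive over [0, 1] vanish;
  \<open>H (t + 1) - H t\<close> is constant, so the primitive is periodic.\<close>

lemma C0_has_deriv_exists: "\<exists>p. C0_has_deriv p (q - const_fun (average q)) \<and> average p = 0"
proof -
  let ?r = "q - const_fun (average q)"
  have av: "average ?r = 0" by (simp add: average_simps)
  obtain H where H: "\<And>t. (H has_real_derivative C0_fun ?r t) (at t)" "H 1 - H 0 = 0"
    using C0_antideriv[of ?r] av by auto
  have cH: "continuous_on UNIV H" by (rule DERIV_continuous_on) (use H in \<open>auto intro: DERIV_subset\<close>)
  have "H (t + 1) - H t = H (0 + 1) - H 0" for t
  proof (rule DERIV_isconst_all[of "\<lambda>t. H (t + 1) - H t"])
    show "\<forall>x. ((\<lambda>t. H (t + 1) - H t) has_real_derivative 0) (at x)"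
    proof
      fix x
      have "((\<lambda>t. H (t + 1)) has_real_derivative C0_fun ?r (x + 1)) (at x)"
        using H(1)[of "x + 1"] by (simp add: DERIV_shift)
      from DERIV_diff[OF this H(1)[of x]]
      show "((\<lambda>t. H (t + 1) - H t) has_real_derivative 0) (at x)" by (simp only: C0_fun_periodic diff_self)
    qed
  qed
  then have per: "H (t + 1) = H t" for t using H(2) by simp
  have fH: "C0_fun (C0_of H) = H" by (rule C0_fun_C0_of[OF cH per])
  define p where "p = C0_of H - const_fun (average (C0_of H))"
  have "C0_fun p = (\<lambda>t. H t - average (C0_of H))" by (auto simp: p_def fH)
  moreover have "((\<lambda>t. H t - average (C0_of H)) has_real_derivative C0_fun ?r t) (at t)" for t
    using DERIV_diff[OF H(1)[of t] DERIV_const] by simp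
  ultimately have "C0_has_deriv p ?r" unfolding C0_has_deriv_def by metis
  moreover have "average p = 0" by (simp add: p_def average_simps)
  ultimately show ?thesis by blast
qed

definition prim :: "C0 \<Rightarrow> C0" where
  "prim q = (SOME p. C0_has_deriv p (q - const_fun (average q)) \<and> average p = 0)"

lemma prim: "C0_has_deriv (prim q) (q - const_fun (average q))" "average (prim q) = 0"
  using someI_ex[OF C0_has_deriv_exists[of q]] unfolding prim_def by auto

lemma prim_deriv: "(C0_fun (prim q) has_real_derivative (C0_fun q t - average q)) (at t)"
  using prim(1)[of q] unfolding C0_has_deriv_def by simp

lemma C0_deriv_0: assumes "C0_has_deriv u 0" shows "u = const_fun (average u)"
proof -
  have "C0_fun u t = C0_fun u 0" for t
    using DERIV_isconst_all[of "C0_fun u" t 0] assms by (simp add: C0_has_deriv_def)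
  then have "u = const_fun (C0_fun u 0)" by (intro C0_eqI) simp
  then show ?thesis by (metis average_const_fun)
qed

lemma C0_deriv_average: assumes "C0_has_deriv u v" shows "average v = 0"
proof -
  obtain H where H: "\<And>t. (H has_real_derivative C0_fun v t) (at t)" "H 1 - H 0 = average v"
    using C0_antideriv[of v] by auto
  have "C0_fun u 1 - H 1 = C0_fun u 0 - H 0"
  proof (rule DERIV_isconst_all[of "\<lambda>t. C0_fun u t - H t"], rule allI)
    fix x show "((\<lambda>t. C0_fun u t - H t) has_real_derivative 0) (at x)"
      using DERIV_diff[OF _ H(1)[of x], of "C0_fun u" "C0_fun v x"] assms by (simp add: C0_has_deriv_def)
  qed
  then show ?thesis using H(2) C0_fun_periodic[of u 0] by simp
qed

lemma C0_deriv_prim: assumes "C0_has_deriv u v" shows "u = prim v + const_fun (average u)"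
proof -
  have "C0_has_deriv (u - prim v) (v - (v - const_fun (average v)))"
    by (intro C0_has_deriv_simps assms prim)
  then have "C0_has_deriv (u - prim v) 0" by (simp add: C0_deriv_average[OF assms] const_fun_0)
  from C0_deriv_0[OF this] show ?thesis by (simp add: average_simps prim algebra_simps)
qed

lemma prim_unique: assumes "C0_has_deriv p (q - const_fun (average q))" "average p = 0" shows "p = prim q"
proof -
  have "p = prim (q - const_fun (average q))" using C0_deriv_prim[OF assms(1)] assms(2) by (simp add: const_fun_0)
  moreover have "prim q = prim (q - const_fun (average q))" using C0_deriv_prim[OF prim(1)[of q]] prim(2)[of q] by (simp add: const_fun_0)
  ultimately show ?thesis by simp
qed

text \<open>\<open>prim q\<close> has average 0 and so vanishes somewhere; its slope is at most
  \<open>2 * norm q\<close>, and one period starting at the zero is enough.\<close>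

lemma norm_prim_le: "norm (prim q) \<le> 2 * norm q"
proof -
  obtain t0 where t0: "C0_fun (prim q) t0 = 0" using average_C0_attained[of "prim q"] prim(2)[of q] by auto
  show ?thesis
  proof (rule norm_C0_le_on[of t0])
    fix t assume t: "t0 \<le> t" "t < t0 + 1"
    have "\<bar>C0_fun (prim q) t - C0_fun (prim q) t0\<bar> \<le> (2 * norm q) * \<bar>t - t0\<bar>"
    proof (rule field_differentiable_bound[of UNIV "C0_fun (prim q)" "\<lambda>t. C0_fun q t - average q", unfolded real_norm_def])
      fix z show "(C0_fun (prim q) has_field_derivative C0_fun q z - average q) (at z within UNIV)" using prim_deriv by simp
      show "\<bar>C0_fun q z - average q\<bar> \<le> 2 * norm q" using abs_C0_fun_le[of q z] abs_average_C0_le[of q] by linarith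
    qed auto
    also have "\<dots> \<le> 2 * norm q" using t by (intro mult_left_le) auto
    finally show "\<bar>C0_fun (prim q) t\<bar> \<le> 2 * norm q" using t0 by simp
  qed
qed

lemma bounded_linear_prim: "bounded_linear prim"
proof (rule bounded_linear_intro[of _ 2])
  fix x y :: C0 and r :: real
  show "prim (x + y) = prim x + prim y"
  proof (rule prim_unique[symmetric])
    have "C0_has_deriv (prim x + prim y) ((x - const_fun (average x)) + (y - const_fun (average y)))"
      by (intro C0_has_deriv_simps prim)
    then show "C0_has_deriv (prim x + prim y) (x + y - const_fun (average (x + y)))"
      by (simp add: average_simps const_fun_add algebra_simps)
  qed (simp add: average_simps prim)
  show "prim (r *\<^sub>R x) = r *\<^sub>R prim x"
  proof (rule prim_unique[symmetric])
    have "C0_has_deriv (r *\<^sub>R prim x) (r *\<^sub>R (x - const_fun (average x)))"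
      by (intro C0_has_deriv_simps prim)
    then show "C0_has_deriv (r *\<^sub>R prim x) (r *\<^sub>R x - const_fun (average (r *\<^sub>R x)))"
      by (simp add: average_simps const_fun_scaleR algebra_simps)
  qed (simp add: average_simps prim)
  show "norm (prim x) \<le> norm x * 2" using norm_prim_le[of x] by simp
qed

subsection \<open>Zeros of periodic functions\<close>

text \<open>Right after \<open>a\<close> the function is positive. At the first later point
  \<open>\<tau>\<close> where it is at most 0, it would vanish while coming down from positive
  values, against the positive slope there.\<close>

lemma pos_after_zero:
  fixes w :: "real \<Rightarrow> real"
  assumes d: "\<And>t. (w has_real_derivative w' t) (at t)" and pos: "\<And>t. w t = 0 \<Longrightarrow> w' t > 0" and a: "w a = 0" "a < b"
  shows "w b > 0"
proof (rule ccontr)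
  assume "\<not> w b > 0"
  obtain d1 where d1: "d1 > 0" "\<And>h. 0 < h \<Longrightarrow> h < d1 \<Longrightarrow> w a < w (a + h)"
    using DERIV_pos_inc_right[OF d pos[OF a(1)]] by blast
  define h where "h = min d1 (b - a) / 2"
  have h: "0 < h" "h < d1" "h < b - a" using d1(1) a by (auto simp: h_def min_def)
  define c where "c = a + h"
  have c: "a < c" "c < b" "w c > 0" using h d1(2)[of h] a by (auto simp: c_def)
  have cw: "continuous_on A w" for A by (rule DERIV_continuous_on) (use d in \<open>auto intro: DERIV_subset\<close>)
  define S where "S = {t \<in> {c..b}. w t \<le> 0}"
  have "S = {c..b} \<inter> {t. w t \<le> 0}" by (auto simp: S_def)
  then have "closed S" by (simp add: closed_Int closed_Collect_le[OF cw continuous_on_const])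
  moreover have "bounded S" unfolding S_def by (rule bounded_subset[of "{c..b}"]) auto
  ultimately have "compact S" by (simp add: compact_eq_bounded_closed)
  moreover have "b \<in> S" using c \<open>\<not> w b > 0\<close> by (simp add: S_def)
  ultimately obtain \<tau> where \<tau>: "\<tau> \<in> S" "\<And>s. s \<in> S \<Longrightarrow> \<tau> \<le> s" using compact_attains_inf[of S] by blast
  have c\<tau>: "c < \<tau>" "\<tau> \<le> b" using \<tau>(1) c by (auto simp: S_def order_le_less)
  have posl: "w s > 0" if "c \<le> s" "s < \<tau>" for s using \<tau>(2)[of s] that c\<tau> by (force simp: S_def)
  have "w \<tau> = 0"
  proof (rule ccontr)
    assume "w \<tau> \<noteq> 0"
    then have "w \<tau> < 0" using \<tau>(1) by (simp add: S_def)
    then obtain s where "c \<le> s" "s \<le> \<tau>" "w s = 0" using IVT2'[of w \<tau> 0 c] c c\<tau> cw by auto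
    then show False using posl[of s] \<open>w \<tau> < 0\<close> by (cases "s = \<tau>") auto
  qed
  from DERIV_pos_inc_left[OF d pos[OF this]] obtain d3 where d3: "d3 > 0" "\<And>h. 0 < h \<Longrightarrow> h < d3 \<Longrightarrow> w (\<tau> - h) < w \<tau>" by blast
  define h' where "h' = min d3 (\<tau> - c) / 2"
  have "0 < h'" "h' < d3" "h' < \<tau> - c" using d3 c\<tau> by (auto simp: h'_def min_def)
  then show False using d3(2)[of h'] posl[of "\<tau> - h'"] \<open>w \<tau> = 0\<close> by auto
qed

text \<open>A zero recurs after one period, where \<open>pos_after_zero\<close> makes the function
  positive. This crossing argument is behind the bound on \<open>\<gamma>\<close> in
  \<open>linear_bound\<close> and behind \<open>K_average\<close>.\<close>

lemma periodic_not_all_upcrossing: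
  fixes w :: "real \<Rightarrow> real"
  assumes d: "\<And>t. (w has_real_derivative w' t) (at t)" and per: "\<And>t. w (t + 1) = w t"
    and z: "w t0 = 0" and pos: "\<And>t. w t = 0 \<Longrightarrow> w' t > 0"
  shows False
  using pos_after_zero[OF d pos z, of "t0 + 1"] per[of t0] z by simp

lemma C0_not_all_upcrossing:
  assumes "C0_has_deriv w w'" "average w = 0" "\<And>t. C0_fun w t = 0 \<Longrightarrow> C0_fun w' t > 0"
  shows False
proof -
  obtain t0 where "C0_fun w t0 = 0" using average_C0_attained[of w] assms(2) by auto
  then show False using assms(1,3)
    by (intro periodic_not_all_upcrossing[of "C0_fun w" "C0_fun w'" t0]) (simp_all add: C0_has_deriv_def C0_fun_periodic)
qed

subsection \<open>The linear equation\<close>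

text \<open>For w = h - r the equation reads w' = \<gamma> - \<alpha> (r + w) with the unknown
  constant \<gamma> = \<integral>\<alpha> h. If |\<gamma>| exceeded \<open>a * norm r\<close>, all
  zeros of w would be crossed in one direction. With \<gamma> bounded, Gronwall from a zero of w
  over one period bounds w. The constant depends on \<alpha> through \<open>a\<close> only, which
  makes it uniform along continuations and on balls.\<close>

lemma linear_bound:
  assumes h: "h + prim (mult_C0 \<alpha> h) = r" and a: "norm \<alpha> \<le> a"
  shows "norm h \<le> (1 + 2 * a * exp (2 * a)) * norm r"
proof -
  have a0: "a \<ge> 0" using a norm_ge_zero order_trans by blast
  define w where "w = - prim (mult_C0 \<alpha> h)"
  define \<gamma> where "\<gamma> = average (mult_C0 \<alpha> h)"
  have hw: "h = r + w" using h by (simp add: w_def algebra_simps)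
  have w': "C0_has_deriv w (const_fun \<gamma> - mult_C0 \<alpha> h)"
    using C0_has_deriv_simps(4)[OF prim(1)[of "mult_C0 \<alpha> h"]] by (simp add: w_def \<gamma>_def)
  have avw: "average w = 0" by (simp add: w_def average_simps prim)
  have \<alpha>r: "\<bar>C0_fun \<alpha> t * C0_fun r t\<bar> \<le> a * norm r" for t
    unfolding abs_mult by (intro mult_mono order.trans[OF abs_C0_fun_le a] abs_C0_fun_le a0) auto
  have \<alpha>r': "C0_fun \<alpha> t * C0_fun r t \<le> a * norm r" "- (a * norm r) \<le> C0_fun \<alpha> t * C0_fun r t" for t
    using \<alpha>r[of t] by (auto simp: abs_le_iff)
  have "\<gamma> \<le> a * norm r"
  proof (rule ccontr)
    assume "\<not> \<gamma> \<le> a * norm r"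
    then have "C0_fun (const_fun \<gamma> - mult_C0 \<alpha> h) t > 0" if "C0_fun w t = 0" for t
      using \<alpha>r'(1)[of t] that by (simp add: hw)
    then show False by (rule C0_not_all_upcrossing[OF w' avw])
  qed
  moreover have "- \<gamma> \<le> a * norm r"
  proof (rule ccontr)
    assume "\<not> - \<gamma> \<le> a * norm r"
    then have "C0_fun (- (const_fun \<gamma> - mult_C0 \<alpha> h)) t > 0" if "C0_fun (- w) t = 0" for t
      using \<alpha>r'(2)[of t] that by (simp add: hw)
    then show False using avw by (intro C0_not_all_upcrossing[OF C0_has_deriv_simps(4)[OF w']]) (simp_all add: average_simps)
  qed
  ultimately have \<gamma>: "\<bar>\<gamma>\<bar> \<le> a * norm r" by simp
  obtain t0 where t0: "C0_fun w t0 = 0" using average_C0_attained[of w] avw by auto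
  \<comment> \<open>The primitive of \<alpha> that vanishes at \<open>t0\<close>; the linear term
    restores the average that \<open>prim\<close> removes. \<open>exp (A t)\<close> is the
    integrating factor, between \<open>exp (- a)\<close> and \<open>exp a\<close> on the period
    after \<open>t0\<close>.\<close>
  define A where "A t = C0_fun (prim \<alpha>) t + average \<alpha> * t - (C0_fun (prim \<alpha>) t0 + average \<alpha> * t0)" for t
  have A': "(A has_real_derivative C0_fun \<alpha> t) (at t)" for t
    unfolding A_def using prim_deriv[of \<alpha> t] by (auto intro!: derivative_eq_intros)
  have Ab: "\<bar>A t\<bar> \<le> a" if t: "t0 \<le> t" "t \<le> t0 + 1" for t
  proof -
    have "\<bar>A t - A t0\<bar> \<le> a * \<bar>t - t0\<bar>"
      by (rule field_differentiable_bound[of UNIV A "C0_fun \<alpha>", unfolded real_norm_def])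
         (use A' order.trans[OF abs_C0_fun_le a] in auto)
    also have "\<dots> \<le> a" using t a0 by (intro mult_left_le) auto
    finally show ?thesis by (simp add: A_def)
  qed
  have "norm w \<le> 2 * a * exp (2 * a) * norm r"
  proof (rule norm_C0_le_on[of t0])
    fix t assume t: "t0 \<le> t" "t < t0 + 1"
    let ?B = "exp a * (2 * a * norm r)"
    have "\<bar>exp (A t) * C0_fun w t - exp (A t0) * C0_fun w t0\<bar> \<le> ?B * \<bar>t - t0\<bar>"
    proof (rule field_differentiable_bound[of "{t0..t0+1}" "\<lambda>t. exp (A t) * C0_fun w t" "\<lambda>t. exp (A t) * (\<gamma> - C0_fun \<alpha> t * C0_fun r t)", unfolded real_norm_def])
      fix z assume z: "z \<in> {t0..t0+1}"
      have "(C0_fun w has_real_derivative \<gamma> - C0_fun \<alpha> z * C0_fun h z) (at z)"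
        using w' by (simp add: C0_has_deriv_def)
      then have "((\<lambda>t. exp (A t) * C0_fun w t) has_real_derivative exp (A z) * (\<gamma> - C0_fun \<alpha> z * C0_fun r z)) (at z)"
        using A'[of z] by (auto intro!: derivative_eq_intros simp: hw algebra_simps)
      then show "((\<lambda>t. exp (A t) * C0_fun w t) has_field_derivative exp (A z) * (\<gamma> - C0_fun \<alpha> z * C0_fun r z)) (at z within {t0..t0+1})"
        by (rule DERIV_subset) simp
      show "\<bar>exp (A z) * (\<gamma> - C0_fun \<alpha> z * C0_fun r z)\<bar> \<le> ?B"
        unfolding abs_mult
        by (intro mult_mono) (use Ab[of z] z \<gamma> \<alpha>r[of z] in auto)
    qed (use t in auto)
    also have "\<dots> \<le> ?B" using t a0 by (intro mult_left_le) auto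
    finally have 1: "exp (A t) * \<bar>C0_fun w t\<bar> \<le> ?B" using t0 by (simp add: abs_mult)
    have "\<bar>C0_fun w t\<bar> = exp (- A t) * (exp (A t) * \<bar>C0_fun w t\<bar>)" by (simp add: exp_minus)
    also have "\<dots> \<le> exp a * ?B"
      by (intro mult_mono 1) (use Ab[of t] t in auto)
    also have "\<dots> = 2 * a * exp (2 * a) * norm r" by (simp add: mult_exp_exp algebra_simps)
    finally show "\<bar>C0_fun w t\<bar> \<le> 2 * a * exp (2 * a) * norm r" .
  qed
  then show ?thesis unfolding hw using norm_triangle_ineq[of r w] by (simp add: algebra_simps)
qed

text \<open>The a priori bound is uniform in \<mu>, so steps of fixed length 1/n lead from \<mu> = 0
  to \<mu> = 1. The solution operator \<open>S\<close> at j/n is Lipschitz with constant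
  \<open>\<bar>C\<bar>\<close>, and n is so large that the perturbation by
  \<open>(1 / n) *\<^sub>R G x\<close> is a contraction.\<close>

lemma continuity_method:
  fixes G :: "'a::banach \<Rightarrow> 'a"
  assumes G: "bounded_linear G" and C: "\<And>\<mu> x. 0 \<le> \<mu> \<Longrightarrow> \<mu> \<le> 1 \<Longrightarrow> norm x \<le> C * norm (x + \<mu> *\<^sub>R G x)"
  shows "\<exists>x. x + G x = q"
proof -
  interpret bounded_linear G by (rule G)
  obtain L where L: "\<And>x. norm (G x) \<le> norm x * L" "L \<ge> 0" using nonneg_bounded by metis
  obtain n :: nat where n: "real n > 2 * \<bar>C\<bar> * L + 1" using reals_Archimedean2 by blast
  have n0: "real n > 0" using n L(2) by (smt (verit) abs_ge_zero mult_nonneg_nonneg)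
  have "\<exists>x. x + (real j / n) *\<^sub>R G x = y" if "j \<le> n" for j y using that
  proof (induction j arbitrary: y)
    case 0 show ?case by simp
  next
    case (Suc j)
    let ?T = "\<lambda>x. x + (real j / n) *\<^sub>R G x"
    have \<mu>: "0 \<le> real j / n" "real j / n \<le> 1" using Suc.prems n0 by auto
    define S where "S y = (SOME x. ?T x = y)" for y
    have S: "?T (S y) = y" for y
      unfolding S_def by (rule someI_ex[OF Suc.IH]) (use Suc.prems in simp)
    have Sl: "norm (S a - S b) \<le> \<bar>C\<bar> * norm (a - b)" for a b
    proof -
      have "a - b = ?T (S a) - ?T (S b)" using S by simp
      also have "\<dots> = (S a - S b) + (real j / n) *\<^sub>R G (S a - S b)" by (simp add: diff algebra_simps)
      finally have "norm (S a - S b) \<le> C * norm (a - b)" using C[OF \<mu>, of "S a - S b"] by simp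
      then show ?thesis by (smt (verit) mult_right_mono norm_ge_zero abs_ge_self)
    qed
    show ?case
    proof -
      have "\<exists>!x\<in>UNIV. S (y - (1 / n) *\<^sub>R G x) = x"
      proof (rule Banach_fix[of UNIV "1/2"])
        fix a b
        have "dist (S (y - (1 / n) *\<^sub>R G a)) (S (y - (1 / n) *\<^sub>R G b)) \<le> \<bar>C\<bar> * norm ((1/n) *\<^sub>R G (b - a))"
          unfolding dist_norm by (rule order.trans[OF Sl]) (simp add: diff algebra_simps)
        also have "\<dots> \<le> \<bar>C\<bar> * ((1/n) * (norm (b - a) * L))"
          using L(1)[of "b - a"] by (intro mult_left_mono) (auto intro!: divide_right_mono)
        also have "\<dots> = (\<bar>C\<bar> * L / n) * dist a b" by (simp add: dist_norm norm_minus_commute)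
        also have "\<bar>C\<bar> * L / n \<le> 1/2" using n n0 by (simp add: divide_le_eq)
        then have "(\<bar>C\<bar> * L / n) * dist a b \<le> 1/2 * dist a b" by (intro mult_right_mono) auto
        finally show "dist (S (y - (1 / n) *\<^sub>R G a)) (S (y - (1 / n) *\<^sub>R G b)) \<le> 1/2 * dist a b" .
      qed (auto simp: complete_UNIV)
      then obtain x where x: "S (y - (1 / n) *\<^sub>R G x) = x" by auto
      have "?T x = y - (1 / n) *\<^sub>R G x" using S[of "y - (1 / n) *\<^sub>R G x"] x by simp
      then have "x + (real (Suc j) / n) *\<^sub>R G x = y" by (simp add: add_divide_distrib algebra_simps)
      then show "\<exists>x. x + (real (Suc j) / n) *\<^sub>R G x = y" by blast
    qed
  qed
  from this[of n q] n0 show ?thesis by simp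
qed

text \<open>The value is carried along the segment from \<open>K 0\<close> to \<open>q\<close>. Its
  points have norm at most \<open>\<rho>\<close>, so all preimages met on the way lie in one ball,
  where \<open>C\<close> and \<open>r\<close> are uniform; hence each step may have length
  \<open>r / (2 * C)\<close>, wherever it starts.\<close>

lemma newton_surjective:
  fixes K :: "'a::banach \<Rightarrow> 'a"
  assumes bound: "\<And>\<rho>. \<exists>R. \<forall>x. norm (K x) \<le> \<rho> \<longrightarrow> norm x \<le> R"
    and unif: "\<And>R. \<exists>C>0. \<exists>r>0. \<forall>x. norm x \<le> R \<longrightarrow> (\<exists>A Li. bounded_linear Li \<and> (\<forall>y. A (Li y) = y) \<and> (\<forall>h. Li (A h) = h) \<and>
       (\<forall>y. norm (Li y) \<le> C * norm y) \<and>
       (\<forall>z1\<in>cball x r. \<forall>z2\<in>cball x r. norm (K z1 - K z2 - A (z1 - z2)) \<le> 1 / (2 * C) * norm (z1 - z2)))"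
  shows "\<exists>x. K x = q"
proof -
  define \<rho> where "\<rho> = norm (K 0) + norm (q - K 0)"
  obtain R where R: "\<And>x. norm (K x) \<le> \<rho> \<Longrightarrow> norm x \<le> R" using bound[of \<rho>] by blast
  obtain C r where C: "C > 0" "r > 0" and U: "\<And>x. norm x \<le> R \<Longrightarrow> \<exists>A Li. bounded_linear Li \<and> (\<forall>y. A (Li y) = y) \<and> (\<forall>h. Li (A h) = h) \<and>
       (\<forall>y. norm (Li y) \<le> C * norm y) \<and>
       (\<forall>z1\<in>cball x r. \<forall>z2\<in>cball x r. norm (K z1 - K z2 - A (z1 - z2)) \<le> 1 / (2 * C) * norm (z1 - z2))"
    using unif[of R] by metis
  have step: "\<exists>x'. K x' = p + \<delta>" if p: "K x = p" "norm p \<le> \<rho>" and \<delta>: "norm \<delta> \<le> r / (2 * C)" for x p \<delta>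
  proof -
    obtain A Li where Li: "bounded_linear Li" "\<And>y. A (Li y) = y" "\<And>h. Li (A h) = h" "\<And>y. norm (Li y) \<le> C * norm y"
      and K: "\<And>z1 z2. z1 \<in> cball x r \<Longrightarrow> z2 \<in> cball x r \<Longrightarrow> norm (K z1 - K z2 - A (z1 - z2)) \<le> 1 / (2 * C) * norm (z1 - z2)"
      using U[OF R[of x]] p by blast
    interpret Li: bounded_linear Li by (rule Li(1))
    \<comment> \<open>Newton iteration with the inverse frozen at \<open>x\<close>. The tolerance
      \<open>1 / (2 * C)\<close> against the bound \<open>C\<close> of \<open>Li\<close> gives
      contraction by 1/2, and \<open>\<delta>\<close> displaces the centre by at most
      \<open>r / 2\<close>, so the ball is mapped into itself.\<close>
    define T where "T z = z - Li (K z - p - \<delta>)" for z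
    have Tc: "norm (T z1 - T z2) \<le> 1/2 * norm (z1 - z2)" if "z1 \<in> cball x r" "z2 \<in> cball x r" for z1 z2
    proof -
      have "T z1 - T z2 = - Li (K z1 - K z2 - A (z1 - z2))"
        unfolding T_def by (simp add: Li.diff Li(3))
      then have "norm (T z1 - T z2) \<le> C * norm (K z1 - K z2 - A (z1 - z2))" using Li(4) by simp
      also have "\<dots> \<le> C * (1 / (2 * C) * norm (z1 - z2))" using K[OF that] C by (intro mult_left_mono) auto
      finally show ?thesis using C by simp
    qed
    have "\<exists>!z\<in>cball x r. T z = z"
    proof (rule Banach_fix[of "cball x r" "1/2"])
      show "T ` cball x r \<subseteq> cball x r"
      proof (rule image_subsetI)
        fix z assume z: "z \<in> cball x r"
        have xx: "x \<in> cball x r" using C by simp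
        have "norm (T z - x) \<le> norm (T z - T x) + norm (T x - x)" by (metis add_diff_eq diff_add_cancel norm_triangle_ineq)
        also have "norm (T z - T x) \<le> 1/2 * norm (z - x)" by (rule Tc[OF z xx])
        also have "norm (T x - x) = norm (Li \<delta>)" by (simp add: T_def p Li.neg)
        also have "\<dots> \<le> C * (r / (2 * C))" by (rule order.trans[OF Li(4)]) (use \<delta> C in \<open>intro mult_left_mono, auto\<close>)
        also have "\<dots> = r / 2" using C by simp
        finally show "T z \<in> cball x r" using z by (simp add: dist_norm norm_minus_commute)
      qed
    qed (use C Tc in \<open>auto simp: dist_norm complete_eq_closed\<close>)
    then obtain z where "T z = z" by auto
    then have "Li (K z - p - \<delta>) = 0" by (simp add: T_def)
    then have "K z - p - \<delta> = A 0" using Li(2)[of "K z - p - \<delta>"] by simp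
    moreover have "A 0 = 0" using Li(2)[of 0] Li.zero by simp
    ultimately show ?thesis by (intro exI[of _ z]) (simp add: algebra_simps)
  qed
  obtain n :: nat where n: "real n > norm (q - K 0) / (r / (2 * C)) + 1" using reals_Archimedean2 by blast
  have rC: "r / (2 * C) > 0" using C by simp
  have n0: "real n > 0" using n rC by (smt (verit) divide_nonneg_pos norm_ge_zero)
  have "norm (q - K 0) / (r / (2 * C)) \<le> n" using n by linarith
  then have "norm (q - K 0) \<le> n * (r / (2 * C))" using rC by (simp only: pos_divide_le_eq)
  then have small: "norm ((1 / n) *\<^sub>R (q - K 0)) \<le> r / (2 * C)" using n0 by (simp add: divide_le_eq mult.commute)
  have "\<exists>x. K x = K 0 + (real j / n) *\<^sub>R (q - K 0)" if "j \<le> n" for j using that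
  proof (induction j)
    case 0 then show ?case by auto
  next
    case (Suc j)
    then obtain x where x: "K x = K 0 + (real j / n) *\<^sub>R (q - K 0)" by auto
    have "norm (K 0 + (real j / n) *\<^sub>R (q - K 0)) \<le> norm (K 0) + (real j / n) * norm (q - K 0)"
      by (rule order.trans[OF norm_triangle_ineq]) simp
    also have "\<dots> \<le> \<rho>" unfolding \<rho>_def using Suc.prems n0 by (intro add_left_mono mult_left_le_one_le) auto
    finally have "\<exists>x'. K x' = (K 0 + (real j / n) *\<^sub>R (q - K 0)) + (1 / n) *\<^sub>R (q - K 0)" by (rule step[OF x _ small])
    then show ?case by (simp add: add_divide_distrib scaleR_add_left algebra_simps)
  qed
  from this[of n] n0 show "\<exists>x. K x = q" by simp
qed

text \<open>Scaling \<alpha> by \<mu> in [0, 1] does not increase its norm, so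
  \<open>linear_bound\<close> is uniform along the continuation.\<close>

lemma linear_solvable: "\<exists>h. h + prim (mult_C0 \<alpha> h) = r"
proof (rule continuity_method[where C = "1 + 2 * norm \<alpha> * exp (2 * norm \<alpha>)"])
  interpret m: bounded_bilinear mult_C0 by (rule bounded_bilinear_mult_C0)
  interpret p: bounded_linear prim by (rule bounded_linear_prim)
  show "bounded_linear (\<lambda>h. prim (mult_C0 \<alpha> h))"
    by (rule bounded_linear_compose[OF bounded_linear_prim m.bounded_linear_right])
  fix \<mu> :: real and x :: C0 assume \<mu>: "0 \<le> \<mu>" "\<mu> \<le> 1"
  have "x + prim (mult_C0 (\<mu> *\<^sub>R \<alpha>) x) = x + \<mu> *\<^sub>R prim (mult_C0 \<alpha> x)" by (simp add: m.scaleR_left p.scaleR)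
  moreover have "norm (\<mu> *\<^sub>R \<alpha>) \<le> norm \<alpha>" using \<mu> by (simp add: mult_left_le_one_le)
  ultimately show "norm x \<le> (1 + 2 * norm \<alpha> * exp (2 * norm \<alpha>)) * norm (x + \<mu> *\<^sub>R prim (mult_C0 \<alpha> x))"
    by (rule linear_bound)
qed

section \<open>The Nemytskii operators\<close>

text \<open>\<open>fx k\<close> is the \<open>k\<close>-th derivative of \<open>fx 0\<close> in the second variable.\<close>

locale circle_family =
  fixes fx :: "nat \<Rightarrow> real \<Rightarrow> real \<Rightarrow> real"
  assumes cont: "\<And>k. continuous_on UNIV (\<lambda>(t, x). fx k t x)"
    and per: "\<And>k t x. fx k (t + 1) x = fx k t x"
    and deriv: "\<And>k t x. (fx k t has_real_derivative fx (Suc k) t x) (at x)"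
begin

definition nem :: "nat \<Rightarrow> C0 \<Rightarrow> C0" where "nem k = nemytskii (fx k)"

lemma nem_apply [simp]: "C0_fun (nem k u) t = fx k t (C0_fun u t)"
  unfolding nem_def by (rule nemytskii_apply[OF cont per])

lemma cont_compose:
  assumes "continuous_on S a" "continuous_on S b" shows "continuous_on S (\<lambda>s. fx k (a s) (b s))"
proof -
  have "continuous_on S (\<lambda>s. (\<lambda>(t, x). fx k t x) (a s, b s))"
    by (rule continuous_on_compose2[OF cont]) (auto intro!: continuous_on_Pair assms)
  then show ?thesis by simp
qed

lemma fx_bound: "\<exists>B\<ge>0. \<forall>t z. \<bar>z\<bar> \<le> \<rho> \<longrightarrow> \<bar>fx k t z\<bar> \<le> B"
proof -
  have "compact ((\<lambda>(t, x). fx k t x) ` ({0..1} \<times> {-\<rho>..\<rho>}))"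
    by (intro compact_continuous_image continuous_on_subset[OF cont] compact_Times) auto
  then obtain B where B: "\<And>y. y \<in> (\<lambda>(t, x). fx k t x) ` ({0..1} \<times> {-\<rho>..\<rho>}) \<Longrightarrow> norm y \<le> B"
    using compact_imp_bounded bounded_iff by metis
  have "\<bar>fx k t z\<bar> \<le> max 0 B" if z: "\<bar>z\<bar> \<le> \<rho>" for t z
  proof -
    have "fx k t z = fx k (frac t) z"
      using periodic_int[of "\<lambda>t. fx k t z" t "- \<lfloor>t\<rfloor>"] per by (simp add: frac_def)
    moreover have "norm (fx k (frac t) z) \<le> B"
      by (rule B) (use z in \<open>force simp: frac_ge_0 less_imp_le[OF frac_lt_1]\<close>)
    ultimately show ?thesis by simp
  qed
  then show ?thesis by (intro exI[of _ "max 0 B"]) auto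
qed

lemma fx_lipschitz:
  assumes B: "\<And>z. \<bar>z\<bar> \<le> \<rho> \<Longrightarrow> \<bar>fx (Suc k) t z\<bar> \<le> B" and z: "\<bar>z\<bar> \<le> \<rho>" "\<bar>z'\<bar> \<le> \<rho>"
  shows "\<bar>fx k t z - fx k t z'\<bar> \<le> B * \<bar>z - z'\<bar>"
proof (rule field_differentiable_bound[of "{-\<rho>..\<rho>}" "fx k t" "fx (Suc k) t", unfolded real_norm_def])
  fix x assume "x \<in> {-\<rho>..\<rho>}"
  then show "\<bar>fx (Suc k) t x\<bar> \<le> B" by (intro B) auto
  show "(fx k t has_field_derivative fx (Suc k) t x) (at x within {-\<rho>..\<rho>})" using deriv by (rule DERIV_subset) simp
qed (use z in auto)

lemma nem_bound: "\<exists>B\<ge>0. \<forall>x. norm x \<le> \<rho> \<longrightarrow> norm (nem k x) \<le> B"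
proof -
  obtain B where "B \<ge> 0" and B: "\<And>t z. \<bar>z\<bar> \<le> \<rho> \<Longrightarrow> \<bar>fx k t z\<bar> \<le> B" using fx_bound[of \<rho> k] by blast
  moreover have "norm (nem k x) \<le> B" if "norm x \<le> \<rho>" for x
    using that by (intro norm_C0_le) (auto intro!: B order.trans[OF abs_C0_fun_le])
  ultimately show ?thesis by blast
qed

text \<open>A Taylor estimate at each \<open>t\<close>, with one constant for all \<open>t\<close>
  because the arguments stay in a bounded range.\<close>

lemma nem_hvd: "((\<lambda>\<tau>. nem k (x + \<tau> *\<^sub>R h)) has_vector_derivative mult_C0 (nem (Suc k) x) h) (at 0)"
  unfolding hvd0_iff
proof (intro allI impI)
  fix e :: real assume e: "e > 0"
  obtain B where B0: "B \<ge> 0" and B: "\<And>t z. \<bar>z\<bar> \<le> norm x + norm h \<Longrightarrow> \<bar>fx (Suc (Suc k)) t z\<bar> \<le> B"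
    using fx_bound[of "norm x + norm h" "Suc (Suc k)"] by blast
  define M where "M = B * (norm h * norm h)"
  have M: "M \<ge> 0" using B0 by (simp add: M_def)
  have main: "norm (nem k (x + \<tau> *\<^sub>R h) - nem k (x + 0 *\<^sub>R h) - \<tau> *\<^sub>R mult_C0 (nem (Suc k) x) h) \<le> M * (\<tau> * \<tau>)"
    if \<tau>: "\<bar>\<tau>\<bar> < 1" for \<tau>
  proof (rule norm_C0_le)
    fix t
    let ?z = "C0_fun x t" and ?d = "\<tau> * C0_fun h t"
    have "norm (fx k t (?z + 1 * ?d) - fx k t (?z + 0 * ?d) - fx (Suc k) t (?z + 0 * ?d) * ?d) \<le> M * (\<tau> * \<tau>)"
    proof (rule taylor1_bound[of "\<lambda>s. fx k t (?z + s * ?d)" "\<lambda>s. fx (Suc k) t (?z + s * ?d) * ?d" "\<lambda>s. fx (Suc (Suc k)) t (?z + s * ?d) * ?d * ?d"])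
      fix s :: real assume s: "s \<in> {0..1}"
      have lin: "((\<lambda>s. ?z + s * ?d) has_real_derivative ?d) (at s)" by (auto intro!: derivative_eq_intros)
      show "((\<lambda>s. fx k t (?z + s * ?d)) has_vector_derivative fx (Suc k) t (?z + s * ?d) * ?d) (at s)"
        unfolding has_vector_derivative_real_iff by (rule DERIV_chain2[OF deriv lin])
      show "((\<lambda>s. fx (Suc k) t (?z + s * ?d) * ?d) has_vector_derivative fx (Suc (Suc k)) t (?z + s * ?d) * ?d * ?d) (at s)"
        unfolding has_vector_derivative_real_iff by (rule DERIV_cmult_right[OF DERIV_chain2[OF deriv lin]])
      have "\<bar>s * ?d\<bar> \<le> 1 * (1 * norm h)" unfolding abs_mult
        using s \<tau> by (intro mult_mono abs_C0_fun_le) auto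
      then have "\<bar>?z + s * ?d\<bar> \<le> norm x + norm h" using abs_C0_fun_le[of x t] by linarith
      from B[OF this] have "\<bar>fx (Suc (Suc k)) t (?z + s * ?d)\<bar> \<le> B" .
      moreover have "\<bar>?d\<bar> \<le> \<bar>\<tau>\<bar> * norm h" unfolding abs_mult by (intro mult_left_mono abs_C0_fun_le) auto
      ultimately have "\<bar>fx (Suc (Suc k)) t (?z + s * ?d)\<bar> * \<bar>?d\<bar> * \<bar>?d\<bar> \<le> B * (\<bar>\<tau>\<bar> * norm h) * (\<bar>\<tau>\<bar> * norm h)"
        using B0 by (intro mult_mono mult_nonneg_nonneg) auto
      also have "\<dots> = B * (norm h * norm h) * (\<bar>\<tau>\<bar> * \<bar>\<tau>\<bar>)" by (simp only: mult_ac)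
      also have "\<dots> = M * (\<tau> * \<tau>)" by (simp only: M_def abs_mult_self_eq)
      finally show "norm (fx (Suc (Suc k)) t (?z + s * ?d) * ?d * ?d) \<le> M * (\<tau> * \<tau>)" unfolding real_norm_def abs_mult .
    qed
    then show "\<bar>C0_fun (nem k (x + \<tau> *\<^sub>R h) - nem k (x + 0 *\<^sub>R h) - \<tau> *\<^sub>R mult_C0 (nem (Suc k) x) h) t\<bar> \<le> M * (\<tau> * \<tau>)"
      by (simp add: mult_ac)
  qed
  show "\<exists>d>0. \<forall>\<tau>. \<bar>\<tau>\<bar> < d \<longrightarrow> norm (nem k (x + \<tau> *\<^sub>R h) - nem k (x + 0 *\<^sub>R h) - \<tau> *\<^sub>R mult_C0 (nem (Suc k) x) h) \<le> e * \<bar>\<tau>\<bar>"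
  proof (intro exI[of _ "min 1 (e / (M + 1))"] conjI allI impI)
    show "min 1 (e / (M + 1)) > 0" using e M by simp
    fix \<tau> assume \<tau>: "\<bar>\<tau>\<bar> < min 1 (e / (M + 1))"
    then have "\<bar>\<tau>\<bar> * (M + 1) \<le> e" using M by (simp add: pos_less_divide_eq)
    then have "M * \<bar>\<tau>\<bar> \<le> e" by (simp add: algebra_simps)
    then have "M * \<bar>\<tau>\<bar> * \<bar>\<tau>\<bar> \<le> e * \<bar>\<tau>\<bar>" by (intro mult_right_mono) auto
    then show "norm (nem k (x + \<tau> *\<^sub>R h) - nem k (x + 0 *\<^sub>R h) - \<tau> *\<^sub>R mult_C0 (nem (Suc k) x) h) \<le> e * \<bar>\<tau>\<bar>"
      using main[of \<tau>] \<tau> by (simp add: mult.assoc)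
  qed
qed

text \<open>The factor \<open>c\<close> absorbs directions: a derivative along \<open>h\<close>
  replaces \<open>k\<close> by \<open>Suc k\<close> and \<open>c\<close> by
  \<open>mult_C0 h c\<close>, and unit \<open>h\<close> preserves the bound
  \<open>C\<close>.\<close>

lemma nem_usm: "usm UNIV n {\<lambda>x. mult_C0 (nem k x) c | c. norm c \<le> C}"
proof (induction n arbitrary: k)
  have lb: "loc_bdd UNIV {\<lambda>x. mult_C0 (nem k x) c | c. norm c \<le> C}" for k
    unfolding loc_bdd_def
  proof
    fix x :: C0
    obtain B where "B \<ge> 0" and B: "\<And>y. norm y \<le> norm x + 1 \<Longrightarrow> norm (nem k y) \<le> B" using nem_bound by blast
    have "norm (mult_C0 (nem k y) c) \<le> B * C" if "norm (y - x) < 1" "norm c \<le> C" for y c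
      by (rule order.trans[OF norm_mult_C0_le], intro mult_mono B that norm_ge_zero \<open>B \<ge> 0\<close>)
         (use that(1) norm_triangle_sub[of y x] in linarith)
    then show "\<exists>\<delta>>0. \<exists>C'. \<forall>y\<in>UNIV. norm (y - x) < \<delta> \<longrightarrow> (\<forall>G\<in>{\<lambda>x. mult_C0 (nem k x) c | c. norm c \<le> C}. norm (G y) \<le> C')"
      by (intro exI[of _ 1] conjI exI[of _ "B * C"]) auto
  qed
  { case 0 then show ?case unfolding usm.simps by (rule lb) }
  { case (Suc n)
    show ?case
    proof (rule usm_SucI[OF lb Suc.IH[of "Suc k"]])
      fix G :: "C0 \<Rightarrow> C0" and h :: C0 assume G: "G \<in> {\<lambda>x. mult_C0 (nem k x) c | c. norm c \<le> C}" and h: "norm h \<le> 1"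
      from G[unfolded mem_Collect_eq] obtain c where c: "G = (\<lambda>x. mult_C0 (nem k x) c)" "norm c \<le> C" by (elim exE conjE) (rule that)
      have "dir_deriv UNIV G h (\<lambda>x. mult_C0 (nem (Suc k) x) (mult_C0 h c))"
        unfolding dir_deriv_def c
      proof
        fix x
        have "((\<lambda>t. mult_C0 (nem k (x + t *\<^sub>R h)) c) has_vector_derivative mult_C0 (mult_C0 (nem (Suc k) x) h) c) (at 0)"
          by (rule bounded_linear.has_vector_derivative[OF bounded_bilinear.bounded_linear_left[OF bounded_bilinear_mult_C0] nem_hvd])
        moreover have "mult_C0 (mult_C0 (nem (Suc k) x) h) c = mult_C0 (nem (Suc k) x) (mult_C0 h c)"
          by (rule C0_eqI) simp
        ultimately show "((\<lambda>t. mult_C0 (nem k (x + t *\<^sub>R h)) c) has_vector_derivative mult_C0 (nem (Suc k) x) (mult_C0 h c)) (at 0)" by simp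
      qed
      moreover have "norm (mult_C0 h c) \<le> C"
        by (rule order.trans[OF norm_mult_C0_le]) (use h c mult_mono[of "norm h" 1 "norm c" C] in auto)
      ultimately show "\<exists>G'\<in>{\<lambda>x. mult_C0 (nem (Suc k) x) c | c. norm c \<le> C}. dir_deriv UNIV G h G'"
        by (intro bexI[of _ "\<lambda>x. mult_C0 (nem (Suc k) x) (mult_C0 h c)"] CollectI exI[of _ "mult_C0 h c"] conjI refl)
    qed }
qed

lemma smooth_on_nem: "smooth_on UNIV (nem k)"
proof (rule smooth_onI_usm)
  fix n
  have "nem k = (\<lambda>x. mult_C0 (nem k x) (const_fun 1))" by (intro ext C0_eqI) simp
  then show "usm UNIV n {nem k}"
    by (intro usm_subset[OF nem_usm[of n k 1]]) (auto intro!: exI[of _ "const_fun 1"])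
qed simp

text \<open>A divided difference written as a mean over the segment, hence continuous in
  \<open>t\<close> even where \<open>x\<close> and \<open>y\<close> coincide. It turns differences
  of \<open>K\<close> into exact solutions of a linear equation covered by
  \<open>linear_bound\<close>.\<close>

definition quot :: "C0 \<Rightarrow> C0 \<Rightarrow> C0" where
  "quot x y = C0_of (\<lambda>t. integral {0..1} (\<lambda>\<theta>. fx (Suc 0) t (C0_fun y t + \<theta> * (C0_fun x t - C0_fun y t))))"

lemma quot_apply: "C0_fun (quot x y) t = integral {0..1} (\<lambda>\<theta>. fx (Suc 0) t (C0_fun y t + \<theta> * (C0_fun x t - C0_fun y t)))"
proof -
  have "continuous_on UNIV (\<lambda>t. integral (cbox 0 1) (\<lambda>\<theta>. fx (Suc 0) t (C0_fun y t + \<theta> * (C0_fun x t - C0_fun y t))))"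
    by (rule integral_continuous_on_param)
       (auto simp: split_beta intro!: cont_compose continuous_intros continuous_on_compose2[OF continuous_C0_fun])
  then show ?thesis unfolding quot_def
    by (subst C0_fun_C0_of) (auto simp: per C0_fun_periodic)
qed

lemma quot_integrable: "(\<lambda>\<theta>. fx (Suc 0) t (b + \<theta> * d)) integrable_on {0..1}"
  by (rule integrable_continuous_real) (intro cont_compose continuous_intros)

lemma nem_diff: "nem 0 x - nem 0 y = mult_C0 (quot x y) (x - y)"
proof (rule C0_eqI)
  fix t
  let ?y = "C0_fun y t" and ?d = "C0_fun x t - C0_fun y t"
  have "((\<lambda>\<theta>. fx (Suc 0) t (?y + \<theta> * ?d) * ?d) has_integral fx 0 t (?y + 1 * ?d) - fx 0 t (?y + 0 * ?d)) {0..1}"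
  proof (rule fundamental_theorem_of_calculus)
    fix \<theta> :: real
    have lin: "((\<lambda>s. ?y + s * ?d) has_real_derivative ?d) (at \<theta>)" by (auto intro!: derivative_eq_intros)
    have "((\<lambda>\<theta>. fx 0 t (?y + \<theta> * ?d)) has_real_derivative fx (Suc 0) t (?y + \<theta> * ?d) * ?d) (at \<theta>)"
      using DERIV_chain2[OF deriv lin, of 0 t] by simp
    then show "((\<lambda>\<theta>. fx 0 t (?y + \<theta> * ?d)) has_vector_derivative fx (Suc 0) t (?y + \<theta> * ?d) * ?d) (at \<theta> within {0..1})"
      unfolding has_vector_derivative_real_iff by (rule DERIV_subset) simp
  qed simp
  then have "integral {0..1} (\<lambda>\<theta>. fx (Suc 0) t (?y + \<theta> * ?d) * ?d) = fx 0 t (C0_fun x t) - fx 0 t ?y"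
    by (subst integral_unique) simp_all
  then show "C0_fun (nem 0 x - nem 0 y) t = C0_fun (mult_C0 (quot x y) (x - y)) t"
    by (simp add: quot_apply)
qed

lemma quot_close:
  assumes "\<And>\<theta>. 0 \<le> \<theta> \<Longrightarrow> \<theta> \<le> 1 \<Longrightarrow> \<bar>fx (Suc 0) t (C0_fun y t + \<theta> * (C0_fun x t - C0_fun y t)) - c\<bar> \<le> \<eta>"
  shows "\<bar>C0_fun (quot x y) t - c\<bar> \<le> \<eta>"
proof -
  have "\<eta> \<ge> 0" using assms[of 0] by simp
  have "C0_fun (quot x y) t - c = integral {0..1} (\<lambda>\<theta>. fx (Suc 0) t (C0_fun y t + \<theta> * (C0_fun x t - C0_fun y t)) - c)"
    unfolding quot_apply by (subst integral_diff[OF quot_integrable]) auto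
  also have "norm \<dots> \<le> integral {0..1} (\<lambda>\<theta>::real. \<eta>)"
    by (rule integral_norm_bound_integral) (use assms in \<open>auto intro!: integrable_diff quot_integrable\<close>)
  finally show ?thesis by simp
qed

lemma segment_bound: "\<bar>a\<bar> \<le> \<rho> \<Longrightarrow> \<bar>b\<bar> \<le> \<rho> \<Longrightarrow> 0 \<le> \<theta> \<Longrightarrow> \<theta> \<le> 1 \<Longrightarrow> \<bar>b + \<theta> * (a - b)\<bar> \<le> (\<rho>::real)"
proof -
  assume a: "\<bar>a\<bar> \<le> \<rho>" "\<bar>b\<bar> \<le> \<rho>" "0 \<le> \<theta>" "\<theta> \<le> 1"
  have "\<bar>b + \<theta> * (a - b)\<bar> = \<bar>(1 - \<theta>) * b + \<theta> * a\<bar>" by (simp add: algebra_simps)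
  also have "\<dots> \<le> (1 - \<theta>) * \<bar>b\<bar> + \<theta> * \<bar>a\<bar>" using a by (intro order.trans[OF abs_triangle_ineq]) (simp add: abs_mult)
  also have "\<dots> \<le> (1 - \<theta>) * \<rho> + \<theta> * \<rho>" using a by (intro add_mono mult_left_mono) auto
  finally show ?thesis by (simp add: algebra_simps)
qed

section \<open>The diffeomorphism \<open>K\<close> of C0\<close>

definition K :: "C0 \<Rightarrow> C0" where "K x = x + prim (nem 0 x)"

lemma smooth_on_K: "smooth_on UNIV K"
  unfolding K_def
  by (intro smooth_on_add smooth_on_linear_compose[OF bounded_linear_prim] smooth_on_nem
      smooth_on_linear[OF bounded_linear_ident]) auto

lemma K_diff: "K x - K y = (x - y) + prim (mult_C0 (quot x y) (x - y))"
  using bounded_linear.linear[OF bounded_linear_prim] by (simp add: K_def nem_diff[symmetric] linear_diff)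

text \<open>This is \<open>linear_bound\<close> for the coefficient \<open>quot x y\<close>, which
  is bounded on balls. It gives injectivity now and continuity of the inverse later.\<close>

lemma K_lipschitz_below:
  "\<exists>C\<ge>0. \<forall>x y. norm x \<le> \<rho> \<longrightarrow> norm y \<le> \<rho> \<longrightarrow> norm (x - y) \<le> C * norm (K x - K y)"
proof -
  obtain a where a: "a \<ge> 0" "\<And>t z. \<bar>z\<bar> \<le> \<rho> \<Longrightarrow> \<bar>fx (Suc 0) t z\<bar> \<le> a" using fx_bound[of \<rho> "Suc 0"] by blast
  have "norm (x - y) \<le> (1 + 2 * a * exp (2 * a)) * norm (K x - K y)" if xy: "norm x \<le> \<rho>" "norm y \<le> \<rho>" for x y
  proof (rule linear_bound[OF K_diff[symmetric]], rule norm_C0_le)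
    fix t
    have "\<bar>C0_fun (quot x y) t - 0\<bar> \<le> a"
      by (rule quot_close) (use xy in \<open>auto intro!: a segment_bound order.trans[OF abs_C0_fun_le]\<close>)
    then show "\<bar>C0_fun (quot x y) t\<bar> \<le> a" by simp
  qed
  then show ?thesis using a(1) by (intro exI[of _ "1 + 2 * a * exp (2 * a)"]) auto
qed

lemma inj_K: "inj K"
proof (rule injI)
  fix x y assume eq: "K x = K y"
  obtain C where "\<And>x' y'. norm x' \<le> max (norm x) (norm y) \<Longrightarrow> norm y' \<le> max (norm x) (norm y) \<Longrightarrow> norm (x' - y') \<le> C * norm (K x' - K y')"
    using K_lipschitz_below by blast
  from this[of x y] eq show "x = y" by simp
qed

definition DK :: "C0 \<Rightarrow> C0 \<Rightarrow> C0" where "DK x h = h + prim (mult_C0 (nem (Suc 0) x) h)"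
definition DKinv :: "C0 \<Rightarrow> C0 \<Rightarrow> C0" where "DKinv x r = (SOME h. DK x h = r)"

lemma DK_DKinv: "DK x (DKinv x r) = r"
  unfolding DKinv_def by (rule someI_ex) (simp add: DK_def linear_solvable)

lemma DK_linear: "linear (DK x)"
proof -
  have "bounded_linear (\<lambda>h. h + prim (mult_C0 (nem (Suc 0) x) h))"
    by (intro bounded_linear_add bounded_linear_ident bounded_linear_compose[OF bounded_linear_prim]
        bounded_bilinear.bounded_linear_right[OF bounded_bilinear_mult_C0])
  then show ?thesis by (simp add: DK_def[abs_def] bounded_linear.linear)
qed

lemma DK_bound: "norm (nem (Suc 0) x) \<le> a \<Longrightarrow> norm h \<le> (1 + 2 * a * exp (2 * a)) * norm (DK x h)"
  by (rule linear_bound[of _ "nem (Suc 0) x"]) (simp_all add: DK_def)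

lemma DK_eq_0: "DK x h = 0 \<Longrightarrow> h = 0"
  using DK_bound[of x "norm (nem (Suc 0) x)" h] by simp

lemma DKinv_DK: "DKinv x (DK x h) = h"
  using DK_eq_0[of x "DKinv x (DK x h) - h"] by (simp add: linear_diff[OF DK_linear] DK_DKinv)

lemma DKinv_bound: "norm (nem (Suc 0) x) \<le> a \<Longrightarrow> norm (DKinv x r) \<le> (1 + 2 * a * exp (2 * a)) * norm r"
  using DK_bound[of x a "DKinv x r"] by (simp add: DK_DKinv)

lemma DKinv_linear: "bounded_linear (DKinv x)"
proof (rule bounded_linear_intro)
  show "DKinv x (a + b) = DKinv x a + DKinv x b" for a b
    using DKinv_DK[of x "DKinv x a + DKinv x b"] by (simp add: linear_add[OF DK_linear] DK_DKinv)
  show "DKinv x (c *\<^sub>R a) = c *\<^sub>R DKinv x a" for c a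
    using DKinv_DK[of x "c *\<^sub>R DKinv x a"] by (simp add: linear_scale[OF DK_linear] DK_DKinv)
  show "norm (DKinv x r) \<le> norm r * (1 + 2 * norm (nem (Suc 0) x) * exp (2 * norm (nem (Suc 0) x)))" for r
    using DKinv_bound[of x "norm (nem (Suc 0) x)" r] by (simp add: mult.commute)
qed

text \<open>At a zero of w = x - K x the derivative of w is the average minus f(t, x t), and since
  \<open>x\<close> and \<open>K x\<close> agree there, it equals \<open>g t\<close>. If
  \<open>g\<close> had no zero it would have one sign, and all zeros of w would be crossed in the
  same direction. The gain is that the average of f(., x) can be read off from \<open>K x\<close>
  alone.\<close>

lemma K_average: "\<exists>t\<in>{0..1}. average (nem 0 x) = fx 0 t (C0_fun (K x) t)"
proof (rule ccontr)
  assume "\<not> ?thesis"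
  then have ne: "average (nem 0 x) \<noteq> fx 0 t (C0_fun (K x) t)" if "t \<in> {0..1}" for t using that by blast
  define g where "g t = average (nem 0 x) - fx 0 t (C0_fun (K x) t)" for t
  have g_per: "g (t + 1) = g t" for t by (simp add: g_def per C0_fun_periodic)
  have ne': "g t \<noteq> 0" for t
  proof -
    have "g t = g (frac t)" using periodic_int[of g t "- \<lfloor>t\<rfloor>"] g_per by (simp add: frac_def)
    then show ?thesis using ne[of "frac t"] by (simp add: g_def frac_ge_0 less_imp_le[OF frac_lt_1])
  qed
  have cg: "continuous_on UNIV g" unfolding g_def
    by (intro continuous_intros cont_compose continuous_C0_fun)
  have conn: "connected (range g)" by (rule connected_continuous_image[OF cg]) simp
  have sgn: "(\<forall>t. g t > 0) \<or> (\<forall>t. g t < 0)"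
  proof (rule ccontr)
    assume "\<not> ?thesis"
    then obtain s t where "g s \<le> 0" "g t \<ge> 0" by (auto simp: not_less)
    then have "0 \<in> range g" using connectedD_interval[OF conn, of "g s" "g t" 0] by auto
    then show False using ne' by auto
  qed
  define w where "w = - prim (nem 0 x)"
  have w': "C0_has_deriv w (- (nem 0 x - const_fun (average (nem 0 x))))"
    unfolding w_def by (intro C0_has_deriv_simps prim)
  have w2: "C0_has_deriv (- w) (nem 0 x - const_fun (average (nem 0 x)))"
    unfolding w_def using prim by simp
  have avw: "average w = 0" "average (- w) = 0" by (simp_all add: w_def average_simps prim)
  have eq: "C0_fun (K x) t = C0_fun x t" if "C0_fun w t = 0" for t using that by (simp add: K_def w_def)
  from sgn show False
  proof
    assume *: "\<forall>t. g t > 0"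
    have "C0_fun (- (nem 0 x - const_fun (average (nem 0 x)))) t > 0" if "C0_fun w t = 0" for t
      using *[rule_format, of t] eq[OF that] by (simp add: g_def)
    then show False by (rule C0_not_all_upcrossing[OF w' avw(1)])
  next
    assume *: "\<forall>t. g t < 0"
    have "C0_fun (nem 0 x - const_fun (average (nem 0 x))) t > 0" if "C0_fun (- w) t = 0" for t
      using *[rule_format, of t] eq[of t] that by (simp add: g_def)
    then show False by (rule C0_not_all_upcrossing[OF w2 avw(2)])
  qed
qed

end

lemma C0_attains_max:
  assumes "C0_has_deriv w w'"
  obtains t where "\<And>s. C0_fun w s \<le> C0_fun w t" "C0_fun w' t = 0"
proof -
  obtain t where t: "t \<in> {0..1}" "\<And>s. s \<in> {0..1} \<Longrightarrow> C0_fun w s \<le> C0_fun w t"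
    using continuous_attains_sup[OF _ _ continuous_C0_fun[of "{0..1}" w]] by auto
  have max: "C0_fun w s \<le> C0_fun w t" for s
  proof -
    obtain s' where "0 \<le> s'" "s' < 0 + 1" "C0_fun w s' = C0_fun w s" by (rule C0_fun_shift)
    then show ?thesis using t(2)[of s'] by simp
  qed
  have "C0_fun w' t = 0"
    by (rule DERIV_local_max[of "C0_fun w" _ t 1]) (use assms max in \<open>auto simp: C0_has_deriv_def\<close>)
  with max show thesis by (rule that)
qed

lemma smooth_on_has_derivative:
  assumes "smooth_on UNIV g"
  obtains g' where "(g has_derivative g') (at x)"
proof -
  obtain E where E: "tower UNIV E" "\<And>x. E x [] = g x" using smooth_onE_tower[OF assms] by auto
  have ml: "bounded_multilinear_on UNIV 1 (E x)" using E by (auto simp: tower_def)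
  have V: "subspace (UNIV :: 'a set)" by simp
  note sl = bounded_multilinear_on_slots[OF ml V, of "[]" "[]", simplified]
  obtain C where C: "\<And>hs. length hs = 1 \<Longrightarrow> norm (E x hs) \<le> C * prod_list (map norm hs)"
    using bounded_multilinear_on_bound[OF ml] by (metis top_greatest)
  have bl: "bounded_linear (\<lambda>h. E x [h])"
    by (rule bounded_linear_intro[of _ C]) (use sl C[of "[_]"] in \<open>auto simp: mult.commute\<close>)
  have "(g has_derivative (\<lambda>h. E x [h])) (at x)"
    unfolding has_derivative_at_alt
  proof (intro conjI allI impI bl)
    fix e :: real assume "e > 0"
    from towerD[OF E(1) UNIV_I this, where k = 0 and x = x] obtain d where d: "d > 0"
      "\<And>h hs. h \<in> UNIV \<Longrightarrow> norm h < d \<Longrightarrow> length hs = 0 \<Longrightarrow> set hs \<subseteq> UNIV \<Longrightarrow>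
              norm (E (x + h) hs - E x hs - E x (h # hs)) \<le> e * norm h * prod_list (map norm hs)" by blast
    show "\<exists>d>0. \<forall>y. norm (y - x) < d \<longrightarrow> norm (g y - g x - E x [y - x]) \<le> e * norm (y - x)"
      using d(1) d(2)[of "_ - x" "[]"] by (intro exI[of _ d]) (auto simp: E)
  qed
  then show thesis by (rule that)
qed

lemma has_derivative_line:
  assumes "(g has_derivative g') (at x)"
  shows "((\<lambda>t. g (x + t *\<^sub>R h)) has_vector_derivative g' h) (at 0)"
proof -
  have l: "((\<lambda>t. x + t *\<^sub>R h) has_derivative (\<lambda>t. t *\<^sub>R h)) (at 0)" by (auto intro!: derivative_eq_intros)
  have "((\<lambda>t. g (x + t *\<^sub>R h)) has_derivative (\<lambda>t. g' (t *\<^sub>R h))) (at 0)"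
    by (rule has_derivative_compose[OF l]) (use assms in simp)
  then show ?thesis using has_derivative_linear[OF assms] by (simp add: has_vector_derivative_def linear_scale)
qed

text \<open>\<open>usm_iter_dd\<close> handles unit directions; a general \<open>h\<close> is
  reached from \<open>sgn h\<close> by scaling.\<close>

lemma smooth_on_dir_deriv:
  assumes "subspace V" "smooth_on V g" "h \<in> V"
  obtains g' where "dir_deriv V g h g'" "smooth_on V g'"
proof -
  obtain E where E: "tower V E" "\<And>x. x \<in> V \<Longrightarrow> E x [] = g x" using smooth_onE_tower[OF assms(2)] by blast
  have g: "usm V k {g}" for k by (rule smooth_on_usm[OF assms(1,2)])
  have d: "dir_deriv V g h (iter_dd g [h])"
    using usm_iter_dd_dir[OF assms(1) g, of "[]" h] assms(3) by simp
  have "usm V k {iter_dd g [sgn h]}" for k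
  proof -
    obtain B where B: "usm V k B" "\<And>hs. length hs = 1 \<Longrightarrow> set hs \<subseteq> V \<Longrightarrow> (\<forall>h\<in>set hs. norm h \<le> 1) \<Longrightarrow>
           (\<exists>G\<in>B. \<forall>x\<in>V. iter_dd g hs x = G x)" using usm_iter_dd[OF assms(1) g, where k = k and n = 1] by blast
    obtain G where "G \<in> B" "\<forall>x\<in>V. iter_dd g [sgn h] x = G x"
      using B(2)[of "[sgn h]"] sgn_in_subspace[OF assms(1,3)] norm_sgn_le_1[of h] by auto
    then show ?thesis using usm_cong_single[OF assms(1) usm_subset[OF B(1), of "{G}"], of "iter_dd g [sgn h]"] by auto
  qed
  then have "smooth_on V (iter_dd g [sgn h])" by (rule smooth_onI_usm[OF assms(1)])
  then have s: "smooth_on V (\<lambda>x. norm h *\<^sub>R iter_dd g [sgn h] x)"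
    by (rule smooth_on_linear_compose[OF bounded_linear_scaleR_right assms(1)])
  have "iter_dd g [h] x = norm h *\<^sub>R iter_dd g [sgn h] x" if "x \<in> V" for x
    using usm_iter_dd_all[OF assms(1) g, of "[h]"] that assms(3) by simp
  then have "smooth_on V (iter_dd g [h])" using s by (subst smooth_on_cong) auto
  with d show thesis by (rule that)
qed

locale proper_family = circle_family +
  assumes proper: "circle_proper (fx 0)"
begin

lemma level_bound: "\<exists>R\<ge>0. \<forall>t z. \<bar>fx 0 t z\<bar> \<le> B \<longrightarrow> \<bar>z\<bar> \<le> R"
proof -
  have "compact {(t, x). t \<in> {0..1} \<and> fx 0 t x \<in> {-B..B}}" using proper unfolding circle_proper_def by blast
  then obtain R where R: "\<And>p. p \<in> {(t, x). t \<in> {0..1} \<and> fx 0 t x \<in> {-B..B}} \<Longrightarrow> norm p \<le> R"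
    by (meson compact_imp_bounded bounded_iff)
  have "\<bar>z\<bar> \<le> max 0 R" if z: "\<bar>fx 0 t z\<bar> \<le> B" for t z
  proof -
    have "fx 0 t z = fx 0 (frac t) z"
      using periodic_int[of "\<lambda>t. fx 0 t z" t "- \<lfloor>t\<rfloor>"] per by (simp add: frac_def)
    then have "norm (frac t, z) \<le> R" using z by (intro R) (auto simp: frac_ge_0 less_imp_le[OF frac_lt_1])
    moreover have "norm z \<le> norm (frac t, z)" by (rule norm_snd_le)
    ultimately show ?thesis by simp
  qed
  then show ?thesis by (intro exI[of _ "max 0 R"]) auto
qed

text \<open>At the extrema of w = x - K x the value f(t, x t) is the average \<open>c\<close>, and
  \<open>K_average\<close> bounds \<open>c\<close> through \<open>K x\<close>. Properness of f then
  bounds \<open>x\<close> at these two points, so w is bounded there and hence everywhere.\<close>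

lemma K_bound: "\<exists>R. \<forall>x. norm (K x) \<le> \<rho> \<longrightarrow> norm x \<le> R"
proof -
  obtain B where B: "\<And>t z. \<bar>z\<bar> \<le> \<rho> \<Longrightarrow> \<bar>fx 0 t z\<bar> \<le> B" using fx_bound[of \<rho> 0] by blast
  obtain R where R: "\<And>t z. \<bar>fx 0 t z\<bar> \<le> B \<Longrightarrow> \<bar>z\<bar> \<le> R" using level_bound[of B] by blast
  have "norm x \<le> R + 2 * \<rho>" if x: "norm (K x) \<le> \<rho>" for x
  proof -
    define w where "w = - prim (nem 0 x)"
    define c where "c = average (nem 0 x)"
    have xw: "C0_fun x t = C0_fun (K x) t + C0_fun w t" for t by (simp add: K_def w_def)
    have w': "C0_has_deriv w (- (nem 0 x - const_fun c))"
      unfolding w_def c_def by (intro C0_has_deriv_simps prim)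
    have w2: "C0_has_deriv (- w) (nem 0 x - const_fun c)"
      unfolding w_def c_def using prim by simp
    have q: "\<bar>C0_fun (K x) t\<bar> \<le> \<rho>" for t using abs_C0_fun_le[of "K x" t] x by linarith
    obtain t' where "c = fx 0 t' (C0_fun (K x) t')" using K_average[of x] by (auto simp: c_def)
    then have c: "\<bar>c\<bar> \<le> B" using B[OF q] by simp
    obtain t1 where t1: "\<And>s. C0_fun w s \<le> C0_fun w t1" "C0_fun (- (nem 0 x - const_fun c)) t1 = 0"
      by (rule C0_attains_max[OF w']) (rule that)
    obtain t2 where t2: "\<And>s. C0_fun (- w) s \<le> C0_fun (- w) t2" "C0_fun (nem 0 x - const_fun c) t2 = 0"
      by (rule C0_attains_max[OF w2]) (rule that)
    have "\<bar>C0_fun x t1\<bar> \<le> R" "\<bar>C0_fun x t2\<bar> \<le> R" using t1(2) t2(2) c R[of t1 "C0_fun x t1"] R[of t2 "C0_fun x t2"] by auto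
    then have "C0_fun w t1 \<le> R + \<rho>" "- (R + \<rho>) \<le> C0_fun w t2" using xw[of t1] xw[of t2] q[of t1] q[of t2] by linarith+
    then have "\<bar>C0_fun w t\<bar> \<le> R + \<rho>" for t using t1(1)[of t] t2(1)[of t] by simp
    then have "\<bar>C0_fun x t\<bar> \<le> R + 2 * \<rho>" for t using xw[of t] q[of t] by (smt (verit))
    then show ?thesis by (rule norm_C0_le)
  qed
  then show ?thesis by blast
qed

lemma K_surj: "\<exists>x. K x = q"
proof (rule newton_surjective[OF K_bound])
  fix R :: real
  obtain a where a: "a \<ge> 0" "\<And>x. norm x \<le> R \<Longrightarrow> norm (nem (Suc 0) x) \<le> a" using nem_bound[of R "Suc 0"] by blast
  define C where "C = 1 + 2 * a * exp (2 * a)"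
  have C: "C > 0" unfolding C_def using a(1) by (intro add_pos_nonneg) auto
  obtain B where B: "B \<ge> 0" "\<And>t z. \<bar>z\<bar> \<le> R + 1 \<Longrightarrow> \<bar>fx (Suc (Suc 0)) t z\<bar> \<le> B" using fx_bound[of "R + 1" "Suc (Suc 0)"] by blast
  \<comment> \<open>\<open>prim\<close> has norm at most 2, so this \<open>\<eta>\<close> leads to
    the tolerance \<open>1 / (2 * C)\<close> of \<open>newton_surjective\<close>. The radius
    \<open>r\<close> keeps the variation of the coefficient below \<open>\<eta>\<close>, and
    \<open>r \<le> 1\<close> keeps the values in the range for which \<open>B\<close> was
    chosen.\<close>
  define \<eta> where "\<eta> = 1 / (4 * C)"
  define r where "r = min 1 (\<eta> / (B + 1))"
  have \<eta>: "\<eta> > 0" using C by (simp add: \<eta>_def)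
  have r: "r > 0" "r \<le> 1" "B * r \<le> \<eta>"
  proof -
    show "r > 0" "r \<le> 1" using \<eta> B by (auto simp: r_def)
    have "r \<le> \<eta> / (B + 1)" by (simp add: r_def)
    then have "r * (B + 1) \<le> \<eta>" using B(1) by (simp add: pos_le_divide_eq)
    then show "B * r \<le> \<eta>" using \<open>r > 0\<close> by (simp add: algebra_simps)
  qed
  show "\<exists>C>0. \<exists>r>0. \<forall>x::C0. norm x \<le> R \<longrightarrow> (\<exists>A Li. bounded_linear Li \<and> (\<forall>y. A (Li y) = y) \<and> (\<forall>h. Li (A h) = h) \<and>
       (\<forall>y. norm (Li y) \<le> C * norm y) \<and>
       (\<forall>z1\<in>cball x r. \<forall>z2\<in>cball x r. norm (K z1 - K z2 - A (z1 - z2)) \<le> 1 / (2 * C) * norm (z1 - z2)))"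
  proof (rule exI[of _ C], rule conjI[OF C], rule exI[of _ r], rule conjI[OF r(1)], intro allI impI)
    fix x :: C0 assume x: "norm x \<le> R"
    have "norm (K z1 - K z2 - DK x (z1 - z2)) \<le> 1 / (2 * C) * norm (z1 - z2)"
      if z: "z1 \<in> cball x r" "z2 \<in> cball x r" for z1 z2
    proof -
      interpret m: bounded_bilinear mult_C0 by (rule bounded_bilinear_mult_C0)
      interpret p: bounded_linear prim by (rule bounded_linear_prim)
      let ?Q = "quot z1 z2 - nem (Suc 0) x"
      have "K z1 - K z2 - DK x (z1 - z2) = prim (mult_C0 ?Q (z1 - z2))"
        by (simp add: K_diff DK_def m.diff_left p.diff)
      then have "norm (K z1 - K z2 - DK x (z1 - z2)) \<le> 2 * norm (mult_C0 ?Q (z1 - z2))" by (simp add: norm_prim_le)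
      also have "\<dots> \<le> 2 * (norm ?Q * norm (z1 - z2))" by (simp add: norm_mult_C0_le)
      also have "norm ?Q \<le> \<eta>"
      proof (rule norm_C0_le)
        fix t
        have zt: "\<bar>C0_fun z1 t - C0_fun x t\<bar> \<le> r" "\<bar>C0_fun z2 t - C0_fun x t\<bar> \<le> r"
          using z abs_C0_fun_le[of "z1 - x" t] abs_C0_fun_le[of "z2 - x" t] by (auto simp: dist_norm norm_minus_commute)
        have xt: "\<bar>C0_fun x t\<bar> \<le> R" using abs_C0_fun_le[of x t] x by linarith
        have "\<bar>fx (Suc 0) t (C0_fun z2 t + \<theta> * (C0_fun z1 t - C0_fun z2 t)) - fx (Suc 0) t (C0_fun x t)\<bar> \<le> \<eta>"
          if \<theta>: "0 \<le> \<theta>" "\<theta> \<le> 1" for \<theta>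
        proof -
          let ?y = "C0_fun z2 t + \<theta> * (C0_fun z1 t - C0_fun z2 t)"
          have "\<bar>(C0_fun z2 t - C0_fun x t) + \<theta> * ((C0_fun z1 t - C0_fun x t) - (C0_fun z2 t - C0_fun x t))\<bar> \<le> r"
            by (rule segment_bound[OF zt \<theta>])
          then have yx: "\<bar>?y - C0_fun x t\<bar> \<le> r" by (simp add: algebra_simps)
          have "\<bar>fx (Suc 0) t ?y - fx (Suc 0) t (C0_fun x t)\<bar> \<le> B * \<bar>?y - C0_fun x t\<bar>"
            by (rule fx_lipschitz[where \<rho> = "R + 1", OF B(2)]) (use yx xt r in auto)
          also have "\<dots> \<le> B * r" using yx B(1) by (rule mult_left_mono)
          finally show ?thesis using r by simp
        qed
        from quot_close[OF this] show "\<bar>C0_fun ?Q t\<bar> \<le> \<eta>" by simp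
      qed
      then have "2 * (norm ?Q * norm (z1 - z2)) \<le> 2 * (\<eta> * norm (z1 - z2))" by (intro mult_left_mono mult_right_mono) auto
      also have "\<dots> = 1 / (2 * C) * norm (z1 - z2)" by (simp add: \<eta>_def)
      finally show ?thesis .
    qed
    moreover have "norm (DKinv x y) \<le> C * norm y" for y unfolding C_def by (rule DKinv_bound[OF a(2)[OF x]])
    ultimately show "\<exists>A Li. bounded_linear Li \<and> (\<forall>y. A (Li y) = y) \<and> (\<forall>h. Li (A h) = h) \<and>
       (\<forall>y. norm (Li y) \<le> C * norm y) \<and>
       (\<forall>z1\<in>cball x r. \<forall>z2\<in>cball x r. norm (K z1 - K z2 - A (z1 - z2)) \<le> 1 / (2 * C) * norm (z1 - z2))"
      using DKinv_linear DK_DKinv DKinv_DK by blast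
  qed
qed

definition Kinv :: "C0 \<Rightarrow> C0" where "Kinv = inv K"

lemma K_Kinv [simp]: "K (Kinv q) = q"
  unfolding Kinv_def by (rule surj_f_inv_f) (metis K_surj surj_def)

lemma Kinv_K [simp]: "Kinv (K x) = x"
  unfolding Kinv_def by (rule inv_f_f[OF inj_K])

lemma continuous_Kinv: "continuous_on UNIV Kinv"
  unfolding continuous_on_iff
proof (intro ballI allI impI)
  fix q :: C0 and e :: real assume e: "e > 0"
  obtain R where R: "\<And>x. norm (K x) \<le> norm q + 1 \<Longrightarrow> norm x \<le> R" using K_bound by blast
  obtain C where C: "C \<ge> 0" "\<And>x y. norm x \<le> R \<Longrightarrow> norm y \<le> R \<Longrightarrow> norm (x - y) \<le> C * norm (K x - K y)"
    using K_lipschitz_below[of R] by blast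
  show "\<exists>d>0. \<forall>q'\<in>UNIV. dist q' q < d \<longrightarrow> dist (Kinv q') (Kinv q) < e"
  proof (intro exI[of _ "min 1 (e / (C + 1))"] conjI ballI impI)
    show "min 1 (e / (C + 1)) > 0" using e C by simp
    fix q' assume q': "dist q' q < min 1 (e / (C + 1))"
    have "norm q' \<le> norm q + 1" using q' norm_triangle_sub[of q' q] by (simp add: dist_norm)
    then have "norm (Kinv q' - Kinv q) \<le> C * norm (q' - q)" using C(2)[of "Kinv q'" "Kinv q"] R by simp
    also have "\<dots> \<le> (C + 1) * norm (q' - q)" by (simp add: mult_right_mono)
    also have "\<dots> < e" using q' C(1) by (simp add: dist_norm pos_less_divide_eq mult.commute)
    finally show "dist (Kinv q') (Kinv q) < e" by (simp add: dist_norm)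
  qed
qed

lemma nem_hvd_curve: "((\<lambda>t. K (x + t *\<^sub>R h)) has_vector_derivative DK x h) (at 0)"
  unfolding K_def DK_def
  by (intro has_vector_derivative_add bounded_linear.has_vector_derivative[OF bounded_linear_prim] nem_hvd)
     (auto intro!: derivative_eq_intros)

lemma smooth_on_Kinv: "smooth_on UNIV Kinv"
proof -
  obtain E where E: "tower UNIV E" "\<And>x. E x [] = K x" using smooth_onE_tower[OF smooth_on_K] by auto
  \<comment> \<open>The tower of \<open>K\<close> comes from an existence statement; its first order
    is identified through uniqueness of directional derivatives.\<close>
  have E1: "E x [h] = DK x h" for x h
  proof -
    have "((\<lambda>t. K (x + t *\<^sub>R h)) has_vector_derivative E x [h]) (at 0)"
      using dir_derivD[OF tower_dir_deriv[OF E(1), of "[]" h], of x] E(2) by simp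
    from vector_derivative_unique_at[OF this nem_hvd_curve] show ?thesis .
  qed
  show ?thesis
  proof (rule implicit_smooth[where V = UNIV and W = UNIV and E = E and e = "\<lambda>q. q" and L = "\<lambda>q. DKinv (Kinv q)"])
    show "\<exists>C. \<forall>r\<in>UNIV. norm (DKinv (Kinv y) r) \<le> C * norm r" for y
      using DKinv_bound[of "Kinv y" "norm (nem (Suc 0) (Kinv y))"] by blast
  qed (auto simp: E E1 DK_DKinv DKinv_DK continuous_Kinv bounded_linear_ident)
qed

section \<open>The reduced function on C0\<close>

definition \<Phi> :: "C0 \<Rightarrow> real" where "\<Phi> q = average (nem 0 (Kinv q))"

lemma smooth_on_\<Phi>: "smooth_on UNIV \<Phi>"
  unfolding \<Phi>_def
  by (rule smooth_on_linear_compose[OF bounded_linear_average_C0],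
      simp, rule smooth_on_compose[of UNIV UNIV], (rule smooth_on_nem smooth_on_Kinv | simp)+)

lemma \<Phi>_value: "\<exists>t\<in>{0..1}. \<Phi> q = fx 0 t (C0_fun q t)"
  using K_average[of "Kinv q"] by (simp add: \<Phi>_def)

text \<open>Differentiating K (Kinv q) = q along the constants gives h + p(\<alpha> h) = 1, and
  criticality means that \<alpha> h has average 0. Hence h' = - \<alpha> h, so h is a multiple of
  exp (- A) with A a primitive of \<alpha>. It is not zero, having average 1, and its periodicity
  forces \<alpha> to have average 0.\<close>

lemma \<Phi>_critical:
  assumes "((\<lambda>s. \<Phi> (q + s *\<^sub>R const_fun 1)) has_vector_derivative 0) (at 0)"
  shows "average (nem (Suc 0) (Kinv q)) = 0"
proof -
  define \<alpha> where "\<alpha> = nem (Suc 0) (Kinv q)"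
  obtain N' where N': "(nem 0 has_derivative N') (at (Kinv q))" by (rule smooth_on_has_derivative[OF smooth_on_nem])
  have N'eq: "N' h = mult_C0 \<alpha> h" for h
    using vector_derivative_unique_at[OF has_derivative_line[OF N'] nem_hvd[of 0 "Kinv q" h]] by (simp add: \<alpha>_def)
  obtain K' where K': "(K has_derivative K') (at (Kinv q))" by (rule smooth_on_has_derivative[OF smooth_on_K])
  have K'eq: "K' h = DK (Kinv q) h" for h
    by (rule vector_derivative_unique_at[OF has_derivative_line[OF K'] nem_hvd_curve])
  obtain L where L: "(Kinv has_derivative L) (at q)" by (rule smooth_on_has_derivative[OF smooth_on_Kinv])
  define h where "h = L (const_fun 1)"
  have Kc: "((\<lambda>q. K (Kinv q)) has_derivative (\<lambda>d. K' (L d))) (at q)"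
    by (rule has_derivative_compose[OF L K'])
  then have "((\<lambda>q. q) has_derivative (\<lambda>d. K' (L d))) (at q)" by simp
  from has_derivative_unique[OF this has_derivative_ident] have "K' (L d) = d" for d by metis
  then have "DK (Kinv q) h = const_fun 1" unfolding h_def K'eq[symmetric] .
  then have h: "h + prim (mult_C0 \<alpha> h) = const_fun 1" by (simp add: DK_def \<alpha>_def)
  have "((\<lambda>q. average (nem 0 (Kinv q))) has_derivative (\<lambda>d. average (N' (L d)))) (at q)"
    by (intro bounded_linear.has_derivative[OF bounded_linear_average_C0] has_derivative_compose[OF L N'])
  then have "(\<Phi> has_derivative (\<lambda>d. average (N' (L d)))) (at q)" by (simp add: \<Phi>_def[abs_def])
  from vector_derivative_unique_at[OF has_derivative_line[OF this] assms]
  have \<gamma>: "average (mult_C0 \<alpha> h) = 0" by (simp add: h_def N'eq)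
  have avh: "average h = 1" using arg_cong[OF h, of average] by (simp add: average_simps prim)
  have h': "(C0_fun h has_real_derivative - (C0_fun \<alpha> t * C0_fun h t)) (at t)" for t
  proof -
    have eq: "C0_fun h = (\<lambda>t. 1 - C0_fun (prim (mult_C0 \<alpha> h)) t)"
    proof
      fix t have "C0_fun (h + prim (mult_C0 \<alpha> h)) t = 1" by (simp add: h)
      then show "C0_fun h t = 1 - C0_fun (prim (mult_C0 \<alpha> h)) t" by simp
    qed
    have "((\<lambda>t. 1 - C0_fun (prim (mult_C0 \<alpha> h)) t) has_real_derivative 0 - (C0_fun (mult_C0 \<alpha> h) t - average (mult_C0 \<alpha> h))) (at t)"
      by (intro DERIV_diff DERIV_const prim_deriv)
    then show ?thesis unfolding eq[symmetric] using \<gamma> by simp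
  qed
  define A where "A t = C0_fun (prim \<alpha>) t + average \<alpha> * t" for t
  have A': "(A has_real_derivative C0_fun \<alpha> t) (at t)" for t
    unfolding A_def using prim_deriv[of \<alpha> t] by (auto intro!: derivative_eq_intros)
  have const: "exp (A t) * C0_fun h t = exp (A 0) * C0_fun h 0" for t
  proof (rule DERIV_isconst_all[of "\<lambda>t. exp (A t) * C0_fun h t"], rule allI)
    fix t show "((\<lambda>t. exp (A t) * C0_fun h t) has_real_derivative 0) (at t)"
      using A'[of t] h'[of t] by (auto intro!: derivative_eq_intros)
  qed
  have "C0_fun h 0 \<noteq> 0"
  proof
    assume "C0_fun h 0 = 0"
    then have "h = 0" using const by (intro C0_eqI) simp
    then show False using avh by (simp add: average_zero)
  qed
  moreover have "C0_fun h 1 = C0_fun h 0" using C0_fun_periodic[of h 0] by simp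
  ultimately have "exp (A 1) = exp (A 0)" using const[of 1] by simp
  moreover have "A 1 - A 0 = average \<alpha>" using C0_fun_periodic[of "prim \<alpha>" 0] by (simp add: A_def)
  ultimately show ?thesis by (simp add: \<alpha>_def)
qed

lemma kernel_function:
  assumes "average \<alpha> = 0"
  obtains w where "C0_has_deriv w (- mult_C0 \<alpha> w)" "w \<noteq> 0"
proof -
  define e where "e t = exp (- C0_fun (prim \<alpha>) t)" for t
  have fe: "C0_fun (C0_of e) = e"
    unfolding e_def by (rule C0_fun_C0_of) (auto intro!: continuous_intros continuous_C0_fun simp: C0_fun_periodic)
  have "(e has_real_derivative - (C0_fun \<alpha> t * e t)) (at t)" for t
    unfolding e_def using prim_deriv[of \<alpha> t] assms by (auto intro!: derivative_eq_intros)
  then have "C0_has_deriv (C0_of e) (- mult_C0 \<alpha> (C0_of e))" by (simp add: C0_has_deriv_def fe)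
  moreover have "C0_of e \<noteq> 0"
  proof
    assume "C0_of e = 0"
    then have "C0_fun (C0_of e) 0 = 0" by simp
    then show False by (simp add: fe) (simp add: e_def)
  qed
  ultimately show thesis by (rule that)
qed

end

section \<open>The critical set\<close>

lemma C0_C1_intro:
  assumes "\<And>t. (g has_real_derivative g' t) (at t)" "continuous_on UNIV g'" "\<And>t. g (t + 1) = g t" "\<And>t. g' (t + 1) = g' t"
  shows "\<exists>p p'. C0_fun p = g \<and> C0_has_deriv p p'"
  using exists_C1[OF assms] C1_deriv by metis

text \<open>\<open>C0_has_deriv\<close> asks for one continuous derivative, so nested truncated
  squares will do, and \<open>DERIV_max0_sq\<close> differentiates them.\<close>

definition smooth_step :: "real \<Rightarrow> real" where
  "smooth_step z = 1 - (max 0 (1 - (max 0 z)\<^sup>2))\<^sup>2"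

definition smooth_step' :: "real \<Rightarrow> real" where
  "smooth_step' z = 4 * max 0 (1 - (max 0 z)\<^sup>2) * max 0 z"

lemma smooth_step_deriv: "(smooth_step has_real_derivative smooth_step' z) (at z)"
proof -
  define g where "g z = 1 - (max 0 z)\<^sup>2" for z :: real
  define f where "f y = (max 0 y)\<^sup>2" for y :: real
  have g: "(g has_real_derivative 0 - 2 * max 0 z) (at z)"
    unfolding g_def by (rule DERIV_diff[OF DERIV_const DERIV_max0_sq])
  have f: "(f has_real_derivative 2 * max 0 (g z)) (at (g z))"
    unfolding f_def by (rule DERIV_max0_sq)
  have "((\<lambda>z. 1 - f (g z)) has_real_derivative 0 - 2 * max 0 (g z) * (0 - 2 * max 0 z)) (at z)"
    by (rule DERIV_diff[OF DERIV_const DERIV_chain2[OF f g]])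
  moreover have "(\<lambda>z. 1 - f (g z)) = smooth_step" by (simp add: fun_eq_iff f_def g_def smooth_step_def)
  moreover have "0 - 2 * max 0 (g z) * (0 - 2 * max 0 z) = smooth_step' z" by (simp add: g_def smooth_step'_def)
  ultimately show ?thesis by simp
qed

lemma continuous_smooth_step': "continuous_on A smooth_step'"
  unfolding smooth_step'_def by (intro continuous_intros)

lemma smooth_step_nonpos [simp]: "z \<le> 0 \<Longrightarrow> smooth_step z = 0"
  by (simp add: smooth_step_def)

lemma smooth_step_ge_1 [simp]: assumes "z \<ge> 1" shows "smooth_step z = 1"
proof -
  have m: "max 0 z = z" using assms by simp
  have z: "1 * 1 \<le> z * z" using assms by (intro mult_mono) auto
  then have "max 0 (1 - z * z) = 0" by (intro max_absorb1) linarith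
  then show ?thesis unfolding smooth_step_def m by (simp add: power2_eq_square)
qed

lemma smooth_step_range: "0 \<le> smooth_step z" "smooth_step z \<le> 1"
proof -
  have "0 \<le> max 0 (1 - (max 0 z)\<^sup>2)" "max 0 (1 - (max 0 z)\<^sup>2) \<le> 1" by auto
  then have "(max 0 (1 - (max 0 z)\<^sup>2))\<^sup>2 \<le> 1" by (simp only: power2_eq_square mult_le_one)
  then show "0 \<le> smooth_step z" "smooth_step z \<le> 1" by (auto simp: smooth_step_def)
qed

lemma smooth_step'_bound: "\<bar>smooth_step' z\<bar> \<le> 4"
proof (cases "max 0 z \<le> 1")
  case True
  have "max 0 (1 - (max 0 z)\<^sup>2) \<le> 1" by auto
  then have "max 0 (1 - (max 0 z)\<^sup>2) * max 0 z \<le> 1" using True by (intro mult_le_one) auto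
  then show ?thesis by (simp add: smooth_step'_def abs_mult)
next
  case False
  then have "(max 0 z)\<^sup>2 \<ge> 1" by (simp add: one_le_power)
  then show ?thesis by (simp add: smooth_step'_def)
qed

lemma smooth_step_lipschitz: "\<bar>smooth_step a - smooth_step b\<bar> \<le> 4 * \<bar>a - b\<bar>"
proof -
  have "norm (smooth_step a - smooth_step b) \<le> 4 * norm (a - b)"
    by (rule field_differentiable_bound[of UNIV smooth_step smooth_step'])
       (simp_all add: smooth_step_deriv smooth_step'_bound)
  then show ?thesis by simp
qed

lemma smooth_step_cases: "smooth_step z = 0 \<or> smooth_step z = 1 \<or> (0 < z \<and> z < 1)"
proof -
  consider "z \<le> 0" | "z \<ge> 1" | "0 < z" "z < 1" by linarith
  then show ?thesis by cases simp_all
qed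

lemma C0_fun_frac: "C0_fun u t = C0_fun u (frac t)"
  using periodic_int[of "C0_fun u" t "- \<lfloor>t\<rfloor>"] C0_fun_periodic by (simp add: frac_def)

text \<open>Each of the two sines changes sign under a shift by 1, so their product is periodic; on
  [0, 1] it is positive exactly between \<open>l\<close> and \<open>r\<close>. The square of its
  positive part is continuously differentiable.\<close>

lemma bump_exists:
  assumes "0 \<le> l" "l < r" "r \<le> 1"
  obtains b b' where "C0_has_deriv b b'" "\<And>t. 0 \<le> C0_fun b t" "\<And>t. C0_fun b t \<le> 1"
    "\<And>t. 0 \<le> t \<Longrightarrow> t \<le> 1 \<Longrightarrow> C0_fun b t \<noteq> 0 \<longleftrightarrow> l < t \<and> t < r"
proof -
  define p where "p t = sin (pi * (t - l)) * sin (pi * (r - t))" for t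
  define p' where "p' t = pi * cos (pi * (t - l)) * sin (pi * (r - t)) - pi * sin (pi * (t - l)) * cos (pi * (r - t))" for t
  have p_per: "p (t + 1) = p t" "p' (t + 1) = p' t" for t
  proof -
    have e: "pi * (t + 1 - l) = pi * (t - l) + pi" "pi * (r - (t + 1)) = pi * (r - t) - pi"
      by (simp_all add: algebra_simps)
    show "p (t + 1) = p t" "p' (t + 1) = p' t"
      unfolding p_def p'_def e by (simp_all add: sin_diff cos_diff)
  qed
  have dp: "(p has_real_derivative p' t) (at t)" for t
    unfolding p_def p'_def by (auto intro!: derivative_eq_intros simp: algebra_simps)
  have cp: "continuous_on UNIV p" "continuous_on UNIV p'" unfolding p_def p'_def by (intro continuous_intros)+
  have "\<exists>b b'. C0_fun b = (\<lambda>t. (max 0 (p t))\<^sup>2) \<and> C0_has_deriv b b'"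
  proof (rule C0_C1_intro)
    show "((\<lambda>t. (max 0 (p t))\<^sup>2) has_real_derivative 2 * max 0 (p t) * p' t) (at t)" for t
      by (rule DERIV_chain2[OF DERIV_max0_sq dp])
    show "continuous_on UNIV (\<lambda>t. 2 * max 0 (p t) * p' t)" by (intro continuous_intros cp)
  qed (simp_all add: p_per)
  then obtain b b' where b: "C0_fun b = (\<lambda>t. (max 0 (p t))\<^sup>2)" "C0_has_deriv b b'" by blast
  have "\<bar>p t\<bar> \<le> 1" for t unfolding p_def abs_mult by (intro mult_le_one abs_sin_le_one) auto
  then have "max 0 (p t) \<le> 1" for t by (simp add: abs_le_iff)
  then have b1: "C0_fun b t \<le> 1" for t unfolding b power2_eq_square by (intro mult_le_one) auto
  have pos: "p t > 0 \<longleftrightarrow> l < t \<and> t < r" if t: "0 \<le> t" "t \<le> 1" for t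
  proof -
    have nn: "0 \<le> sin (pi * x)" if "0 \<le> x" "x \<le> 1" for x
      by (rule sin_ge_zero) (use that mult_left_mono[of x 1 pi] in auto)
    have np: "sin (pi * x) \<le> 0" if "-1 \<le> x" "x \<le> 0" for x
      using nn[of "- x"] that by simp
    have gt: "0 < sin (pi * x)" if "0 < x" "x < 1" for x
      by (rule sin_gt_zero) (use that mult_strict_left_mono[of x 1 pi] in auto)
    consider "t \<le> l" | "t \<ge> r" | "l < t" "t < r" by linarith
    then show ?thesis
    proof cases
      case 1
      have "p t \<le> 0" unfolding p_def by (rule mult_nonpos_nonneg) (use 1 t assms in \<open>auto intro!: nn np\<close>)
      with 1 show ?thesis by simp
    next
      case 2
      have "p t \<le> 0" unfolding p_def by (rule mult_nonneg_nonpos) (use 2 t assms in \<open>auto intro!: nn np\<close>)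
      with 2 show ?thesis by simp
    next
      case 3
      have "p t > 0" unfolding p_def by (rule mult_pos_pos) (use 3 t assms in \<open>auto intro!: gt\<close>)
      with 3 show ?thesis by simp
    qed
  qed
  show thesis
  proof (rule that[OF b(2) _ b1])
    show "0 \<le> C0_fun b t" for t by (simp add: b)
    fix t :: real assume "0 \<le> t" "t \<le> 1"
    then show "C0_fun b t \<noteq> 0 \<longleftrightarrow> l < t \<and> t < r" using pos[of t] by (auto simp: b max_def)
  qed
qed

lemma cutoff_exists:
  assumes "0 \<le> l" "l < t1" "t1 < r" "r \<le> 1"
  obtains \<theta> \<theta>' l' r' where "C0_has_deriv \<theta> \<theta>'" "\<And>t. 0 \<le> C0_fun \<theta> t" "\<And>t. C0_fun \<theta> t \<le> 1"
    "\<And>t. 0 \<le> t \<Longrightarrow> t \<le> 1 \<Longrightarrow> C0_fun \<theta> t \<noteq> 0 \<Longrightarrow> l < t \<and> t < r"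
    "l \<le> l'" "l' < t1" "t1 < r'" "r' \<le> r" "\<And>t. l' < t \<Longrightarrow> t < r' \<Longrightarrow> C0_fun \<theta> t = 1"
proof -
  obtain b b' where b: "C0_has_deriv b b'" "\<And>t. 0 \<le> C0_fun b t"
    "\<And>t. 0 \<le> t \<Longrightarrow> t \<le> 1 \<Longrightarrow> C0_fun b t \<noteq> 0 \<longleftrightarrow> l < t \<and> t < r"
    using bump_exists[of l r] assms by (metis order.strict_trans)
  define \<beta> where "\<beta> = C0_fun b t1"
  have \<beta>: "\<beta> > 0" using b(2)[of t1] b(3)[of t1] assms by (simp add: \<beta>_def)
  \<comment> \<open>The factor \<open>2 / \<beta>\<close> saturates the step wherever the bump is at
    least half its value at \<open>t1\<close>, that is, on a neighbourhood of
    \<open>t1\<close>.\<close>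
  have "\<exists>\<theta> \<theta>'. C0_fun \<theta> = (\<lambda>t. smooth_step (2 / \<beta> * C0_fun b t)) \<and> C0_has_deriv \<theta> \<theta>'"
  proof (rule C0_C1_intro)
    show "((\<lambda>t. smooth_step (2 / \<beta> * C0_fun b t)) has_real_derivative smooth_step' (2 / \<beta> * C0_fun b t) * (2 / \<beta> * C0_fun b' t)) (at t)" for t
      by (rule DERIV_chain2[OF smooth_step_deriv DERIV_cmult]) (use b in \<open>simp add: C0_has_deriv_def\<close>)
    show "continuous_on UNIV (\<lambda>t. smooth_step' (2 / \<beta> * C0_fun b t) * (2 / \<beta> * C0_fun b' t))"
      by (intro continuous_intros continuous_C0_fun continuous_on_compose2[OF continuous_smooth_step'[of UNIV]]) auto
  qed (simp_all add: C0_fun_periodic)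
  then obtain \<theta> \<theta>' where \<theta>: "C0_fun \<theta> = (\<lambda>t. smooth_step (2 / \<beta> * C0_fun b t))" "C0_has_deriv \<theta> \<theta>'" by blast
  have "isCont (C0_fun b) t1" using continuous_C0_fun[of UNIV b] by (simp add: continuous_on_eq_continuous_at)
  then obtain d where d: "d > 0" "\<And>t. \<bar>t - t1\<bar> < d \<Longrightarrow> \<bar>C0_fun b t - \<beta>\<bar> < \<beta> / 2"
    unfolding continuous_at_eps_delta using \<beta> by (metis \<beta>_def dist_real_def half_gt_zero)
  show thesis
  proof (rule that[OF \<theta>(2), of "max l (t1 - d)" "min r (t1 + d)"])
    fix t assume "max l (t1 - d) < t" "t < min r (t1 + d)"
    then have "\<bar>t - t1\<bar> < d" by auto
    then have "C0_fun b t \<ge> \<beta> / 2" using d(2)[of t] by linarith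
    then show "C0_fun \<theta> t = 1" using \<beta> by (simp add: \<theta> field_simps)
  next
    fix t :: real assume t: "0 \<le> t" "t \<le> 1" "C0_fun \<theta> t \<noteq> 0"
    then have "C0_fun b t \<noteq> 0" by (auto simp: \<theta>)
    then show "l < t \<and> t < r" using b(3) t by blast
  qed (use assms d(1) smooth_step_range in \<open>auto simp: \<theta>\<close>)
qed

text \<open>If the average were 0, \<open>prim b\<close> would be nondecreasing and periodic, hence
  constant around \<open>t0\<close>.\<close>

lemma average_C0_pos:
  assumes "\<And>t. 0 \<le> C0_fun b t" "C0_fun b t0 \<noteq> 0" shows "average b > 0"
proof (rule ccontr)
  assume "\<not> average b > 0"
  moreover have "average (0::C0) \<le> average b" by (rule average_C0_mono) (use assms in simp)
  ultimately have av: "average b = 0" by (simp add: average_zero)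
  have d: "(C0_fun (prim b) has_real_derivative C0_fun b t) (at t)" for t using prim_deriv[of b t] av by simp
  have mono: "C0_fun (prim b) s \<le> C0_fun (prim b) t" if "s \<le> t" for s t
    by (rule DERIV_nonneg_imp_nondecreasing[OF that]) (use d assms(1) in blast)
  have const: "C0_fun (prim b) t = C0_fun (prim b) (t0 - 1/2)" if "\<bar>t0 - t\<bar> < 1/2" for t
  proof (rule antisym)
    show "C0_fun (prim b) (t0 - 1/2) \<le> C0_fun (prim b) t" by (rule mono) (use that in linarith)
    have "C0_fun (prim b) t \<le> C0_fun (prim b) ((t0 - 1/2) + 1)" by (rule mono) (use that in linarith)
    then show "C0_fun (prim b) t \<le> C0_fun (prim b) (t0 - 1/2)" by (simp only: C0_fun_periodic)
  qed
  have "C0_fun b t0 = 0"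
    by (rule DERIV_local_const[OF d, of "1/2"]) (use const const[of t0] in auto)
  then show False using assms(2) by simp
qed

text \<open>Two intervals, because a level zone of the squared sine meets [0, 1] in two mirror
  images; \<open>localize\<close> takes a degenerate second interval.\<close>

lemma average_C0_support:
  assumes v: "\<And>t. \<bar>C0_fun v t\<bar> \<le> M" and lr: "l1 \<le> r1" "l2 \<le> r2"
    and supp: "\<And>t. 0 \<le> t \<Longrightarrow> t \<le> 1 \<Longrightarrow> C0_fun v t \<noteq> 0 \<Longrightarrow> t \<in> {l1..r1} \<union> {l2..r2}"
  shows "\<bar>average v\<bar> \<le> M * ((r1 - l1) + (r2 - l2))"
proof -
  have M: "M \<ge> 0" using v[of 0] by simp
  have sets: "A \<inter> {0..1} \<in> sets circle" if "A \<in> sets borel" for A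
    using that by (subst circle_def, subst sets_restrict_space_iff) auto
  have meas: "measure circle ({l..r} \<inter> {0..1}) \<le> r - l" if "l \<le> r" for l r
  proof -
    have "measure circle ({l..r} \<inter> {0..1}) = measure lborel ({l..r} \<inter> {0..1})"
      unfolding circle_def by (rule measure_restrict_space) auto
    also have "\<dots> \<le> measure lborel {l..r}"
      by (rule measure_mono_fmeasurable) (use that in \<open>auto simp: fmeasurable_def ennreal_less_top\<close>)
    finally show ?thesis using that by simp
  qed
  let ?i = "\<lambda>l r t. indicator ({l..r} \<inter> {0..1}) t :: real"
  have int: "integrable circle (?i l r)" for l r
    by (rule integrable_real_indicator[OF sets]) (auto intro: circle.emeasure_finite simp: less_top[symmetric])
  have "\<bar>average v\<bar> \<le> (\<integral>t. \<bar>C0_fun v t\<bar> \<partial>circle)"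
    unfolding average_C0_def by (rule integral_abs_bound)
  also have "\<dots> \<le> (\<integral>t. M * (?i l1 r1 t + ?i l2 r2 t) \<partial>circle)"
  proof (rule integral_mono)
    show "integrable circle (\<lambda>t. \<bar>C0_fun v t\<bar>)" by (intro integrable_abs) simp
    show "integrable circle (\<lambda>t. M * (?i l1 r1 t + ?i l2 r2 t))"
      by (intro integrable_mult_right Bochner_Integration.integrable_add int)
    fix t assume t: "t \<in> space circle"
    show "\<bar>C0_fun v t\<bar> \<le> M * (?i l1 r1 t + ?i l2 r2 t)"
    proof (cases "C0_fun v t = 0")
      case True then show ?thesis using M by simp
    next
      case False
      then have "1 \<le> ?i l1 r1 t + ?i l2 r2 t" using supp[of t] t by (auto simp: indicator_def)
      then have "M * 1 \<le> M * (?i l1 r1 t + ?i l2 r2 t)" using M by (rule mult_left_mono)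
      then show ?thesis using v[of t] by simp
    qed
  qed
  also have "\<dots> = M * (measure circle ({l1..r1} \<inter> {0..1}) + measure circle ({l2..r2} \<inter> {0..1}))"
    using int by (simp add: Bochner_Integration.integral_add Int_absorb2)
  also have "\<dots> \<le> M * ((r1 - l1) + (r2 - l2))"
    using M meas[OF lr(1)] meas[OF lr(2)] by (intro mult_left_mono) auto
  finally show ?thesis .
qed

section \<open>Oscillation and two-scale averages\<close>

lemma average_C0_HK: "average u = integral {0..1} (C0_fun u)"
proof -
  have "average u = (LBINT t:{0..1}. C0_fun u t)"
    unfolding average_C0_def circle_def by (subst integral_restrict_space) (auto simp: set_lebesgue_integral_def)
  also have "\<dots> = integral {0..1} (C0_fun u)"
    by (rule set_borel_integral_eq_integral(2))
       (unfold set_integrable_def, rule borel_integrable_compact, auto intro: continuous_C0_fun)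
  finally show ?thesis .
qed

lemma integral_periodic_shift:
  fixes g :: "real \<Rightarrow> real"
  assumes c: "continuous_on UNIV g" and per: "\<And>t. g (t + 1) = g t"
  shows "integral {0..1} (\<lambda>t. g (t + a)) = integral {0..1} g"
proof -
  have f: "C0_fun (C0_of g) = g" by (rule C0_fun_C0_of[OF c per])
  obtain H where H: "\<And>t. (H has_real_derivative g t) (at t)" "H 1 - H 0 = average (C0_of g)"
    using C0_antideriv[of "C0_of g"] by (auto simp: f)
  have "((\<lambda>t. g (t + a)) has_integral H (1 + a) - H (0 + a)) {0..1}"
  proof (rule fundamental_theorem_of_calculus)
    fix x :: real
    have "((\<lambda>t. H (t + a)) has_real_derivative g (x + a)) (at x)" using H(1)[of "x + a"] by (simp add: DERIV_shift)
    then show "((\<lambda>t. H (t + a)) has_vector_derivative g (x + a)) (at x within {0..1})"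
      unfolding has_vector_derivative_real_iff by (rule DERIV_subset) simp
  qed simp
  moreover have "H (a + 1) - H a = H (0 + 1) - H 0"
  proof (rule DERIV_isconst_all[of "\<lambda>t. H (t + 1) - H t"], rule allI)
    fix x
    have "((\<lambda>t. H (t + 1)) has_real_derivative g (x + 1)) (at x)" using H(1)[of "x + 1"] by (simp add: DERIV_shift)
    from DERIV_diff[OF this H(1)[of x]] show "((\<lambda>t. H (t + 1) - H t) has_real_derivative 0) (at x)" by (simp only: per diff_self)
  qed
  ultimately have "integral {0..1} (\<lambda>t. g (t + a)) = average (C0_of g)"
    using H(2) by (simp add: integral_unique add.commute)
  then show ?thesis by (simp add: average_C0_HK f)
qed

text \<open>The difference factors into the sines of \<pi> (b - a) and \<pi> (a + b). Concavity
  gives 2 x \<le> sin (\<pi> x) on [0, 1/2], and both a + b and 1 - (a + b) are at least b - a. A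
  quadratic bound is natural, since the slope of the squared sine vanishes at 0 and 1/2.\<close>

lemma sin_square_gap:
  assumes "0 \<le> a" "a \<le> b" "b \<le> 1/2"
  shows "(2 * (b - a))\<^sup>2 \<le> (sin (pi * b))\<^sup>2 - (sin (pi * a))\<^sup>2"
proof -
  have eq: "(sin x)\<^sup>2 - (sin y)\<^sup>2 = sin (x - y) * sin (x + y)" for x y :: real
  proof -
    have "sin (x - y) * sin (x + y) = (sin x * cos y)\<^sup>2 - (cos x * sin y)\<^sup>2"
      by (simp add: sin_diff sin_add power2_eq_square algebra_simps)
    also have "\<dots> = (sin x)\<^sup>2 * (1 - (sin y)\<^sup>2) - (1 - (sin x)\<^sup>2) * (sin y)\<^sup>2"
      by (simp add: power_mult_distrib cos_squared_eq)
    also have "\<dots> = (sin x)\<^sup>2 - (sin y)\<^sup>2" by (simp add: algebra_simps)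
    finally show ?thesis by simp
  qed
  define s where "s = b - a"
  have s: "0 \<le> s" "s \<le> 1/2" using assms by (auto simp: s_def)
  have jord: "2 * x \<le> sin (pi * x)" if "0 \<le> x" "x \<le> 1/2" for x :: real
  proof -
    have conc: "concave_on {0..pi} sin"
    proof (rule f''_le0_imp_concave)
      show "(sin has_real_derivative cos x) (at x)" for x :: real by (rule DERIV_sin)
      show "(cos has_real_derivative - sin x) (at x)" for x :: real by (rule DERIV_cos)
    qed (auto intro: sin_ge_zero)
    have "(1 - 2 * x) * sin 0 + (2 * x) * sin (pi / 2) \<le> sin ((1 - 2 * x) *\<^sub>R 0 + (2 * x) *\<^sub>R (pi / 2))"
      by (rule concave_onD[OF conc]) (use that in auto)
    then show ?thesis by (simp add: mult.commute)
  qed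
  have up: "2 * s \<le> sin (pi * (a + b))"
  proof (cases "a + b \<le> 1/2")
    case True
    then show ?thesis using jord[of "a + b"] assms by (simp add: s_def)
  next
    case False
    have "sin (pi * (a + b)) = sin (pi * (1 - (a + b)))" by (simp add: right_diff_distrib sin_diff)
    then show ?thesis using jord[of "1 - (a + b)"] False assms by (simp add: s_def)
  qed
  have "(2 * s) * (2 * s) \<le> sin (pi * s) * sin (pi * (a + b))"
    by (intro mult_mono jord s up) (use s jord[of s] in auto)
  then show ?thesis using eq[of "pi * b" "pi * a"] by (simp add: power2_eq_square s_def algebra_simps)
qed

lemma periodic_nat:
  fixes u :: "real \<Rightarrow> real"
  assumes "\<And>t. u (t + 1) = u t" shows "u (t + of_nat n) = u t"
  using periodic_int[of u t "int n"] assms by simp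

text \<open>Replacing t by t + \<sigma>/n leaves an integral over a period unchanged and shifts the
  fast argument by \<sigma>, while the slow one changes k by at most \<epsilon>. Averaging over
  \<sigma> in [0, 1] then runs the fast argument through a full period for each fixed t.\<close>

lemma two_scale_average:
  fixes k :: "real \<Rightarrow> real \<Rightarrow> real"
  assumes c: "continuous_on UNIV (\<lambda>(t, s). k t s)"
    and per: "\<And>t s. k (t + 1) s = k t s" "\<And>t s. k t (s + 1) = k t s" and n: "n > 0"
    and \<epsilon>: "\<And>t s \<sigma>. 0 \<le> t \<Longrightarrow> t \<le> 1 \<Longrightarrow> 0 \<le> \<sigma> \<Longrightarrow> \<sigma> \<le> 1 \<Longrightarrow> \<bar>k (t + \<sigma> / real n) s - k t s\<bar> \<le> \<epsilon>"
  shows "\<bar>integral {0..1} (\<lambda>t. k t (real n * t)) - integral {0..1} (\<lambda>s. integral {0..1} (\<lambda>t. k t s))\<bar> \<le> \<epsilon>"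
proof -
  have cc: "continuous_on S (\<lambda>x. k (a x) (b x))" if "continuous_on S a" "continuous_on S b" for S :: "'z::topological_space set" and a b
    using continuous_on_compose2[OF c continuous_on_Pair[OF that]] by simp
  define I where "I = integral {0..1} (\<lambda>t. k t (real n * t))"
  define J where "J \<sigma> = integral {0..1} (\<lambda>t. k t (real n * t + \<sigma>))" for \<sigma>
  have close: "\<bar>I - J \<sigma>\<bar> \<le> \<epsilon>" if \<sigma>: "0 \<le> \<sigma>" "\<sigma> \<le> 1" for \<sigma>
  proof -
    define g where "g t = k t (real n * t)" for t
    have "continuous_on UNIV g" unfolding g_def by (intro cc continuous_intros)
    moreover have "g (t + 1) = g t" for t
      using periodic_nat[of "k t" "real n * t" n, OF per(2)] per(1)[of t "real n * (t + 1)"] by (simp add: g_def distrib_left)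
    ultimately have "integral {0..1} (\<lambda>t. g (t + \<sigma> / n)) = integral {0..1} g"
      by (rule integral_periodic_shift)
    then have "integral {0..1} (\<lambda>t. k (t + \<sigma> / n) (real n * (t + \<sigma> / n))) = I"
      by (simp add: g_def[abs_def] I_def)
    moreover have "real n * (t + \<sigma> / n) = real n * t + \<sigma>" for t using n by (simp add: field_simps)
    ultimately have "I = integral {0..1} (\<lambda>t. k (t + \<sigma> / n) (real n * t + \<sigma>))" by simp
    then have "I - J \<sigma> = integral {0..1} (\<lambda>t. k (t + \<sigma> / n) (real n * t + \<sigma>) - k t (real n * t + \<sigma>))"
      unfolding J_def by (simp add: integral_diff integrable_continuous_real cc continuous_intros)
    also have "norm \<dots> \<le> integral {0..1} (\<lambda>t::real. \<epsilon>)"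
      by (rule integral_norm_bound_integral)
         (use \<epsilon> \<sigma> in \<open>auto intro!: integrable_continuous_real cc continuous_intros\<close>)
    finally show ?thesis by simp
  qed
  have cJ: "continuous_on {0..1} J"
  proof -
    have "continuous_on {0..1} (\<lambda>\<sigma>. integral (cbox 0 1) (\<lambda>t. k t (real n * t + \<sigma>)))"
      by (rule integral_continuous_on_param) (auto simp: split_beta intro!: cc continuous_intros)
    then show ?thesis by (simp add: J_def[abs_def])
  qed
  have "integral {0..1} J = integral (cbox 0 1) (\<lambda>\<sigma>. integral (cbox 0 1) (\<lambda>t. k t (real n * t + \<sigma>)))"
    by (simp add: J_def[abs_def])
  also have "\<dots> = integral (cbox 0 1) (\<lambda>t. integral (cbox 0 1) (\<lambda>\<sigma>. k t (real n * t + \<sigma>)))"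
    by (rule integral_swap_continuous) (auto simp: split_beta intro!: cc continuous_intros)
  also have "\<dots> = integral (cbox 0 1) (\<lambda>t. integral (cbox 0 1) (\<lambda>\<sigma>. k t \<sigma>))"
  proof -
    have "integral {0..1} (\<lambda>\<sigma>. k t (real n * t + \<sigma>)) = integral {0..1} (k t)" for t
      using integral_periodic_shift[of "k t" "real n * t"] cc[of UNIV "\<lambda>s. t" "\<lambda>s. s"] per(2)
      by (simp add: add.commute continuous_on_id)
    then show ?thesis by simp
  qed
  also have "\<dots> = integral (cbox 0 1) (\<lambda>s. integral (cbox 0 1) (\<lambda>t. k t s))"
    by (rule integral_swap_continuous) (auto simp: split_beta intro!: cc continuous_intros)
  finally have JJ: "integral {0..1} J = integral {0..1} (\<lambda>s. integral {0..1} (\<lambda>t. k t s))" by simp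
  have "I - integral {0..1} J = integral {0..1} (\<lambda>\<sigma>. I - J \<sigma>)"
    by (subst integral_diff) (auto intro: integrable_continuous_real cJ)
  also have "norm \<dots> \<le> integral {0..1} (\<lambda>t::real. \<epsilon>)"
    by (rule integral_norm_bound_integral)
       (use close in \<open>auto intro!: integrable_continuous_real continuous_intros cJ\<close>)
  finally show ?thesis by (simp add: JJ I_def)
qed

lemma C0_eqI_on: "(\<And>t. 0 \<le> t \<Longrightarrow> t \<le> 1 \<Longrightarrow> C0_fun u t = C0_fun v t) \<Longrightarrow> u = v"
proof (rule C0_eqI)
  fix t assume *: "\<And>t. 0 \<le> t \<Longrightarrow> t \<le> 1 \<Longrightarrow> C0_fun u t = C0_fun v t"
  have "C0_fun u (frac t) = C0_fun v (frac t)" by (rule *) (simp_all add: frac_ge_0 less_imp_le[OF frac_lt_1])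
  then show "C0_fun u t = C0_fun v t" by (simp add: C0_fun_frac[of u t] C0_fun_frac[of v t])
qed

context circle_family
begin

section \<open>Correcting \<open>Sig\<close> along paths\<close>

definition Sig :: "C0 \<Rightarrow> real" where "Sig x = average (nem (Suc 0) x)"

lemma continuous_nem: "continuous_on A (nem k)"
  by (rule continuous_on_subset[OF smooth_on_continuous_on[OF smooth_on_nem]]) auto

lemma continuous_Sig: "continuous_on A Sig"
  unfolding Sig_def
  by (intro bounded_linear.continuous_on[OF bounded_linear_average_C0] continuous_nem)

text \<open>Near (t0, x t0) the second derivative of f in x keeps its sign and is at least
  \<open>\<kappa>\<close> in absolute value. A bump of that sign supported nearby raises D_2 f
  pointwise, so \<open>Sig\<close> grows along it at a rate of at least \<open>c\<close>.\<close>

lemma control_bump: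
  assumes t0: "0 \<le> l" "l < t0" "t0 < r" "r \<le> 1" and ne: "fx (Suc (Suc 0)) t0 (C0_fun x t0) \<noteq> 0"
  obtains b b' c where "C0_has_deriv b b'" "c > 0"
    "\<And>t. 0 \<le> t \<Longrightarrow> t \<le> 1 \<Longrightarrow> C0_fun b t \<noteq> 0 \<Longrightarrow> l < t \<and> t < r"
    "\<And>\<tau> \<tau>'. -1 \<le> \<tau> \<Longrightarrow> \<tau> < \<tau>' \<Longrightarrow> \<tau>' \<le> 1 \<Longrightarrow> Sig (x + \<tau> *\<^sub>R b) + c * (\<tau>' - \<tau>) \<le> Sig (x + \<tau>' *\<^sub>R b)"
proof -
  define F where "F = (\<lambda>(t, y). fx (Suc (Suc 0)) t (C0_fun x t + y))"
  define s where "s = sgn (F (t0, 0))"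
  define \<kappa> where "\<kappa> = \<bar>F (t0, 0)\<bar> / 2"
  have F0: "F (t0, 0) \<noteq> 0" using ne by (simp add: F_def)
  have \<kappa>: "\<kappa> > 0" using F0 by (simp add: \<kappa>_def)
  have s: "s * s = 1" "s * F (t0, 0) = 2 * \<kappa>" using F0 by (auto simp: s_def \<kappa>_def sgn_if)
  have "continuous_on UNIV F" unfolding F_def split_beta
    by (intro cont_compose continuous_intros continuous_on_compose2[OF continuous_C0_fun[of UNIV]]) auto
  then obtain \<delta> where \<delta>: "\<delta> > 0" "\<And>p. dist p (t0, 0) < \<delta> \<Longrightarrow> dist (F p) (F (t0, 0)) < \<kappa>"
    using \<kappa> unfolding continuous_on_iff by (metis UNIV_I)
  have F: "s * F (t, y) \<ge> \<kappa>" if "\<bar>t - t0\<bar> < \<delta> / 2" "\<bar>y\<bar> < \<delta> / 2" for t y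
  proof -
    have "dist (t, y) (t0, 0) \<le> \<bar>t - t0\<bar> + \<bar>y\<bar>" using norm_Pair_le[of "t - t0" y] by (simp add: dist_norm)
    then have "dist (F (t, y)) (F (t0, 0)) < \<kappa>" using that by (intro \<delta>) linarith
    then have "\<bar>s * F (t, y) - s * F (t0, 0)\<bar> < \<kappa>"
      using F0 by (auto simp: dist_real_def right_diff_distrib[symmetric] abs_mult s_def sgn_if split: if_splits)
    then show ?thesis using s by linarith
  qed
  define l' r' where "l' = max l (t0 - \<delta> / 2)" and "r' = min r (t0 + \<delta> / 2)"
  obtain b0 b0' where b0: "C0_has_deriv b0 b0'" "\<And>t. 0 \<le> C0_fun b0 t" "\<And>t. C0_fun b0 t \<le> 1"
    "\<And>t. 0 \<le> t \<Longrightarrow> t \<le> 1 \<Longrightarrow> C0_fun b0 t \<noteq> 0 \<longleftrightarrow> l' < t \<and> t < r'"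
    by (rule bump_exists[of l' r']) (use t0 \<delta>(1) in \<open>auto simp: l'_def r'_def\<close>)
  \<comment> \<open>The sign makes every change an increase; the height keeps the perturbed values
    inside the box of half-width \<open>\<delta> / 2\<close> for all parameters in [-1, 1].\<close>
  define a where "a = s * (\<delta> / 4)"
  define c where "c = \<kappa> * (\<delta> / 4) * average b0"
  have "C0_fun b0 t0 \<noteq> 0" using b0(4)[of t0] t0 \<delta>(1) by (simp add: l'_def r'_def)
  then have avb: "average b0 > 0" using b0(2) by (rule average_C0_pos[rotated])
  show thesis
  proof (rule that)
    show "C0_has_deriv (a *\<^sub>R b0) (a *\<^sub>R b0')" by (rule C0_has_deriv_simps(5)[OF b0(1)])
    show "c > 0" using \<kappa> \<delta> avb by (simp add: c_def)
    fix t :: real assume "0 \<le> t" "t \<le> 1" "C0_fun (a *\<^sub>R b0) t \<noteq> 0"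
    then show "l < t \<and> t < r" using b0(4)[of t] by (auto simp: l'_def r'_def)
  next
    fix \<tau> \<tau>' :: real assume \<tau>: "-1 \<le> \<tau>" "\<tau> < \<tau>'" "\<tau>' \<le> 1"
    have "average (((\<tau>' - \<tau>) * \<kappa> * (\<delta> / 4)) *\<^sub>R b0) \<le> average (nem (Suc 0) (x + \<tau>' *\<^sub>R a *\<^sub>R b0) - nem (Suc 0) (x + \<tau> *\<^sub>R a *\<^sub>R b0))"
    proof (rule average_C0_mono)
      fix t :: real assume t: "t \<in> {0..1}"
      let ?\<beta> = "a * C0_fun b0 t"
      show "C0_fun (((\<tau>' - \<tau>) * \<kappa> * (\<delta> / 4)) *\<^sub>R b0) t \<le> C0_fun (nem (Suc 0) (x + \<tau>' *\<^sub>R a *\<^sub>R b0) - nem (Suc 0) (x + \<tau> *\<^sub>R a *\<^sub>R b0)) t"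
      proof (cases "C0_fun b0 t = 0")
        case True then show ?thesis by simp
      next
        case False
        then have "l' < t \<and> t < r'" using b0(4)[of t] t by auto
        then have "t0 - \<delta> / 2 < t" "t < t0 + \<delta> / 2" by (auto simp: l'_def r'_def)
        then have t': "\<bar>t - t0\<bar> < \<delta> / 2" by linarith
        have "\<exists>z. \<tau> < z \<and> z < \<tau>' \<and> fx (Suc 0) t (C0_fun x t + \<tau>' * ?\<beta>) - fx (Suc 0) t (C0_fun x t + \<tau> * ?\<beta>) =
            (\<tau>' - \<tau>) * (F (t, z * ?\<beta>) * ?\<beta>)"
        proof (rule MVT2[OF \<tau>(2)])
          fix z :: real
          have lin: "((\<lambda>z. C0_fun x t + z * ?\<beta>) has_real_derivative ?\<beta>) (at z)" by (auto intro!: derivative_eq_intros)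
          show "((\<lambda>z. fx (Suc 0) t (C0_fun x t + z * ?\<beta>)) has_real_derivative F (t, z * ?\<beta>) * ?\<beta>) (at z)"
            using DERIV_chain2[OF deriv lin, of "Suc 0" t] by (simp add: F_def)
        qed
        then obtain z where z: "\<tau> < z" "z < \<tau>'" "fx (Suc 0) t (C0_fun x t + \<tau>' * ?\<beta>) - fx (Suc 0) t (C0_fun x t + \<tau> * ?\<beta>) =
            (\<tau>' - \<tau>) * (F (t, z * ?\<beta>) * ?\<beta>)" by blast
        have "\<bar>z * ?\<beta>\<bar> \<le> 1 * (\<delta> / 4 * 1)"
          unfolding abs_mult a_def using z \<tau> b0(2,3)[of t] \<delta>(1) F0
          by (intro mult_mono) (auto simp: s_def sgn_if abs_if)
        then have "\<bar>z * ?\<beta>\<bar> < \<delta> / 2" using \<delta>(1) by linarith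
        from F[OF t' this] have "\<kappa> * (\<delta> / 4 * C0_fun b0 t) \<le> s * F (t, z * ?\<beta>) * (\<delta> / 4 * C0_fun b0 t)"
          using \<delta>(1) b0(2)[of t] by (intro mult_right_mono) auto
        also have "\<dots> = F (t, z * ?\<beta>) * ?\<beta>" by (simp add: a_def mult_ac)
        finally have "(\<tau>' - \<tau>) * (\<kappa> * (\<delta> / 4 * C0_fun b0 t)) \<le> (\<tau>' - \<tau>) * (F (t, z * ?\<beta>) * ?\<beta>)"
          using \<tau> by (intro mult_left_mono) auto
        then show ?thesis using z(3) by (simp add: mult.assoc)
      qed
    qed
    moreover have "average (((\<tau>' - \<tau>) * \<kappa> * (\<delta> / 4)) *\<^sub>R b0) = c * (\<tau>' - \<tau>)"
      by (simp add: c_def average_scaleR)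
    ultimately show "Sig (x + \<tau> *\<^sub>R a *\<^sub>R b0) + c * (\<tau>' - \<tau>) \<le> Sig (x + \<tau>' *\<^sub>R a *\<^sub>R b0)"
      by (simp add: Sig_def average_diff)
  qed
qed

text \<open>The integrand changes only where the bump lives, and there \<open>X\<close> and
  \<open>x\<close> agree. So the effect of the bump can be computed once, at \<open>x\<close>, for a
  whole path.\<close>

lemma Sig_local:
  assumes "\<And>t. 0 \<le> t \<Longrightarrow> t \<le> 1 \<Longrightarrow> C0_fun b t \<noteq> 0 \<Longrightarrow> C0_fun X t = C0_fun x t"
  shows "Sig (X + \<tau> *\<^sub>R b) - Sig X = Sig (x + \<tau> *\<^sub>R b) - Sig x"
proof -
  have "nem (Suc 0) (X + \<tau> *\<^sub>R b) - nem (Suc 0) X = nem (Suc 0) (x + \<tau> *\<^sub>R b) - nem (Suc 0) x"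
  proof (rule C0_eqI_on)
    fix t :: real assume t: "0 \<le> t" "t \<le> 1"
    show "C0_fun (nem (Suc 0) (X + \<tau> *\<^sub>R b) - nem (Suc 0) X) t = C0_fun (nem (Suc 0) (x + \<tau> *\<^sub>R b) - nem (Suc 0) x) t"
      using assms[OF t] by (cases "C0_fun b t = 0") auto
  qed
  then show ?thesis unfolding Sig_def average_diff[symmetric] by simp
qed

text \<open>By \<open>Sig_local\<close> the bump has the same effect \<open>m\<close> at every point
  of the path, an increasing function whose range contains [-c, c]. Its inverse gives a continuous
  correction that keeps \<open>Sig\<close> at 0; along the corrected path \<open>\<rho>\<close> has
  no zero, so its sign is carried from the start to the end.\<close>

lemma path_control:
  assumes c: "c > 0"
    and mono: "\<And>\<tau> \<tau>'. -1 \<le> \<tau> \<Longrightarrow> \<tau> < \<tau>' \<Longrightarrow> \<tau>' \<le> 1 \<Longrightarrow> Sig (x + \<tau> *\<^sub>R b) + c * (\<tau>' - \<tau>) \<le> Sig (x + \<tau>' *\<^sub>R b)"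
    and loc: "\<And>\<mu> t. 0 \<le> \<mu> \<Longrightarrow> \<mu> \<le> 1 \<Longrightarrow> 0 \<le> t \<Longrightarrow> t \<le> 1 \<Longrightarrow> C0_fun b t \<noteq> 0 \<Longrightarrow> C0_fun (X \<mu>) t = C0_fun x t"
    and cX: "continuous_on {0..1::real} X"
    and small: "\<And>\<mu>. 0 \<le> \<mu> \<Longrightarrow> \<mu> \<le> 1 \<Longrightarrow> \<bar>Sig (X \<mu>)\<bar> < c"
    and XY: "\<And>\<mu> \<tau>. 0 \<le> \<mu> \<Longrightarrow> \<mu> \<le> 1 \<Longrightarrow> X \<mu> + \<tau> *\<^sub>R b \<in> Y"
    and \<rho>: "continuous_on UNIV \<rho>" "\<And>y. y \<in> Y \<Longrightarrow> Sig y = 0 \<Longrightarrow> \<rho> y \<noteq> (0::real)"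
    and start: "Sig (X 0) = 0" "\<rho> (X 0) > 0"
  obtains \<tau> where "Sig (X 1 + \<tau> *\<^sub>R b) = 0" "\<rho> (X 1 + \<tau> *\<^sub>R b) > 0" "Sig (X 1) = 0 \<Longrightarrow> \<tau> = 0"
proof -
  define m where "m \<tau> = Sig (x + \<tau> *\<^sub>R b) - Sig x" for \<tau>
  have sm: "m \<tau> < m \<tau>'" if "-1 \<le> \<tau>" "\<tau> < \<tau>'" "\<tau>' \<le> 1" for \<tau> \<tau>'
    using mono[OF that] mult_pos_pos[OF c, of "\<tau>' - \<tau>"] that by (simp add: m_def)
  have cm: "continuous_on {-1..1} m" unfolding m_def
    by (intro continuous_intros continuous_on_compose2[OF continuous_Sig[of UNIV]]) auto
  define g where "g = inv_into {-1..1} m"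
  have inj: "inj_on m {-1..1}" using sm by (auto simp: inj_on_def) (metis less_irrefl linorder_neqE)
  have gm: "g (m \<tau>) = \<tau>" if "\<tau> \<in> {-1..1}" for \<tau> unfolding g_def by (rule inv_into_f_f[OF inj that])
  have cg: "continuous_on (m ` {-1..1}) g"
    by (rule continuous_on_inv[OF cm]) (auto simp: gm)
  have m1: "m 1 \<ge> c" "m (-1) \<le> - c" "m 0 = 0"
    using mono[of 0 1] mono[of "-1" 0] by (auto simp: m_def)
  have img: "- Sig (X \<mu>) \<in> m ` {-1..1}" if \<mu>: "0 \<le> \<mu>" "\<mu> \<le> 1" for \<mu>
  proof -
    have "connected (m ` {-1..1})" by (rule connected_continuous_image[OF cm]) simp
    from connectedD_interval[OF this, of "m (-1)" "m 1"] show ?thesis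
      using m1 small[OF \<mu>] by (auto simp: abs_less_iff)
  qed
  define \<gamma> where "\<gamma> \<mu> = X \<mu> + g (- Sig (X \<mu>)) *\<^sub>R b" for \<mu>
  have c\<gamma>: "continuous_on {0..1} \<gamma>" unfolding \<gamma>_def
    by (intro continuous_intros cX continuous_on_compose2[OF cg] continuous_on_compose2[OF continuous_Sig[of UNIV] cX])
       (use img in auto)
  have mg: "m (g (- Sig (X \<mu>))) = - Sig (X \<mu>)" if "0 \<le> \<mu>" "\<mu> \<le> 1" for \<mu>
    unfolding g_def by (rule f_inv_into_f[OF img[OF that]])
  have S\<gamma>: "Sig (\<gamma> \<mu>) = 0" if \<mu>: "0 \<le> \<mu>" "\<mu> \<le> 1" for \<mu>
  proof -
    have "Sig (\<gamma> \<mu>) - Sig (X \<mu>) = m (g (- Sig (X \<mu>)))"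
      unfolding \<gamma>_def m_def by (rule Sig_local) (rule loc[OF \<mu>])
    then show ?thesis using mg[OF \<mu>] by simp
  qed
  have ne: "\<rho> (\<gamma> \<mu>) \<noteq> 0" if "0 \<le> \<mu>" "\<mu> \<le> 1" for \<mu>
    using \<rho>(2)[of "\<gamma> \<mu>"] S\<gamma>[OF that] XY[OF that] by (simp add: \<gamma>_def)
  have g0: "g 0 = 0" using gm[of 0] m1(3) by simp
  have \<gamma>0: "\<gamma> 0 = X 0" by (simp add: \<gamma>_def start g0)
  have "\<rho> (\<gamma> 1) > 0"
  proof (rule ccontr)
    assume "\<not> \<rho> (\<gamma> 1) > 0"
    have "connected ((\<lambda>\<mu>. \<rho> (\<gamma> \<mu>)) ` {0..1})"
      by (intro connected_continuous_image continuous_on_compose2[OF \<rho>(1) c\<gamma>]) auto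
    moreover have "\<rho> (\<gamma> 1) \<in> (\<lambda>\<mu>. \<rho> (\<gamma> \<mu>)) ` {0..1}" "\<rho> (\<gamma> 0) \<in> (\<lambda>\<mu>. \<rho> (\<gamma> \<mu>)) ` {0..1}" by auto
    moreover have "\<rho> (\<gamma> 1) \<le> 0" "0 \<le> \<rho> (\<gamma> 0)" using \<open>\<not> \<rho> (\<gamma> 1) > 0\<close> start \<gamma>0 by auto
    ultimately have "0 \<in> (\<lambda>\<mu>. \<rho> (\<gamma> \<mu>)) ` {0..1}" by (rule connectedD_interval)
    then show False using ne by auto
  qed
  then show thesis using S\<gamma>[of 1] g0 by (intro that[of "g (- Sig (X 1))"]) (simp_all add: \<gamma>_def)
qed

lemma nonvanishing_interval:
  assumes "\<exists>t. fx k t (C0_fun u t) \<noteq> 0"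
  obtains l r where "0 \<le> l" "l < r" "r \<le> 1" "\<And>t. l < t \<Longrightarrow> t < r \<Longrightarrow> fx k t (C0_fun u t) \<noteq> 0"
proof -
  obtain t where "C0_fun (nem k u) t \<noteq> 0" using assms by auto
  then have ne: "C0_fun (nem k u) (frac t) \<noteq> 0" by (subst (asm) C0_fun_frac)
  have "continuous (at (frac t)) (C0_fun (nem k u))"
    using continuous_C0_fun[of UNIV "nem k u"] unfolding continuous_on_eq_continuous_at[OF open_UNIV] by blast
  from continuous_at_avoid[OF this ne]
  obtain e where e: "e > 0" "\<And>y. dist (frac t) y < e \<Longrightarrow> C0_fun (nem k u) y \<noteq> 0" by auto
  show thesis
    by (rule that[of "frac t" "min 1 (frac t + e)"])
       (use e(1) e(2) in \<open>auto simp: frac_ge_0 frac_lt_1 dist_real_def\<close>)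
qed

end

context circle_family
begin

lemma nem_fun: "C0_fun (nem k u) = (\<lambda>t. fx k t (C0_fun u t))"
  by (rule ext) simp

text \<open>
  Moves \<open>u0\<close> within the critical set to a point that agrees with \<open>u1\<close> near some \<open>t1\<close>, so that one and the
  same bump at \<open>t1\<close> controls \<open>Sig\<close> along the whole path in \<open>sign_constant\<close>.
\<close>

lemma localize:
  assumes Y: "\<And>x y. x \<in> Y \<Longrightarrow> y \<in> Y \<Longrightarrow> x + y \<in> Y" "\<And>c x. x \<in> Y \<Longrightarrow> c *\<^sub>R x \<in> Y"
    "\<And>p p'. C0_has_deriv p p' \<Longrightarrow> p \<in> Y" "\<And>\<theta> \<theta>' y. C0_has_deriv \<theta> \<theta>' \<Longrightarrow> y \<in> Y \<Longrightarrow> mult_C0 \<theta> y \<in> Y"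
    and \<rho>: "continuous_on UNIV \<rho>" "\<And>y. y \<in> Y \<Longrightarrow> Sig y = 0 \<Longrightarrow> \<rho> y \<noteq> (0::real)"
    and reg: "\<And>y. y \<in> Y \<Longrightarrow> Sig y = 0 \<Longrightarrow> \<exists>t. fx (Suc (Suc 0)) t (C0_fun y t) \<noteq> 0"
    and u0: "u0 \<in> Y" "Sig u0 = 0" "\<rho> u0 > 0" and u1: "u1 \<in> Y" "Sig u1 = 0"
  obtains h l r t1 where "h \<in> Y" "Sig h = 0" "\<rho> h > 0" "0 \<le> l" "l < t1" "t1 < r" "r \<le> 1"
    "fx (Suc (Suc 0)) t1 (C0_fun u1 t1) \<noteq> 0" "\<And>t. l < t \<Longrightarrow> t < r \<Longrightarrow> C0_fun h t = C0_fun u1 t"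
proof -
  obtain l0 r0 where lr0: "0 \<le> l0" "l0 < r0" "r0 \<le> 1" "\<And>t. l0 < t \<Longrightarrow> t < r0 \<Longrightarrow> fx (Suc (Suc 0)) t (C0_fun u0 t) \<noteq> 0"
    by (rule nonvanishing_interval[OF reg[OF u0(1,2)]]) blast
  obtain l1 r1 where lr1: "0 \<le> l1" "l1 < r1" "r1 \<le> 1" "\<And>t. l1 < t \<Longrightarrow> t < r1 \<Longrightarrow> fx (Suc (Suc 0)) t (C0_fun u1 t) \<noteq> 0"
    by (rule nonvanishing_interval[OF reg[OF u1]]) blast
  define t0 where "t0 = (l0 + r0) / 2"
  \<comment> \<open>The point at one third of the interval is taken when the midpoint happens to be
    \<open>t0\<close>.\<close>
  define t1 where "t1 = (if (l1 + r1) / 2 \<noteq> t0 then (l1 + r1) / 2 else (2 * l1 + r1) / 3)"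
  have t0: "l0 < t0" "t0 < r0" using lr0 by (auto simp: t0_def)
  have t1: "l1 < t1" "t1 < r1" "t1 \<noteq> t0" using lr1 by (auto simp: t1_def field_simps)
  define d where "d = \<bar>t1 - t0\<bar> / 2"
  have d: "d > 0" using t1 by (simp add: d_def)
  obtain b b' c where b: "C0_has_deriv b b'" "c > 0"
    "\<And>t. 0 \<le> t \<Longrightarrow> t \<le> 1 \<Longrightarrow> C0_fun b t \<noteq> 0 \<Longrightarrow> max l0 (t0 - d) < t \<and> t < min r0 (t0 + d)"
    "\<And>\<tau> \<tau>'. -1 \<le> \<tau> \<Longrightarrow> \<tau> < \<tau>' \<Longrightarrow> \<tau>' \<le> 1 \<Longrightarrow> Sig (u0 + \<tau> *\<^sub>R b) + c * (\<tau>' - \<tau>) \<le> Sig (u0 + \<tau>' *\<^sub>R b)"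
    by (rule control_bump[of "max l0 (t0 - d)" t0 "min r0 (t0 + d)" u0]) (use lr0 t0 d in auto)
  obtain B where B: "B \<ge> 0" "\<And>t z. \<bar>z\<bar> \<le> norm u0 + norm u1 \<Longrightarrow> \<bar>fx (Suc 0) t z\<bar> \<le> B"
    using fx_bound[of "norm u0 + norm u1" "Suc 0"] by blast
  \<comment> \<open>\<open>u0\<close> is changed on an interval of length at most
    \<open>2 * e\<close>, which changes \<open>Sig\<close> by at most
    \<open>2 * B * (2 * e)\<close>; this has to stay below the strength \<open>c\<close> of the bump
    at \<open>t0\<close>. The bound \<open>e \<le> d\<close> separates the supports of bump and
    cutoff.\<close>
  define e where "e = min d (c / (8 * (B + 1)))"
  have e: "e > 0" "e \<le> d" "2 * B * (2 * e) < c"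
  proof -
    show e0: "e > 0" "e \<le> d" using d b(2) B(1) by (auto simp: e_def)
    have "e \<le> c / (8 * (B + 1))" by (simp add: e_def)
    then have "8 * (B + 1) * e \<le> c" using B(1) by (simp add: pos_le_divide_eq mult.commute)
    then have "8 * (B * e) + 8 * e \<le> c" by (simp add: algebra_simps)
    moreover have "B * e \<ge> 0" using B(1) e0 by simp
    moreover have "2 * B * (2 * e) = 4 * (B * e)" by simp
    ultimately show "2 * B * (2 * e) < c" using e0 by linarith
  qed
  define l r where "l = max l1 (t1 - e)" and "r = min r1 (t1 + e)"
  have lr: "0 \<le> l" "l < t1" "t1 < r" "r \<le> 1" "r - l \<le> 2 * e" using lr1 t1 e by (auto simp: l_def r_def)
  obtain \<theta> \<theta>' l' r' where \<theta>: "C0_has_deriv \<theta> \<theta>'" "\<And>t. 0 \<le> C0_fun \<theta> t" "\<And>t. C0_fun \<theta> t \<le> 1"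
    "\<And>t. 0 \<le> t \<Longrightarrow> t \<le> 1 \<Longrightarrow> C0_fun \<theta> t \<noteq> 0 \<Longrightarrow> l < t \<and> t < r"
    "l \<le> l'" "l' < t1" "t1 < r'" "r' \<le> r" "\<And>t. l' < t \<Longrightarrow> t < r' \<Longrightarrow> C0_fun \<theta> t = 1"
    by (rule cutoff_exists[OF lr(1-4)]) (rule that)
  have disj: "C0_fun b t = 0" if "l < t" "t < r" for t
  proof (rule ccontr)
    assume "C0_fun b t \<noteq> 0"
    then have "max l0 (t0 - d) < t \<and> t < min r0 (t0 + d)" using b(3)[of t] that lr by auto
    moreover have "t1 - d < t" "t < t1 + d" using that e by (auto simp: l_def r_def)
    ultimately show False unfolding d_def by (auto simp: abs_if field_simps split: if_splits)
  qed
  define w where "w = mult_C0 \<theta> (u1 - u0)"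
  define X where "X \<mu> = u0 + \<mu> *\<^sub>R w" for \<mu> :: real
  have diffY: "x - y \<in> Y" if "x \<in> Y" "y \<in> Y" for x y using Y(1)[OF that(1) Y(2)[OF that(2), of "-1"]] by simp
  have wY: "w \<in> Y" unfolding w_def by (rule Y(4)[OF \<theta>(1) diffY[OF u1(1) u0(1)]])
  have bY: "b \<in> Y" by (rule Y(3)[OF b(1)])
  have small: "\<bar>Sig (X \<mu>)\<bar> < c" if \<mu>: "0 \<le> \<mu>" "\<mu> \<le> 1" for \<mu>
  proof -
    let ?v = "nem (Suc 0) (X \<mu>) - nem (Suc 0) u0"
    have "\<bar>average ?v\<bar> \<le> 2 * B * ((r - l) + (0 - 0))"
    proof (rule average_C0_support)
      fix t
      have "\<bar>C0_fun u0 t + (\<mu> * C0_fun \<theta> t) * (C0_fun u1 t - C0_fun u0 t)\<bar> \<le> norm u0 + norm u1"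
        by (rule segment_bound) (use \<mu> \<theta>(2,3)[of t] abs_C0_fun_le[of u0 t] abs_C0_fun_le[of u1 t] norm_ge_zero[of u0] norm_ge_zero[of u1] in
           \<open>auto intro: mult_le_one simp del: norm_ge_zero\<close>)
      then have "\<bar>fx (Suc 0) t (C0_fun (X \<mu>) t)\<bar> \<le> B" by (intro B) (simp add: X_def w_def mult.assoc)
      moreover have "\<bar>fx (Suc 0) t (C0_fun u0 t)\<bar> \<le> B"
        by (rule B(2)) (use abs_C0_fun_le[of u0 t] norm_ge_zero[of u1] in linarith)
      ultimately show "\<bar>C0_fun ?v t\<bar> \<le> 2 * B" by simp
    next
      fix t :: real assume t: "0 \<le> t" "t \<le> 1" "C0_fun ?v t \<noteq> 0"
      then have "C0_fun \<theta> t \<noteq> 0" by (auto simp: X_def w_def)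
      from \<theta>(4)[OF t(1,2) this] show "t \<in> {l..r} \<union> {0..0}" by simp
    qed (use lr in auto)
    also have "\<dots> \<le> 2 * B * (2 * e)" using lr(5) B(1) by (intro mult_left_mono) auto
    also have "\<dots> < c" by (rule e(3))
    finally show ?thesis using u0(2) by (simp add: Sig_def average_simps)
  qed
  obtain \<tau> where \<tau>: "Sig (X 1 + \<tau> *\<^sub>R b) = 0" "\<rho> (X 1 + \<tau> *\<^sub>R b) > 0"
  proof (rule path_control[where x = u0 and b = b and c = c and X = X and Y = Y and \<rho> = \<rho>])
    show "C0_fun (X \<mu>) t = C0_fun u0 t" if "0 \<le> \<mu>" "\<mu> \<le> 1" "0 \<le> t" "t \<le> 1" "C0_fun b t \<noteq> 0" for \<mu> t
      using disj[of t] \<theta>(4)[of t] that by (auto simp: X_def w_def)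
    show "continuous_on {0..1} X" unfolding X_def by (intro continuous_intros)
    show "X \<mu> + \<tau> *\<^sub>R b \<in> Y" for \<mu> \<tau> unfolding X_def by (intro Y(1) Y(2) u0(1) wY bY)
    show "Sig (X 0) = 0" "\<rho> (X 0) > 0" using u0 by (simp_all add: X_def)
  qed (use b small \<rho> in blast)+
  show thesis
  proof (rule that[of "X 1 + \<tau> *\<^sub>R b" l' t1 r'])
    show "X 1 + \<tau> *\<^sub>R b \<in> Y" unfolding X_def by (intro Y(1) Y(2) u0(1) wY bY)
    show "C0_fun (X 1 + \<tau> *\<^sub>R b) t = C0_fun u1 t" if "l' < t" "t < r'" for t
      using that \<theta>(5,8,9)[of] disj[of t] by (simp add: X_def w_def \<theta>(9)[OF that])
    show "fx (Suc (Suc 0)) t1 (C0_fun u1 t1) \<noteq> 0" using lr1(4) t1 by blast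
  qed (use \<tau> lr \<theta>(5-8) in auto)
qed

text \<open>The path replaces \<open>h\<close> by \<open>u1\<close> on the set where the squared
  sine of \<pi> n t lies below a growing level z, with softened edges. At a fixed phase s the
  average over t is \<open>V (S s z)\<close>, and \<open>V\<close> vanishes at 0 and 1, so only the
  edges contribute. The edges and the finite n cost at most c/3 each; the total stays below the
  strength c of a bump at \<open>t1\<close>, around which \<open>h\<close> and \<open>u1\<close>
  agree.\<close>

theorem sign_constant:
  assumes Y: "\<And>x y. x \<in> Y \<Longrightarrow> y \<in> Y \<Longrightarrow> x + y \<in> Y" "\<And>c x. x \<in> Y \<Longrightarrow> c *\<^sub>R x \<in> Y"
    "\<And>p p'. C0_has_deriv p p' \<Longrightarrow> p \<in> Y" "\<And>\<theta> \<theta>' y. C0_has_deriv \<theta> \<theta>' \<Longrightarrow> y \<in> Y \<Longrightarrow> mult_C0 \<theta> y \<in> Y"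
    and \<rho>: "continuous_on UNIV \<rho>" "\<And>y. y \<in> Y \<Longrightarrow> Sig y = 0 \<Longrightarrow> \<rho> y \<noteq> (0::real)"
    and reg: "\<And>y. y \<in> Y \<Longrightarrow> Sig y = 0 \<Longrightarrow> \<exists>t. fx (Suc (Suc 0)) t (C0_fun y t) \<noteq> 0"
    and u0: "u0 \<in> Y" "Sig u0 = 0" "\<rho> u0 > 0" and u1: "u1 \<in> Y" "Sig u1 = 0"
  shows "\<rho> u1 > 0"
proof -
  obtain h l r t1 where h: "h \<in> Y" "Sig h = 0" "\<rho> h > 0" and lr: "0 \<le> l" "l < t1" "t1 < r" "r \<le> 1"
    "fx (Suc (Suc 0)) t1 (C0_fun u1 t1) \<noteq> 0" and agree: "\<And>t. l < t \<Longrightarrow> t < r \<Longrightarrow> C0_fun h t = C0_fun u1 t"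
    by (rule localize[OF Y \<rho> reg u0 u1]) blast+
  obtain b b' c where b: "C0_has_deriv b b'" "c > 0"
    "\<And>t. 0 \<le> t \<Longrightarrow> t \<le> 1 \<Longrightarrow> C0_fun b t \<noteq> 0 \<Longrightarrow> l < t \<and> t < r"
    "\<And>\<tau> \<tau>'. -1 \<le> \<tau> \<Longrightarrow> \<tau> < \<tau>' \<Longrightarrow> \<tau>' \<le> 1 \<Longrightarrow> Sig (u1 + \<tau> *\<^sub>R b) + c * (\<tau>' - \<tau>) \<le> Sig (u1 + \<tau>' *\<^sub>R b)"
    by (rule control_bump[OF lr]) blast
  define D where "D = u1 - h"
  define \<kappa> where "\<kappa> t y = fx (Suc 0) t (C0_fun h t + y * C0_fun D t)" for t y
  have \<kappa>_cont: "continuous_on S (\<lambda>p. \<kappa> (a p) (y p))" if "continuous_on S a" "continuous_on S y" for S :: "'z::topological_space set" and a y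
    unfolding \<kappa>_def by (intro cont_compose continuous_intros that continuous_on_compose2[OF continuous_C0_fun[of UNIV]]) auto
  have \<kappa>_per: "\<kappa> (t + 1) y = \<kappa> t y" for t y by (simp add: \<kappa>_def per C0_fun_periodic)
  obtain M where M: "M \<ge> 0" "\<And>t z. \<bar>z\<bar> \<le> norm h + norm u1 \<Longrightarrow> \<bar>fx (Suc 0) t z\<bar> \<le> M"
    using fx_bound[of "norm h + norm u1" "Suc 0"] by blast
  have \<kappa>M: "\<bar>\<kappa> t y\<bar> \<le> M" if "0 \<le> y" "y \<le> 1" for t y
    unfolding \<kappa>_def D_def C0_fun_simps
    by (rule M(2), rule segment_bound)
       (use that abs_C0_fun_le[of h t] abs_C0_fun_le[of u1 t] norm_ge_zero[of h] norm_ge_zero[of u1] in \<open>auto simp del: norm_ge_zero\<close>)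
  define V where "V y = Sig (h + y *\<^sub>R D)" for y
  have V_int: "V y = integral {0..1} (\<lambda>t. \<kappa> t y)" for y
    by (simp add: V_def Sig_def average_C0_HK \<kappa>_def nem_fun)
  have VM: "\<bar>V y\<bar> \<le> M" if "0 \<le> y" "y \<le> 1" for y
  proof -
    have "norm (integral {0..1} (\<lambda>t. \<kappa> t y)) \<le> integral {0..1} (\<lambda>t::real. M)"
      by (rule integral_norm_bound_integral)
         (use \<kappa>M[OF that] in \<open>auto intro!: integrable_continuous_real \<kappa>_cont continuous_intros\<close>)
    then show ?thesis by (simp add: V_int)
  qed
  have V01: "V 0 = 0" "V 1 = 0" using h u1 by (simp_all add: V_def D_def)
  have cV: "continuous_on A V" for A
    unfolding V_def by (intro continuous_on_compose2[OF continuous_Sig[of UNIV]] continuous_intros) auto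
  \<comment> \<open>The edges will occupy a set of measure at most \<open>4 * d\<close>, where
    \<open>V\<close> is bounded by \<open>M\<close>.\<close>
  define d where "d = c / (12 * (M + 1))"
  have d: "d > 0" "M * (4 * d) \<le> c / 3"
  proof -
    show "d > 0" using b M by (simp add: d_def)
    have "12 * (M + 1) * d = c" using M by (simp add: d_def)
    then show "M * (4 * d) \<le> c / 3" using \<open>d > 0\<close> by (simp add: algebra_simps)
  qed
  \<comment> \<open>Matched to \<open>sin_square_gap\<close>: a zone of height
    \<open>\<delta>\<close> of the squared sine has width below \<open>d\<close> on
    [0, 1/2].\<close>
  define \<delta> where "\<delta> = (2 * d)\<^sup>2"
  have \<delta>: "\<delta> > 0" using d by (simp add: \<delta>_def)
  define S where "S s z = smooth_step ((z - (sin (pi * s))\<^sup>2) / \<delta>)" for s z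
  have S01: "0 \<le> S s z" "S s z \<le> 1" for s z by (simp_all add: S_def smooth_step_range)
  have S_per: "S (s + 1) z = S s z" for s z
    by (simp add: S_def distrib_left)
  have cS: "continuous_on A (\<lambda>p. S (a p) z)" if "continuous_on A a" for A :: "'z::t2_space set" and a z
  proof -
    have "continuous_on UNIV smooth_step" by (rule DERIV_continuous_on) (use smooth_step_deriv in \<open>auto intro: DERIV_subset\<close>)
    moreover have "continuous_on A (\<lambda>p. (z - (sin (pi * a p))\<^sup>2) / \<delta>)"
      using that \<delta> by (intro continuous_intros) auto
    ultimately show ?thesis unfolding S_def by (rule continuous_on_compose2) simp
  qed
  have avV: "\<bar>integral {0..1} (\<lambda>s. V (S s z))\<bar> \<le> c / 3" for z
  proof -
    define v where "v = C0_of (\<lambda>s. V (S s z))"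
    have fv: "C0_fun v = (\<lambda>s. V (S s z))"
      unfolding v_def by (rule C0_fun_C0_of) (intro continuous_on_compose2[OF cV[of UNIV]] cS continuous_intros, auto simp: S_per)
    \<comment> \<open>The edge zone: outside it the step is 0 or 1, where \<open>V\<close> vanishes.
      By the symmetry of the sine it is determined by its part in [0, 1/2].\<close>
    define T where "T s \<longleftrightarrow> 0 < (z - (sin (pi * s))\<^sup>2) / \<delta> \<and> (z - (sin (pi * s))\<^sup>2) / \<delta> < 1" for s
    have vT: "T s" if "C0_fun v s \<noteq> 0" for s
      using that V01 smooth_step_cases[of "(z - (sin (pi * s))\<^sup>2) / \<delta>"] by (auto simp: fv S_def T_def)
    have T_sym: "T (1 - s) \<longleftrightarrow> T s" for s
    proof -
      have "sin (pi * (1 - s)) = sin (pi * s)" by (simp add: right_diff_distrib sin_diff)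
      then show ?thesis by (simp add: T_def)
    qed
    have gap: "s' - s < d" if "T s" "T s'" "0 \<le> s" "s \<le> s'" "s' \<le> 1/2" for s s'
    proof -
      have "(2 * (s' - s))\<^sup>2 \<le> (sin (pi * s'))\<^sup>2 - (sin (pi * s))\<^sup>2" by (rule sin_square_gap) (use that in auto)
      also have "\<dots> < \<delta>" using that(1,2) \<delta> by (simp add: T_def divide_less_eq zero_less_divide_iff)
      finally have "(2 * (s' - s))\<^sup>2 < (2 * d)\<^sup>2" by (simp add: \<delta>_def)
      then have "2 * (s' - s) < 2 * d" by (rule power2_less_imp_less) (use d in simp)
      then show ?thesis by simp
    qed
    have "\<bar>average v\<bar> \<le> M * (4 * d)"
    proof (cases "\<exists>s0. T s0 \<and> 0 \<le> s0 \<and> s0 \<le> 1/2")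
      case True
      then obtain s0 where s0: "T s0" "0 \<le> s0" "s0 \<le> 1/2" by blast
      have near: "\<bar>s - s0\<bar> \<le> d" if "T s" "0 \<le> s" "s \<le> 1/2" for s
        using gap[of s s0] gap[of s0 s] s0 that by (cases "s \<le> s0") auto
      have "\<bar>average v\<bar> \<le> M * (((s0 + d) - (s0 - d)) + ((1 - s0 + d) - (1 - s0 - d)))"
      proof (rule average_C0_support)
        show "\<bar>C0_fun v s\<bar> \<le> M" for s using VM S01 by (simp add: fv)
        fix s :: real assume s: "0 \<le> s" "s \<le> 1" "C0_fun v s \<noteq> 0"
        then have "T s" using vT by blast
        then show "s \<in> {s0 - d..s0 + d} \<union> {1 - s0 - d..1 - s0 + d}"
          using near[of s] near[of "1 - s"] T_sym[of s] s by (cases "s \<le> 1/2") (auto simp: abs_le_iff)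
      qed (use d in auto)
      then show ?thesis by simp
    next
      case False
      have "C0_fun v s = 0" if "0 \<le> s" "s \<le> 1" for s
      proof (rule ccontr)
        assume "C0_fun v s \<noteq> 0"
        then have "T s" by (rule vT)
        then show False using False T_sym[of s] that by (cases "s \<le> 1/2") (auto dest: spec[of _ "1 - s"])
      qed
      then have "v = 0" by (intro C0_eqI_on) simp
      then show ?thesis using M d by (simp add: average_zero)
    qed
    then show ?thesis using d(2) by (simp add: average_C0_HK fv)
  qed
  \<comment> \<open>The slow variable ranges over [0, 2], since t + \<sigma>/n may exceed 1.\<close>
  have "uniformly_continuous_on ({0..2} \<times> {0..1}) (\<lambda>p. \<kappa> (fst p) (snd p))"
    by (intro compact_uniformly_continuous \<kappa>_cont continuous_intros compact_Times) auto
  then obtain \<eta> where \<eta>: "\<eta> > 0" "\<And>p q. p \<in> {0..2} \<times> {0..1} \<Longrightarrow> q \<in> {0..2} \<times> {0..1} \<Longrightarrow> dist q p < \<eta> \<Longrightarrow>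
      dist (\<kappa> (fst q) (snd q)) (\<kappa> (fst p) (snd p)) < c / 3"
    unfolding uniformly_continuous_on_def using b(2) by (metis zero_less_divide_iff zero_less_numeral)
  obtain n :: nat where n: "real n > 1 / \<eta> + 1" using reals_Archimedean2 by blast
  have n0: "n > 0" "1 / real n < \<eta>" "1 / real n \<le> 1"
  proof -
    have i: "0 < 1 / \<eta>" using \<eta> by simp
    then have n1: "real n > 1" "real n > 1 / \<eta>" using n by linarith+
    then show "n > 0" "1 / real n \<le> 1" by auto
    show "1 / real n < \<eta>" using n1 \<eta>(1) by (simp add: field_simps)
  qed
  have \<theta>_ex: "\<exists>\<theta> \<theta>'. C0_fun \<theta> = (\<lambda>t. S (real n * t) z) \<and> C0_has_deriv \<theta> \<theta>'" for z
  proof (rule C0_C1_intro)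
    let ?a = "\<lambda>t. (z - (sin (pi * (real n * t)))\<^sup>2) / \<delta>"
    show "((\<lambda>t. S (real n * t) z) has_real_derivative smooth_step' (?a t) * (- (2 * sin (pi * (real n * t)) * (cos (pi * (real n * t)) * (pi * n))) / \<delta>)) (at t)" for t
      unfolding S_def
      by (rule DERIV_chain2[OF smooth_step_deriv]) (use \<delta> in \<open>auto intro!: derivative_eq_intros simp: field_simps\<close>)
    show "continuous_on UNIV (\<lambda>t. smooth_step' (?a t) * (- (2 * sin (pi * (real n * t)) * (cos (pi * (real n * t)) * (pi * n))) / \<delta>))"
      using \<delta> by (intro continuous_intros continuous_on_compose2[OF continuous_smooth_step'[of UNIV]]) auto
    \<comment> \<open>One period of t shifts the phase by n \<pi>, which multiplies sine and cosine
      by the same sign; it cancels in the square and in the product.\<close>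
    have arg: "pi * (real n * (t + 1)) = pi * (real n * t) + n * pi" for t by (simp add: algebra_simps)
    have sn: "sin (x + n * pi) = (-1) ^ n * sin x" "cos (x + n * pi) = (-1) ^ n * cos x" for x
      by (simp_all add: sin_add cos_add)
    have sq: "((-1) ^ n * x)\<^sup>2 = x\<^sup>2" "(-1) ^ n * x * ((-1) ^ n * y * w) = x * (y * w)" for x y w :: real
    proof -
      have e: "(-1) ^ n * (-1) ^ n = (1::real)" by (simp flip: power_mult_distrib)
      have "((-1) ^ n * x)\<^sup>2 = ((-1) ^ n * (-1) ^ n) * x\<^sup>2" by (simp only: power2_eq_square mult_ac)
      then show "((-1) ^ n * x)\<^sup>2 = x\<^sup>2" by (simp only: e mult_1)
      have "(-1) ^ n * x * ((-1) ^ n * y * w) = ((-1) ^ n * (-1) ^ n) * (x * (y * w))" by (simp only: mult_ac)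
      then show "(-1) ^ n * x * ((-1) ^ n * y * w) = x * (y * w)" by (simp only: e mult_1)
    qed
    show "S (real n * (t + 1)) z = S (real n * t) z" for t unfolding S_def arg sn sq ..
    show "smooth_step' ((z - (sin (pi * (real n * (t + 1))))\<^sup>2) / \<delta>) * (- (2 * sin (pi * (real n * (t + 1))) * (cos (pi * (real n * (t + 1))) * (pi * n))) / \<delta>) =
        smooth_step' (?a t) * (- (2 * sin (pi * (real n * t)) * (cos (pi * (real n * t)) * (pi * n))) / \<delta>)" for t
      unfolding arg sn sq mult.assoc[of 2] ..
  qed
  define \<Theta> where "\<Theta> z = (SOME \<theta>. \<exists>\<theta>'. C0_fun \<theta> = (\<lambda>t. S (real n * t) z) \<and> C0_has_deriv \<theta> \<theta>')" for z
  have \<Theta>: "C0_fun (\<Theta> z) = (\<lambda>t. S (real n * t) z)" "\<exists>\<theta>'. C0_has_deriv (\<Theta> z) \<theta>'" for z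
    using someI_ex[OF \<theta>_ex[of z]] unfolding \<Theta>_def by blast+
  have \<Theta>_lip: "norm (\<Theta> z - \<Theta> z') \<le> 4 / \<delta> * \<bar>z - z'\<bar>" for z z'
  proof (rule norm_C0_le)
    fix t
    have "\<bar>S (real n * t) z - S (real n * t) z'\<bar> \<le> 4 * \<bar>(z - (sin (pi * (real n * t)))\<^sup>2) / \<delta> - (z' - (sin (pi * (real n * t)))\<^sup>2) / \<delta>\<bar>"
      unfolding S_def by (rule smooth_step_lipschitz)
    also have "\<dots> = 4 / \<delta> * \<bar>z - z'\<bar>" using \<delta> by (simp add: diff_divide_distrib[symmetric] abs_divide)
    finally show "\<bar>C0_fun (\<Theta> z - \<Theta> z') t\<bar> \<le> 4 / \<delta> * \<bar>z - z'\<bar>" by (simp add: \<Theta>)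
  qed
  have c\<Theta>: "continuous_on A \<Theta>" for A
  proof (rule continuous_on_subset[of UNIV])
    show "continuous_on UNIV \<Theta>"
      unfolding continuous_on_iff
    proof (intro ballI allI impI)
      fix z e :: real assume e: "e > 0"
      show "\<exists>d>0. \<forall>z'\<in>UNIV. dist z' z < d \<longrightarrow> dist (\<Theta> z') (\<Theta> z) < e"
      proof (intro exI[of _ "e * \<delta> / 4"] conjI ballI impI)
        show "e * \<delta> / 4 > 0" using e \<delta> by simp
        fix z' assume "dist z' z < e * \<delta> / 4"
        then have "4 / \<delta> * \<bar>z' - z\<bar> < 4 / \<delta> * (e * \<delta> / 4)" using \<delta> by (intro mult_strict_left_mono) (auto simp: dist_real_def)
        then show "dist (\<Theta> z') (\<Theta> z) < e" using \<Theta>_lip[of z' z] \<delta> by (simp add: dist_norm)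
      qed
    qed
  qed simp
  \<comment> \<open>The level runs up to \<open>1 + \<delta>\<close>, so that at
    \<open>\<mu> = 1\<close> the step is saturated even where the squared sine is 1.\<close>
  define X where "X \<mu> = h + mult_C0 (\<Theta> (\<mu> * (1 + \<delta>))) D" for \<mu> :: real
  have X_apply: "C0_fun (X \<mu>) t = C0_fun h t + S (real n * t) (\<mu> * (1 + \<delta>)) * C0_fun D t" for \<mu> t
    by (simp add: X_def \<Theta>)
  have X0: "X 0 = h"
  proof (rule C0_eqI)
    fix t have "S (real n * t) 0 = 0" unfolding S_def using \<delta> by (intro smooth_step_nonpos) (simp add: divide_le_0_iff)
    then show "C0_fun (X 0) t = C0_fun h t" by (simp add: X_apply)
  qed
  have X1: "X 1 = u1"
  proof (rule C0_eqI)
    fix t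
    have "(sin (pi * (real n * t)))\<^sup>2 \<le> 1" by (simp add: abs_square_le_1)
    then have "S (real n * t) (1 + \<delta>) = 1" unfolding S_def using \<delta> by (intro smooth_step_ge_1) (simp add: le_divide_eq)
    then show "C0_fun (X 1) t = C0_fun u1 t" by (simp add: X_apply D_def)
  qed
  have small: "\<bar>Sig (X \<mu>)\<bar> < c" for \<mu>
  proof -
    let ?z = "\<mu> * (1 + \<delta>)"
    let ?k = "\<lambda>t s. \<kappa> t (S s ?z)"
    have "\<bar>integral {0..1} (\<lambda>t. ?k t (real n * t)) - integral {0..1} (\<lambda>s. integral {0..1} (\<lambda>t. ?k t s))\<bar> \<le> c / 3"
    proof (rule two_scale_average)
      show "continuous_on UNIV (\<lambda>(t, s). ?k t s)" unfolding split_beta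
        by (intro \<kappa>_cont cS continuous_intros)
      fix t s \<sigma> :: real assume t: "0 \<le> t" "t \<le> 1" "0 \<le> \<sigma>" "\<sigma> \<le> 1"
      have q: "0 \<le> \<sigma> / n" "\<sigma> / n \<le> 1 / n" using t by (auto intro: divide_right_mono)
      have "1 / real n \<le> 1" using n0 by simp
      with q have q2: "t + \<sigma> / n \<le> 2" using t by linarith
      have "dist (\<kappa> (fst (t + \<sigma> / n, S s ?z)) (snd (t + \<sigma> / n, S s ?z))) (\<kappa> (fst (t, S s ?z)) (snd (t, S s ?z))) < c / 3"
      proof (rule \<eta>(2))
        show "(t + \<sigma> / n, S s ?z) \<in> {0..2} \<times> {0..1}" unfolding mem_Times_iff fst_conv snd_conv atLeastAtMost_iff
          using t(1) q(1) q2 S01 by (intro conjI add_nonneg_nonneg) assumption+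
        show "dist (t + \<sigma> / n, S s ?z) (t, S s ?z) < \<eta>"
          using q n0 by (simp add: dist_Pair_Pair dist_real_def)
      qed (use t S01 in auto)
      then show "\<bar>?k (t + \<sigma> / n) s - ?k t s\<bar> \<le> c / 3" by (simp add: dist_real_def)
    qed (use \<kappa>_per S_per n0 in auto)
    moreover have "integral {0..1} (\<lambda>t. ?k t (real n * t)) = Sig (X \<mu>)"
      by (simp add: Sig_def average_C0_HK nem_fun X_apply \<kappa>_def)
    moreover have "integral {0..1} (\<lambda>s. integral {0..1} (\<lambda>t. ?k t s)) = integral {0..1} (\<lambda>s. V (S s ?z))"
      by (simp add: V_int)
    ultimately show ?thesis using avV[of ?z] b(2) by linarith
  qed
  have bY: "b \<in> Y" by (rule Y(3)[OF b(1)])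
  have DY: "D \<in> Y" unfolding D_def using Y(1)[OF u1(1) Y(2)[OF h(1), of "-1"]] by simp
  obtain \<tau> where \<tau>: "Sig (X 1 + \<tau> *\<^sub>R b) = 0" "\<rho> (X 1 + \<tau> *\<^sub>R b) > 0" "Sig (X 1) = 0 \<Longrightarrow> \<tau> = 0"
  proof (rule path_control[where x = u1 and b = b and c = c and X = X and Y = Y and \<rho> = \<rho>])
    show "C0_fun (X \<mu>) t = C0_fun u1 t" if "0 \<le> \<mu>" "\<mu> \<le> 1" "0 \<le> t" "t \<le> 1" "C0_fun b t \<noteq> 0" for \<mu> t
      using agree[of t] b(3)[of t] that by (simp add: X_apply D_def)
    show "continuous_on {0..1} X" unfolding X_def
      by (intro continuous_intros bounded_linear.continuous_on[OF bounded_bilinear.bounded_linear_left[OF bounded_bilinear_mult_C0]]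
          continuous_on_compose2[OF c\<Theta>[of UNIV]]) auto
    show "X \<mu> + \<tau> *\<^sub>R b \<in> Y" for \<mu> \<tau>
      unfolding X_def using \<Theta>(2) by (intro Y(1) Y(2) h(1) bY) (metis Y(4) DY)
    show "Sig (X 0) = 0" "\<rho> (X 0) > 0" using h by (simp_all add: X0)
  qed (use b small \<rho> in blast)+
  then show ?thesis using u1(2) by (simp add: X1)
qed

end

section \<open>The fold normal form\<close>

lemma neg_before_zero:
  fixes w :: "real \<Rightarrow> real"
  assumes d: "\<And>t. (w has_real_derivative w' t) (at t)" and pos: "\<And>t. w t = 0 \<Longrightarrow> w' t > 0" and a: "w a = 0" "b < a"
  shows "w b < 0"
proof -
  have "- w (- (- b)) > 0"
  proof (rule pos_after_zero[of "\<lambda>t. - w (- t)" "\<lambda>t. w' (- t)" "- a"])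
    fix t :: real
    have "((\<lambda>t. w (- t)) has_real_derivative w' (- t) * (- 1)) (at t)"
      by (rule DERIV_chain2[OF d]) (auto intro!: derivative_eq_intros)
    from DERIV_minus[OF this] show "((\<lambda>t. - w (- t)) has_real_derivative w' (- t)) (at t)" by simp
  qed (use pos a in auto)
  then show ?thesis by simp
qed

text \<open>The signs of \<open>H\<close> at \<open>r w - e / 2\<close> and
  \<open>r w + e / 2\<close> persist for nearby \<open>w'\<close> and trap \<open>r w'\<close>
  between these two points.\<close>

lemma root_continuous:
  fixes H :: "real \<Rightarrow> 'c::metric_space \<Rightarrow> real"
  assumes c: "\<And>s. continuous_on P (H s)"
    and r: "\<And>s w. w \<in> P \<Longrightarrow> s < r w \<Longrightarrow> H s w < 0" "\<And>s w. w \<in> P \<Longrightarrow> r w < s \<Longrightarrow> H s w > 0"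
  shows "continuous_on P r"
  unfolding continuous_on_iff
proof (intro ballI allI impI)
  fix w and e :: real assume w: "w \<in> P" and e: "e > 0"
  have "H (r w - e / 2) w < 0" "H (r w + e / 2) w > 0" using r w e by auto
  then obtain d1 d2 where d: "d1 > 0" "d2 > 0"
    "\<And>w'. w' \<in> P \<Longrightarrow> dist w' w < d1 \<Longrightarrow> dist (H (r w - e / 2) w') (H (r w - e / 2) w) < - H (r w - e / 2) w"
    "\<And>w'. w' \<in> P \<Longrightarrow> dist w' w < d2 \<Longrightarrow> dist (H (r w + e / 2) w') (H (r w + e / 2) w) < H (r w + e / 2) w"
    using c[of "r w - e / 2"] c[of "r w + e / 2"] w unfolding continuous_on_iff by (metis neg_0_less_iff_less)
  show "\<exists>d>0. \<forall>w'\<in>P. dist w' w < d \<longrightarrow> dist (r w') (r w) < e"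
  proof (intro exI[of _ "min d1 d2"] conjI ballI impI)
    fix w' assume w': "w' \<in> P" "dist w' w < min d1 d2"
    have "H (r w - e / 2) w' < 0" "H (r w + e / 2) w' > 0" using d(3,4)[of w'] w' by (auto simp: dist_real_def)
    then have "\<not> r w' < r w - e / 2" "\<not> r w + e / 2 < r w'" using r w' by (meson less_asym)+
    then show "dist (r w') (r w) < e" using e by (simp add: dist_real_def abs_less_iff) 
  qed (use d in auto)
qed

text \<open>\<open>E\<close> stands for the functions of average zero, and \<open>V\<close> for the
  family of lines over them.\<close>

locale fiber_space =
  fixes E :: "'b::real_normed_vector set"
  assumes E: "subspace E" "closed E"
begin

definition V :: "(real \<times> 'b) set" where "V = UNIV \<times> E"

lemma V_subspace: "subspace V"
  unfolding V_def by (rule subspace_Times) (simp_all add: E)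

lemma V_closed: "closed V"
  unfolding V_def by (rule closed_Times) (simp_all add: E)

lemma V_mem [simp]: "(s, v) \<in> V \<longleftrightarrow> v \<in> E" by (simp add: V_def)

lemma E_0 [simp]: "0 \<in> E" using E by (simp add: subspace_0)

lemma smooth_fst: "smooth_on V fst" and smooth_snd: "smooth_on V snd"
  by (intro smooth_on_linear bounded_linear_fst bounded_linear_snd V_subspace)+

text \<open>The derivative of (h, snd) is triangular with diagonal entries \<open>h1\<close> and the
  identity, so it is invertible wherever \<open>h1\<close> does not vanish, and
  \<open>implicit_smooth\<close> applies. The inclusion \<open>e v = (0, v)\<close> yields the
  critical points \<open>m\<close>, and the identity yields the fibrewise inverse
  \<open>r\<close>.\<close>

lemma fiber_root_smooth:
  fixes h :: "real \<times> 'b \<Rightarrow> real" and \<kappa> :: "'u::real_normed_vector \<Rightarrow> real \<times> 'b"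
  assumes U: "subspace U" and h: "smooth_on V h" and h1: "dir_deriv V h (1, 0) h1"
    and \<kappa>: "\<And>y. y \<in> U \<Longrightarrow> \<kappa> y \<in> V" "continuous_on U \<kappa>"
    and e: "bounded_linear e" "\<And>y. y \<in> U \<Longrightarrow> e y \<in> V" "\<And>y. y \<in> U \<Longrightarrow> (h (\<kappa> y), snd (\<kappa> y)) = e y"
    and ne: "\<And>y. y \<in> U \<Longrightarrow> h1 (\<kappa> y) \<noteq> 0"
  shows "smooth_on U \<kappa>"
proof -
  have "smooth_on V (\<lambda>x. (h x, snd x))" by (rule smooth_on_Pair[OF V_subspace h smooth_snd])
  then obtain D where D: "tower V D" "\<And>x. x \<in> V \<Longrightarrow> D x [] = (h x, snd x)" by (rule smooth_onE_tower) blast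
  obtain H where H: "tower V H" "\<And>x. x \<in> V \<Longrightarrow> H x [] = h x" using smooth_onE_tower[OF h] by blast
  have hd: "dir_deriv V h k (\<lambda>x. H x [k])" if k: "k \<in> V" for k
    using dir_deriv_cong[OF tower_dir_deriv[OF H(1) V_subspace, of "[]" k] V_subspace k, of h "\<lambda>x. H x [k]"] H k by auto
  have D1: "D x [k] = (H x [k], snd k)" if x: "x \<in> V" and k: "k \<in> V" for x k
  proof -
    have "dir_deriv V (\<lambda>x. (h x, snd x)) k (\<lambda>x. D x [k])"
      using dir_deriv_cong[OF tower_dir_deriv[OF D(1) V_subspace, of "[]" k] V_subspace k, of "\<lambda>x. (h x, snd x)" "\<lambda>x. D x [k]"] D k by auto
    moreover have "dir_deriv V (\<lambda>x. (h x, snd x)) k (\<lambda>x. (H x [k], snd k))"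
      unfolding dir_deriv_def
    proof
      fix x assume x: "x \<in> V"
      have "((\<lambda>t. snd (x + t *\<^sub>R k)) has_vector_derivative snd k) (at 0)"
        by (intro bounded_linear.has_vector_derivative[OF bounded_linear_snd]) (auto intro!: derivative_eq_intros)
      with dir_derivD[OF hd[OF k] x]
      show "((\<lambda>t. (h (x + t *\<^sub>R k), snd (x + t *\<^sub>R k))) has_vector_derivative (H x [k], snd k)) (at 0)"
        by (rule has_vector_derivative_Pair)
    qed
    ultimately show ?thesis using dir_deriv_unique x by metis
  qed
  have e10: "(1, 0) \<in> V" by simp
  have H1: "H x [(1, 0)] = h1 x" if "x \<in> V" for x
    using dir_deriv_unique[OF hd[OF e10] h1 that] .
  have ml: "bounded_multilinear_on V 1 (H x)" if "x \<in> V" for x using H(1) that by (auto simp: tower_def)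
  have Hlin: "H x [(a, k)] = a * h1 x + H x [(0, k)]" if x: "x \<in> V" and k: "k \<in> E" for x a k
    using bounded_multilinear_on_slot[OF ml[OF x], of "[]" "[]" "(1, 0)" "(0, k)" a] H1[OF x] k by simp
  \<comment> \<open>Back substitution in the triangular system.\<close>
  define L where "L y p = ((fst p - H (\<kappa> y) [(0, snd p)]) / h1 (\<kappa> y), snd p)" for y and p :: "real \<times> 'b"
  show ?thesis
  proof (rule implicit_smooth[OF U V_subspace V_closed V_subspace V_closed D(1), where e = e and L = L])
    show "D x [] \<in> V" if "x \<in> V" for x using D(2) that by (auto simp: V_def)
    show "D (\<kappa> y) [] = e y" if "y \<in> U" for y using D(2)[OF \<kappa>(1)[OF that]] e(3)[OF that] by simp
    show LV: "L y r \<in> V" if "y \<in> U" "r \<in> V" for y r using that by (auto simp: L_def V_def)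
    show "D (\<kappa> y) [L y r] = r" if y: "y \<in> U" and r: "r \<in> V" for y r
    proof -
      obtain a k where ak: "r = (a, k)" "k \<in> E" using r by (auto simp: V_def)
      show ?thesis unfolding D1[OF \<kappa>(1)[OF y] LV[OF y r]]
        using Hlin[OF \<kappa>(1)[OF y] ak(2), of "(a - H (\<kappa> y) [(0, k)]) / h1 (\<kappa> y)"] ne[OF y] by (simp add: L_def ak)
    qed
    show "L y (D (\<kappa> y) [x]) = x" if y: "y \<in> U" and x: "x \<in> V" for y x
    proof -
      obtain a k where ak: "x = (a, k)" "k \<in> E" using x by (auto simp: V_def)
      show ?thesis unfolding D1[OF \<kappa>(1)[OF y] x]
        using Hlin[OF \<kappa>(1)[OF y] ak(2), of a] ne[OF y] by (simp add: L_def ak)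
    qed
    show "\<exists>C. \<forall>r\<in>V. norm (L y r) \<le> C * norm r" if y: "y \<in> U" for y
    proof -
      obtain C where C: "C \<ge> 0" "\<And>hs. length hs = 1 \<Longrightarrow> set hs \<subseteq> V \<Longrightarrow> norm (H (\<kappa> y) hs) \<le> C * prod_list (map norm hs)"
        using bounded_multilinear_on_bound[OF ml[OF \<kappa>(1)[OF y]]] by metis
      have "norm (L y r) \<le> ((1 + C) / \<bar>h1 (\<kappa> y)\<bar> + 1) * norm r" if r: "r \<in> V" for r
      proof -
        obtain a k where ak: "r = (a, k)" "k \<in> E" using r by (auto simp: V_def)
        have n: "\<bar>a\<bar> \<le> norm r" "norm k \<le> norm r" using norm_fst_le[of a k] norm_snd_le[of k a] by (auto simp: ak)
        have "\<bar>H (\<kappa> y) [(0, k)]\<bar> \<le> C * norm k" using C(2)[of "[(0, k)]"] ak by (simp add: norm_Pair)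
        also have "\<dots> \<le> C * norm r" using n C by (intro mult_left_mono)
        finally have "\<bar>a - H (\<kappa> y) [(0, k)]\<bar> \<le> (1 + C) * norm r" using n(1) by (simp add: distrib_right)
        then have "\<bar>(a - H (\<kappa> y) [(0, k)]) / h1 (\<kappa> y)\<bar> \<le> (1 + C) / \<bar>h1 (\<kappa> y)\<bar> * norm r"
          by (simp add: abs_divide divide_right_mono)
        moreover have "norm (L y r) \<le> \<bar>(a - H (\<kappa> y) [(0, k)]) / h1 (\<kappa> y)\<bar> + norm k"
          unfolding L_def ak using norm_Pair_le[of "(a - H (\<kappa> y) [(0, k)]) / h1 (\<kappa> y)" k] by simp
        ultimately show ?thesis using n(2) by (simp add: distrib_right)
      qed
      then show ?thesis by blast
    qed
  qed (use \<kappa> e in auto)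
qed

text \<open>Contracts each line to its point over 0 with the parameter fixed, since the Taylor
  remainder is taken along a line and not towards the origin of \<open>V\<close>.\<close>

definition scale :: "real \<Rightarrow> real \<times> 'b \<Rightarrow> real \<times> 'b" where "scale r x = (r * fst x, snd x)"

lemma scale_in [simp]: "x \<in> V \<Longrightarrow> scale r x \<in> V" by (auto simp: scale_def V_def)

lemma norm_scale: "0 \<le> r \<Longrightarrow> r \<le> 1 \<Longrightarrow> norm (scale r x) \<le> norm x"
  unfolding scale_def norm_prod_def
  by (intro real_sqrt_le_mono add_mono power_mono) (auto simp: abs_mult mult_left_le_one_le)

lemma scale_lin: "scale r (x + t *\<^sub>R h) = scale r x + t *\<^sub>R scale r h" "scale r (x - y) = scale r x - scale r y"
  by (auto simp: scale_def algebra_simps)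

text \<open>Differentiation under the integral makes \<open>G (h # hs)\<close> the derivative of
  \<open>G hs\<close>, so local bounds uniform in the integration variable are what remains. They
  come from compactness of the segment \<open>scale r x\<close>, which is covered by finitely many
  balls on which the tower is bounded.\<close>

lemma smooth_on_integral:
  fixes \<psi> :: "real \<times> 'b \<Rightarrow> real"
  assumes \<psi>: "smooth_on V \<psi>"
  shows "smooth_on V (\<lambda>x. integral {0..1} (\<lambda>r. (1 - r) * \<psi> (scale r x)))"
proof -
  obtain D where D: "tower V D" "\<And>x. x \<in> V \<Longrightarrow> D x [] = \<psi> x" using smooth_onE_tower[OF \<psi>] by blast
  define G where "G hs x = integral {0..1} (\<lambda>r. (1 - r) * D (scale r x) (map (scale r) hs))" for hs x
  have cont: "continuous_on UNIV (\<lambda>p. (1 - snd p) * D (scale (snd p) (x + fst p *\<^sub>R h)) (map (scale (snd p)) hs))"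
    if x: "x \<in> V" and h: "h \<in> V" and hs: "set hs \<subseteq> V" for x h hs
    unfolding continuous_on_def
  proof
    fix p :: "real \<times> real"
    have sc: "((\<lambda>p::real \<times> real. scale (snd p) (a + fst p *\<^sub>R b)) \<longlongrightarrow> scale (snd p) (a + fst p *\<^sub>R b)) (at p within UNIV)" for a b :: "real \<times> 'b"
      unfolding scale_def by (intro tendsto_intros) 
    define as where "as = map (\<lambda>k. (\<lambda>p::real \<times> real. scale (snd p) k, scale (snd p) k)) hs"
    have "((\<lambda>p. D (scale (snd p) (x + fst p *\<^sub>R h)) (map (\<lambda>q. fst q p) as)) \<longlongrightarrow>
        D (scale (snd p) (x + fst p *\<^sub>R h)) (map snd as)) (at p within UNIV)"
    proof (rule tower_tendsto[OF D(1) V_subspace sc])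
      show "scale (snd q) (x + fst q *\<^sub>R h) \<in> V" for q :: "real \<times> real"
        using V_subspace x h by (simp add: subspace_add subspace_scale)
      show "scale (snd p) (x + fst p *\<^sub>R h) \<in> V" using V_subspace x h by (simp add: subspace_add subspace_scale)
      fix q assume "q \<in> set as"
      then obtain k where k: "k \<in> set hs" "q = (\<lambda>p::real \<times> real. scale (snd p) k, scale (snd p) k)" by (auto simp: as_def)
      then show "(\<forall>t. fst q t \<in> V) \<and> snd q \<in> V \<and> (fst q \<longlongrightarrow> snd q) (at p within UNIV)"
        using hs sc[of k 0] by auto
    qed
    then have "((\<lambda>p. D (scale (snd p) (x + fst p *\<^sub>R h)) (map (scale (snd p)) hs)) \<longlongrightarrow>
        D (scale (snd p) (x + fst p *\<^sub>R h)) (map (scale (snd p)) hs)) (at p within UNIV)"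
      by (simp add: as_def o_def)
    then show "((\<lambda>p. (1 - snd p) * D (scale (snd p) (x + fst p *\<^sub>R h)) (map (scale (snd p)) hs)) \<longlongrightarrow>
        (1 - snd p) * D (scale (snd p) (x + fst p *\<^sub>R h)) (map (scale (snd p)) hs)) (at p within UNIV)"
      by (intro tendsto_intros)
  qed
  have cont1: "continuous_on A (\<lambda>r. (1 - r) * D (scale r x) (map (scale r) hs))" if "x \<in> V" "set hs \<subseteq> V" for x hs A
  proof -
    have "continuous_on A (\<lambda>r. (\<lambda>p. (1 - snd p) * D (scale (snd p) (x + fst p *\<^sub>R 0)) (map (scale (snd p)) hs)) (0, r))"
      by (rule continuous_on_compose2[OF cont[OF that(1) _ that(2)]]) (auto intro!: continuous_intros simp: zero_prod_def)
    then show ?thesis by simp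
  qed
  have lb: "loc_bdd V {G hs | hs. length hs = n \<and> set hs \<subseteq> V \<and> (\<forall>h\<in>set hs. norm h \<le> 1)}" for n
    unfolding loc_bdd_def
  proof
    fix x assume x: "x \<in> V"
    have "\<forall>r. \<exists>\<delta> C. \<delta> > 0 \<and> C \<ge> 0 \<and> (\<forall>y hs. y \<in> V \<longrightarrow> norm (y - scale r x) < \<delta> \<longrightarrow> length hs = n \<longrightarrow> set hs \<subseteq> V \<longrightarrow>
        norm (D y hs) \<le> C * prod_list (map norm hs))"
    proof
      fix r show "\<exists>\<delta> C. \<delta> > 0 \<and> C \<ge> 0 \<and> (\<forall>y hs. y \<in> V \<longrightarrow> norm (y - scale r x) < \<delta> \<longrightarrow> length hs = n \<longrightarrow> set hs \<subseteq> V \<longrightarrow>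
        norm (D y hs) \<le> C * prod_list (map norm hs))"
        by (rule tower_loc_bound[OF D(1) V_subspace scale_in[OF x, of r], where n = n]) blast
    qed
    then obtain \<delta> C where \<delta>: "\<And>r. \<delta> r > 0" "\<And>r. C r \<ge> (0::real)"
      "\<And>r y hs. y \<in> V \<Longrightarrow> norm (y - scale r x) < \<delta> r \<Longrightarrow> length hs = n \<Longrightarrow> set hs \<subseteq> V \<Longrightarrow> norm (D y hs) \<le> C r * prod_list (map norm hs)"
      by metis
    have cs: "continuous_on {0..1} (\<lambda>r. scale r x)" unfolding scale_def by (intro continuous_intros)
    have K: "compact ((\<lambda>r. scale r x) ` {0..1})" by (rule compact_continuous_image[OF cs]) simp
    obtain R where R: "R \<subseteq> {0..1}" "finite R" "(\<lambda>r. scale r x) ` {0..1} \<subseteq> (\<Union>r\<in>R. ball (scale r x) (\<delta> r / 2))"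
    proof (rule compactE_image[OF K, of "{0..1}" "\<lambda>r. ball (scale r x) (\<delta> r / 2)"])
      show "(\<lambda>r. scale r x) ` {0..1} \<subseteq> (\<Union>r\<in>{0..1}. ball (scale r x) (\<delta> r / 2))" using \<delta>(1) by force
    qed auto
    \<comment> \<open>Half radii: if \<open>y\<close> is within \<open>d\<close> of
      \<open>x\<close>, the scaled \<open>y\<close> stays in the full ball around the centre found
      for the scaled \<open>x\<close>. The inserted 1 keeps the set nonempty.\<close>
    define d where "d = Min (insert 1 ((\<lambda>r. \<delta> r / 2) ` R))"
    define M where "M = (\<Sum>r\<in>R. C r)"
    have d: "d > 0" using R(2) \<delta>(1) by (auto simp: d_def)
    have d2: "d \<le> \<delta> r / 2" if "r \<in> R" for r unfolding d_def by (rule Min_le) (use R(2) that in auto)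
    have M: "M \<ge> 0" "\<And>r. r \<in> R \<Longrightarrow> C r \<le> M" using R(2) \<delta>(2) by (auto simp: M_def sum_nonneg intro: member_le_sum)
    have "norm (G hs y) \<le> M" if y: "y \<in> V" "norm (y - x) < d" and hs: "length hs = n" "set hs \<subseteq> V" "\<forall>h\<in>set hs. norm h \<le> 1" for y hs
    proof -
      have "norm ((1 - r) * D (scale r y) (map (scale r) hs)) \<le> M" if r: "r \<in> {0..1}" for r
      proof -
        obtain r0 where r0: "r0 \<in> R" "dist (scale r0 x) (scale r x) < \<delta> r0 / 2"
          using subsetD[OF R(3) imageI[OF r]] by auto
        have "norm (scale r y - scale r0 x) \<le> norm (scale r (y - x)) + norm (scale r x - scale r0 x)"
          using norm_triangle_ineq[of "scale r (y - x)" "scale r x - scale r0 x"] by (simp add: scale_lin)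
        also have "\<dots> < \<delta> r0" using norm_scale[of r "y - x"] r y(2) d2[OF r0(1)] r0(2)
          by (simp add: dist_norm norm_minus_commute)
        finally have "norm (D (scale r y) (map (scale r) hs)) \<le> C r0 * prod_list (map norm (map (scale r) hs))"
          by (intro \<delta>(3)) (use y hs in auto)
        also have "\<dots> \<le> M * 1"
        proof (rule mult_mono[OF M(2)[OF r0(1)]])
          show "prod_list (map norm (map (scale r) hs)) \<le> 1"
            by (rule prod_list_norm_le_1) (use hs(3) norm_scale[of r] r in \<open>auto intro: order.trans\<close>)
        qed (rule M(1) prod_list_norm_nonneg)+
        finally have "norm (D (scale r y) (map (scale r) hs)) \<le> M" by simp
        moreover have "\<bar>1 - r\<bar> * norm (D (scale r y) (map (scale r) hs)) \<le> norm (D (scale r y) (map (scale r) hs))"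
          using r by (intro mult_left_le_one_le) auto
        ultimately show ?thesis by (simp add: abs_mult)
      qed
      then have "norm (integral {0..1} (\<lambda>r. (1 - r) * D (scale r y) (map (scale r) hs))) \<le> integral {0..1} (\<lambda>r::real. M)"
        by (intro integral_norm_bound_integral integrable_continuous_real cont1 continuous_intros y hs) auto
      then show ?thesis by (simp add: G_def)
    qed
    then show "\<exists>\<delta>>0. \<exists>C. \<forall>y\<in>V. norm (y - x) < \<delta> \<longrightarrow>
        (\<forall>F\<in>{G hs | hs. length hs = n \<and> set hs \<subseteq> V \<and> (\<forall>h\<in>set hs. norm h \<le> 1)}. norm (F y) \<le> C)"
      using d by blast
  qed
  have dd: "dir_deriv V (G hs) h (G (h # hs))" if h: "h \<in> V" and hs: "set hs \<subseteq> V" for h hs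
    unfolding dir_deriv_def
  proof
    fix x assume x: "x \<in> V"
    have "((\<lambda>t. integral (cbox 0 1) (\<lambda>r. (1 - r) * D (scale r (x + t *\<^sub>R h)) (map (scale r) hs))) has_vector_derivative
        integral (cbox 0 1) (\<lambda>r. (1 - r) * D (scale r (x + 0 *\<^sub>R h)) (map (scale r) (h # hs)))) (at 0 within UNIV)"
    proof (rule leibniz_rule_vector_derivative)
      fix t r :: real
      have xt: "scale r x + t *\<^sub>R scale r h \<in> V" using V_subspace x h by (simp add: subspace_add subspace_scale)
      have "((\<lambda>t. D (scale r x + t *\<^sub>R scale r h) (map (scale r) hs)) has_vector_derivative
          D (scale r x + t *\<^sub>R scale r h) (scale r h # map (scale r) hs)) (at t)"
        by (rule dir_deriv_line[OF tower_dir_deriv[OF D(1) V_subspace] V_subspace]) (use x h hs in auto)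
      from has_vector_derivative_mult_right[OF this, of "1 - r"]
      show "((\<lambda>t. (1 - r) * D (scale r (x + t *\<^sub>R h)) (map (scale r) hs)) has_vector_derivative
          (1 - r) * D (scale r (x + t *\<^sub>R h)) (map (scale r) (h # hs))) (at t within UNIV)"
        by (simp add: scale_lin)
    next
      fix t :: real
      show "(\<lambda>r. (1 - r) * D (scale r (x + t *\<^sub>R h)) (map (scale r) hs)) integrable_on cbox 0 1"
        using V_subspace x h hs by (auto intro!: integrable_continuous_real cont1 simp: subspace_add subspace_scale)
    next
      show "continuous_on (UNIV \<times> cbox 0 1) (\<lambda>(t, r). (1 - r) * D (scale r (x + t *\<^sub>R h)) (map (scale r) (h # hs)))"
        using continuous_on_subset[OF cont[OF x h, of "h # hs"] subset_UNIV] h hs by (simp add: split_beta)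
    qed auto
    then show "((\<lambda>t. G hs (x + t *\<^sub>R h)) has_vector_derivative G (h # hs) x) (at 0)" by (simp add: G_def)
  qed
  have us: "usm V k {G hs | hs. length hs = n \<and> set hs \<subseteq> V \<and> (\<forall>h\<in>set hs. norm h \<le> 1)}" for k n
  proof (induction k arbitrary: n)
    case 0 then show ?case using lb by simp
  next
    case (Suc k)
    show ?case
    proof (rule usm_SucI[OF lb Suc.IH[of "Suc n"]])
      fix F h assume "F \<in> {G hs | hs. length hs = n \<and> set hs \<subseteq> V \<and> (\<forall>h\<in>set hs. norm h \<le> 1)}" and h: "h \<in> V" "norm h \<le> 1"
      then obtain hs where hs: "F = G hs" "length hs = n" "set hs \<subseteq> V" "\<forall>h\<in>set hs. norm h \<le> 1" by auto
      then have "G (h # hs) \<in> {G hs | hs. length hs = Suc n \<and> set hs \<subseteq> V \<and> (\<forall>h\<in>set hs. norm h \<le> 1)}"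
        using h by (intro CollectI exI[of _ "h # hs"]) auto
      with dd[OF h(1) hs(3)] show "\<exists>F'\<in>{G hs | hs. length hs = Suc n \<and> set hs \<subseteq> V \<and> (\<forall>h\<in>set hs. norm h \<le> 1)}. dir_deriv V F h F'"
        unfolding hs(1) by (rule rev_bexI[where P = "dir_deriv V (G hs) h", rotated])
    qed
  qed
  have "smooth_on V (G [])"
    by (rule smooth_onI_usm[OF V_subspace], rule usm_subset[OF us[of _ 0]]) auto
  moreover have "G [] x = integral {0..1} (\<lambda>r. (1 - r) * \<psi> (scale r x))" if "x \<in> V" for x
    using D(2)[OF scale_in[OF that]] by (simp add: G_def)
  ultimately show ?thesis by (subst smooth_on_cong) auto
qed

end

section \<open>The parametrised Morse lemma\<close>

lemma taylor_integral:
  fixes g g1 g2 :: "real \<Rightarrow> real"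
  assumes d: "\<And>s. (g has_real_derivative g1 s) (at s)" "\<And>s. (g1 has_real_derivative g2 s) (at s)"
    and c: "continuous_on UNIV g2"
  shows "g s = g 0 + s * g1 0 + s\<^sup>2 * integral {0..1} (\<lambda>r. (1 - r) * g2 (r * s))"
proof -
  \<comment> \<open>This function of \<open>r\<close> leads from the first-order expansion at
    \<open>r = 0\<close> to \<open>g s\<close> at \<open>r = 1\<close>, and the terms with
    \<open>g1\<close> cancel in its derivative.\<close>
  have "((\<lambda>r. g (r * s) + (1 - r) * (s * g1 (r * s))) has_vector_derivative s\<^sup>2 * ((1 - r) * g2 (r * s))) (at r within {0..1})" for r
  proof -
    have "((\<lambda>r. g (r * s)) has_real_derivative g1 (r * s) * s) (at r)" "((\<lambda>r. g1 (r * s)) has_real_derivative g2 (r * s) * s) (at r)"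
      by (rule DERIV_chain2[OF d(1)] DERIV_chain2[OF d(2)], auto intro!: derivative_eq_intros)+
    then have "((\<lambda>r. g (r * s) + (1 - r) * (s * g1 (r * s))) has_real_derivative s\<^sup>2 * ((1 - r) * g2 (r * s))) (at r)"
      by (auto intro!: derivative_eq_intros simp: algebra_simps power2_eq_square)
    then show ?thesis by (simp add: has_real_derivative_iff_has_vector_derivative has_vector_derivative_at_within)
  qed
  from fundamental_theorem_of_calculus[OF _ this]
  have "((\<lambda>r. s\<^sup>2 * ((1 - r) * g2 (r * s))) has_integral g s - (g 0 + s * g1 0)) {0..1}" by simp
  then have "integral {0..1} (\<lambda>r. s\<^sup>2 * ((1 - r) * g2 (r * s))) = g s - (g 0 + s * g1 0)" by (rule integral_unique)
  then show ?thesis by simp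
qed

text \<open>Normalised to minima: \<open>global_fold\<close> multiplies the reduced function by the
  sign that makes its second derivative positive on the critical set.\<close>

locale fold_family = fiber_space E for E :: "'b::real_normed_vector set" +
  fixes \<phi> \<phi>1 \<phi>2 :: "real \<times> 'b \<Rightarrow> real"
  assumes \<phi>: "smooth_on V \<phi>" "smooth_on V \<phi>1" "smooth_on V \<phi>2"
    and \<phi>_deriv: "dir_deriv V \<phi> (1, 0) \<phi>1" "dir_deriv V \<phi>1 (1, 0) \<phi>2"
    and nondegenerate: "\<And>x. x \<in> V \<Longrightarrow> \<phi>1 x = 0 \<Longrightarrow> \<phi>2 x > 0"
    and coercive: "\<And>v. v \<in> E \<Longrightarrow> filterlim (\<lambda>s. \<phi> (s, v)) at_top at_top" "\<And>v. v \<in> E \<Longrightarrow> filterlim (\<lambda>s. \<phi> (s, v)) at_top at_bot"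
begin

lemma fiber_deriv:
  assumes "dir_deriv V G (1, 0) G'" "v \<in> E"
  shows "((\<lambda>s. G (s, v)) has_real_derivative G' (s, v)) (at s)"
  using dir_deriv_line[OF assms(1) V_subspace, of "(0, v)" s] assms(2)
  by (simp add: has_real_derivative_iff_has_vector_derivative)

lemma fiber_continuous:
  assumes "smooth_on V G" shows "continuous_on E (\<lambda>v. G (s, v))"
  by (rule continuous_on_compose2[OF smooth_on_continuous_on[OF assms V_subspace]]) (auto intro!: continuous_intros)

lemma min_exists: assumes v: "v \<in> E" shows "\<exists>s. \<phi>1 (s, v) = 0"
proof -
  \<comment> \<open>The margin 1 places 0 strictly between \<open>a\<close> and \<open>b\<close> and
    makes the minimum on [a, b] a minimum on the whole line.\<close>
  obtain b where b: "\<And>s. s \<ge> b \<Longrightarrow> \<phi> (s, v) \<ge> \<phi> (0, v) + 1"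
    using coercive(1)[OF v] unfolding filterlim_at_top eventually_at_top_linorder by blast
  obtain a where a: "\<And>s. s \<le> a \<Longrightarrow> \<phi> (s, v) \<ge> \<phi> (0, v) + 1"
    using coercive(2)[OF v] unfolding filterlim_at_top eventually_at_bot_linorder by blast
  have ab: "a < 0" "0 < b" using a[of 0] b[of 0] by force+
  have "continuous_on {a..b} (\<lambda>s. \<phi> (s, v))" by (rule DERIV_continuous_on) (use fiber_deriv[OF \<phi>_deriv(1) v] in \<open>blast intro: DERIV_subset\<close>)
  with ab obtain s where s: "s \<in> {a..b}" "\<And>y. y \<in> {a..b} \<Longrightarrow> \<phi> (s, v) \<le> \<phi> (y, v)"
    using continuous_attains_inf[of "{a..b}" "\<lambda>s. \<phi> (s, v)"] by fastforce
  have "\<phi> (s, v) \<le> \<phi> (y, v)" for y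
  proof (cases "y \<in> {a..b}")
    case False
    then have "\<phi> (y, v) \<ge> \<phi> (0, v) + 1" using a[of y] b[of y] by fastforce
    then show ?thesis using s(2)[of 0] ab by simp
  qed (use s in blast)
  then show ?thesis using DERIV_local_min[OF fiber_deriv[OF \<phi>_deriv(1) v], of 1 s] by auto
qed

definition m where "m v = (SOME s. \<phi>1 (s, v) = 0)"

lemma m: "v \<in> E \<Longrightarrow> \<phi>1 (m v, v) = 0"
  unfolding m_def using min_exists by (rule someI_ex)

text \<open>Nondegeneracy lets \<open>\<phi>1\<close> cross 0 upwards only, hence once; in
  particular the choice in \<open>m\<close> is unambiguous.\<close>

lemma m_sign: assumes v: "v \<in> E" shows "s < m v \<Longrightarrow> \<phi>1 (s, v) < 0" "m v < s \<Longrightarrow> \<phi>1 (s, v) > 0"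
  by (rule neg_before_zero[OF fiber_deriv[OF \<phi>_deriv(2) v] _ m[OF v]] pos_after_zero[OF fiber_deriv[OF \<phi>_deriv(2) v] _ m[OF v]];
      use v nondegenerate in auto)+

lemma smooth_m: "smooth_on E m"
proof -
  have c: "continuous_on E m"
    by (rule root_continuous[where H = "\<lambda>s v. \<phi>1 (s, v)"]) (use m_sign fiber_continuous[OF \<phi>(2)] in auto)
  have "smooth_on E (\<lambda>v. (m v, v))"
  proof (rule fiber_root_smooth[OF E(1) \<phi>(2) \<phi>_deriv(2), where e = "\<lambda>v. (0, v)"])
    show "bounded_linear (\<lambda>v::'b. (0::real, v))" by (intro bounded_linear_Pair bounded_linear_zero bounded_linear_ident)
    show "\<phi>2 (m v, v) \<noteq> 0" if "v \<in> E" for v using nondegenerate[of "(m v, v)"] m that by force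
  qed (use m c in \<open>auto intro!: continuous_intros\<close>)
  from smooth_on_linear_compose[OF bounded_linear_fst E(1) this] show ?thesis by simp
qed

lemma smooth_m_snd: "smooth_on V (\<lambda>p. m (snd p))"
  by (rule smooth_on_compose[OF V_subspace E smooth_m smooth_snd]) (auto simp: V_def)

definition shift :: "real \<times> 'b \<Rightarrow> real \<times> 'b" where "shift p = (fst p + m (snd p), snd p)"

lemma smooth_shift: "smooth_on V shift"
  unfolding shift_def[abs_def] by (intro smooth_on_Pair smooth_on_add V_subspace smooth_fst smooth_snd smooth_m_snd)

lemma shift_in: "p \<in> V \<Longrightarrow> shift p \<in> V" by (auto simp: shift_def V_def)

definition \<mu> where "\<mu> v = \<phi> (m v, v)"

lemma smooth_\<mu>: "smooth_on E \<mu>"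
  unfolding \<mu>_def[abs_def]
  by (rule smooth_on_compose[OF E(1) V_subspace V_closed \<phi>(1) smooth_on_Pair[OF E(1) smooth_m smooth_on_linear[OF bounded_linear_ident E(1)]]]) auto

definition q where "q p = integral {0..1} (\<lambda>r. (1 - r) * \<phi>2 (shift (scale r p)))"

lemma smooth_q: "smooth_on V q"
  unfolding q_def[abs_def]
  by (rule smooth_on_integral, rule smooth_on_compose[OF V_subspace V_subspace V_closed \<phi>(3) smooth_shift shift_in])

lemma shifted: assumes p: "p \<in> V" shows "\<phi> (shift p) = \<mu> (snd p) + (fst p)\<^sup>2 * q p"
proof -
  obtain s v where sv: "p = (s, v)" "v \<in> E" using p by (auto simp: V_def)
  have D: "((\<lambda>s. G (s + m v, v)) has_real_derivative G' (s + m v, v)) (at s)" if "dir_deriv V G (1, 0) G'" for s G G'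
    using fiber_deriv[OF that sv(2), of "s + m v"] unfolding DERIV_shift by simp
  have "continuous_on UNIV (\<lambda>s. \<phi>2 (s + m v, v))"
    by (rule continuous_on_compose2[OF smooth_on_continuous_on[OF \<phi>(3) V_subspace]]) (auto intro!: continuous_intros simp: sv)
  from taylor_integral[OF D[OF \<phi>_deriv(1)] D[OF \<phi>_deriv(2)] this, of s] m[OF sv(2)]
  show ?thesis by (simp add: sv shift_def \<mu>_def q_def scale_def)
qed

lemma shifted_strict: assumes v: "v \<in> E" and s: "s \<noteq> m v" shows "\<phi> (s, v) > \<mu> v"
proof (cases "s < m v")
  case True
  then show ?thesis unfolding \<mu>_def using m_sign(1)[OF v] fiber_deriv[OF \<phi>_deriv(1) v]
    by (intro DERIV_neg_imp_decreasing_open[of s "m v" "\<lambda>s. \<phi> (s, v)"]) 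
       (auto intro!: DERIV_continuous_on[of _ "\<lambda>s. \<phi> (s, v)" "\<lambda>s. \<phi>1 (s, v)"] intro: DERIV_subset)
next
  case False
  then show ?thesis unfolding \<mu>_def using s m_sign(2)[OF v] fiber_deriv[OF \<phi>_deriv(1) v]
    by (intro DERIV_pos_imp_increasing_open[of "m v" s "\<lambda>s. \<phi> (s, v)"]) 
       (auto intro!: DERIV_continuous_on[of _ "\<lambda>s. \<phi> (s, v)" "\<lambda>s. \<phi>1 (s, v)"] intro: DERIV_subset)
qed

text \<open>Away from the minimum, \<open>q\<close> is the positive number \<phi> - \<mu> divided by
  a square. At the minimum the integrand is \<open>1 - r\<close> times a constant, which leaves half
  of \<open>\<phi>2\<close>.\<close>

lemma q_pos: assumes p: "p \<in> V" shows "q p > 0"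
proof -
  obtain s v where sv: "p = (s, v)" "v \<in> E" using p by (auto simp: V_def)
  show ?thesis
  proof (cases "s = 0")
    case False
    then have "\<phi> (shift p) > \<mu> v" using shifted_strict[OF sv(2), of "s + m v"] by (simp add: sv shift_def)
    then show ?thesis using shifted[OF p] False by (simp add: sv zero_less_mult_iff)
  next
    case True
    have "((\<lambda>r::real. r - r\<^sup>2 / 2) has_vector_derivative (1 - r)) (at r within {0..1})" for r
      unfolding has_real_derivative_iff_has_vector_derivative[symmetric]
      by (auto intro!: derivative_eq_intros simp: field_simps)
    from fundamental_theorem_of_calculus[OF _ this] have "integral {0..1} (\<lambda>r::real. 1 - r) = 1 / 2"
      by (intro integral_unique) simp
    then have "q p = 1 / 2 * \<phi>2 (m v, v)"
      unfolding q_def by (simp add: True sv shift_def scale_def)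
    then show ?thesis using nondegenerate[of "(m v, v)"] m sv(2) by simp
  qed
qed

text \<open>The signed square root of \<phi> - \<mu> on the shifted line; with the factor
  \<open>fst p\<close> taken out of the root it is smooth across 0.\<close>

definition X :: "real \<times> 'b \<Rightarrow> real" where "X p = fst p * sqrt (q p)"

lemma smooth_X: "smooth_on V X"
  unfolding X_def[abs_def]
  by (rule smooth_on_bilinear[OF bounded_bilinear_mult V_subspace smooth_fst smooth_on_sqrt[OF V_subspace smooth_q q_pos]])

lemma X_square: "p \<in> V \<Longrightarrow> (X p)\<^sup>2 = \<phi> (shift p) - \<mu> (snd p)"
  using shifted[of p] q_pos[of p] by (simp add: X_def power_mult_distrib)

lemma X_sign: assumes "(s, v) \<in> V" shows "X (s, v) > 0 \<longleftrightarrow> s > 0" "X (s, v) < 0 \<longleftrightarrow> s < 0"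
  using q_pos[OF assms] by (auto simp: X_def zero_less_mult_iff mult_less_0_iff)

text \<open>Off 0, differentiating the square of \<open>X\<close> gives 2 X X1 = \<phi>1, and
  \<open>X\<close> and \<open>\<phi>1\<close> have the same sign. At 0 this relation is void, and
  the limit of the quotients X/h = sqrt q is taken instead.\<close>

lemma X_deriv:
  assumes d: "dir_deriv V X (1, 0) X1" and p: "p \<in> V" shows "X1 p > 0"
proof -
  obtain s v where sv: "p = (s, v)" "v \<in> E" using p by (auto simp: V_def)
  note D = fiber_deriv[OF d sv(2)]
  show ?thesis
  proof (cases "s = 0")
    case True
    have "((\<lambda>h. (X (0 + h, v) - X (0, v)) / h) \<longlongrightarrow> X1 (0, v)) (at 0)" using D[of 0] by (simp add: DERIV_def)
    moreover have "((\<lambda>h. (X (0 + h, v) - X (0, v)) / h) \<longlongrightarrow> sqrt (q (0, v))) (at 0)"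
    proof (rule Lim_transform_eventually)
      have "continuous_on UNIV (\<lambda>h. q (h, v))"
        by (rule continuous_on_compose2[OF smooth_on_continuous_on[OF smooth_q V_subspace]]) (auto intro!: continuous_intros simp: sv)
      then show "((\<lambda>h. sqrt (q (h, v))) \<longlongrightarrow> sqrt (q (0, v))) (at 0)"
        by (intro tendsto_intros) (simp add: continuous_on_def)
      show "\<forall>\<^sub>F h in at 0. sqrt (q (h, v)) = (X (0 + h, v) - X (0, v)) / h"
        by (rule eventually_mono[OF eventually_neq_at_within[of 0]]) (simp add: X_def)
    qed
    ultimately have "X1 (0, v) = sqrt (q (0, v))" by (rule tendsto_unique[OF trivial_limit_at])
    then show ?thesis using q_pos[OF p] by (simp add: sv True)
  next
    case False
    have "((\<lambda>s. (X (s, v))\<^sup>2) has_real_derivative 2 * X (s, v) * X1 (s, v)) (at s)"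
      using D[of s] by (auto intro!: derivative_eq_intros)
    moreover have "(\<lambda>s. (X (s, v))\<^sup>2) = (\<lambda>s. \<phi> (s + m v, v) - \<mu> v)"
      using X_square[of "(_, v)"] sv(2) by (auto simp: shift_def)
    ultimately have "((\<lambda>s. \<phi> (s + m v, v) - \<mu> v) has_real_derivative 2 * X (s, v) * X1 (s, v)) (at s)" by simp
    moreover have "((\<lambda>s. \<phi> (s + m v, v) - \<mu> v) has_real_derivative \<phi>1 (s + m v, v)) (at s)"
      using fiber_deriv[OF \<phi>_deriv(1) sv(2), of "s + m v"] by (auto intro!: derivative_eq_intros simp: DERIV_shift)
    ultimately have e: "2 * X (s, v) * X1 (s, v) = \<phi>1 (s + m v, v)" by (rule DERIV_unique)
    show ?thesis
    proof (cases "s > 0")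
      case True
      then have "X (s, v) > 0" "\<phi>1 (s + m v, v) > 0" using X_sign[of s v] m_sign[OF sv(2)] sv(2) by auto
      then show ?thesis using e by (metis mult_pos_pos sv(1) zero_less_mult_pos zero_less_numeral)
    next
      case F: False
      then have "X (s, v) < 0" "\<phi>1 (s + m v, v) < 0" using False X_sign[of s v] m_sign[OF sv(2)] sv(2) by auto
      then have "2 * X (s, v) * X1 (s, v) < 0" "2 * X (s, v) < 0" using e by auto
      then show ?thesis unfolding sv mult_less_0_iff by linarith
    qed
  qed
qed

lemma X_mono: assumes v: "v \<in> E" and st: "s < t" shows "X (s, v) < X (t, v)"
proof -
  obtain X1 where X1: "dir_deriv V X (1, 0) X1" using smooth_on_dir_deriv[OF V_subspace smooth_X, of "(1, 0)"] by auto
  show ?thesis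
    by (rule DERIV_pos_imp_increasing[OF st]) (use fiber_deriv[OF X1 v] X_deriv[OF X1] v in \<open>blast intro: V_mem[THEN iffD2]\<close>)
qed

text \<open>The square of \<open>X\<close> is \<phi> - \<mu>, which tends to infinity at both ends,
  while the sign of \<open>X\<close> is that of the coordinate; the intermediate value theorem
  applies.\<close>

lemma X_surj: assumes v: "v \<in> E" shows "\<exists>s. X (s, v) = y"
proof -
  have c: "continuous_on A (\<lambda>s. X (s, v))" for A
    by (rule continuous_on_compose2[OF smooth_on_continuous_on[OF smooth_X V_subspace]]) (auto intro!: continuous_intros simp: v)
  have sq: "(X (s, v))\<^sup>2 = \<phi> (s + m v, v) - \<mu> v" for s using X_square[of "(s, v)"] v by (simp add: shift_def)
  obtain b where b: "\<And>s. s \<ge> b \<Longrightarrow> \<phi> (s, v) \<ge> \<mu> v + y\<^sup>2"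
    using coercive(1)[OF v] unfolding filterlim_at_top eventually_at_top_linorder by blast
  obtain a where a: "\<And>s. s \<le> a \<Longrightarrow> \<phi> (s, v) \<ge> \<mu> v + y\<^sup>2"
    using coercive(2)[OF v] unfolding filterlim_at_top eventually_at_bot_linorder by blast
  define t where "t = max (b - m v) 1" define s where "s = min (a - m v) (-1)"
  have "b \<le> t + m v" "s + m v \<le> a" by (simp_all add: t_def s_def max_def min_def)
  from b[OF this(1)] a[OF this(2)] have t: "t > 0" "y\<^sup>2 \<le> (X (t, v))\<^sup>2" and s: "s < 0" "y\<^sup>2 \<le> (X (s, v))\<^sup>2"
    by (simp_all add: sq) (simp_all add: t_def s_def)
  have "\<bar>y\<bar> \<le> \<bar>X (t, v)\<bar>" "\<bar>y\<bar> \<le> \<bar>X (s, v)\<bar>" using s(2) t(2) by (simp_all add: abs_le_square_iff)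
  moreover have "X (t, v) > 0" "X (s, v) < 0" using X_sign s(1) t(1) v by auto
  ultimately have "X (s, v) \<le> y" "y \<le> X (t, v)" by linarith+
  then show ?thesis using IVT'[of "\<lambda>s. X (s, v)" s y t] c s(1) t(1) by auto
qed

definition r where "r p = (SOME s. X (s, snd p) = fst p)"

lemma X_r: assumes "p \<in> V" shows "X (r p, snd p) = fst p"
proof -
  have "snd p \<in> E" using assms by (auto simp: V_def)
  from X_surj[OF this, of "fst p"] show ?thesis unfolding r_def by (rule someI_ex)
qed

lemma r_X: assumes v: "v \<in> E" shows "r (X (s, v), v) = s"
  using X_r[of "(X (s, v), v)"] X_mono[OF v, of "r (X (s, v), v)" s] X_mono[OF v, of s "r (X (s, v), v)"] v by force

lemma smooth_r: "smooth_on V r"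
proof -
  have c: "continuous_on V r"
  proof (rule root_continuous[where H = "\<lambda>s p. X (s, snd p) - fst p"])
    show "continuous_on V (\<lambda>p. X (s, snd p) - fst p)" for s
      by (intro continuous_intros continuous_on_compose2[OF smooth_on_continuous_on[OF smooth_X V_subspace]]) (auto simp: V_def)
    show "X (s, snd p) - fst p < 0" if "p \<in> V" "s < r p" for s p using X_mono[OF _ that(2), of "snd p"] X_r[OF that(1)] that(1) by (auto simp: V_def)
    show "X (s, snd p) - fst p > 0" if "p \<in> V" "r p < s" for s p using X_mono[OF _ that(2), of "snd p"] X_r[OF that(1)] that(1) by (auto simp: V_def)
  qed
  obtain X1 where X1: "dir_deriv V X (1, 0) X1" using smooth_on_dir_deriv[OF V_subspace smooth_X, of "(1, 0)"] by auto
  have "smooth_on V (\<lambda>p. (r p, snd p))"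
  proof (rule fiber_root_smooth[OF V_subspace smooth_X X1, where e = "\<lambda>p. p"])
    show "X1 (r p, snd p) \<noteq> 0" if "p \<in> V" for p using X_deriv[OF X1, of "(r p, snd p)"] that by (auto simp: V_def)
  qed (use X_r c in \<open>auto intro!: continuous_intros simp: V_def\<close>)
  from smooth_on_linear_compose[OF bounded_linear_fst V_subspace this] show ?thesis by simp
qed

theorem normal_form:
  obtains \<Theta> \<Theta>' :: "real \<times> 'b \<Rightarrow> real \<times> 'b" and \<nu> where "smooth_on V \<Theta>" "smooth_on V \<Theta>'" "smooth_on E \<nu>"
    "\<And>p. p \<in> V \<Longrightarrow> \<Theta> p \<in> V" "\<And>p. p \<in> V \<Longrightarrow> \<Theta>' p \<in> V"
    "\<And>p. p \<in> V \<Longrightarrow> \<Theta> (\<Theta>' p) = p" "\<And>p. p \<in> V \<Longrightarrow> \<Theta>' (\<Theta> p) = p" "\<And>p. p \<in> V \<Longrightarrow> snd (\<Theta>' p) = snd p"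
    "\<And>p. p \<in> V \<Longrightarrow> \<phi> (\<Theta>' p) = \<nu> (snd p) + (fst p)\<^sup>2"
proof
  \<comment> \<open>\<open>?\<Theta>\<close> moves the minimum to 0 and then applies
    \<open>X\<close> on the line; \<open>?\<Theta>'\<close> inverts \<open>X\<close> by
    \<open>r\<close> and moves back.\<close>
  let ?\<Theta> = "\<lambda>p. (X (fst p - m (snd p), snd p), snd p)" and ?\<Theta>' = "\<lambda>p. shift (r p, snd p)"
  have inV: "(fst p - m (snd p), snd p) \<in> V" "(r p, snd p) \<in> V" if "p \<in> V" for p using that by (auto simp: V_def)
  show "smooth_on V ?\<Theta>"
    by (intro smooth_on_Pair V_subspace smooth_snd,
        rule smooth_on_compose[OF V_subspace V_subspace V_closed smooth_X smooth_on_Pair[OF V_subspace smooth_on_diff[OF V_subspace smooth_fst smooth_m_snd] smooth_snd] inV(1)])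
  show "smooth_on V ?\<Theta>'"
    by (rule smooth_on_compose[OF V_subspace V_subspace V_closed smooth_shift smooth_on_Pair[OF V_subspace smooth_r smooth_snd] inV(2)])
  show "smooth_on E \<mu>" by (rule smooth_\<mu>)
  fix p assume p: "p \<in> V"
  then have v: "snd p \<in> E" by (auto simp: V_def)
  then show "?\<Theta> p \<in> V" "?\<Theta>' p \<in> V" "snd (?\<Theta>' p) = snd p" by (simp_all add: shift_def)
  show "?\<Theta> (?\<Theta>' p) = p" using X_r[OF p] by (simp add: shift_def)
  show "?\<Theta>' (?\<Theta> p) = p" using r_X[OF v] by (simp add: shift_def)
  show "\<phi> (?\<Theta>' p) = \<mu> (snd p) + (fst p)\<^sup>2"
    using X_square[OF inV(2)[OF p]] X_r[OF p] by simp
qed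

end

section \<open>Reduction to a real-valued function\<close>

text \<open>
  \<open>'a\<close> and \<open>'b\<close> play the roles of \<open>B\<^sup>1\<close> and \<open>B\<^sup>0\<close>, with the inclusions \<open>i : B\<^sup>1 \<rightarrow> C\<^sup>0\<close> and \<open>j : C\<^sup>0 \<rightarrow> B\<^sup>0\<close>,
  the derivative \<open>d\<close> and the primitive \<open>P\<close> of average zero, which kills constants.
\<close>

locale circle_pair =
  fixes i :: "'a::circle_space \<Rightarrow> C0" and j :: "C0 \<Rightarrow> 'b::circle_space" and d :: "'a \<Rightarrow> 'b" and P :: "'b \<Rightarrow> 'a"
  assumes linear_maps: "bounded_linear i" "bounded_linear j" "bounded_linear d" "bounded_linear P"
    and linear_average: "bounded_linear (average :: 'a \<Rightarrow> real)" "bounded_linear (average :: 'b \<Rightarrow> real)"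
    and const: "i (const_fun c) = const_fun c" "j (const_fun c) = const_fun c" "d (const_fun c) = 0"
    and average: "average (i u) = average u" "average (j x) = average x" "average (P w) = 0"
    and d_P: "d (P w) = w - const_fun (average w)"
    and P_d: "P (d u) = u - const_fun (average u)"
    and i_P_j: "i (P (j x)) = prim x"
    and range_mult: "C0_has_deriv \<theta> \<theta>' \<Longrightarrow> mult_C0 \<theta> (i u) \<in> range i"
begin

lemma average_d: "average (d u) = 0"
proof -
  have "d (P (d u)) = d u" unfolding P_d by (simp add: linear_diff[OF bounded_linear.linear[OF linear_maps(3)]] const)
  then have "const_fun (average (d u)) = (0 :: 'b)" unfolding d_P by simp
  then have "average (const_fun (average (d u)) :: 'b) = 0" by (simp add: average_zero)
  then show ?thesis by (simp add: average_const_fun)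
qed

text \<open>\<open>P (const_fun c)\<close> has derivative 0, so by \<open>P_d\<close> it is the
  constant of its own average, which is 0.\<close>

lemma P_const: "P (const_fun c) = 0"
proof -
  have "d (P (const_fun c)) = 0" by (simp add: d_P average_const_fun)
  with P_d[of "P (const_fun c)"] show ?thesis
    by (simp add: average const_fun_0 linear_0[OF bounded_linear.linear[OF linear_maps(4)]])
qed

lemmas lin = linear_add[OF bounded_linear.linear[OF linear_maps(1)]] linear_add[OF bounded_linear.linear[OF linear_maps(2)]]
  linear_add[OF bounded_linear.linear[OF linear_maps(3)]] linear_add[OF bounded_linear.linear[OF linear_maps(4)]]
  linear_diff[OF bounded_linear.linear[OF linear_maps(1)]] linear_diff[OF bounded_linear.linear[OF linear_maps(2)]]
  linear_diff[OF bounded_linear.linear[OF linear_maps(3)]] linear_diff[OF bounded_linear.linear[OF linear_maps(4)]]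
  linear_cmul[OF bounded_linear.linear[OF linear_maps(1)]]

text \<open>Through this, bumps and kernel functions built in C0 become elements of B1 in both
  settings.\<close>

lemma C1_in_range: assumes "C0_has_deriv p p'" shows "i (const_fun (average p) + P (j p')) = p"
  using C0_deriv_prim[OF assms] by (simp add: lin const i_P_j add.commute)

text \<open>The right side of K u = \<integral>w + p w as an element of C0. Adding a constant to
  \<open>w\<close> adds the same constant here, so the lines in B0 go to the lines in C0.\<close>

definition Q :: "'b \<Rightarrow> C0" where "Q w = const_fun (average w) + i (P w)"

lemma bounded_linear_Q: "bounded_linear Q"
  unfolding Q_def[abs_def]
  by (intro bounded_linear_add bounded_linear_compose[OF bounded_linear_const_fun] linear_average
      bounded_linear_compose[OF linear_maps(1)] linear_maps)

lemma Q_const: "Q (v + const_fun s) = Q v + s *\<^sub>R const_fun 1"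
  by (simp add: Q_def lin P_const average_simps const_fun_add const_fun_0 linear_0[OF bounded_linear.linear[OF linear_maps(1)]]
      flip: const_fun_scaleR)

end

lemma diffeomorphism_onI:
  assumes g: "smooth_on V g" "smooth_on W k" "\<And>x. x \<in> V \<Longrightarrow> g x \<in> W" "\<And>y. y \<in> W \<Longrightarrow> k y \<in> V"
    and inv: "\<And>x. x \<in> V \<Longrightarrow> k (g x) = x" "\<And>y. y \<in> W \<Longrightarrow> g (k y) = y"
  shows "diffeomorphism_on V W g"
proof -
  have b: "bij_betw g V W" by (rule bij_betw_byWitness[where f' = k]) (use assms in auto)
  have "inv_into V g y = k y" if "y \<in> W" for y
    by (rule inv_into_f_eq) (use b assms that in \<open>auto simp: bij_betw_def\<close>)
  then have "smooth_on W (inv_into V g)" using g(2) by (subst smooth_on_cong)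
  with b g(1) show ?thesis by (simp add: diffeomorphism_on_def)
qed

section \<open>Growth of the reduced function at infinity\<close>

context proper_family
begin

text \<open>By properness the zeros of f lie in a bounded strip, so f keeps its sign on the
  connected half strip beyond \<open>R\<close>. \<open>\<epsilon>\<close> selects the end; at this
  stage the signs at the two ends may differ.\<close>

lemma eventual_sign:
  assumes \<epsilon>: "\<epsilon> = 1 \<or> \<epsilon> = (-1::real)"
  obtains R \<sigma> where "\<sigma> = 1 \<or> \<sigma> = (-1::real)" "\<And>t z. t \<in> {0..1} \<Longrightarrow> z > R \<Longrightarrow> \<sigma> * fx 0 t (\<epsilon> * z) > 0"
proof -
  obtain R where R: "R \<ge> 0" "\<And>t z. \<bar>fx 0 t z\<bar> \<le> 0 \<Longrightarrow> \<bar>z\<bar> \<le> R" using level_bound[of 0] by blast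
  define g where "g p = fx 0 (fst p) (\<epsilon> * snd p)" for p :: "real \<times> real"
  have c: "continuous_on ({0..1} \<times> {R<..}) g" unfolding g_def
    using continuous_on_compose2[OF cont[of 0], where f = "\<lambda>p. (fst p, \<epsilon> * snd p)", of "{0..1} \<times> {R<..}"]
    by (force intro!: continuous_intros)
  have con: "connected (g ` ({0..1} \<times> {R<..}))"
    by (rule connected_continuous_image[OF c]) (intro convex_connected convex_Times convex_closed_interval convex_real_interval)
  have ne: "g p \<noteq> 0" if "p \<in> {0..1} \<times> {R<..}" for p
    using R(2)[of "fst p" "\<epsilon> * snd p"] that \<epsilon> R(1) by (auto simp: g_def)
  define \<sigma> where "\<sigma> = sgn (g (0, R + 1))"
  have p0: "(0::real, R + 1) \<in> {0..1} \<times> {R<..}" by simp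
  show thesis
  proof (rule that)
    show "\<sigma> = 1 \<or> \<sigma> = -1" using ne[OF p0] by (auto simp: \<sigma>_def sgn_if)
    fix t z :: real assume t: "t \<in> {0..1}" "z > R"
    then have p: "(t, z) \<in> {0..1} \<times> {R<..}" by simp
    have n0: "0 \<notin> g ` ({0..1} \<times> {R<..})" using ne by (metis imageE)
    have "g (t, z) > 0 \<longleftrightarrow> g (0, R + 1) > 0"
      using connectedD_interval[OF con imageI[OF p] imageI[OF p0], of 0] connectedD_interval[OF con imageI[OF p0] imageI[OF p], of 0] n0
        ne[OF p] ne[OF p0] by linarith
    then show "\<sigma> * fx 0 t (\<epsilon> * z) > 0" using ne[OF p] ne[OF p0]
      by (cases "g (t, z) > 0") (auto simp: \<sigma>_def g_def sgn_if)
  qed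
qed

text \<open>By \<open>\<Phi>_value\<close> the value of \<Phi> is one of f at the point of the
  shifted function over some unknown t. The growth of f is uniform in t, so it passes to
  \<Phi>.\<close>

lemma coercive_sign:
  assumes "\<epsilon> = 1 \<or> \<epsilon> = (-1::real)"
  obtains \<sigma> where "\<sigma> = 1 \<or> \<sigma> = (-1::real)" "\<And>q. filterlim (\<lambda>s. \<sigma> * \<Phi> (q + (\<epsilon> * s) *\<^sub>R const_fun 1)) at_top at_top"
proof -
  obtain R \<sigma> where \<sigma>: "\<sigma> = 1 \<or> \<sigma> = -1" "\<And>t z. t \<in> {0..1} \<Longrightarrow> z > R \<Longrightarrow> \<sigma> * fx 0 t (\<epsilon> * z) > 0"
    using eventual_sign[OF assms] by metis
  show thesis
  proof (rule that[OF \<sigma>(1)])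
    fix q show "filterlim (\<lambda>s. \<sigma> * \<Phi> (q + (\<epsilon> * s) *\<^sub>R const_fun 1)) at_top at_top"
      unfolding filterlim_at_top eventually_at_top_linorder
    proof
      fix B
      obtain R' where R': "R' \<ge> 0" "\<And>t z. \<bar>fx 0 t z\<bar> \<le> \<bar>B\<bar> \<Longrightarrow> \<bar>z\<bar> \<le> R'" using level_bound[of "\<bar>B\<bar>"] by blast
      have "B \<le> \<sigma> * \<Phi> (q + (\<epsilon> * s) *\<^sub>R const_fun 1)" if s: "s \<ge> norm q + \<bar>R\<bar> + R' + 1" for s
      proof -
        obtain t where t: "t \<in> {0..1}" "\<Phi> (q + (\<epsilon> * s) *\<^sub>R const_fun 1) = fx 0 t (C0_fun (q + (\<epsilon> * s) *\<^sub>R const_fun 1) t)"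
          using \<Phi>_value by blast
        define z where "z = \<epsilon> * C0_fun q t + s"
        have z: "C0_fun (q + (\<epsilon> * s) *\<^sub>R const_fun 1) t = \<epsilon> * z" using assms by (auto simp: z_def algebra_simps)
        have zR: "z > R" "z > R'" using abs_C0_fun_le[of q t] s assms R'(1) by (auto simp: z_def)
        have "\<bar>\<epsilon> * z\<bar> = z" using zR(2) R'(1) assms by auto
        then have "\<bar>fx 0 t (\<epsilon> * z)\<bar> > \<bar>B\<bar>" using R'(2)[of t "\<epsilon> * z"] zR by force
        moreover have "\<sigma> * fx 0 t (\<epsilon> * z) = \<bar>fx 0 t (\<epsilon> * z)\<bar>" using \<sigma>(2)[OF t(1) zR(1)] \<sigma>(1) by auto
        ultimately show ?thesis unfolding t(2) z by linarith
      qed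
      then show "\<exists>N. \<forall>s\<ge>N. B \<le> \<sigma> * \<Phi> (q + (\<epsilon> * s) *\<^sub>R const_fun 1)" by blast
    qed
  qed
qed

end

section \<open>The fold theorem for an abstract pair\<close>

locale circle_problem = circle_pair i j d P + proper_family fx
  for i :: "'a::circle_space \<Rightarrow> C0" and j :: "C0 \<Rightarrow> 'b::circle_space" and d :: "'a \<Rightarrow> 'b" and P :: "'b \<Rightarrow> 'a"
    and fx :: "nat \<Rightarrow> real \<Rightarrow> real \<Rightarrow> real"
begin

definition F :: "'a \<Rightarrow> 'b" where "F u = d u + j (nem 0 (i u))"

text \<open>\<open>Kinv (Q w)\<close> is the solution merely as an element of C0. Inserting it into
  the nonlinear term and integrating once by \<open>P\<close> gives an element of B1 with the same
  values (\<open>i_Pinv\<close>), depending smoothly on \<open>w\<close> in the norm of B1.\<close>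

definition Pinv :: "'b \<Rightarrow> 'a" where "Pinv w = const_fun (average w) + P (w - j (nem 0 (Kinv (Q w))))"

lemma Psi_eq: "Psi F u = d u + j (nem 0 (i u)) - const_fun (average (nem 0 (i u))) + const_fun (average u)"
  by (simp add: Psi_def F_def average_simps average average_d)

lemma average_Psi: "average (Psi F u) = average u"
  by (simp add: Psi_eq average_simps average average_d)

lemma Q_Psi: "Q (Psi F u) = K (i u)"
proof -
  have "Q (Psi F u) = const_fun (average u) + i (P (Psi F u))" by (simp add: Q_def average_Psi)
  also have "i (P (Psi F u)) = i u - const_fun (average u) + prim (nem 0 (i u))"
    unfolding Psi_eq by (simp add: lin P_const P_d const i_P_j)
  finally show ?thesis by (simp add: K_def)
qed

lemma Pinv_Psi: "Pinv (Psi F u) = u"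
proof -
  have "P (Psi F u - j (nem 0 (i u))) = u - const_fun (average u)"
    unfolding Psi_eq by (simp add: lin P_const P_d)
  then show ?thesis by (simp add: Pinv_def Q_Psi average_Psi)
qed

lemma i_Pinv: "i (Pinv w) = Kinv (Q w)"
proof -
  have "i (Pinv w) = Q w - prim (nem 0 (Kinv (Q w)))" by (simp add: Pinv_def Q_def lin const i_P_j)
  also have "\<dots> = K (Kinv (Q w)) - prim (nem 0 (Kinv (Q w)))" by simp
  finally show ?thesis unfolding K_def by simp
qed

lemma Psi_Pinv: "Psi F (Pinv w) = w"
proof -
  have a: "average (Pinv w) = average w" by (simp add: Pinv_def average_simps average)
  have "d (Pinv w) = w - j (nem 0 (Kinv (Q w))) - const_fun (average w - average (nem 0 (Kinv (Q w))))"
    by (simp add: Pinv_def lin const d_P average_simps average const_fun_diff)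
  then show ?thesis by (simp add: Psi_eq i_Pinv a const_fun_diff)
qed

lemma inv_Psi: "inv (Psi F) = Pinv"
  by (rule inv_unique_comp) (auto simp: Psi_Pinv Pinv_Psi)

lemma average_F_Pinv: "average (F (Pinv w)) = \<Phi> (Q w)"
  by (simp add: F_def average_simps average average_d i_Pinv \<Phi>_def)

lemma phi_eq: "phi F v s = \<Phi> (Q v + s *\<^sub>R const_fun 1)"
  by (simp add: phi_def inv_Psi average_F_Pinv Q_const)

lemma smooth_Psi: "smooth_on UNIV (Psi F)"
  unfolding Psi_eq[abs_def]
proof (intro smooth_on_add smooth_on_diff subspace_UNIV)
  have n: "smooth_on UNIV (\<lambda>u. nem 0 (i u))"
    by (rule smooth_on_compose[OF subspace_UNIV subspace_UNIV closed_UNIV smooth_on_nem smooth_on_linear[OF linear_maps(1) subspace_UNIV]]) simp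
  show "smooth_on UNIV (\<lambda>u. j (nem 0 (i u)))" by (rule smooth_on_linear_compose[OF linear_maps(2) subspace_UNIV n])
  show "smooth_on UNIV (\<lambda>u. const_fun (average (nem 0 (i u))) :: 'b)"
    by (intro smooth_on_linear_compose[OF bounded_linear_const_fun subspace_UNIV] smooth_on_linear_compose[OF bounded_linear_average_C0 subspace_UNIV] n)
qed (intro smooth_on_linear_compose[OF bounded_linear_const_fun subspace_UNIV] smooth_on_linear linear_maps linear_average subspace_UNIV)+

lemma smooth_Pinv: "smooth_on UNIV Pinv"
proof -
  have "smooth_on UNIV (\<lambda>w. Kinv (Q w))"
    by (rule smooth_on_compose[OF subspace_UNIV subspace_UNIV closed_UNIV smooth_on_Kinv smooth_on_linear[OF bounded_linear_Q subspace_UNIV]]) simp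
  then have "smooth_on UNIV (\<lambda>w. nem 0 (Kinv (Q w)))"
    by (rule smooth_on_compose[OF subspace_UNIV subspace_UNIV closed_UNIV smooth_on_nem]) simp
  then have "smooth_on UNIV (\<lambda>w. P (w - j (nem 0 (Kinv (Q w)))))"
    by (intro smooth_on_linear_compose[OF linear_maps(4)] smooth_on_linear_compose[OF linear_maps(2)]
        smooth_on_diff smooth_on_linear[OF bounded_linear_ident] subspace_UNIV)
  then show ?thesis unfolding Pinv_def[abs_def]
    by (intro smooth_on_add smooth_on_linear[OF bounded_linear_compose[OF bounded_linear_const_fun linear_average(2)]] subspace_UNIV)
qed

text \<open>For \<alpha> of average 0 the equation w' + \<alpha> w = 0 has a nonzero periodic
  solution. It is continuously differentiable, so it comes from an element of B1, which lies in the
  kernel of the derivative of \<open>F\<close>.\<close>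

lemma critical_pointI:
  assumes "Sig (i u) = 0" shows "critical_point F u"
proof -
  let ?\<alpha> = "nem (Suc 0) (i u)"
  obtain w where w: "C0_has_deriv w (- mult_C0 ?\<alpha> w)" "w \<noteq> 0"
    using kernel_function assms unfolding Sig_def by blast
  obtain N' where N': "(nem 0 has_derivative N') (at (i u))" using smooth_on_has_derivative[OF smooth_on_nem] by blast
  have N'_eq: "N' h = mult_C0 ?\<alpha> h" for h
    using vector_derivative_unique_at[OF has_derivative_line[OF N'] nem_hvd] by simp
  have i: "(i has_derivative i) (at u)" by (rule bounded_linear_imp_has_derivative[OF linear_maps(1)])
  have F': "(F has_derivative (\<lambda>h. d h + j (N' (i h)))) (at u)"
    unfolding F_def[abs_def]
    by (intro has_derivative_add bounded_linear_imp_has_derivative linear_maps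
        bounded_linear.has_derivative[OF linear_maps(2)] has_derivative_compose[OF i N'])
  define h where "h = const_fun (average w) + P (j (- mult_C0 ?\<alpha> w))"
  have ih: "i h = w" unfolding h_def by (rule C1_in_range[OF w(1)])
  have "d h = j (- mult_C0 ?\<alpha> w)"
    using C0_deriv_average[OF w(1)] by (simp add: h_def lin const d_P average const_fun_0)
  then have "d h + j (N' (i h)) = 0" by (simp add: ih N'_eq flip: lin(2)) (simp add: linear_0[OF bounded_linear.linear[OF linear_maps(2)]])
  moreover have "d 0 + j (N' (i 0)) = 0" 
    using linear_0[OF has_derivative_linear[OF F']] by simp
  moreover have "h \<noteq> 0" using ih w(2) linear_0[OF bounded_linear.linear[OF linear_maps(1)]] by auto
  ultimately have "\<not> inj (\<lambda>h. d h + j (N' (i h)))" by (metis (mono_tags, lifting) injD)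
  then show ?thesis unfolding critical_point_def bij_def using F' by blast
qed

theorem global_fold:
  assumes reg: "regular_value (\<lambda>u. Sig (i u)) 0"
    and folds: "\<And>u. critical_point F u \<Longrightarrow> fold_point F u"
  shows "global_fold F"
proof -
  obtain \<Phi>1 where \<Phi>1: "dir_deriv UNIV \<Phi> (const_fun 1) \<Phi>1" "smooth_on UNIV \<Phi>1"
    using smooth_on_dir_deriv[OF subspace_UNIV smooth_on_\<Phi>, of "const_fun 1"] by blast
  obtain \<Phi>2 where \<Phi>2: "dir_deriv UNIV \<Phi>1 (const_fun 1) \<Phi>2" "smooth_on UNIV \<Phi>2"
    using smooth_on_dir_deriv[OF subspace_UNIV \<Phi>1(2), of "const_fun 1"] by blast
  have D: "((\<lambda>s. G (q + s *\<^sub>R const_fun 1)) has_real_derivative G' (q + s *\<^sub>R const_fun 1)) (at s)"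
    if "dir_deriv UNIV G (const_fun 1) G'" for G G' :: "C0 \<Rightarrow> real" and q s
    using dir_deriv_line[OF that subspace_UNIV UNIV_I UNIV_I] by (simp add: has_vector_derivative_real_iff)
  \<comment> \<open>The second derivative along the line, read at the solution \<open>x\<close>
    instead of the datum \<open>K x\<close>, because the critical set is described by
    solutions.\<close>
  define \<rho> where "\<rho> x = \<Phi>2 (K x)" for x
  have \<rho>_cont: "continuous_on UNIV \<rho>" unfolding \<rho>_def
    by (rule continuous_on_compose2[OF smooth_on_continuous_on[OF \<Phi>2(2) subspace_UNIV] smooth_on_continuous_on[OF smooth_on_K subspace_UNIV]]) simp
  have \<rho>_ne: "\<rho> (i u) \<noteq> 0" if "Sig (i u) = 0" for u
  proof -
    define w s v where "w = Psi F u" and "s = average w" and "v = w - const_fun s"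
    have "deriv (phi F v) = (\<lambda>s. \<Phi>1 (Q v + s *\<^sub>R const_fun 1))"
      using DERIV_imp_deriv[OF D[OF \<Phi>1(1)]] unfolding phi_eq[abs_def] by blast
    then have "deriv (deriv (phi F v)) s = \<Phi>2 (Q v + s *\<^sub>R const_fun 1)"
      using DERIV_imp_deriv[OF D[OF \<Phi>2(1)]] by simp
    moreover have "Q v + s *\<^sub>R const_fun 1 = K (i u)" using Q_const[of v s] Q_Psi[of u] by (simp add: v_def w_def)
    moreover have "fold_point F u" by (rule folds[OF critical_pointI[OF that]])
    ultimately show ?thesis by (simp add: fold_point_def Let_def \<rho>_def w_def s_def v_def)
  qed
  \<comment> \<open>If D_2^2 f vanished along \<open>u\<close>, the derivative of \<open>Sig\<close>
    at \<open>u\<close> would be zero and not surjective.\<close>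
  have reg': "\<exists>t. fx (Suc (Suc 0)) t (C0_fun (i u) t) \<noteq> 0" if "Sig (i u) = 0" for u
  proof (rule ccontr)
    assume "\<not> ?thesis"
    then have z: "nem (Suc (Suc 0)) (i u) = 0" by (intro C0_eqI) simp
    obtain g' where g': "((\<lambda>u. Sig (i u)) has_derivative g') (at u)" "surj g'"
      using reg \<open>Sig (i u) = 0\<close> unfolding regular_value_def by blast
    have "g' h = 0" for h
    proof -
      have "((\<lambda>t. Sig (i u + t *\<^sub>R i h)) has_vector_derivative average (mult_C0 (nem (Suc (Suc 0)) (i u)) (i h))) (at 0)"
        unfolding Sig_def by (rule bounded_linear.has_vector_derivative[OF bounded_linear_average_C0 nem_hvd])
      moreover have "mult_C0 (nem (Suc (Suc 0)) (i u)) (i h) = 0" by (rule C0_eqI) (simp add: z)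
      ultimately show ?thesis
        using vector_derivative_unique_at[OF has_derivative_line[OF g'(1), of h]] by (simp add: lin average_zero)
    qed
    then show False using g'(2) unfolding surj_def by (metis zero_neq_one)
  qed
  obtain u0 where u0: "Sig (i u0) = 0" using reg unfolding regular_value_def by (metis rangeE)
  define \<sigma> where "\<sigma> = sgn (\<rho> (i u0))"
  have \<sigma>: "\<sigma> = 1 \<or> \<sigma> = -1" using \<rho>_ne[OF u0] by (auto simp: \<sigma>_def sgn_if)
  have \<rho>_pos: "\<sigma> * \<rho> (i u) > 0" if "Sig (i u) = 0" for u
  proof (rule sign_constant[where Y = "range i" and \<rho> = "\<lambda>x. \<sigma> * \<rho> x" and ?u0.0 = "i u0" and ?u1.0 = "i u"])
    show "x + y \<in> range i" if "x \<in> range i" "y \<in> range i" for x y using that by clarify (simp flip: lin(1))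
    show "c *\<^sub>R x \<in> range i" if "x \<in> range i" for x c using that by clarify (simp flip: lin(9))
    show "p \<in> range i" if "C0_has_deriv p p'" for p p' using rangeI[of i "const_fun (average p) + P (j p')"] unfolding C1_in_range[OF that] .
    show "mult_C0 \<theta> y \<in> range i" if "C0_has_deriv \<theta> \<theta>'" "y \<in> range i" for \<theta> \<theta>' y using range_mult[OF that(1)] that(2) by blast
    show "continuous_on UNIV (\<lambda>x. \<sigma> * \<rho> x)" by (intro continuous_intros \<rho>_cont)
    show "\<sigma> * \<rho> y \<noteq> 0" if "y \<in> range i" "Sig y = 0" for y using \<rho>_ne \<sigma> that by auto
    show "\<exists>t. fx (Suc (Suc 0)) t (C0_fun y t) \<noteq> 0" if "y \<in> range i" "Sig y = 0" for y using reg' that by blast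
    show "\<sigma> * \<rho> (i u0) > 0" using \<rho>_ne[OF u0] by (simp add: \<sigma>_def sgn_if)
  qed (use u0 that in auto)
  have min: "\<sigma> * \<Phi>2 (Q w) > 0" if "\<Phi>1 (Q w) = 0" for w
  proof -
    have "((\<lambda>s. \<Phi> (Q w + s *\<^sub>R const_fun 1)) has_vector_derivative 0) (at 0)"
      using D[OF \<Phi>1(1), of "Q w" 0] that by (simp add: has_vector_derivative_real_iff)
    then have "Sig (i (Pinv w)) = 0" unfolding i_Pinv Sig_def by (rule \<Phi>_critical)
    from \<rho>_pos[OF this] show ?thesis by (simp add: \<rho>_def i_Pinv)
  qed
  have coercive: "filterlim (\<lambda>s. \<sigma> * \<Phi> (q + (\<epsilon> * s) *\<^sub>R const_fun 1)) at_top at_top" if \<epsilon>: "\<epsilon> = 1 \<or> \<epsilon> = -1" for \<epsilon> :: real and q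
  proof -
    obtain \<tau> where \<tau>: "\<tau> = 1 \<or> \<tau> = -1" "\<And>q. filterlim (\<lambda>s. \<tau> * \<Phi> (q + (\<epsilon> * s) *\<^sub>R const_fun 1)) at_top at_top"
      using coercive_sign[OF \<epsilon>] by blast
    \<comment> \<open>Otherwise \<sigma> \<Phi> would tend to minus infinity at this end. On the
      line through the critical point given by \<open>u0\<close>, however, it is nondecreasing from
      that point outwards, because its derivative crosses 0 upwards only.\<close>
    have "\<tau> = \<sigma>"
    proof (rule ccontr)
      assume ne: "\<tau> \<noteq> \<sigma>"
      let ?w = "Psi F u0" let ?l = "\<lambda>s. ?w + const_fun (\<epsilon> * s)"
      define g where "g s = \<sigma> * \<Phi> (Q ?w + (\<epsilon> * s) *\<^sub>R const_fun 1)" for s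
      define g1 where "g1 s = \<epsilon> * (\<sigma> * \<Phi>1 (Q ?w + (\<epsilon> * s) *\<^sub>R const_fun 1))" for s
      define g2 where "g2 s = \<sigma> * \<Phi>2 (Q ?w + (\<epsilon> * s) *\<^sub>R const_fun 1)" for s
      have e2: "\<epsilon> * \<epsilon> = 1" using \<epsilon> by auto
      have c: "((\<lambda>s. G (Q ?w + (\<epsilon> * s) *\<^sub>R const_fun 1)) has_real_derivative G' (Q ?w + (\<epsilon> * s) *\<^sub>R const_fun 1) * \<epsilon>) (at s)"
        if "dir_deriv UNIV G (const_fun 1) G'" for G G' s
        by (rule DERIV_chain2[OF D[OF that]]) (auto intro!: derivative_eq_intros)
      have g: "(g has_real_derivative g1 s) (at s)" for s
        unfolding g_def g1_def using DERIV_cmult[OF c[OF \<Phi>1(1)], of \<sigma> s] by (simp add: mult_ac)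
      have "(g1 has_real_derivative \<epsilon> * (\<sigma> * (\<Phi>2 (Q ?w + (\<epsilon> * s) *\<^sub>R const_fun 1) * \<epsilon>))) (at s)" for s
        unfolding g1_def by (intro DERIV_cmult c[OF \<Phi>2(1)])
      moreover have "\<epsilon> * (\<sigma> * (y * \<epsilon>)) = \<sigma> * y" for y using e2 by (metis mult.assoc mult.commute mult_1)
      ultimately have g1: "(g1 has_real_derivative g2 s) (at s)" for s unfolding g2_def by simp
      have pos: "g2 s > 0" if "g1 s = 0" for s
      proof -
        have "\<Phi>1 (Q (?l s)) = 0" using that \<epsilon> \<sigma> by (auto simp: g1_def Q_const)
        from min[OF this] show ?thesis by (simp add: g2_def Q_const)
      qed
      have "\<Phi>1 (Q ?w) = 0"
      proof -
        have "fold_point F u0" by (rule folds[OF critical_pointI[OF u0]])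
        then have "deriv (phi F (?w - const_fun (average ?w))) (average ?w) = 0" by (simp add: fold_point_def Let_def)
        then have "\<Phi>1 (Q (?w - const_fun (average ?w)) + average ?w *\<^sub>R const_fun 1) = 0"
          using DERIV_imp_deriv[OF D[OF \<Phi>1(1)]] unfolding phi_eq[abs_def] by simp
        then show ?thesis using Q_const[of "?w - const_fun (average ?w)" "average ?w"] by simp
      qed
      then have g10: "g1 0 = 0" by (simp add: g1_def)
      have mono: "g 0 \<le> g s" if "s \<ge> 0" for s
      proof (rule DERIV_nonneg_imp_nondecreasing[OF that])
        fix x :: real assume "0 \<le> x"
        then have "g1 x \<ge> 0" using pos_after_zero[OF g1 pos g10, of x] g10 by (cases "x = 0") auto
        then show "\<exists>y. (g has_real_derivative y) (at x) \<and> 0 \<le> y" using g by blast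
      qed
      obtain N where N: "\<And>s. s \<ge> N \<Longrightarrow> \<tau> * \<Phi> (Q ?w + (\<epsilon> * s) *\<^sub>R const_fun 1) \<ge> 1 - g 0"
        using \<tau>(2)[of "Q ?w"] unfolding filterlim_at_top eventually_at_top_linorder by blast
      have "\<tau> = - \<sigma>" using ne \<tau>(1) \<sigma> by auto
      then have "- g (max N 0) \<ge> 1 - g 0" using N[of "max N 0"] by (simp add: g_def)
      moreover have "g 0 \<le> g (max N 0)" by (rule mono) simp
      ultimately show False by linarith
    qed
    then show ?thesis using \<tau>(2) by simp
  qed
  have Ebl: "subspace (avg_zero :: 'b set)" "closed (avg_zero :: 'b set)"
  proof -
    show "subspace (avg_zero :: 'b set)" by (auto simp: subspace_def avg_zero_def average_simps)
    show "closed (avg_zero :: 'b set)"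
      unfolding avg_zero_def
      by (intro closed_Collect_eq bounded_linear.continuous_on[OF linear_average(2)] continuous_on_id continuous_on_const)
  qed
  interpret fs: fiber_space "avg_zero :: 'b set" by unfold_locales (fact Ebl)+
  define l :: "real \<times> 'b \<Rightarrow> 'b" where "l p = snd p + const_fun (fst p)" for p
  have l_bl: "bounded_linear l" unfolding l_def[abs_def]
    by (intro bounded_linear_add bounded_linear_snd bounded_linear_compose[OF bounded_linear_const_fun] bounded_linear_fst)
  have Ql: "Q (l (s, v)) = Q v + s *\<^sub>R const_fun 1" for s v by (simp add: l_def Q_const)
  have smV: "smooth_on fs.V (\<lambda>p. \<sigma> * G (Q (l p)))" if "smooth_on UNIV G" for G :: "C0 \<Rightarrow> real"
    by (rule smooth_on_linear_compose[OF bounded_linear_mult_right fs.V_subspace], 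
        rule smooth_on_compose[OF fs.V_subspace subspace_UNIV closed_UNIV that
          smooth_on_linear[OF bounded_linear_compose[OF bounded_linear_Q l_bl] fs.V_subspace]]) simp
  have ddV: "dir_deriv fs.V (\<lambda>p. \<sigma> * G (Q (l p))) (1, 0) (\<lambda>p. \<sigma> * G' (Q (l p)))" if "dir_deriv UNIV G (const_fun 1) G'" for G G' :: "C0 \<Rightarrow> real"
    unfolding dir_deriv_def
  proof
    fix p :: "real \<times> 'b"
    have "Q (l (p + t *\<^sub>R (1, 0))) = Q (l p) + t *\<^sub>R const_fun 1" for t
      by (cases p) (simp add: Ql scaleR_add_left)
    then show "((\<lambda>t. \<sigma> * G (Q (l (p + t *\<^sub>R (1, 0))))) has_vector_derivative \<sigma> * G' (Q (l p))) (at 0)"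
      using DERIV_cmult[OF D[OF that, of "Q (l p)" 0], of \<sigma>] by (simp add: has_vector_derivative_real_iff)
  qed
  interpret ff: fold_family "avg_zero :: 'b set" "\<lambda>p. \<sigma> * \<Phi> (Q (l p))" "\<lambda>p. \<sigma> * \<Phi>1 (Q (l p))" "\<lambda>p. \<sigma> * \<Phi>2 (Q (l p))"
  proof unfold_locales
    show "\<sigma> * \<Phi>2 (Q (l x)) > 0" if "\<sigma> * \<Phi>1 (Q (l x)) = 0" for x using min that \<sigma> by auto
    show "filterlim (\<lambda>s. \<sigma> * \<Phi> (Q (l (s, v)))) at_top at_top" for v using coercive[of 1 "Q v"] by (simp add: Ql)
    show "filterlim (\<lambda>s. \<sigma> * \<Phi> (Q (l (s, v)))) at_top at_bot" for v
      unfolding filterlim_at_bot_mirror using coercive[of "-1" "Q v"] by (simp add: Ql)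
  qed (intro smV ddV smooth_on_\<Phi> \<Phi>1 \<Phi>2)+
  obtain \<Theta> \<Theta>' \<nu> where \<Theta>: "smooth_on fs.V \<Theta>" "smooth_on fs.V \<Theta>'" "smooth_on (avg_zero :: 'b set) \<nu>"
    "\<And>p. p \<in> fs.V \<Longrightarrow> \<Theta> p \<in> fs.V" "\<And>p. p \<in> fs.V \<Longrightarrow> \<Theta>' p \<in> fs.V"
    "\<And>p. p \<in> fs.V \<Longrightarrow> \<Theta> (\<Theta>' p) = p" "\<And>p. p \<in> fs.V \<Longrightarrow> \<Theta>' (\<Theta> p) = p" "\<And>p. p \<in> fs.V \<Longrightarrow> snd (\<Theta>' p) = snd p"
    "\<And>p. p \<in> fs.V \<Longrightarrow> \<sigma> * \<Phi> (Q (l (\<Theta>' p))) = \<nu> (snd p) + (fst p)\<^sup>2"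
    by (rule ff.normal_form) (rule that)
  define s where "s w = (average w, w - const_fun (average w))" for w :: 'b
  have s_bl: "bounded_linear s" unfolding s_def[abs_def]
    by (intro bounded_linear_Pair bounded_linear_sub linear_average bounded_linear_ident bounded_linear_compose[OF bounded_linear_const_fun])
  have V: "fs.V = UNIV \<times> avg_zero" by (rule fs.V_def)
  have sV: "s w \<in> fs.V" for w unfolding V by (simp add: s_def avg_zero_def average_simps)
  have ls: "l (s w) = w" for w by (simp add: l_def s_def)
  have sl: "s (l p) = p" if "p \<in> fs.V" for p
    using that unfolding V by (auto simp: l_def s_def avg_zero_def average_simps)
  define \<Xi>1 where "\<Xi>1 u = \<Theta> (s (Psi F u))" for u
  define \<Xi>1' where "\<Xi>1' p = Pinv (l (\<Theta>' p))" for p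
  \<comment> \<open>Height above the minimum of the line as first coordinate; the factor
    \<open>\<sigma>\<close> lets maxima lead to the square as well.\<close>
  define \<Xi>0 where "\<Xi>0 w = (\<sigma> * average w - \<nu> (w - const_fun (average w)), w - const_fun (average w))" for w
  define \<Xi>0' where "\<Xi>0' p = snd p + const_fun (\<sigma> * (fst p + \<nu> (snd p)))" for p
  have inv1: "\<Xi>1' (\<Xi>1 u) = u" for u by (simp add: \<Xi>1_def \<Xi>1'_def \<Theta>(7)[OF sV] ls Pinv_Psi)
  have inv1': "\<Xi>1 (\<Xi>1' p) = p" if "p \<in> fs.V" for p by (simp add: \<Xi>1_def \<Xi>1'_def Psi_Pinv sl[OF \<Theta>(5)[OF that]] \<Theta>(6)[OF that])
  have "diffeomorphism_on UNIV fs.V \<Xi>1"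
  proof (rule diffeomorphism_onI[where k = \<Xi>1'])
    have "smooth_on UNIV (\<lambda>u. s (Psi F u))" by (rule smooth_on_linear_compose[OF s_bl subspace_UNIV smooth_Psi])
    then show "smooth_on UNIV \<Xi>1" unfolding \<Xi>1_def[abs_def]
      by (rule smooth_on_compose[OF subspace_UNIV fs.V_subspace fs.V_closed \<Theta>(1)]) (rule sV)
    show "smooth_on fs.V \<Xi>1'" unfolding \<Xi>1'_def[abs_def]
      by (rule smooth_on_compose[OF fs.V_subspace subspace_UNIV closed_UNIV smooth_Pinv smooth_on_linear_compose[OF l_bl fs.V_subspace \<Theta>(2)]]) simp
    show "\<Xi>1 u \<in> fs.V" for u unfolding \<Xi>1_def by (rule \<Theta>(4)[OF sV])
  qed (simp_all add: inv1 inv1')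
  moreover have "diffeomorphism_on UNIV fs.V \<Xi>0"
  proof (rule diffeomorphism_onI[where k = \<Xi>0'])
    have a: "w - const_fun (average w) \<in> avg_zero" for w :: 'b by (simp add: avg_zero_def average_simps)
    have sm: "smooth_on UNIV (\<lambda>w::'b. w - const_fun (average w))"
      by (intro smooth_on_linear bounded_linear_sub linear_average bounded_linear_ident bounded_linear_compose[OF bounded_linear_const_fun] subspace_UNIV)
    show "smooth_on UNIV \<Xi>0" unfolding \<Xi>0_def[abs_def]
      by (intro smooth_on_Pair smooth_on_diff sm subspace_UNIV
          smooth_on_linear[OF bounded_linear_compose[OF bounded_linear_mult_right linear_average(2)]]
          smooth_on_compose[OF subspace_UNIV Ebl \<Theta>(3) sm] a)
    have "smooth_on fs.V (\<lambda>p. \<nu> (snd p))"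
      by (rule smooth_on_compose[OF fs.V_subspace Ebl \<Theta>(3) fs.smooth_snd]) (auto simp: V)
    then show "smooth_on fs.V \<Xi>0'" unfolding \<Xi>0'_def[abs_def]
      by (intro smooth_on_add fs.smooth_snd fs.smooth_fst fs.V_subspace smooth_on_linear_compose[OF bounded_linear_const_fun]
          smooth_on_linear_compose[OF bounded_linear_mult_right])
    have \<sigma>2: "\<sigma> * (\<sigma> * y) = y" for y using \<sigma> by auto
    show "\<Xi>0' (\<Xi>0 w) = w" for w by (simp add: \<Xi>0_def \<Xi>0'_def \<sigma>2)
    show "\<Xi>0 w \<in> fs.V" for w by (simp add: V \<Xi>0_def a)
    fix p assume "p \<in> fs.V"
    then show "\<Xi>0 (\<Xi>0' p) = p" unfolding V by (auto simp: \<Xi>0_def \<Xi>0'_def avg_zero_def average_simps \<sigma>2)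
  qed simp
  moreover have "\<Xi>0 (F (inv \<Xi>1 (x, v))) = (x\<^sup>2, v)" if v: "v \<in> avg_zero" for x v
  proof -
    have p: "(x, v) \<in> fs.V" using v by (simp add: V)
    have "inj \<Xi>1" using inv1 by (rule inj_on_inverseI)
    then have i: "inv \<Xi>1 (x, v) = \<Xi>1' (x, v)" using inv1'[OF p] by (rule inv_f_eq)
    define t where "t = fst (\<Theta>' (x, v))"
    have \<Theta>': "\<Theta>' (x, v) = (t, v)" using \<Theta>(8)[OF p] by (simp add: t_def prod_eq_iff)
    let ?w = "l (t, v)"
    have "average ?w = t" using v by (simp add: l_def avg_zero_def average_simps)
    then have aP: "average (Pinv ?w) = t" using average_Psi[of "Pinv ?w"] by (simp add: Psi_Pinv)
    \<comment> \<open>\<open>F u\<close> and \<open>Psi F u\<close> differ by a constant and so have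
      the same part of average zero.\<close>
    have "F (Pinv ?w) - const_fun (average (F (Pinv ?w))) + const_fun (average (Pinv ?w)) = ?w"
      using Psi_Pinv[of ?w] by (simp only: Psi_def)
    then have "F (Pinv ?w) = v + const_fun (average (F (Pinv ?w)))" unfolding aP by (simp add: l_def algebra_simps)
    then have "F (Pinv ?w) - const_fun (average (F (Pinv ?w))) = v" by (simp only: diff_eq_eq)
    then have "\<Xi>0 (F (Pinv ?w)) = (\<sigma> * average (F (Pinv ?w)) - \<nu> v, v)" by (simp add: \<Xi>0_def)
    also have "\<sigma> * average (F (Pinv ?w)) = \<nu> v + x\<^sup>2" using \<Theta>(9)[OF p] by (simp add: average_F_Pinv \<Theta>')
    finally show ?thesis by (simp add: i \<Xi>1'_def \<Theta>')
  qed
  ultimately show ?thesis unfolding global_fold_def V by blast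
qed

end

section \<open>Weak derivatives\<close>

lemma inner_C0: "inner (C0_to_L2 u) (C0_to_L2 v) = average (mult_C0 u v)"
proof -
  have [measurable]: "C0_fun w \<in> borel_measurable circle" for w
    using sq_integrable_C0_fun[of w] by (simp add: sq_integrable_def)
  note [measurable] = rep_L2_measurable
  show ?thesis unfolding inner_C0_to_L2 average_C0_def mult_C0_fun
    by (rule integral_cong_AE; (measurable)?) (use AE_rep_C0_to_L2[of u] in eventually_elim, simp)
qed

lemma C0_has_deriv_mult:
  assumes "C0_has_deriv u u'" "C0_has_deriv v v'"
  shows "C0_has_deriv (mult_C0 u v) (mult_C0 u' v + mult_C0 u v')"
proof -
  have "C0_fun (mult_C0 u v) = (\<lambda>t. C0_fun u t * C0_fun v t)" by auto
  then show ?thesis using assms unfolding C0_has_deriv_def by (auto intro!: derivative_eq_intros)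
qed

lemma const_fun_L2_eq: "C0_to_L2 (const_fun c) = const_fun c"
proof (rule L2_eqI)
  have "AE t in circle. rep_L2 (const_fun c) t = c"
    unfolding const_fun_L2_def by (rule AE_rep_abs_L2[OF sq_integrable_const])
  then show "AE t in circle. rep_L2 (C0_to_L2 (const_fun c)) t = rep_L2 (const_fun c) t"
    using AE_rep_C0_to_L2[of "const_fun c"] by eventually_elim simp
qed

lemma average_L2_eq: "average w = inner w (C0_to_L2 (const_fun 1))"
  by (simp add: inner_C0_to_L2 average_L2_def)

lemma average_C0_to_L2: "average (C0_to_L2 u) = average u"
proof -
  have "mult_C0 u (const_fun 1) = u" by (rule C0_eqI) simp
  then show ?thesis by (simp add: average_L2_eq inner_C0)
qed

lemma norm_C0_to_L2_le: "norm (C0_to_L2 u) \<le> norm u"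
proof -
  have "(norm (C0_to_L2 u))\<^sup>2 = average (mult_C0 u u)" by (simp add: power2_norm_eq_inner inner_C0)
  also have "\<dots> \<le> norm (mult_C0 u u)" using abs_average_C0_le[of "mult_C0 u u"] by simp
  also have "\<dots> \<le> (norm u)\<^sup>2" using norm_mult_C0_le[of u u] by (simp add: power2_eq_square)
  finally show ?thesis by (rule power2_le_imp_le) simp
qed

lemma bounded_linear_C0_to_L2: "bounded_linear C0_to_L2"
  by (rule bounded_linear_intro[of _ 1]) (use norm_C0_to_L2_le in \<open>auto simp: C0_to_L2_add C0_to_L2_scaleR\<close>)

lemma norm_const_L2: "norm (const_fun c :: L2) \<le> \<bar>c\<bar>"
  using norm_C0_to_L2_le[of "const_fun c"] by (simp add: const_fun_L2_eq)

lemma abs_average_L2_le: "\<bar>average w\<bar> \<le> norm (w :: L2)"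
proof -
  have "\<bar>average w\<bar> \<le> norm w * norm (C0_to_L2 (const_fun 1))" unfolding average_L2_eq by (rule Cauchy_Schwarz_ineq2)
  also have "\<dots> \<le> norm w * 1" using norm_C0_to_L2_le[of "const_fun 1"] by (intro mult_left_mono) auto
  finally show ?thesis by simp
qed

lemma bounded_linear_average_L2: "bounded_linear (average :: L2 \<Rightarrow> real)"
  by (rule bounded_linear_intro[of _ 1]) (use abs_average_L2_le in \<open>auto simp: average_simps\<close>)

lemma C0_to_L2_minus: "C0_to_L2 (- u) = - C0_to_L2 u"
  using C0_to_L2_scaleR[of "-1" u] by simp

lemma weak_deriv_test: assumes "weak_deriv u v" "C0_has_deriv p p'" shows "inner (C0_to_L2 u) (C0_to_L2 p') = - inner v (C0_to_L2 p)"
proof -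
  have r: "Rep_C1 (Abs_C1 p) = p" using assms(2) by (intro Abs_C1_inverse) auto
  then have "C1_deriv (Abs_C1 p) = p'" using assms(2) by (intro C1_derivI) simp
  with assms(1) r show ?thesis unfolding weak_deriv_def by metis
qed

lemma weak_derivI: assumes "\<And>p p'. C0_has_deriv p p' \<Longrightarrow> inner (C0_to_L2 u) (C0_to_L2 p') = - inner v (C0_to_L2 p)"
  shows "weak_deriv u v"
  unfolding weak_deriv_def using assms[OF C1_deriv] by blast

lemma strong_weak_deriv: assumes "C0_has_deriv u u'" shows "weak_deriv u (C0_to_L2 u')"
proof (rule weak_derivI)
  fix p p' assume "C0_has_deriv p p'"
  from C0_deriv_average[OF C0_has_deriv_mult[OF assms this]]
  show "inner (C0_to_L2 u) (C0_to_L2 p') = - inner (C0_to_L2 u') (C0_to_L2 p)"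
    by (simp add: inner_C0 average_simps)
qed

text \<open>The function u - \<integral>u is tested with its own primitive, which gives inner
  product 0 with itself.\<close>

lemma weak_deriv_0: assumes "weak_deriv u 0" shows "u = const_fun (average u)"
proof -
  let ?y = "u - const_fun (average u)"
  have "C0_has_deriv (const_fun (average u)) 0" by (simp add: C0_has_deriv_def C0_fun_const[abs_def])
  from weak_deriv_diff[OF assms strong_weak_deriv[OF this]] have "weak_deriv ?y 0" by (simp add: C0_to_L2_zero)
  moreover have "C0_has_deriv (prim ?y) ?y" using prim(1)[of ?y] by (simp add: average_simps const_fun_0)
  ultimately have "inner (C0_to_L2 ?y) (C0_to_L2 ?y) = 0" by (auto dest: weak_deriv_test)
  then have "?y = 0" by (intro C0_to_L2_eq_0D) simp
  then show ?thesis by simp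
qed

lemma weak_deriv_eqI: assumes "weak_deriv u w" "weak_deriv v w" "average u = average v" shows "u = v"
proof -
  have "weak_deriv (u - v) 0" using weak_deriv_diff[OF assms(1,2)] by simp
  from weak_deriv_0[OF this] show ?thesis using assms(3) by (simp add: average_simps const_fun_0)
qed

lemma weak_deriv_average: assumes "weak_deriv u v" shows "average v = 0"
proof -
  have "C0_has_deriv (const_fun 1) 0" by (simp add: C0_has_deriv_def C0_fun_const[abs_def])
  from weak_deriv_test[OF assms this] show ?thesis by (simp add: average_L2_eq C0_to_L2_zero)
qed

text \<open>The Leibniz rule by duality: the weak derivative of u is tested with \<theta> p, which
  is again continuously differentiable. The product of \<theta> with the L2 class \<open>v\<close>
  is formed on a representative.\<close>

lemma weak_deriv_mult:
  assumes "weak_deriv u v" "C0_has_deriv \<theta> \<theta>'"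
  shows "\<exists>z. weak_deriv (mult_C0 \<theta> u) z"
proof -
  have m [measurable]: "C0_fun w \<in> borel_measurable circle" for w
    using sq_integrable_C0_fun[of w] by (simp add: sq_integrable_def)
  note [measurable] = rep_L2_measurable
  let ?g = "\<lambda>t. C0_fun \<theta> t * rep_L2 v t"
  have sq: "sq_integrable ?g"
    unfolding sq_integrable_def
  proof
    show "integrable circle (\<lambda>t. (?g t)\<^sup>2)"
    proof (rule Bochner_Integration.integrable_bound)
      show "integrable circle (\<lambda>t. (norm \<theta>)\<^sup>2 * (rep_L2 v t)\<^sup>2)"
        using sq_integrable_rep_L2[of v] by (simp add: sq_integrable_def)
      show "AE t in circle. norm ((?g t)\<^sup>2) \<le> norm ((norm \<theta>)\<^sup>2 * (rep_L2 v t)\<^sup>2)"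
        using abs_C0_fun_le[of \<theta>] 
        by (intro AE_I2) (auto simp: power_mult_distrib abs_le_square_iff[symmetric] intro!: mult_right_mono)
    qed measurable
  qed measurable
  define z where "z = abs_L2 ?g"
  have z: "inner z (C0_to_L2 p) = inner v (C0_to_L2 (mult_C0 \<theta> p))" for p
    unfolding inner_C0_to_L2 z_def
    by (rule integral_cong_AE; (measurable)?) (use AE_rep_abs_L2[OF sq] in \<open>eventually_elim, simp add: mult_ac\<close>)
  have "weak_deriv (mult_C0 \<theta> u) (z + C0_to_L2 (mult_C0 \<theta>' u))"
  proof (rule weak_derivI)
    fix p p' assume p: "C0_has_deriv p p'"
    have "inner (C0_to_L2 u) (C0_to_L2 (mult_C0 \<theta>' p + mult_C0 \<theta> p')) = - inner v (C0_to_L2 (mult_C0 \<theta> p))"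
      by (rule weak_deriv_test[OF assms(1) C0_has_deriv_mult[OF assms(2) p]])
    moreover have "mult_C0 u (mult_C0 \<theta>' p) = mult_C0 (mult_C0 \<theta>' u) p" "mult_C0 u (mult_C0 \<theta> p') = mult_C0 (mult_C0 \<theta> u) p'"
      by (rule C0_eqI, simp)+
    ultimately show "inner (C0_to_L2 (mult_C0 \<theta> u)) (C0_to_L2 p') = - inner (z + C0_to_L2 (mult_C0 \<theta>' u)) (C0_to_L2 p)"
      by (simp add: inner_add_left z C0_to_L2_add inner_add_right inner_C0)
  qed
  then show ?thesis ..
qed

text \<open>The periodic sawtooth is the Green kernel of \<open>d/dt\<close> on functions of average zero.\<close>

definition sawtooth :: "real \<Rightarrow> real" where "sawtooth x = 1 / 2 - frac x"

lemma abs_sawtooth: "\<bar>sawtooth x\<bar> \<le> 1 / 2"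
  using frac_ge_0[of x] frac_lt_1[of x] unfolding sawtooth_def by linarith

lemma abs_sawtooth_le_1: "\<bar>sawtooth x\<bar> \<le> 1"
  using abs_sawtooth[of x] by simp

lemma sawtooth_measurable: "sawtooth \<in> borel_measurable borel"
  unfolding sawtooth_def[abs_def] frac_def by measurable

lemma sawtooth_shift_measurable:
  "(\<lambda>s. sawtooth (t - s)) \<in> borel_measurable circle" "(\<lambda>s. sawtooth (s - t)) \<in> borel_measurable circle"
  by (rule borel_measurable_circle, rule measurable_compose[OF _ sawtooth_measurable], measurable)+

text \<open>Integration by parts on both sides of \<open>s\<close>, where the sawtooth is affine;
  its jump produces \<open>- \<phi> s\<close>. Periodicity is not built in, so that the formula
  serves test functions as well as \<open>\<phi> t = t\<close> in
  \<open>average_prim_L2\<close>.\<close>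

lemma sawtooth_integral:
  assumes d: "\<And>t. (\<phi> has_real_derivative \<psi> t) (at t)" "\<And>t. (\<Phi> has_real_derivative \<phi> t) (at t)" and s: "s \<in> {0..1}"
  shows "((\<lambda>t. sawtooth (t - s) * \<psi> t) has_integral - \<phi> s + (1 / 2 - s) * (\<phi> 0 - \<phi> 1) + (\<Phi> 1 - \<Phi> 0)) {0..1}"
proof -
  have D: "((\<lambda>t. (c - (t - s)) * \<phi> t + \<Phi> t) has_vector_derivative (c - (t - s)) * \<psi> t) (at t within A)" for c t A
  proof -
    have "((\<lambda>t. (c - (t - s)) * \<phi> t + \<Phi> t) has_real_derivative (c - (t - s)) * \<psi> t) (at t)"
      using d by (auto intro!: derivative_eq_intros)
    then show ?thesis by (simp add: has_real_derivative_iff_has_vector_derivative has_vector_derivative_at_within)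
  qed
  have "((\<lambda>t. sawtooth (t - s) * \<psi> t) has_integral
      ((- 1 / 2 - (s - s)) * \<phi> s + \<Phi> s) - ((- 1 / 2 - (0 - s)) * \<phi> 0 + \<Phi> 0)) {0..s}"
  proof (rule has_integral_spike_finite[OF _ _ fundamental_theorem_of_calculus[OF _ D]])
    fix t assume "t \<in> {0..s} - {s}"
    then have "frac (t - s) = t - s + 1" using s by (subst frac_unique_iff) auto
    then show "sawtooth (t - s) * \<psi> t = (- 1 / 2 - (t - s)) * \<psi> t" by (simp add: sawtooth_def)
  qed (use s in auto)
  moreover have "((\<lambda>t. sawtooth (t - s) * \<psi> t) has_integral
      ((1 / 2 - (1 - s)) * \<phi> 1 + \<Phi> 1) - ((1 / 2 - (s - s)) * \<phi> s + \<Phi> s)) {s..1}"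
  \<comment> \<open>The excepted point \<open>s + 1\<close> lies in the interval only for
    \<open>s = 0\<close>, where it is the right endpoint.\<close>
  proof (rule has_integral_spike_finite[OF _ _ fundamental_theorem_of_calculus[OF _ D], where S = "{s + 1}"])
    fix t assume "t \<in> {s..1} - {s + 1}"
    then have "frac (t - s) = t - s" using s by (subst frac_unique_iff) auto
    then show "sawtooth (t - s) * \<psi> t = (1 / 2 - (t - s)) * \<psi> t" by (simp add: sawtooth_def)
  qed (use s in auto)
  ultimately have "((\<lambda>t. sawtooth (t - s) * \<psi> t) has_integral
      ((- 1 / 2 - (s - s)) * \<phi> s + \<Phi> s) - ((- 1 / 2 - (0 - s)) * \<phi> 0 + \<Phi> 0) +
      (((1 / 2 - (1 - s)) * \<phi> 1 + \<Phi> 1) - ((1 / 2 - (s - s)) * \<phi> s + \<Phi> s))) {0..1}"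
    using s by (intro has_integral_combine[of 0 s 1]) auto
  moreover have "((- 1 / 2 - (s - s)) * \<phi> s + \<Phi> s) - ((- 1 / 2 - (0 - s)) * \<phi> 0 + \<Phi> 0) +
      (((1 / 2 - (1 - s)) * \<phi> 1 + \<Phi> 1) - ((1 / 2 - (s - s)) * \<phi> s + \<Phi> s)) =
      - \<phi> s + (1 / 2 - s) * (\<phi> 0 - \<phi> 1) + (\<Phi> 1 - \<Phi> 0)" by (simp add: field_simps)
  ultimately show ?thesis by (simp only:)
qed

text \<open>With the kernel as an element of L2 the primitive becomes an inner product, so
  Cauchy-Schwarz bounds its sup norm by the L2 norm.\<close>

definition kern :: "real \<Rightarrow> L2" where "kern t = abs_L2 (\<lambda>s. sawtooth (t - s))"

lemma sq_integrable_sawtooth: "sq_integrable (\<lambda>s. sawtooth (t - s))"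
proof -
  note m = sawtooth_shift_measurable(1)[of t]
  have "(sawtooth x)\<^sup>2 \<le> 1" for x using abs_sawtooth[of x] by (simp add: abs_square_le_1)
  then show ?thesis unfolding sq_integrable_def
    by (intro conjI m circle.integrable_const_bound[of _ 1] borel_measurable_power) auto
qed

lemma AE_rep_kern: "AE s in circle. rep_L2 (kern t) s = sawtooth (t - s)"
  unfolding kern_def by (rule AE_rep_abs_L2[OF sq_integrable_sawtooth])

lemma inner_kern: "inner w (kern t) = (\<integral>s. rep_L2 w s * sawtooth (t - s) \<partial>circle)"
  unfolding inner_L2_def
proof (rule integral_cong_AE)
  show "AE s in circle. rep_L2 w s * rep_L2 (kern t) s = rep_L2 w s * sawtooth (t - s)"
    using AE_rep_kern[of t] by eventually_elim simp
qed (intro borel_measurable_times rep_L2_measurable sawtooth_shift_measurable)+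

lemma norm_kern: "norm (kern t) \<le> 1"
proof -
  have "(norm (kern t))\<^sup>2 = (\<integral>s. (sawtooth (t - s))\<^sup>2 \<partial>circle)"
    unfolding power2_norm_eq_inner inner_kern
  proof (rule integral_cong_AE)
    show "AE s in circle. rep_L2 (kern t) s * sawtooth (t - s) = (sawtooth (t - s))\<^sup>2"
      using AE_rep_kern[of t] by eventually_elim (simp add: power2_eq_square)
  qed (intro borel_measurable_times borel_measurable_power rep_L2_measurable sawtooth_shift_measurable)+
  also have "\<dots> \<le> (\<integral>s. 1 \<partial>circle)"
    using sq_integrable_sawtooth[of t] abs_sawtooth_le_1 by (intro integral_mono) (auto simp: sq_integrable_def abs_square_le_1)
  finally have "(norm (kern t))\<^sup>2 \<le> 1\<^sup>2" by simp
  then show ?thesis by (rule power2_le_imp_le) simp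
qed

text \<open>Dominated convergence: the sawtooth jumps at integers only, and the \<open>s\<close> for
  which \<open>t - s\<close> is an integer form a countable set.\<close>

lemma continuous_inner_kern: "continuous_on UNIV (\<lambda>t. inner w (kern t))"
  unfolding continuous_on_sequentially
proof (intro allI ballI impI)
  fix X and t :: real assume X: "(\<forall>n. X n \<in> UNIV) \<and> X \<longlonglongrightarrow> t"
  note [measurable] = sawtooth_shift_measurable
  note [measurable] = rep_L2_measurable
  have "(\<lambda>n. \<integral>s. rep_L2 w s * sawtooth (X n - s) \<partial>circle) \<longlonglongrightarrow> (\<integral>s. rep_L2 w s * sawtooth (t - s) \<partial>circle)"
  proof (rule integral_dominated_convergence[where w = "\<lambda>s. \<bar>rep_L2 w s\<bar>"])
    have "countable ((\<lambda>k::int. t - of_int k) ` UNIV)" by (rule countable_image) simp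
    then have "(\<lambda>k::int. t - of_int k) ` UNIV \<in> null_sets lborel" by (rule countable_imp_null_set_lborel)
    from AE_not_in[OF this] have "AE s in lborel. t - s \<notin> \<int>"
    proof eventually_elim
      case (elim s)
      show ?case
      proof
        assume "t - s \<in> \<int>"
        then obtain k where "t - s = of_int k" by (rule Ints_cases)
        then have "s = t - of_int k" by simp
        with elim show False by blast
      qed
    qed
    then have "AE s in circle. t - s \<notin> \<int>" unfolding circle_def by (subst AE_restrict_space_iff) auto
    then show "AE s in circle. (\<lambda>n. rep_L2 w s * sawtooth (X n - s)) \<longlonglongrightarrow> rep_L2 w s * sawtooth (t - s)"
    proof eventually_elim
      case (elim s)
      have "(\<lambda>n. X n - s) \<longlonglongrightarrow> t - s" using X by (intro tendsto_intros) auto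
      then have "(\<lambda>n. frac (X n - s)) \<longlonglongrightarrow> frac (t - s)" by (rule isCont_tendsto_compose[OF continuous_frac[OF elim]])
      then show ?case unfolding sawtooth_def by (intro tendsto_intros)
    qed
    show "AE s in circle. norm (rep_L2 w s * sawtooth (X n - s)) \<le> \<bar>rep_L2 w s\<bar>" for n
    proof (rule AE_I2)
      fix s have "\<bar>sawtooth (X n - s)\<bar> \<le> 1" using abs_sawtooth[of "X n - s"] by simp
      then show "norm (rep_L2 w s * sawtooth (X n - s)) \<le> \<bar>rep_L2 w s\<bar>"
        unfolding real_norm_def abs_mult by (rule mult_left_le) simp
    qed
  qed (measurable; simp)+
  then show "((\<lambda>t. inner w (kern t)) \<circ> X) \<longlonglongrightarrow> inner w (kern t)" by (simp add: inner_kern o_def)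
qed

definition prim_L2 :: "L2 \<Rightarrow> C0" where "prim_L2 w = C0_of (\<lambda>t. inner w (kern t))"

lemma prim_L2_fun [simp]: "C0_fun (prim_L2 w) t = inner w (kern t)"
proof -
  have "kern (t + 1) = kern t" for t
  proof -
    have "frac (t + 1 - s) = frac (t - s)" for s using frac_1_eq[of "t - s"] by (simp add: algebra_simps)
    then show ?thesis unfolding kern_def sawtooth_def by simp
  qed
  then show ?thesis unfolding prim_L2_def by (subst C0_fun_C0_of[OF continuous_inner_kern]) auto
qed

lemma norm_prim_L2: "norm (prim_L2 w) \<le> norm w"
proof (rule norm_C0_le)
  fix t
  have "\<bar>inner w (kern t)\<bar> \<le> norm w * norm (kern t)" by (rule Cauchy_Schwarz_ineq2)
  also have "\<dots> \<le> norm w" using norm_kern[of t] by (simp add: mult_left_le)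
  finally show "\<bar>C0_fun (prim_L2 w) t\<bar> \<le> norm w" by simp
qed

text \<open>Fubini brings the integral over t inside, where \<open>sawtooth_integral\<close>
  evaluates it; the integrand is dominated by \<open>norm \<psi>\<close> times the absolute value of
  \<open>w\<close>.\<close>

lemma prim_L2_inner:
  assumes p: "\<And>t. (\<phi> has_real_derivative C0_fun \<psi> t) (at t)" and P: "\<And>t. (\<Phi> has_real_derivative \<phi> t) (at t)"
  shows "average (mult_C0 (prim_L2 w) \<psi>) = (\<integral>s. rep_L2 w s * (- \<phi> s + (1 / 2 - s) * (\<phi> 0 - \<phi> 1) + (\<Phi> 1 - \<Phi> 0)) \<partial>circle)"
proof -
  interpret pair_sigma_finite circle circle by standard
  have C [measurable]: "C0_fun v \<in> borel_measurable circle" for v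
    using sq_integrable_C0_fun[of v] by (simp add: sq_integrable_def)
  have ident: "(\<lambda>x. x) \<in> circle \<rightarrow>\<^sub>M borel" unfolding circle_def by (rule measurable_restrict_space1) simp
  note sc = sawtooth_shift_measurable
  have [measurable]: "(\<lambda>p. sawtooth (fst p - snd p)) \<in> borel_measurable (circle \<Otimes>\<^sub>M circle)"
    by (rule measurable_compose[OF _ sawtooth_measurable])
       (intro borel_measurable_diff measurable_compose[OF measurable_fst ident] measurable_compose[OF measurable_snd ident])
  note [measurable] = rep_L2_measurable
  let ?f = "\<lambda>(t, s). rep_L2 w s * sawtooth (t - s) * C0_fun \<psi> t"
  have fm: "?f \<in> borel_measurable (circle \<Otimes>\<^sub>M circle)" unfolding split_beta by measurable
  have b: "norm (rep_L2 w s * sawtooth (t - s) * C0_fun \<psi> t) \<le> norm \<psi> * \<bar>rep_L2 w s\<bar>" for s t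
  proof -
    have "\<bar>sawtooth (t - s)\<bar> \<le> 1" using abs_sawtooth[of "t - s"] by simp
    then have "\<bar>rep_L2 w s\<bar> * \<bar>sawtooth (t - s)\<bar> * \<bar>C0_fun \<psi> t\<bar> \<le> \<bar>rep_L2 w s\<bar> * 1 * norm \<psi>"
      by (intro mult_mono abs_C0_fun_le) auto
    then show ?thesis by (simp add: abs_mult mult_ac)
  qed
  have isx: "integrable circle (\<lambda>s. rep_L2 w s * sawtooth (t - s) * C0_fun \<psi> t)" for t
    by (rule Bochner_Integration.integrable_bound[of _ "\<lambda>s. norm \<psi> * \<bar>rep_L2 w s\<bar>"])
       (use b sc in \<open>auto intro!: borel_measurable_times rep_L2_measurable\<close>)
  have int: "integrable (circle \<Otimes>\<^sub>M circle) ?f"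
  proof (rule Fubini_integrable[OF fm])
    have "(\<lambda>t. \<integral>s. norm (?f (t, s)) \<partial>circle) \<in> borel_measurable circle"
      using fm by measurable
    moreover have "norm (\<integral>s. norm (?f (t, s)) \<partial>circle) \<le> norm \<psi> * (\<integral>s. \<bar>rep_L2 w s\<bar> \<partial>circle)" for t
    proof -
      have "(\<integral>s. norm (?f (t, s)) \<partial>circle) \<le> (\<integral>s. norm \<psi> * \<bar>rep_L2 w s\<bar> \<partial>circle)"
        by (rule integral_mono) (use isx b in \<open>auto intro: integrable_norm\<close>)
      then show ?thesis by (simp add: abs_of_nonneg integral_nonneg_AE)
    qed
    ultimately show "integrable circle (\<lambda>t. \<integral>s. norm (?f (t, s)) \<partial>circle)"
      by (intro circle.integrable_const_bound) auto
  qed (use isx in simp)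
  have "average (mult_C0 (prim_L2 w) \<psi>) = (\<integral>t. (\<integral>s. ?f (t, s) \<partial>circle) \<partial>circle)"
    unfolding average_C0_def by (rule Bochner_Integration.integral_cong) (simp_all add: inner_kern)
  also have "\<dots> = (\<integral>s. (\<integral>t. ?f (t, s) \<partial>circle) \<partial>circle)"
    using Fubini_integral[OF int] by simp
  also have "\<dots> = (\<integral>s. rep_L2 w s * (- \<phi> s + (1 / 2 - s) * (\<phi> 0 - \<phi> 1) + (\<Phi> 1 - \<Phi> 0)) \<partial>circle)"
  proof (rule Bochner_Integration.integral_cong[OF refl])
    fix s assume "s \<in> space circle"
    then have s: "s \<in> {0..1}" by simp
    have "integrable circle (\<lambda>t. sawtooth (t - s) * C0_fun \<psi> t)"
    proof (rule Bochner_Integration.integrable_bound[of _ "\<lambda>t. norm \<psi>"])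
      show "AE t in circle. norm (sawtooth (t - s) * C0_fun \<psi> t) \<le> norm (norm \<psi>)"
      proof (rule AE_I2)
        fix t have "\<bar>sawtooth (t - s)\<bar> \<le> 1" using abs_sawtooth[of "t - s"] by simp
        then have "\<bar>sawtooth (t - s)\<bar> * \<bar>C0_fun \<psi> t\<bar> \<le> 1 * norm \<psi>" by (intro mult_mono abs_C0_fun_le) auto
        then show "norm (sawtooth (t - s) * C0_fun \<psi> t) \<le> norm (norm \<psi>)" by (simp add: abs_mult)
      qed
    qed (use sc C in auto)
    then have si: "set_integrable lborel {0..1} (\<lambda>t. sawtooth (t - s) * C0_fun \<psi> t)"
      unfolding circle_def set_integrable_def by (subst (asm) integrable_restrict_space) auto
    have "(\<integral>t. sawtooth (t - s) * C0_fun \<psi> t \<partial>circle) = (LINT t:{0..1}|lborel. sawtooth (t - s) * C0_fun \<psi> t)"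
      unfolding circle_def set_lebesgue_integral_def by (subst integral_restrict_space) auto
    also have "\<dots> = integral {0..1} (\<lambda>t. sawtooth (t - s) * C0_fun \<psi> t)"
      by (rule set_borel_integral_eq_integral(2)[OF si])
    also have "\<dots> = - \<phi> s + (1 / 2 - s) * (\<phi> 0 - \<phi> 1) + (\<Phi> 1 - \<Phi> 0)"
      by (rule integral_unique[OF sawtooth_integral[OF p P s]])
    finally show "(\<integral>t. ?f (t, s) \<partial>circle) = rep_L2 w s * (- \<phi> s + (1 / 2 - s) * (\<phi> 0 - \<phi> 1) + (\<Phi> 1 - \<Phi> 0))"
      by (simp add: mult.assoc)
  qed
  finally show ?thesis .
qed

lemma average_prim_L2: "average (prim_L2 w) = 0"
proof -
  have "mult_C0 (prim_L2 w) (const_fun 1) = prim_L2 w" by (rule C0_eqI) simp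
  \<comment> \<open>With \<open>\<phi> t = t\<close> and \<Phi> t = t^2/2 the bracket vanishes for
    every \<open>s\<close>.\<close>
  moreover have "average (mult_C0 (prim_L2 w) (const_fun 1)) = (\<integral>s. rep_L2 w s * (- s + (1 / 2 - s) * (0 - 1) + (1\<^sup>2 / 2 - 0\<^sup>2 / 2)) \<partial>circle)"
    by (rule prim_L2_inner) (auto intro!: derivative_eq_intros)
  ultimately show ?thesis by simp
qed

lemma weak_deriv_prim_L2: "weak_deriv (prim_L2 w) (w - const_fun (average w))"
proof (rule weak_derivI)
  fix p p' assume p: "C0_has_deriv p p'"
  obtain H where H: "\<And>t. (H has_real_derivative C0_fun p t) (at t)" "H 1 - H 0 = average p" using C0_antideriv by blast
  have p01: "C0_fun p 1 = C0_fun p 0" using C0_fun_periodic[of p 0] by simp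
  have "inner (C0_to_L2 (prim_L2 w)) (C0_to_L2 p') = (\<integral>s. rep_L2 w s * (- C0_fun p s + (1 / 2 - s) * (C0_fun p 0 - C0_fun p 1) + (H 1 - H 0)) \<partial>circle)"
    unfolding inner_C0 by (rule prim_L2_inner) (use p H in \<open>auto simp: C0_has_deriv_def\<close>)
  also have "\<dots> = inner w (C0_to_L2 (const_fun (average p) - p))"
    by (simp add: inner_C0_to_L2 p01 H(2))
  also have "const_fun (average p) - p = const_fun (average p) + - p" by simp
  also have "inner w (C0_to_L2 (const_fun (average p) + - p)) = average p * average w - inner w (C0_to_L2 p)"
  proof -
    have "const_fun (average p) = (average p *\<^sub>R const_fun 1 :: C0)" by (simp flip: const_fun_scaleR)
    then have "inner w (C0_to_L2 (const_fun (average p))) = average p * average w" by (simp only: C0_to_L2_scaleR average_L2_eq inner_scaleR_right)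
    then show ?thesis by (simp only: C0_to_L2_add C0_to_L2_minus inner_add_right inner_minus_right diff_conv_add_uminus)
  qed
  also have "average p * average w = inner (const_fun (average w)) (C0_to_L2 p)"
  proof -
    have "const_fun (average w) = (average w *\<^sub>R C0_to_L2 (const_fun 1))" by (simp add: const_fun_L2_eq flip: const_fun_scaleR)
    then have "inner (const_fun (average w)) (C0_to_L2 p) = average w * inner (C0_to_L2 (const_fun 1)) (C0_to_L2 p)"
      by (simp only: inner_scaleR_left)
    moreover have "mult_C0 (const_fun 1) p = p" by (rule C0_eqI) simp
    ultimately show ?thesis by (simp add: inner_C0)
  qed
  finally show "inner (C0_to_L2 (prim_L2 w)) (C0_to_L2 p') = - inner (w - const_fun (average w)) (C0_to_L2 p)"
    by (simp add: inner_diff_left)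
qed

section \<open>The pairs \<open>(C\<^sup>1, C\<^sup>0)\<close> and \<open>(H\<^sup>1, L\<^sup>2)\<close>\<close>

lemma Rep_Abs_C1: "C0_has_deriv p p' \<Longrightarrow> Rep_C1 (Abs_C1 p) = p"
  by (rule Abs_C1_inverse) auto

lemma Rep_Abs_H1: "weak_deriv u v \<Longrightarrow> Rep_H1 (Abs_H1 u) = u"
  by (rule Abs_H1_inverse) auto

lemma C1_deriv_Abs: "C0_has_deriv p p' \<Longrightarrow> C1_deriv (Abs_C1 p) = p'"
  by (rule C1_derivI) (simp add: Rep_Abs_C1)

lemma H1_deriv_Abs: "weak_deriv u v \<Longrightarrow> H1_deriv (Abs_H1 u) = v"
  by (rule H1_derivI) (simp add: Rep_Abs_H1)

lemma C1_deriv_linear: "C1_deriv (u + v) = C1_deriv u + C1_deriv v" "C1_deriv (c *\<^sub>R u) = c *\<^sub>R C1_deriv u"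
  by (rule C1_derivI, unfold plus_C1.rep_eq scaleR_C1.rep_eq, intro C0_has_deriv_simps C1_deriv)+

lemma H1_deriv_linear: "H1_deriv (u + v) = H1_deriv u + H1_deriv v" "H1_deriv (c *\<^sub>R u) = c *\<^sub>R H1_deriv u"
  by (rule H1_derivI, unfold plus_H1.rep_eq scaleR_H1.rep_eq, intro weak_deriv_add weak_deriv_scaleR H1_deriv)+

lemma norm_const_diff_C0: "norm (q - const_fun (average q)) \<le> 2 * norm (q :: C0)"
  using norm_triangle_ineq4[of q "const_fun (average q)"] abs_average_C0_le[of q] by simp

lemma norm_const_diff_L2: "norm (w - const_fun (average w)) \<le> 2 * norm (w :: L2)"
  using norm_triangle_ineq4[of w "const_fun (average w)"] norm_const_L2[of "average w"] abs_average_L2_le[of w] by simp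

interpretation C1_pair: circle_pair Rep_C1 "\<lambda>x. x" C1_deriv "\<lambda>q. Abs_C1 (prim q)"
proof (rule circle_pair.intro)
  show i: "bounded_linear Rep_C1"
    by (rule bounded_linear_intro[of _ 1]) (simp_all add: plus_C1.rep_eq scaleR_C1.rep_eq norm_C1_def)
  show "bounded_linear (\<lambda>x :: C0. x)" by (rule bounded_linear_ident)
  show "bounded_linear C1_deriv"
    by (rule bounded_linear_intro[of _ 1]) (simp_all add: C1_deriv_linear norm_C1_def)
  have R: "Rep_C1 (Abs_C1 (prim q)) = prim q" for q by (rule Rep_Abs_C1[OF prim(1)])
  have D: "C1_deriv (Abs_C1 (prim q)) = q - const_fun (average q)" for q by (rule C1_deriv_Abs[OF prim(1)])
  note P = bounded_linear.linear[OF bounded_linear_prim]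
  show "bounded_linear (\<lambda>q. Abs_C1 (prim q))"
  \<comment> \<open>2 for the function and 2 for its derivative.\<close>
  proof (rule bounded_linear_intro[of _ 4])
    show "Abs_C1 (prim (x + y)) = Abs_C1 (prim x) + Abs_C1 (prim y)" for x y
      unfolding Rep_C1_inject[symmetric] plus_C1.rep_eq R by (simp add: linear_add[OF P])
    show "Abs_C1 (prim (c *\<^sub>R x)) = c *\<^sub>R Abs_C1 (prim x)" for c x
      unfolding Rep_C1_inject[symmetric] scaleR_C1.rep_eq R by (simp add: linear_cmul[OF P])
    show "norm (Abs_C1 (prim q)) \<le> norm q * 4" for q
      using norm_prim_le[of q] norm_const_diff_C0[of q] by (simp add: norm_C1_def R D)
  qed
  show "bounded_linear (average :: C0 \<Rightarrow> real)" by (rule bounded_linear_average_C0)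
  show "bounded_linear (average :: C1 \<Rightarrow> real)"
    using bounded_linear_compose[OF bounded_linear_average_C0 i] by (simp flip: average_C1_def)
  fix c :: real and u :: C1 and q \<theta> \<theta>' :: C0
  have c: "C0_has_deriv (const_fun c) 0" by (simp add: C0_has_deriv_def C0_fun_const[abs_def])
  show "Rep_C1 (const_fun c) = const_fun c" by (rule const_fun_C1.rep_eq)
  then show "C1_deriv (const_fun c) = 0" using c by (intro C1_derivI) simp
  show "const_fun c = (const_fun c :: C0)" "average q = (average q :: real)" by (rule refl)+
  show "average (Rep_C1 u) = average u" by (simp add: average_C1_def)
  show "average (Abs_C1 (prim q)) = 0" by (simp add: average_C1_def R prim)
  show "C1_deriv (Abs_C1 (prim q)) = q - const_fun (average q)" by (rule D)
  show "Rep_C1 (Abs_C1 (prim q)) = prim q" by (rule R)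
  show "Abs_C1 (prim (C1_deriv u)) = u - const_fun (average u)"
    using C0_deriv_prim[OF C1_deriv[of u]]
    by (simp add: Rep_C1_inject[symmetric] minus_C1.rep_eq R const_fun_C1.rep_eq average_C1_def algebra_simps)
  assume "C0_has_deriv \<theta> \<theta>'"
  from Rep_Abs_C1[OF C0_has_deriv_mult[OF this C1_deriv[of u]]]
  show "mult_C0 \<theta> (Rep_C1 u) \<in> range Rep_C1" by (metis rangeI)
qed

text \<open>Both sides have the same weak derivative and the same average. With
  \<open>norm_prim_L2\<close> this bounds the sup norm by the H1 norm, the embedding into C0 that
  \<open>circle_pair\<close> asks for.\<close>

lemma Rep_H1_prim: "Rep_H1 u = const_fun (average u) + prim_L2 (H1_deriv u)"
proof (rule weak_deriv_eqI)
  show "weak_deriv (Rep_H1 u) (H1_deriv u)" by (rule H1_deriv)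
  have "C0_has_deriv (const_fun (average u)) 0" by (simp add: C0_has_deriv_def C0_fun_const[abs_def])
  from weak_deriv_add[OF strong_weak_deriv[OF this] weak_deriv_prim_L2[of "H1_deriv u"]]
  show "weak_deriv (const_fun (average u) + prim_L2 (H1_deriv u)) (H1_deriv u)"
    by (simp add: C0_to_L2_zero weak_deriv_average[OF H1_deriv] const_fun_0)
  show "average (Rep_H1 u) = average (const_fun (average u) + prim_L2 (H1_deriv u))"
    by (simp add: average_simps average_prim_L2 average_H1_def)
qed

lemma norm_H1_bounds: "norm (C0_to_L2 (Rep_H1 u)) \<le> norm u" "norm (H1_deriv u) \<le> norm u"
  "norm u \<le> norm (C0_to_L2 (Rep_H1 u)) + norm (H1_deriv u)"
proof -
  have e: "norm u = sqrt ((norm (C0_to_L2 (Rep_H1 u)))\<^sup>2 + (norm (H1_deriv u))\<^sup>2)"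
    by (simp add: norm_H1_def inner_H1_def power2_norm_eq_inner)
  show "norm (C0_to_L2 (Rep_H1 u)) \<le> norm u" "norm (H1_deriv u) \<le> norm u" unfolding e by (rule real_le_rsqrt; simp)+
  show "norm u \<le> norm (C0_to_L2 (Rep_H1 u)) + norm (H1_deriv u)" unfolding e by (rule sqrt_sum_squares_le_sum) auto
qed

lemma linear_prim_L2: "prim_L2 (v + w) = prim_L2 v + prim_L2 w" "prim_L2 (c *\<^sub>R w) = c *\<^sub>R prim_L2 w"
  by (rule C0_eqI, simp add: inner_add_left)+

interpretation H1_pair: circle_pair Rep_H1 C0_to_L2 H1_deriv "\<lambda>w. Abs_H1 (prim_L2 w)"
proof (rule circle_pair.intro)
  have aH: "average u = average (C0_to_L2 (Rep_H1 u))" for u :: H1 by (simp add: average_C0_to_L2 average_H1_def)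
  show "bounded_linear C0_to_L2" by (rule bounded_linear_C0_to_L2)
  show i: "bounded_linear Rep_H1"
  proof (rule bounded_linear_intro[of _ 2])
    fix u
    have "norm (Rep_H1 u) \<le> \<bar>average u\<bar> + norm (prim_L2 (H1_deriv u))"
      using norm_triangle_ineq[of "const_fun (average u)" "prim_L2 (H1_deriv u)"] unfolding Rep_H1_prim[symmetric] by simp
    also have "\<bar>average u\<bar> \<le> norm u" unfolding aH using abs_average_L2_le norm_H1_bounds(1) by (rule order.trans)
    also have "norm (prim_L2 (H1_deriv u)) \<le> norm u" using norm_prim_L2 norm_H1_bounds(2) by (rule order.trans)
    finally show "norm (Rep_H1 u) \<le> norm u * 2" by simp
  qed (simp_all add: plus_H1.rep_eq scaleR_H1.rep_eq)
  show "bounded_linear H1_deriv"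
    by (rule bounded_linear_intro[of _ 1]) (simp_all add: H1_deriv_linear norm_H1_bounds)
  have R: "Rep_H1 (Abs_H1 (prim_L2 w)) = prim_L2 w" for w by (rule Rep_Abs_H1[OF weak_deriv_prim_L2])
  have D: "H1_deriv (Abs_H1 (prim_L2 w)) = w - const_fun (average w)" for w by (rule H1_deriv_Abs[OF weak_deriv_prim_L2])
  show "bounded_linear (\<lambda>w. Abs_H1 (prim_L2 w))"
  \<comment> \<open>1 for the function and 2 for its derivative.\<close>
  proof (rule bounded_linear_intro[of _ 3])
    show "Abs_H1 (prim_L2 (x + y)) = Abs_H1 (prim_L2 x) + Abs_H1 (prim_L2 y)" for x y
      unfolding Rep_H1_inject[symmetric] plus_H1.rep_eq R by (simp add: linear_prim_L2)
    show "Abs_H1 (prim_L2 (c *\<^sub>R x)) = c *\<^sub>R Abs_H1 (prim_L2 x)" for c x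
      unfolding Rep_H1_inject[symmetric] scaleR_H1.rep_eq R by (simp add: linear_prim_L2)
    show "norm (Abs_H1 (prim_L2 w)) \<le> norm w * 3" for w
      using norm_H1_bounds(3)[of "Abs_H1 (prim_L2 w)"] norm_C0_to_L2_le[of "prim_L2 w"] norm_prim_L2[of w] norm_const_diff_L2[of w]
      by (simp add: R D)
  qed
  show "bounded_linear (average :: L2 \<Rightarrow> real)" by (rule bounded_linear_average_L2)
  show "bounded_linear (average :: H1 \<Rightarrow> real)"
    using bounded_linear_compose[OF bounded_linear_average_C0 i] by (simp flip: average_H1_def)
  fix c :: real and u :: H1 and w :: L2 and q \<theta> \<theta>' :: C0
  have c: "C0_has_deriv (const_fun c) 0" by (simp add: C0_has_deriv_def C0_fun_const[abs_def])
  show "Rep_H1 (const_fun c) = const_fun c" by (rule const_fun_H1.rep_eq)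
  then show "H1_deriv (const_fun c) = 0" using strong_weak_deriv[OF c] by (intro H1_derivI) (simp add: C0_to_L2_zero)
  show "C0_to_L2 (const_fun c) = const_fun c" by (rule const_fun_L2_eq)
  show "average (C0_to_L2 q) = average q" by (rule average_C0_to_L2)
  show "average (Rep_H1 u) = average u" by (simp add: average_H1_def)
  show "average (Abs_H1 (prim_L2 w)) = 0" by (simp add: average_H1_def R average_prim_L2)
  show "H1_deriv (Abs_H1 (prim_L2 w)) = w - const_fun (average w)" by (rule D)
  show "Rep_H1 (Abs_H1 (prim_L2 (C0_to_L2 q))) = prim q"
    unfolding R
  proof (rule weak_deriv_eqI[OF weak_deriv_prim_L2])
    have "C0_to_L2 (q - const_fun (average q)) = C0_to_L2 q - const_fun (average (C0_to_L2 q))"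
      using C0_to_L2_add[of q "- const_fun (average q)"] by (simp add: C0_to_L2_minus const_fun_L2_eq average_C0_to_L2)
    then show "weak_deriv (prim q) (C0_to_L2 q - const_fun (average (C0_to_L2 q)))"
      using strong_weak_deriv[OF prim(1)[of q]] by simp
  qed (simp add: average_prim_L2 prim)
  show "Abs_H1 (prim_L2 (H1_deriv u)) = u - const_fun (average u)"
    using Rep_H1_prim[of u] by (simp add: Rep_H1_inject[symmetric] minus_H1.rep_eq R const_fun_H1.rep_eq)
  assume "C0_has_deriv \<theta> \<theta>'"
  from weak_deriv_mult[OF H1_deriv[of u] this] Rep_Abs_H1
  show "mult_C0 \<theta> (Rep_H1 u) \<in> range Rep_H1" by (metis rangeI)
qed

section \<open>The theorem for the two concrete pairs\<close>

lemma smooth_circle_family: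
  assumes per: "\<And>t x. f (t + 1) x = f t x" and smooth: "smooth_on UNIV (\<lambda>(t, x). f t (x::real) :: real)"
  obtains fx where "circle_family fx" "fx 0 = f"
proof -
  obtain D where D: "tower UNIV D" "\<And>p. D p [] = f (fst p) (snd p)"
    using smooth_onE_tower[OF smooth] by (metis UNIV_I case_prod_beta)
  \<comment> \<open>The direction (0, 1) repeated \<open>k\<close> times gives the partial
    derivatives in x; periodicity passes from each order to the next by uniqueness of
    derivatives.\<close>
  define fx where "fx k t x = D (t, x) (replicate k (0, 1))" for k t x
  have deriv: "(fx k t has_real_derivative fx (Suc k) t x) (at x)" for k t x
    using dir_deriv_line[OF tower_dir_deriv[OF D(1) subspace_UNIV, of "replicate k (0, 1)" "(0, 1)"] subspace_UNIV, of "(t, 0)" x]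
    by (simp add: fx_def[abs_def] has_vector_derivative_real_iff)
  have fx0: "fx 0 = f" by (simp add: fx_def D fun_eq_iff)
  have fxper: "fx k (t + 1) = fx k t" for k t
  proof (induction k)
    case 0 show ?case by (simp add: fx0 per fun_eq_iff)
  next
    case (Suc k)
    show ?case
    proof
      fix x show "fx (Suc k) (t + 1) x = fx (Suc k) t x"
        using DERIV_unique[OF deriv[of k "t + 1" x]] deriv[of k t x] unfolding Suc by blast
    qed
  qed
  have cont: "continuous_on UNIV (\<lambda>(t, x). fx k t x)" for k
    unfolding continuous_on_def
  proof
    fix p :: "real \<times> real"
    define as where "as = replicate k (\<lambda>q :: real \<times> real. (0 :: real, 1 :: real), (0 :: real, 1 :: real))"
    have "((\<lambda>q. D q (map (\<lambda>a. fst a q) as)) \<longlongrightarrow> D p (map snd as)) (at p within UNIV)"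
      by (rule tower_tendsto[OF D(1) subspace_UNIV]) (auto simp: as_def)
    then show "((\<lambda>(t, x). fx k t x) \<longlongrightarrow> (case p of (t, x) \<Rightarrow> fx k t x)) (at p within UNIV)"
      by (simp add: as_def fx_def case_prod_unfold)
  qed
  show thesis
  proof (rule that)
    show "circle_family fx" by standard (use cont deriv fxper in auto)
  qed (rule fx0)
qed

theorem theorem4p5:
  fixes f :: "real \<Rightarrow> real \<Rightarrow> real"
  assumes periodic: "\<And>t x. f (t + 1) x = f t x"
    and smooth: "smooth_on UNIV (\<lambda>(t, x). f t x)"
    and proper: "circle_proper f"
  shows "(regular_value (\<lambda>u :: H1. Sigma1 f (H1_fun u)) 0 \<longrightarrow>
            (\<forall>u. critical_point (F_H1 f) u \<longrightarrow> fold_point (F_H1 f) u) \<longrightarrow>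
            global_fold (F_H1 f)) \<and>
         (regular_value (\<lambda>u :: C1. Sigma1 f (C1_fun u)) 0 \<longrightarrow>
            (\<forall>u. critical_point (F_C1 f) u \<longrightarrow> fold_point (F_C1 f) u) \<longrightarrow>
            global_fold (F_C1 f))"
proof -
  obtain fx where fx: "circle_family fx" "fx 0 = f" using smooth_circle_family[OF periodic smooth] by blast
  interpret fam: proper_family fx
    using fx proper by (simp add: proper_family_def proper_family_axioms_def)
  interpret H: circle_problem Rep_H1 C0_to_L2 H1_deriv "\<lambda>w. Abs_H1 (prim_L2 w)" fx by unfold_locales
  interpret C: circle_problem Rep_C1 "\<lambda>x. x" C1_deriv "\<lambda>q. Abs_C1 (prim q)" fx by unfold_locales
  have "deriv (f t) x = fx (Suc 0) t x" for t x using DERIV_imp_deriv[OF fam.deriv[of 0 t x]] by (simp add: fx)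
  then have S: "Sigma1 f (C0_fun u) = fam.Sig u" for u by (simp add: Sigma1_def fam.Sig_def average_C0_def fam.nem_fun)
  have n: "fam.nem 0 = nemytskii f" by (simp add: fam.nem_def fx)
  have F: "F_H1 f = H.F" "F_C1 f = C.F" by (simp_all add: fun_eq_iff F_H1_def H.F_def F_C1_def C.F_def n)
  show ?thesis
    using H.global_fold C.global_fold by (simp add: F S H1_fun_def[abs_def] C1_fun_def[abs_def])
qed

end
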